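(* Let $p,p'\ge2$ be coprime integers and $k+2=\frac{p'}p$. Assume that $\ell\in\mathbb Z$, $1\le s\le p'-1$, $1\le r\le p-2$ and $\lambda=\lambda_{r,s}^+=\frac12\left(s-1-(k+2)(r-1)\right)$. Then: (1) $\widetilde{\mathcal M_{r,s}^{\ell,+}(\lambda)}$ is a logarithmic $V_k(sl(2))$-module of $\widetilde L_{sug}(0)$-nilpotent rank two. (2) The logarithmic module $\widetilde{\mathcal M_{r,s}^{\ell,+}(\lambda)}$ appears in the following non-split extension of weight $V_k(sl(2))$-modules: $$0\rightarrow L^{Vir}(d_{p,p'},h_{p,p'}^{r+1,s})\otimes\Pi_{(\ell+1)}(-\tfrac k2+\lambda)\rightarrow\widetilde{\mathcal M_{r,s}^{\ell,+}(\lambda)}\rightarrow L^{Vir}(d_{p,p'},h_{p,p'}^{r,s})\otimes\Pi_{(\ell)}(\lambda)\rightarrow0 .$$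
   Context: $d_{p,p'}=1-\frac{6(p-p')^2}{pp'}$, $h_{p,p'}^{r,s}=\frac{(sp-rp')^2-(p-p')^2}{4pp'}$ for $1\le r\le p-1$, $1\le s\le p'-1$; $L^{Vir}(d_{p,p'},h)$ is the irreducible highest weight Virasoro module; $v_{r,s}$ is the highest weight vector of $L^{Vir}(d_{p,p'},h_{p,p'}^{r,s})$; $\omega_{p,p'}$ is the conformal vector of $L^{Vir}(d_{p,p'},0)$. Let $\langle c,c\rangle=\langle d,d\rangle=0$, $\langle c,d\rangle=2$; $M(1)$ is the Heisenberg vertex algebra generated by $c(z),d(z)$ with $[a(m),b(n)]=m\langle a,b\rangle\delta_{m+n,0}$; $\Pi(0)=M(1)\otimes\mathbb C[\mathbb Zc]$; $\mu=\frac d2+\frac k4c$, $\nu=\frac d2-\frac k4c$; $\Pi_{(r)}(\lambda)=\Pi(0)e^{r\mu+\lambda c}$ with the usual lattice vertex operators. The simple affine vertex algebra $V_k(sl(2))$ is mapped into $L^{Vir}(d_{p,p'},0)\otimes\Pi(0)$ by $e\mapsto e^c$, $h\mapsto2\mu(-1)\mathbf 1$, $f\mapsto[(k+2)\omega_{p,p'}-\nu(-1)^2-(k+1)\nu(-2)]e^{-c}$, and identified with its image. A module is weight if $L_{sug}(0)$ and $h(0)$ act semisimply ($L_{sug}$ the Sugawara Virasoro field). Extended vertex algebra: $\mathcal M_{2,1}=L^{Vir}(d_{p,p'},h_{p,p'}^{2,1})\otimes\Pi_{(1)}(-\frac k2)$ (note $\Pi_{(1)}(-\frac k2)=\Pi(0)e^\nu$),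 and $\mathcal V=(L^{Vir}(d_{p,p'},0)\otimes\Pi(0))\oplus\mathcal M_{2,1}$ with $Y_{\mathcal V}(v_1+w_1,z)(v_2+w_2)=Y(v_1,z)v_2+Y(v_1,z)w_2+e^{zL(-1)}Y(v_2,-z)w_1$ for $v_i$ in the first summand, $w_i\in\mathcal M_{2,1}$. Let $s=v_{2,1}\otimes e^\nu\in\mathcal M_{2,1}$, and $S=s_0=\mathrm{Res}_zY(s,z)$; $S$ commutes with $\widehat{sl(2)}$ and $V_k(sl(2))\subset\ker_{\mathcal V}S$. $\mathcal M_{r,s}^{\ell,+}(\lambda)=\big(L^{Vir}(d_{p,p'},h_{p,p'}^{r,s})\otimes\Pi_{(\ell)}(\lambda)\big)\oplus\big(L^{Vir}(d_{p,p'},h_{p,p'}^{r+1,s})\otimes\Pi_{(\ell+1)}(-\frac k2+\lambda)\big)$ is a $\mathcal V$-module: the vertex algebra $L^{Vir}(d_{p,p'},0)\otimes\Pi(0)$ acts diagonally; $w\in\mathcal M_{2,1}$ acts by zero on the second summand and maps the first summand to the second by $\mathcal Y(w,z)$, where $\mathcal Y=\mathcal Y_1\otimes\mathcal Y_2$, $\mathcal Y_1$ is a non-trivial Virasoro intertwining operator of type $\binom{L^{Vir}(d_{p,p'},h^{r+1,s}_{p,p'})}{L^{Vir}(d_{p,p'},h^{2,1}_{p,p'})\ \ L^{Vir}(d_{p,p'},h^{r,s}_{p,p'})}$ and $\mathcal Y_2$ is the non-trivial lattice intertwining operator of type $\binom{\Pi_{(\ell+1)}(-\frac k2+\lambda)}{\Pi_{(1)}(-\frac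 k2)\ \ \Pi_{(\ell)}(\lambda)}$ (the product has integral powers of $z$). For a $\mathcal V$-module $(\mathcal M,Y_{\mathcal M})$, $\widetilde{\mathcal M}$ is the $V_k(sl(2))$-module with the same underlying space and vertex operator $\widetilde Y(a,z)=Y_{\mathcal M}(\Delta(s,z)a,z)$, $a\in V_k(sl(2))$, where $\Delta(s,z)=z^{s_0}\exp\big(\sum_{n\ge1}\frac{s_n}{-n}(-z)^{-n}\big)$; $\widetilde L_{sug}(0)$ is the resulting action of the zero mode of the Sugawara field. A module is logarithmic if it is the direct sum of generalized eigenspaces of (Sugawara) $L(0)$; it has nilpotent rank $m$ if $(L(0)-L_{ss}(0))^m=0$ and $(L(0)-L_{ss}(0))^{m-1}\ne0$, where $L_{ss}(0)$ is the semisimple part of $L(0)$. *)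

theory Defs
  imports
    Complex_Main
    "HOL-Library.Poly_Mapping"
    "HOL-Library.Multiset"
    "HOL-Library.Product_Plus"
begin

section \<open>Complex vector spaces\<close>

class complex_vector = ab_group_add +
  fixes scaleC :: "complex \<Rightarrow> 'a \<Rightarrow> 'a" (infixr "*\<^sub>C" 75)
  assumes scaleC_add_right: "a *\<^sub>C (x + y) = a *\<^sub>C x + a *\<^sub>C y"
    and scaleC_add_left: "(a + b) *\<^sub>C x = a *\<^sub>C x + b *\<^sub>C x"
    and scaleC_scaleC: "a *\<^sub>C b *\<^sub>C x = (a * b) *\<^sub>C x"
    and scaleC_one: "1 *\<^sub>C x = x"

interpretation cvec: vector_space "scaleC :: complex \<Rightarrow> 'a \<Rightarrow> 'a::complex_vector"
  by unfold_locales
    (simp_all add: scaleC_add_right scaleC_add_left scaleC_scaleC scaleC_one)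

abbreviation clinear :: "('a::complex_vector \<Rightarrow> 'b::complex_vector) \<Rightarrow> bool" where
  "clinear \<equiv> Vector_Spaces.linear scaleC scaleC"

instantiation complex :: complex_vector
begin
definition scaleC_complex :: "complex \<Rightarrow> complex \<Rightarrow> complex" where
  "scaleC_complex a x = a * x"
instance
  by standard (simp_all add: scaleC_complex_def algebra_simps)
end

instantiation prod :: (complex_vector, complex_vector) complex_vector
begin
definition scaleC_prod :: "complex \<Rightarrow> 'a \<times> 'b \<Rightarrow> 'a \<times> 'b" where
  "scaleC_prod a x = (a *\<^sub>C fst x, a *\<^sub>C snd x)"
instance
  by standard
    (simp_all add: scaleC_prod_def prod_eq_iff scaleC_add_right scaleC_add_left
      scaleC_scaleC scaleC_one)
end

instantiation poly_mapping :: (type, complex_vector) complex_vector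
begin
definition scaleC_poly_mapping ::
    "complex \<Rightarrow> ('a \<Rightarrow>\<^sub>0 'b) \<Rightarrow> ('a \<Rightarrow>\<^sub>0 'b)" where
  "scaleC_poly_mapping a x = Poly_Mapping.map (scaleC a) x"
instance
proof -
  have *: "Poly_Mapping.lookup (a *\<^sub>C x) i = a *\<^sub>C Poly_Mapping.lookup x i" for a and x :: "'a \<Rightarrow>\<^sub>0 'b" and i
    by (simp add: scaleC_poly_mapping_def map.rep_eq when_def cvec.scale_zero_right)
  show "OFCLASS('a \<Rightarrow>\<^sub>0 'b, complex_vector_class)"
    by standard
      (rule poly_mapping_eqI,
        simp add: * lookup_add scaleC_add_right scaleC_add_left scaleC_scaleC scaleC_one)+
qed
end

text \<open>
  The tensor product of a vector space with one that has a basis indexed by \<open>'i\<close>: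
  \<open>W \<otimes> ('i \<Rightarrow>\<^sub>0 complex)\<close> is realised as \<open>'i \<Rightarrow>\<^sub>0 W\<close>.
\<close>

definition tens :: "'w::complex_vector \<Rightarrow> ('i \<Rightarrow>\<^sub>0 complex) \<Rightarrow> ('i \<Rightarrow>\<^sub>0 'w)" where
  "tens x u = Poly_Mapping.map (\<lambda>t. t *\<^sub>C x) u"


section \<open>Semisimple and generalised eigenspace decompositions\<close>

definition eigen_decomp ::
    "('m::complex_vector \<Rightarrow> 'm) \<Rightarrow> 'm \<Rightarrow> (complex \<Rightarrow>\<^sub>0 'm) \<Rightarrow> bool" where
  "eigen_decomp T x f \<longleftrightarrow>
     (\<forall>t. T (Poly_Mapping.lookup f t) = t *\<^sub>C Poly_Mapping.lookup f t) \<and>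
     x = Sum_any (Poly_Mapping.lookup f)"

definition acts_semisimply :: "('m::complex_vector \<Rightarrow> 'm) \<Rightarrow> bool" where
  "acts_semisimply T \<longleftrightarrow> (\<forall>x. \<exists>!f. eigen_decomp T x f)"

definition gen_eigenspace :: "('m::complex_vector \<Rightarrow> 'm) \<Rightarrow> complex \<Rightarrow> 'm set" where
  "gen_eigenspace T t = {x. \<exists>n::nat. ((\<lambda>y. T y - t *\<^sub>C y) ^^ n) x = 0}"

definition gen_eigen_decomp ::
    "('m::complex_vector \<Rightarrow> 'm) \<Rightarrow> 'm \<Rightarrow> (complex \<Rightarrow>\<^sub>0 'm) \<Rightarrow> bool" where
  "gen_eigen_decomp T x f \<longleftrightarrow>
     (\<forall>t. Poly_Mapping.lookup f t \<in> gen_eigenspace T t) \<and>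
     x = Sum_any (Poly_Mapping.lookup f)"

definition sum_of_gen_eigenspaces :: "('m::complex_vector \<Rightarrow> 'm) \<Rightarrow> bool" where
  "sum_of_gen_eigenspaces T \<longleftrightarrow> (\<forall>x. \<exists>!f. gen_eigen_decomp T x f)"

text \<open>Meaningful when \<open>sum_of_gen_eigenspaces T\<close> holds.\<close>

definition semisimple_part :: "('m::complex_vector \<Rightarrow> 'm) \<Rightarrow> 'm \<Rightarrow> 'm" where
  "semisimple_part T x =
     Sum_any (\<lambda>t. t *\<^sub>C Poly_Mapping.lookup (THE f. gen_eigen_decomp T x f) t)"

definition nilpotent_rank :: "('m::complex_vector \<Rightarrow> 'm) \<Rightarrow> nat \<Rightarrow> bool" where
  "nilpotent_rank T m \<longleftrightarrow>
     (let N = (\<lambda>x. T x - semisimple_part T x) in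
        1 \<le> m \<and> (\<forall>x. (N ^^ m) x = 0) \<and> (\<exists>x. (N ^^ (m - 1)) x \<noteq> 0))"


section \<open>Vertex algebras, modules and intertwining operators\<close>

text \<open>
  A vertex operator map is given by its modes: \<open>Y a n\<close> is the coefficient of
  \<open>z\<^bsup>-n-1\<^esup>\<close> in \<open>Y(a,z)\<close>. The Jacobi identity is stated in its mode form (the
  Borcherds identity); all sums there have finite support by the truncation property.
  \<open>A\<close> is the carrier of a subalgebra of the vertex algebra \<open>(Y, vac)\<close>.
\<close>

definition vertex_module ::
    "'a::complex_vector set \<Rightarrow> ('a \<Rightarrow> int \<Rightarrow> 'a \<Rightarrow> 'a) \<Rightarrow> 'a \<Rightarrow>
     ('a \<Rightarrow> int \<Rightarrow> 'm::complex_vector \<Rightarrow> 'm) \<Rightarrow> bool" where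
  "vertex_module A Y vac YM \<longleftrightarrow>
     (\<forall>a\<in>A. \<forall>n. clinear (YM a n)) \<and>
     (\<forall>a\<in>A. \<forall>b\<in>A. \<forall>n x. YM (a + b) n x = YM a n x + YM b n x) \<and>
     (\<forall>t. \<forall>a\<in>A. \<forall>n x. YM (t *\<^sub>C a) n x = t *\<^sub>C YM a n x) \<and>
     (\<forall>a\<in>A. \<forall>x. \<exists>N. \<forall>n\<ge>N. YM a n x = 0) \<and>
     (\<forall>n x. YM vac n x = (if n = -1 then x else 0)) \<and>
     (\<forall>a\<in>A. \<forall>b\<in>A. \<forall>l m n x.
        (Sum_any (\<lambda>i::nat. (of_int m gchoose i) *\<^sub>C
           YM (Y a (l + int i) b) (m + n - int i) x)) =
        (Sum_any (\<lambda>i::nat. ((-1) ^ i * (of_int l gchoose i)) *\<^sub>C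
           (YM a (l + m - int i) (YM b (n + int i) x) -
            ((-1) powi l) *\<^sub>C YM b (l + n - int i) (YM a (m + int i) x)))))"

definition vertex_algebra :: "('a::complex_vector \<Rightarrow> int \<Rightarrow> 'a \<Rightarrow> 'a) \<Rightarrow> 'a \<Rightarrow> bool" where
  "vertex_algebra Y vac \<longleftrightarrow>
     vertex_module UNIV Y vac Y \<and>
     (\<forall>a. Y a (-1) vac = a \<and> (\<forall>n\<ge>0. Y a n vac = 0))"

text \<open>
  Intertwining operators of type \<open>(W3; W1 W2)\<close>, with complex modes:
  \<open>I w t\<close> is the coefficient of \<open>z\<^bsup>-t-1\<^esup>\<close>. The last conjunct is the
  \<open>L(-1)\<close>-derivative property, \<open>L(-1)\<close> being the mode 0 of the conformal vector.
\<close>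

definition intertwining_operator ::
    "'a::complex_vector \<Rightarrow>
     ('a \<Rightarrow> int \<Rightarrow> 'w1::complex_vector \<Rightarrow> 'w1) \<Rightarrow> ('a \<Rightarrow> int \<Rightarrow> 'w2::complex_vector \<Rightarrow> 'w2) \<Rightarrow>
     ('a \<Rightarrow> int \<Rightarrow> 'w3::complex_vector \<Rightarrow> 'w3) \<Rightarrow> ('w1 \<Rightarrow> complex \<Rightarrow> 'w2 \<Rightarrow> 'w3) \<Rightarrow> bool" where
  "intertwining_operator conf Y1 Y2 Y3 I \<longleftrightarrow>
     (\<forall>w t. clinear (I w t)) \<and>
     (\<forall>t x. clinear (\<lambda>w. I w t x)) \<and>
     (\<forall>w x. \<exists>N. \<forall>t. Re t \<ge> N \<longrightarrow> I w t x = 0) \<and>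
     (\<forall>a w l m t x.
        (Sum_any (\<lambda>i::nat. (of_int m gchoose i) *\<^sub>C
           I (Y1 a (l + int i) w) (of_int m + t - of_nat i) x)) =
        (Sum_any (\<lambda>i::nat. ((-1) ^ i * (of_int l gchoose i)) *\<^sub>C
           (Y3 a (l + m - int i) (I w (t + of_nat i) x) -
            ((-1) powi l) *\<^sub>C I w (of_int l + t - of_nat i) (Y2 a (m + int i) x))))) \<and>
     (\<forall>w t x. I (Y1 conf 0 w) t x = (- t) *\<^sub>C I w (t - 1) x)"

definition nontrivial_intertwining :: "('w1 \<Rightarrow> complex \<Rightarrow> 'w2 \<Rightarrow> 'w3::zero) \<Rightarrow> bool" where
  "nontrivial_intertwining I \<longleftrightarrow> (\<exists>w t x. I w t x \<noteq> 0)"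

inductive_set generated_subalgebra ::
    "('a::complex_vector \<Rightarrow> int \<Rightarrow> 'a \<Rightarrow> 'a) \<Rightarrow> 'a \<Rightarrow> 'a set \<Rightarrow> 'a set"
  for Y vac G where
  vac: "vac \<in> generated_subalgebra Y vac G"
| gen: "a \<in> G \<Longrightarrow> a \<in> generated_subalgebra Y vac G"
| add: "a \<in> generated_subalgebra Y vac G \<Longrightarrow> b \<in> generated_subalgebra Y vac G \<Longrightarrow>
    a + b \<in> generated_subalgebra Y vac G"
| scale: "a \<in> generated_subalgebra Y vac G \<Longrightarrow> t *\<^sub>C a \<in> generated_subalgebra Y vac G"
| mode: "a \<in> generated_subalgebra Y vac G \<Longrightarrow> b \<in> generated_subalgebra Y vac G \<Longrightarrow>
    Y a n b \<in> generated_subalgebra Y vac G"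

text \<open>
  Modes of the tensor product of two vertex (or intertwining) operators:
  \<open>(a \<otimes> u)\<^sub>n = \<Sum> a\<^sub>i \<otimes> u\<^sub>j\<close> over \<open>i + j = n - 1\<close>, extended
  bilinearly from the basis tensors. The index type is \<open>int\<close> for vertex operators and
  \<open>complex\<close> for intertwining operators.
\<close>

definition tensor_modes ::
    "('a::complex_vector \<Rightarrow> 'n::ring_1 \<Rightarrow> 'b::complex_vector \<Rightarrow> 'c::complex_vector) \<Rightarrow>
     (('i \<Rightarrow>\<^sub>0 complex) \<Rightarrow> 'n \<Rightarrow> ('j \<Rightarrow>\<^sub>0 complex) \<Rightarrow> ('l \<Rightarrow>\<^sub>0 complex)) \<Rightarrow>
     ('i \<Rightarrow>\<^sub>0 'a) \<Rightarrow> 'n \<Rightarrow> ('j \<Rightarrow>\<^sub>0 'b) \<Rightarrow> ('l \<Rightarrow>\<^sub>0 'c)" where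
  "tensor_modes Y1 Y2 a n x =
     (\<Sum>i\<in>Poly_Mapping.keys a. \<Sum>j\<in>Poly_Mapping.keys x. Sum_any (\<lambda>t.
        tens (Y1 (Poly_Mapping.lookup a i) t (Poly_Mapping.lookup x j))
             (Y2 (Poly_Mapping.single i 1) (n - 1 - t) (Poly_Mapping.single j 1))))"

text \<open>
  \<open>exp_coeff A j\<close> is the coefficient of \<open>u\<^sup>j\<close> in \<open>exp (\<Sum>n\<ge>1. A n u\<^sup>n)\<close>,
  and \<open>pow_coeff A q j\<close> that in the \<open>q\<close>-th power of the exponent.
\<close>

primrec pow_coeff ::
    "(nat \<Rightarrow> 'v::complex_vector \<Rightarrow> 'v) \<Rightarrow> nat \<Rightarrow> nat \<Rightarrow> 'v \<Rightarrow> 'v" where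
  "pow_coeff A 0 j v = (if j = 0 then v else 0)"
| "pow_coeff A (Suc q) j v = (\<Sum>i=1..j. A i (pow_coeff A q (j - i) v))"

definition exp_coeff ::
    "(nat \<Rightarrow> 'v::complex_vector \<Rightarrow> 'v) \<Rightarrow> nat \<Rightarrow> 'v \<Rightarrow> 'v" where
  "exp_coeff A j v = (\<Sum>q\<le>j. (1 / fact q) *\<^sub>C pow_coeff A q j v)"


section \<open>Irreducible highest weight Virasoro modules\<close>

definition central_charge :: "nat \<Rightarrow> nat \<Rightarrow> complex" where
  "central_charge p p' = 1 - 6 * (of_nat p - of_nat p')\<^sup>2 / (of_nat p * of_nat p')"

definition h_weight :: "nat \<Rightarrow> nat \<Rightarrow> nat \<Rightarrow> nat \<Rightarrow> complex" where
  "h_weight p p' r s =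
     ((of_nat s * of_nat p - of_nat r * of_nat p')\<^sup>2 - (of_nat p - of_nat p')\<^sup>2) /
     (4 * of_nat p * of_nat p')"

definition virasoro_rep :: "complex \<Rightarrow> (int \<Rightarrow> 'v::complex_vector \<Rightarrow> 'v) \<Rightarrow> bool" where
  "virasoro_rep d L \<longleftrightarrow>
     (\<forall>n. clinear (L n)) \<and>
     (\<forall>m n x. L m (L n x) - L n (L m x) =
        of_int (m - n) *\<^sub>C L (m + n) x +
        (if m + n = 0 then (of_int (m ^ 3 - m) / 12 * d) *\<^sub>C x else 0))"

definition virasoro_submodule ::
    "(int \<Rightarrow> 'v::complex_vector \<Rightarrow> 'v) \<Rightarrow> 'v set \<Rightarrow> bool" where
  "virasoro_submodule L U \<longleftrightarrow> cvec.subspace U \<and> (\<forall>n. \<forall>x\<in>U. L n x \<in> U)"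

text \<open>
  \<open>L\<close> makes the type \<open>'v\<close> an irreducible highest weight module of central charge \<open>d\<close> and
  highest weight \<open>h\<close>, with highest weight vector \<open>v\<close>; this determines it up to isomorphism.
\<close>

definition irreducible_highest_weight ::
    "complex \<Rightarrow> complex \<Rightarrow> (int \<Rightarrow> 'v::complex_vector \<Rightarrow> 'v) \<Rightarrow> 'v \<Rightarrow> bool" where
  "irreducible_highest_weight d h L v \<longleftrightarrow>
     virasoro_rep d L \<and>
     v \<noteq> 0 \<and> L 0 v = h *\<^sub>C v \<and> (\<forall>n>0. L n v = 0) \<and>
     (\<forall>U. virasoro_submodule L U \<and> v \<in> U \<longrightarrow> U = UNIV) \<and>
     (\<forall>U. virasoro_submodule L U \<longrightarrow> U = {0} \<or> U = UNIV)"

text \<open>The vertex algebra \<open>L\<^sup>V\<^sup>i\<^sup>r(d,0)\<close> with conformal vector \<open>\<omega>\<close>, and its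
  modules \<open>L\<^sup>V\<^sup>i\<^sup>r(d,h)\<close>.\<close>

definition virasoro_vertex_algebra ::
    "complex \<Rightarrow> ('a::complex_vector \<Rightarrow> int \<Rightarrow> 'a \<Rightarrow> 'a) \<Rightarrow> 'a \<Rightarrow> 'a \<Rightarrow> bool" where
  "virasoro_vertex_algebra d Y vac \<omega> \<longleftrightarrow>
     vertex_algebra Y vac \<and> irreducible_highest_weight d 0 (\<lambda>n. Y \<omega> (n + 1)) vac"

definition virasoro_irreducible_module ::
    "complex \<Rightarrow> ('a::complex_vector \<Rightarrow> int \<Rightarrow> 'a \<Rightarrow> 'a) \<Rightarrow> 'a \<Rightarrow> 'a \<Rightarrow>
     complex \<Rightarrow> ('a \<Rightarrow> int \<Rightarrow> 'w::complex_vector \<Rightarrow> 'w) \<Rightarrow> 'w \<Rightarrow> bool" where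
  "virasoro_irreducible_module d Y vac \<omega> h YW v \<longleftrightarrow>
     vertex_module UNIV Y vac YW \<and> irreducible_highest_weight d h (\<lambda>n. YW \<omega> (n + 1)) v"


section \<open>The lattice vertex algebra \<open>\<Pi>(0)\<close> and its modules\<close>

text \<open>
  The pair \<open>(x, y)\<close> stands for \<open>x c + y d\<close>. A generator index \<open>(g, j)\<close> stands for
  \<open>g(-j-1)\<close>, so multisets of such pairs index the monomial basis of \<open>M(1)\<close>. The basis
  vector \<open>(X, m)\<close> of \<open>Pi\<close> stands for \<open>X \<otimes> e\<^bsup>m c\<^esup>\<close> in \<open>\<Pi>(0)\<close>, and for
  \<open>X \<otimes> e\<^bsup>\<ell> \<mu> + (\<lambda> + m) c\<^esup>\<close> in
  \<open>\<Pi>\<^sub>(\<^sub>\<ell>\<^sub>)(\<lambda>) = \<Pi>(0) e\<^bsup>\<ell> \<mu> + \<lambda> c\<^esup>\<close>: all these spaces share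
  the type \<open>Pi\<close> and differ in the action of the zero modes and of the lattice operators.
\<close>

type_synonym hvec = "complex \<times> complex"

datatype heis_gen = GenC | GenD

type_synonym fock_index = "(heis_gen \<times> nat) multiset \<times> int"
type_synonym Pi = "fock_index \<Rightarrow>\<^sub>0 complex"

definition form :: "hvec \<Rightarrow> hvec \<Rightarrow> complex" where
  "form a b = 2 * (fst a * snd b + snd a * fst b)"

definition cvector :: hvec where "cvector = (1, 0)"
definition dvector :: hvec where "dvector = (0, 1)"
definition \<mu>vector :: "complex \<Rightarrow> hvec" where "\<mu>vector k = (k / 4, 1 / 2)"
definition \<nu>vector :: "complex \<Rightarrow> hvec" where "\<nu>vector k = (- k / 4, 1 / 2)"

primrec gen_vec :: "heis_gen \<Rightarrow> hvec" where
  "gen_vec GenC = cvector"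
| "gen_vec GenD = dvector"

definition basis_exp :: "int \<Rightarrow> Pi" where
  "basis_exp m = Poly_Mapping.single ({#}, m) 1"

definition lin_ext :: "('i \<Rightarrow> 'v::complex_vector) \<Rightarrow> ('i \<Rightarrow>\<^sub>0 complex) \<Rightarrow> 'v" where
  "lin_ext f x = (\<Sum>i\<in>Poly_Mapping.keys x. Poly_Mapping.lookup x i *\<^sub>C f i)"

text \<open>\<open>heis k l lam a n\<close> is the action of \<open>a(n)\<close> on \<open>\<Pi>\<^sub>(\<^sub>l\<^sub>)(\<lambda>)\<close>,
  normalised by \<open>[a(m), b(n)] = m \<langle>a,b\<rangle> \<delta>\<^bsub>m+n,0\<^esub>\<close>.\<close>

definition charge :: "complex \<Rightarrow> int \<Rightarrow> complex \<Rightarrow> int \<Rightarrow> hvec" where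
  "charge k l lam m =
     of_int l *\<^sub>C \<mu>vector k + (lam + of_int m) *\<^sub>C cvector"

fun heis_basis :: "complex \<Rightarrow> int \<Rightarrow> complex \<Rightarrow> hvec \<Rightarrow> int \<Rightarrow> fock_index \<Rightarrow> Pi" where
  "heis_basis k l lam a n (X, m) =
     (if n < 0 then
        Poly_Mapping.single (add_mset (GenC, nat (- n - 1)) X, m) (fst a) +
        Poly_Mapping.single (add_mset (GenD, nat (- n - 1)) X, m) (snd a)
      else if n = 0 then
        Poly_Mapping.single (X, m) (form a (charge k l lam m))
      else
        (\<Sum>g\<in>{GenC, GenD}.
           Poly_Mapping.single (X - {#(g, nat (n - 1))#}, m)
             (of_int n * form a (gen_vec g) * of_nat (count X (g, nat (n - 1))))))"

definition heis :: "complex \<Rightarrow> int \<Rightarrow> complex \<Rightarrow> hvec \<Rightarrow> int \<Rightarrow> Pi \<Rightarrow> Pi" where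
  "heis k l lam a n = lin_ext (heis_basis k l lam a n)"

definition shift :: "int \<Rightarrow> Pi \<Rightarrow> Pi" where
  "shift q = lin_ext (\<lambda>(X, m). Poly_Mapping.single (X, m + q) 1)"

text \<open>
  The modes of \<open>Y(e\<^sup>\<alpha>,z) =
    exp(\<Sum>n>0. \<alpha>(-n)/n z\<^sup>n) exp(-\<Sum>n>0. \<alpha>(n)/n z\<^bsup>-n\<^esup>) e\<^sup>\<alpha> z\<^bsup>\<alpha>(0)\<^esup>\<close>
  for \<open>\<alpha> = q c\<close>; here \<open>\<alpha>(0)\<close> acts on \<open>\<Pi>\<^sub>(\<^sub>l\<^sub>)(\<lambda>)\<close> as \<open>q l\<close>.
  The cocycle is trivial on \<open>\<int> c\<close>.
\<close>

definition lattice_mode :: "complex \<Rightarrow> int \<Rightarrow> complex \<Rightarrow> int \<Rightarrow> int \<Rightarrow> Pi \<Rightarrow> Pi" where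
  "lattice_mode k l lam q n x =
     (let \<alpha> = of_int q *\<^sub>C cvector;
          neg = exp_coeff (\<lambda>i v. (1 / of_nat i) *\<^sub>C heis k l lam \<alpha> (- int i) v);
          pos = exp_coeff (\<lambda>i v. (- 1 / of_nat i) *\<^sub>C heis k l lam \<alpha> (int i) v)
      in (Sum_any (\<lambda>i::nat.
            if int i - n - 1 - q * l \<ge> 0
            then neg (nat (int i - n - 1 - q * l)) (pos i (shift q x)) else 0)))"

text \<open>
  \<open>YPi l lam\<close> is the vertex operator map of \<open>\<Pi>\<^sub>(\<^sub>l\<^sub>)(\<lambda>)\<close>; in particular
  \<open>YPi 0 0\<close> is that of the vertex algebra \<open>\<Pi>(0)\<close>. As \<open>c(-1)\<one>\<close>, \<open>d(-1)\<one>\<close> and the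
  \<open>e\<^bsup>q c\<^esup>\<close> generate \<open>\<Pi>(0)\<close>, this determines \<open>YPi\<close> uniquely.
\<close>

definition lattice_vertex_operators ::
    "complex \<Rightarrow> (int \<Rightarrow> complex \<Rightarrow> Pi \<Rightarrow> int \<Rightarrow> Pi \<Rightarrow> Pi) \<Rightarrow> bool" where
  "lattice_vertex_operators k YPi \<longleftrightarrow>
     vertex_algebra (YPi 0 0) (basis_exp 0) \<and>
     (\<forall>l lam.
        vertex_module UNIV (YPi 0 0) (basis_exp 0) (YPi l lam) \<and>
        (\<forall>a n. YPi l lam (heis k 0 0 a (-1) (basis_exp 0)) n = heis k l lam a n) \<and>
        (\<forall>q n. YPi l lam (basis_exp q) n = lattice_mode k l lam q n))"

text \<open>
  Adding a multiple of \<open>a(-2)\<one>\<close> to the conformal vector \<open>c(-1)d(-1)\<one> / 2\<close> does not change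
  its mode 0, which is all that enters the definition of intertwining operators.
\<close>

definition Pi_conformal :: "complex \<Rightarrow> Pi" where
  "Pi_conformal k =
     (1 / 2) *\<^sub>C heis k 0 0 cvector (-1) (heis k 0 0 dvector (-1) (basis_exp 0))"


section \<open>\<open>V\<^sub>k(sl(2))\<close> inside \<open>L\<^sup>V\<^sup>i\<^sup>r(d,0) \<otimes> \<Pi>(0)\<close>\<close>

definition e_vec :: "'a::complex_vector \<Rightarrow> (fock_index \<Rightarrow>\<^sub>0 'a)" where
  "e_vec vac = tens vac (basis_exp 1)"

definition h_vec :: "complex \<Rightarrow> 'a::complex_vector \<Rightarrow> (fock_index \<Rightarrow>\<^sub>0 'a)" where
  "h_vec k vac = 2 *\<^sub>C tens vac (heis k 0 0 (\<mu>vector k) (-1) (basis_exp 0))"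

definition f_vec :: "complex \<Rightarrow> 'a::complex_vector \<Rightarrow> 'a \<Rightarrow> (fock_index \<Rightarrow>\<^sub>0 'a)" where
  "f_vec k vac \<omega> =
     (k + 2) *\<^sub>C tens \<omega> (basis_exp (-1))
     - tens vac (heis k 0 0 (\<nu>vector k) (-1) (heis k 0 0 (\<nu>vector k) (-1) (basis_exp (-1))))
     - (k + 1) *\<^sub>C tens vac (heis k 0 0 (\<nu>vector k) (-2) (basis_exp (-1)))"

text \<open>\<open>V\<^sub>k(sl(2))\<close> is generated by \<open>e\<close>, \<open>h\<close>, \<open>f\<close>, so its image is the subalgebra
  generated by their images; \<open>Y\<close> is the vertex operator map of
  \<open>L\<^sup>V\<^sup>i\<^sup>r(d,0) \<otimes> \<Pi>(0)\<close>.\<close>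

definition Vk_sl2 ::
    "complex \<Rightarrow> ((fock_index \<Rightarrow>\<^sub>0 'a) \<Rightarrow> int \<Rightarrow> (fock_index \<Rightarrow>\<^sub>0 'a) \<Rightarrow> (fock_index \<Rightarrow>\<^sub>0 'a)) \<Rightarrow>
     'a::complex_vector \<Rightarrow> 'a \<Rightarrow> (fock_index \<Rightarrow>\<^sub>0 'a) set" where
  "Vk_sl2 k Y vac \<omega> =
     generated_subalgebra Y (tens vac (basis_exp 0)) {e_vec vac, h_vec k vac, f_vec k vac \<omega>}"

definition sugawara ::
    "complex \<Rightarrow> ((fock_index \<Rightarrow>\<^sub>0 'a) \<Rightarrow> int \<Rightarrow> (fock_index \<Rightarrow>\<^sub>0 'a) \<Rightarrow> (fock_index \<Rightarrow>\<^sub>0 'a)) \<Rightarrow>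
     'a::complex_vector \<Rightarrow> 'a \<Rightarrow> (fock_index \<Rightarrow>\<^sub>0 'a)" where
  "sugawara k Y vac \<omega> =
     (1 / (2 * (k + 2))) *\<^sub>C
       (Y (e_vec vac) (-1) (f_vec k vac \<omega>) + Y (f_vec k vac \<omega>) (-1) (e_vec vac)
        + (1 / 2) *\<^sub>C Y (h_vec k vac) (-1) (h_vec k vac))"


section \<open>The extended vertex algebra, its modules, and the twisted action\<close>

text \<open>
  \<open>Y\<close> and \<open>YW\<close> are the actions of the first summand on itself and on the second summand,
  \<open>conf\<close> is the conformal vector, so that \<open>YW conf 0\<close> is \<open>L(-1)\<close>. The inner sum is the
  coefficient of \<open>z\<^bsup>-n-1\<^esup>\<close> in \<open>e\<^bsup>zL(-1)\<^esup> Y(v2,-z) w1\<close>.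
\<close>

definition extended_vertex_operator ::
    "'v::complex_vector \<Rightarrow> ('v \<Rightarrow> int \<Rightarrow> 'v \<Rightarrow> 'v) \<Rightarrow>
     ('v \<Rightarrow> int \<Rightarrow> 'w::complex_vector \<Rightarrow> 'w) \<Rightarrow> 'v \<times> 'w \<Rightarrow> int \<Rightarrow> 'v \<times> 'w \<Rightarrow> 'v \<times> 'w" where
  "extended_vertex_operator conf Y YW = (\<lambda>(v1, w1) n (v2, w2).
     (Y v1 n v2,
      YW v1 n w2 +
      (Sum_any (\<lambda>i::nat. (((-1) powi (n + int i + 1)) / fact i) *\<^sub>C
         (YW conf 0 ^^ i) (YW v2 (n + int i) w1)))))"

definition extended_module_operator ::
    "('v::complex_vector \<Rightarrow> int \<Rightarrow> 'x::complex_vector \<Rightarrow> 'x) \<Rightarrow>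
     ('v \<Rightarrow> int \<Rightarrow> 'y::complex_vector \<Rightarrow> 'y) \<Rightarrow> ('w \<Rightarrow> complex \<Rightarrow> 'x \<Rightarrow> 'y) \<Rightarrow>
     'v \<times> 'w \<Rightarrow> int \<Rightarrow> 'x \<times> 'y \<Rightarrow> 'x \<times> 'y" where
  "extended_module_operator YX YY I = (\<lambda>(v, w) n (x, y).
     (YX v n x, YY v n y + I w (of_int n) x))"

text \<open>
  \<open>Delta_coeff Y s i a\<close> is the coefficient of \<open>z\<^sup>i\<close> in
  \<open>\<Delta>(s,z)a = z\<^bsup>s\<^sub>0\<^esup> exp(\<Sum>n\<ge>1. s\<^sub>n/(-n) (-z)\<^bsup>-n\<^esup>) a\<close>, where
  \<open>z\<^bsup>s\<^sub>0\<^esup>\<close> acts as \<open>z\<^sup>t\<close> on the \<open>t\<close>-eigenspace of \<open>s\<^sub>0\<close>. It is only used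
  for \<open>a\<close> in the kernel of \<open>s\<^sub>0\<close>, where \<open>z\<^bsup>s\<^sub>0\<^esup>\<close> is the identity.
\<close>

definition eigen_component ::
    "('m::complex_vector \<Rightarrow> 'm) \<Rightarrow> complex \<Rightarrow> 'm \<Rightarrow> 'm" where
  "eigen_component T t x = Poly_Mapping.lookup (THE f. eigen_decomp T x f) t"

definition Delta_coeff ::
    "('v::complex_vector \<Rightarrow> int \<Rightarrow> 'v \<Rightarrow> 'v) \<Rightarrow> 'v \<Rightarrow> int \<Rightarrow> 'v \<Rightarrow> 'v" where
  "Delta_coeff Y s i a =
     Sum_any (\<lambda>j::nat. eigen_component (Y s 0) (of_int (i + int j))
        (exp_coeff (\<lambda>n v. ((-1) ^ n / (- of_nat n)) *\<^sub>C Y s (int n) v) j a))"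

definition twisted_operator ::
    "('v::complex_vector \<Rightarrow> int \<Rightarrow> 'v \<Rightarrow> 'v) \<Rightarrow> 'v \<Rightarrow>
     ('v \<Rightarrow> int \<Rightarrow> 'm::complex_vector \<Rightarrow> 'm) \<Rightarrow> 'v \<Rightarrow> int \<Rightarrow> 'm \<Rightarrow> 'm" where
  "twisted_operator Y s YM a n x =
     Sum_any (\<lambda>i::int. YM (Delta_coeff Y s i a) (n + i) x)"


section \<open>Weight modules, logarithmic modules, extensions\<close>

text \<open>\<open>conf\<close> is the Sugawara vector, so \<open>YM conf 1\<close> is \<open>L(0)\<close>.\<close>

definition weight_module ::
    "'a::complex_vector set \<Rightarrow> ('a \<Rightarrow> int \<Rightarrow> 'a \<Rightarrow> 'a) \<Rightarrow> 'a \<Rightarrow> 'a \<Rightarrow> 'a \<Rightarrow>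
     ('a \<Rightarrow> int \<Rightarrow> 'm::complex_vector \<Rightarrow> 'm) \<Rightarrow> bool" where
  "weight_module A Y vac conf h YM \<longleftrightarrow>
     vertex_module A Y vac YM \<and> acts_semisimply (YM conf 1) \<and> acts_semisimply (YM h 0)"

definition logarithmic_module ::
    "'a::complex_vector set \<Rightarrow> ('a \<Rightarrow> int \<Rightarrow> 'a \<Rightarrow> 'a) \<Rightarrow> 'a \<Rightarrow> 'a \<Rightarrow>
     ('a \<Rightarrow> int \<Rightarrow> 'm::complex_vector \<Rightarrow> 'm) \<Rightarrow> bool" where
  "logarithmic_module A Y vac conf YM \<longleftrightarrow>
     vertex_module A Y vac YM \<and> sum_of_gen_eigenspaces (YM conf 1)"

definition module_hom_on ::
    "'a set \<Rightarrow> ('a \<Rightarrow> int \<Rightarrow> 'm::complex_vector \<Rightarrow> 'm) \<Rightarrow>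
     ('a \<Rightarrow> int \<Rightarrow> 'n::complex_vector \<Rightarrow> 'n) \<Rightarrow> ('m \<Rightarrow> 'n) \<Rightarrow> bool" where
  "module_hom_on A YM YN \<phi> \<longleftrightarrow>
     clinear \<phi> \<and> (\<forall>a\<in>A. \<forall>n x. \<phi> (YM a n x) = YN a n (\<phi> x))"

definition nonsplit_extension ::
    "'a set \<Rightarrow> ('a \<Rightarrow> int \<Rightarrow> 'm1::complex_vector \<Rightarrow> 'm1) \<Rightarrow>
     ('a \<Rightarrow> int \<Rightarrow> 'm::complex_vector \<Rightarrow> 'm) \<Rightarrow>
     ('a \<Rightarrow> int \<Rightarrow> 'm2::complex_vector \<Rightarrow> 'm2) \<Rightarrow> bool" where
  "nonsplit_extension A Y1 YM Y2 \<longleftrightarrow>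
     (\<exists>\<iota> \<pi>. module_hom_on A Y1 YM \<iota> \<and> module_hom_on A YM Y2 \<pi> \<and>
        inj \<iota> \<and> surj \<pi> \<and> range \<iota> = {x. \<pi> x = 0} \<and>
        \<not> (\<exists>\<sigma>. module_hom_on A Y2 YM \<sigma> \<and> (\<forall>y. \<pi> (\<sigma> y) = y)))"

end

theory Submission
  imports Defs "HOL-Computational_Algebra.Formal_Power_Series"
begin

text \<open>
  On the sum of two modules glued by an intertwining operator \<open>J\<close>, the twist by \<open>\<Delta>(s,z)\<close> acts by
  \<open>(x, y) \<mapsto> (a\<^sub>n x, a\<^sub>n y + D(a,n) x)\<close> with \<open>D(a,n) = \<Sum>j\<ge>1. (-1)\<^bsup>j-1\<^esup>/j J(s\<^sub>j a, n - j)\<close>. The Borcherds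
  identity for this action says that \<open>D\<close> is a cocycle; it follows from the commutator formula for
  \<open>s\<^sub>j (a\<^sub>q b)\<close> and a Vandermonde identity for the coefficients of the logarithm, provided
  \<open>s\<^sub>0\<close> vanishes on \<open>V\<^sub>k(sl(2))\<close>. The latter comes down to \<open>s\<^sub>0 f = 0\<close>, which is the level two null
  vector of \<open>L\<^sup>V\<^sup>i\<^sup>r(d, h\<^bsup>2,1\<^esup>)\<close>.

  For the Sugawara vector \<open>s\<^sub>1 \<omega> = s\<close> and \<open>s\<^sub>j \<omega> = 0\<close> for \<open>j \<ge> 2\<close>, so \<open>L(0)\<close> becomes
  \<open>(x, y) \<mapsto> (L(0) x, L(0) y + S x)\<close>, where \<open>S\<close> commutes with the semisimple \<open>L(0)\<close>. Everything
  therefore rests on \<open>S \<noteq> 0\<close>. An intertwining operator does not vanish on generating vectors, and its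
  leading coefficient on highest weight vectors is singular, hence again a highest weight vector;
  comparing weights, the leading exponents of the Virasoro and the lattice factor are opposite
  precisely because of the choice of \<open>\<lambda>\<close>, and \<open>S\<close> maps \<open>v\<^bsub>r,s\<^esub> \<otimes> e\<^bsup>\<ell>\<mu>+(\<lambda>-1)c\<^esup>\<close> to a nonzero multiple of
  the corresponding vector of the second summand. A splitting would write the image of this
  eigenvector as \<open>(t - L(0)) y\<close> with \<open>t\<close> its eigenvalue, which is impossible as \<open>L(0)\<close> is semisimple.
\<close>

section \<open>Borcherds identities\<close>

text \<open>No Jacobi identity for \<open>extended_vertex_operator\<close> enters the argument. Two
  elements of its second summand multiply to zero, so on V_k(sl(2)) the exponential in Delta(s,z)
  stops after its linear term, and the only products with s that matter are s_j a, which
  skew-symmetry defines from the action of a on the module containing s. Every identity for s_j is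
  derived from that action and from L(-1). Tensor products pose a second obstacle: a negative power
  of z1 - z2 does not split between the factors, so locality and associativity are carried through
  the product separately, and the Jacobi identity is rebuilt from them. Since \<open>Sum_any\<close>
  is 0 on infinite support, each rearrangement of a double sum requires an explicit cutoff; many
  auxiliary bounds serve only this purpose. The parameters enter in terms of t = k + 2 = p'/p: d =
  13 - 6t - 6/t, h^{2,1} = 3t/4 - 1/2, and lambda = h^{2,1} + h^{r,s} - h^{r+1,s}, which says that
  the nonzero modes of the Virasoro intertwining operator have indices in lambda + Z.\<close>

unbundle no fps_syntax

section \<open>Complex-linear maps\<close>

lemma clinear_iff:
  "clinear f \<longleftrightarrow> (\<forall>x y. f (x + y) = f x + f y) \<and> (\<forall>c x. f (c *\<^sub>C x) = c *\<^sub>C f x)"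
  by (simp add: Vector_Spaces.linear_iff cvec.vector_space_axioms)

lemma clinearI:
  "(\<And>x y. f (x + y) = f x + f y) \<Longrightarrow> (\<And>c x. f (c *\<^sub>C x) = c *\<^sub>C f x) \<Longrightarrow> clinear f"
  by (simp add: clinear_iff)

lemma clinear_add: "clinear f \<Longrightarrow> f (x + y) = f x + f y"
  and clinear_scale: "clinear f \<Longrightarrow> f (c *\<^sub>C x) = c *\<^sub>C f x"
  by (simp_all add: clinear_iff)

lemma clinear_zero: "clinear f \<Longrightarrow> f 0 = 0"
  by (metis add_cancel_left_left clinear_add)

lemma clinear_minus: "clinear f \<Longrightarrow> f (- x) = - f x"
  by (metis clinear_add clinear_zero add.right_inverse add_eq_0_iff)

lemma clinear_diff: "clinear f \<Longrightarrow> f (x - y) = f x - f y"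
  by (metis clinear_add clinear_minus diff_conv_add_uminus)

lemma clinear_sum: "clinear f \<Longrightarrow> f (sum g A) = (\<Sum>i\<in>A. f (g i))"
  by (induction A rule: infinite_finite_induct) (simp_all add: clinear_zero clinear_add)

lemma clinear_compose: "clinear f \<Longrightarrow> clinear g \<Longrightarrow> clinear (\<lambda>x. f (g x))"
  by (simp add: clinear_iff)

lemma clinear_funpow:
  fixes f :: "'a::complex_vector \<Rightarrow> 'a"
  assumes "clinear f"
  shows "clinear (f ^^ n)"
proof (induction n)
  case 0 show ?case by (rule clinearI) simp_all
next
  case (Suc n) then show ?case using clinear_compose[OF assms Suc] by (simp add: o_def)
qed

lemmas scaleC_simps = scaleC_add_right scaleC_add_left scaleC_scaleC scaleC_one
  cvec.scale_zero_left cvec.scale_zero_right cvec.scale_minus_left cvec.scale_minus_right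
  cvec.scale_left_diff_distrib cvec.scale_right_diff_distrib

section \<open>Rearrangement of finitely supported sums\<close>

lemma Sum_any_eq_sum:
  "finite A \<Longrightarrow> (\<And>x. x \<notin> A \<Longrightarrow> g x = 0) \<Longrightarrow> Sum_any g = sum g A"
  by (rule Sum_any.expand_superset) auto

lemma Sum_any_nat:
  fixes f :: "nat \<Rightarrow> 'a::comm_monoid_add"
  shows "(\<And>i. N \<le> i \<Longrightarrow> f i = 0) \<Longrightarrow> Sum_any f = sum f {..<N}"
  by (rule Sum_any_eq_sum) auto

lemma Sum_any_single:
  "(\<And>x. x \<noteq> a \<Longrightarrow> g x = 0) \<Longrightarrow> Sum_any g = g a"
  by (subst Sum_any_eq_sum[where A = "{a}"]) auto

lemma finite_support_nat:
  fixes f :: "nat \<Rightarrow> 'a::zero"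
  shows "(\<And>i. N \<le> i \<Longrightarrow> f i = 0) \<Longrightarrow> finite {i. f i \<noteq> 0}"
  by (rule finite_subset[of _ "{..<N}"]) (auto simp: not_le[symmetric])

lemma clinear_Sum_any:
  assumes "clinear f" "finite {i. g i \<noteq> 0}"
  shows "f (Sum_any g) = Sum_any (\<lambda>i. f (g i))"
proof -
  have "Sum_any (\<lambda>i. f (g i)) = (\<Sum>i\<in>{i. g i \<noteq> 0}. f (g i))"
    by (rule Sum_any_eq_sum) (auto simp: assms clinear_zero)
  then show ?thesis by (simp add: Sum_any.expand_set clinear_sum assms)
qed

lemma Sum_any_pair:
  assumes "finite A" "\<And>a b. (a, b) \<notin> A \<Longrightarrow> g a b = 0"
  shows "Sum_any (\<lambda>a. Sum_any (g a)) = Sum_any (\<lambda>(a, b). g a b)"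
proof (rule Sum_any.cartesian_product)
  show "finite (fst ` A \<times> snd ` A)" using assms by simp
  show "{a. \<exists>b. g a b \<noteq> 0} \<times> {b. \<exists>a. g a b \<noteq> 0} \<subseteq> fst ` A \<times> snd ` A"
    using assms(2) by (force simp: image_iff)
qed

lemma Sum_any_swap:
  assumes "finite A" "\<And>a b. (a, b) \<notin> A \<Longrightarrow> g a b = 0"
  shows "Sum_any (\<lambda>a. Sum_any (\<lambda>b. g a b)) = Sum_any (\<lambda>b. Sum_any (\<lambda>a. g a b))"
proof (rule Sum_any.swap)
  show "finite (fst ` A \<times> snd ` A)" using assms by simp
  show "{a. \<exists>b. g a b \<noteq> 0} \<times> {b. \<exists>a. g a b \<noteq> 0} \<subseteq> fst ` A \<times> snd ` A"
    using assms(2) by (force simp: image_iff)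
qed

lemma Sum_any_reindex: "bij h \<Longrightarrow> Sum_any g = Sum_any (\<lambda>x. g (h x))"
  by (rule Sum_any.reindex_cong[of h]) (auto simp: o_def)

lemma Sum_any_shift_int:
  fixes g :: "int \<Rightarrow> 'a::comm_monoid_add"
  shows "Sum_any g = Sum_any (\<lambda>x. g (x + c))"
  by (rule Sum_any_reindex, rule bij_betw_byWitness[where f' = "\<lambda>x. x - c"]) auto

section \<open>Bilinear maps, and the Borcherds identity as an identity of residues\<close>

definition cbilinear ::
    "('a::complex_vector \<Rightarrow> 'b::complex_vector \<Rightarrow> 'c::complex_vector) \<Rightarrow> bool" where
  "cbilinear b \<longleftrightarrow> (\<forall>x. clinear (b x)) \<and> (\<forall>y. clinear (\<lambda>x. b x y))"

lemma cbilinear_zero: "cbilinear b \<Longrightarrow> b 0 y = 0" "cbilinear b \<Longrightarrow> b x 0 = 0"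
  unfolding cbilinear_def using clinear_zero[of "\<lambda>x. b x y"] clinear_zero[of "b x"] by auto

lemma cbilinear_sum:
  "cbilinear b \<Longrightarrow> b (sum f A) (sum g B) = (\<Sum>i\<in>A. \<Sum>j\<in>B. b (f i) (g j))"
  unfolding cbilinear_def
  by (simp add: clinear_sum clinear_sum[of "\<lambda>x. b x y" for y] sum.swap[of _ A B])

lemma cbilinear_scale:
  "cbilinear b \<Longrightarrow> b (c *\<^sub>C x) (d *\<^sub>C y) = (c * d) *\<^sub>C b x y"
  unfolding cbilinear_def
  by (simp add: clinear_scale clinear_scale[of "\<lambda>x. b x y" for y] scaleC_scaleC)

text \<open>The shape of the coefficients a_p b_q x: a bound in q that is uniform in p, and for each
  q a bound in p. For iterates (a_p b)_q x the two indices change roles, whence the swapped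
  abstraction over \<open>K\<close> in later hypotheses.\<close>

definition trunc2 :: "(int \<Rightarrow> int \<Rightarrow> 'm::zero) \<Rightarrow> bool" where
  "trunc2 G \<longleftrightarrow> (\<exists>B. \<forall>q\<ge>B. \<forall>p. G p q = 0) \<and> (\<forall>q. \<exists>P. \<forall>p\<ge>P. G p q = 0)"

text \<open>The residue in z1 and z2 of z1^m z2^n (z1 - z2)^l times the series with coefficient
  \<open>G p q\<close> at z1^(-p-1) z2^(-q-1), where (z1 - z2)^l is expanded in nonnegative powers
  of z2.\<close>

definition expand_diff :: "(int \<Rightarrow> int \<Rightarrow> 'm::complex_vector) \<Rightarrow> int \<Rightarrow> int \<Rightarrow> int \<Rightarrow> 'm" where
  "expand_diff G l m n =
     Sum_any (\<lambda>i::nat. ((-1) ^ i * (of_int l gchoose i)) *\<^sub>C G (l + m - int i) (n + int i))"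

text \<open>The corresponding residue in z0 and z2 of z0^l (z2 + z0)^m z2^n, with
  \<open>K p q\<close> at z0^(-p-1) z2^(-q-1); here z0 stands for z1 - z2.\<close>

definition expand_sum :: "(int \<Rightarrow> int \<Rightarrow> 'm::complex_vector) \<Rightarrow> int \<Rightarrow> int \<Rightarrow> int \<Rightarrow> 'm" where
  "expand_sum K l m n =
     Sum_any (\<lambda>i::nat. (of_int m gchoose i) *\<^sub>C K (l + int i) (m + n - int i))"

text \<open>For the coefficients a_p b_q x, b_p a_q x and (a_p b)_q x this is the Jacobi identity
  tested against one monomial. In \<open>H\<close> the first index belongs to z2, so m and n are
  interchanged there, and (-1)^l comes from z1 - z2 = -(z2 - z1).\<close>

definition borcherds ::
    "(int \<Rightarrow> int \<Rightarrow> 'm::complex_vector) \<Rightarrow> (int \<Rightarrow> int \<Rightarrow> 'm) \<Rightarrow> (int \<Rightarrow> int \<Rightarrow> 'm) \<Rightarrow>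
     int \<Rightarrow> int \<Rightarrow> int \<Rightarrow> bool" where
  "borcherds G H K l m n \<longleftrightarrow>
     expand_sum K l m n = expand_diff G l m n - ((-1) powi l) *\<^sub>C expand_diff H l n m"

lemma trunc2D1: "trunc2 G \<Longrightarrow> \<exists>B. \<forall>q\<ge>B. \<forall>p. G p q = 0"
  and trunc2D2: "trunc2 G \<Longrightarrow> \<exists>P. \<forall>p\<ge>P. G p q = 0"
  by (auto simp: trunc2_def)

lemma expand_diff_finite:
  assumes "trunc2 G"
  shows "finite {i::nat. ((-1) ^ i * c i) *\<^sub>C G (a - int i) (n + int i) \<noteq> 0}"
proof -
  obtain B where B: "\<And>q p. B \<le> q \<Longrightarrow> G p q = 0" using trunc2D1[OF assms] by blast
  show ?thesis
    by (rule finite_support_nat[of "nat (B - n)"]) (simp add: B)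
qed

lemma expand_sum_finite:
  assumes "trunc2 (\<lambda>q p. K p q)"
  shows "finite {i::nat. c i *\<^sub>C K (l + int i) (a - int i) \<noteq> 0}"
proof -
  obtain B where B: "\<And>q p. B \<le> p \<Longrightarrow> K p q = 0" using trunc2D1[OF assms] by blast
  show ?thesis
    by (rule finite_support_nat[of "nat (B - l)"]) (simp add: B)
qed

lemma Sum_any_nat_Suc:
  fixes f :: "nat \<Rightarrow> 'a::comm_monoid_add"
  assumes "finite {i. f i \<noteq> 0}"
  shows "Sum_any f = f 0 + Sum_any (\<lambda>i. f (Suc i))"
proof -
  obtain N where N: "\<And>i. N \<le> i \<Longrightarrow> f i = 0"
    using assms by (metis (mono_tags, lifting) finite_nat_set_iff_bounded linorder_not_less mem_Collect_eq)
  have "Sum_any f = sum f {..<Suc N}" by (rule Sum_any_nat) (simp add: N)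
  also have "\<dots> = f 0 + (\<Sum>i<N. f (Suc i))" by (rule sum.lessThan_Suc_shift)
  also have "(\<Sum>i<N. f (Suc i)) = Sum_any (\<lambda>i. f (Suc i))"
    by (rule Sum_any_nat[symmetric]) (simp add: N)
  finally show ?thesis .
qed

lemma Sum_any_diff:
  fixes f g :: "'a \<Rightarrow> 'b::ab_group_add"
  assumes "finite {a. f a \<noteq> 0}" "finite {a. g a \<noteq> 0}"
  shows "Sum_any (\<lambda>a. f a - g a) = Sum_any f - Sum_any g"
proof -
  have f: "finite ({a. f a \<noteq> 0} \<union> {a. g a \<noteq> 0})" using assms by simp
  have "Sum_any (\<lambda>a. f a - g a) = (\<Sum>a\<in>{a. f a \<noteq> 0} \<union> {a. g a \<noteq> 0}. f a - g a)"
    "Sum_any f = sum f ({a. f a \<noteq> 0} \<union> {a. g a \<noteq> 0})"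
    "Sum_any g = sum g ({a. f a \<noteq> 0} \<union> {a. g a \<noteq> 0})"
    by (rule Sum_any_eq_sum[OF f], simp)+
  then show ?thesis by (simp add: sum_subtractf)
qed

lemma gbinomial_Suc_of_int:
  "(of_int (m + 1) gchoose Suc i :: complex) = (of_int m gchoose i) + (of_int m gchoose Suc i)"
  by (simp add: gbinomial_Suc_Suc)

text \<open>Pascal's rule in the form z0 (z2 + z0)^m = (z2 + z0)^(m+1) - z2 (z2 + z0)^m. The
  recursion for \<open>expand_diff\<close> is the same rule for (z1 - z2)^(l+1).\<close>

lemma expand_sum_rec:
  assumes "trunc2 (\<lambda>q p. K p q)"
  shows "expand_sum K (l + 1) m n = expand_sum K l (m + 1) n - expand_sum K l m (n + 1)"
proof -
  note fin = expand_sum_finite[OF assms]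
  let ?f = "\<lambda>i::nat. (of_int (m + 1) gchoose i) *\<^sub>C K (l + int i) (m + n + 1 - int i)"
  let ?g = "\<lambda>i::nat. (of_int m gchoose i) *\<^sub>C K (l + int i) (m + n + 1 - int i)"
  have f: "finite {i. ?f i \<noteq> 0}" and g: "finite {i. ?g i \<noteq> 0}" by (rule fin)+
  have "expand_sum K l (m + 1) n - expand_sum K l m (n + 1) = Sum_any ?f - Sum_any ?g"
    by (simp add: expand_sum_def algebra_simps)
  also have "\<dots> = Sum_any (\<lambda>i. ?f i - ?g i)"
    using Sum_any_diff[OF f g] by simp
  also have "\<dots> = Sum_any (\<lambda>i. ((of_int (m + 1) gchoose i) - (of_int m gchoose i)) *\<^sub>C
      K (l + int i) (m + n + 1 - int i))"
    by (simp add: scaleC_simps)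
  also have "\<dots> = Sum_any (\<lambda>i. (of_int m gchoose i) *\<^sub>C K (l + 1 + int i) (m + n - int i))"
    by (subst Sum_any_nat_Suc[OF fin])
      (simp only: gbinomial_Suc_of_int, simp add: algebra_simps scaleC_simps)
  finally show ?thesis by (simp add: expand_sum_def)
qed

lemma expand_diff_rec:
  assumes "trunc2 G"
  shows "expand_diff G (l + 1) m n = expand_diff G l (m + 1) n - expand_diff G l m (n + 1)"
proof -
  note fin = expand_diff_finite[OF assms]
  let ?c = "\<lambda>i. (-1) ^ i * (of_int l gchoose i) :: complex"
  let ?f = "\<lambda>i::nat. ?c i *\<^sub>C G (l + m + 1 - int i) (n + int i)"
  let ?g = "\<lambda>i::nat. ?c i *\<^sub>C G (l + m - int i) (n + 1 + int i)"
  let ?h = "\<lambda>i::nat. ((-1) ^ i * (of_int (l + 1) gchoose i)) *\<^sub>C G (l + m + 1 - int i) (n + int i)"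
  have f: "finite {i. ?f i \<noteq> 0}" and g: "finite {i. ?g i \<noteq> 0}" and h: "finite {i. ?h i \<noteq> 0}"
    by (rule fin)+
  have f': "finite {i. ?f (Suc i) \<noteq> 0}"
    using finite_vimageI[OF f, of Suc] by (simp add: vimage_def)
  have "expand_diff G (l + 1) m n = Sum_any ?h"
    by (simp add: expand_diff_def algebra_simps)
  also have "\<dots> = ?f 0 + Sum_any (\<lambda>i. ?f (Suc i) - ?g i)"
    by (subst Sum_any_nat_Suc[OF h], simp only: gbinomial_Suc_of_int,
        simp add: algebra_simps scaleC_simps, rule Sum_any.cong, simp add: algebra_simps)
  also have "\<dots> = Sum_any ?f - Sum_any ?g"
    by (subst Sum_any_diff[OF f' g], subst Sum_any_nat_Suc[OF f]) simp
  finally show ?thesis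
    by (simp add: expand_diff_def algebra_simps)
qed

text \<open>
  The defect of the Borcherds identity satisfies a three-term recursion in \<open>(l, m, n)\<close>, so
  the identity follows from locality (large \<open>l\<close>) and associativity (one \<open>m\<close>).
\<close>

lemma borcherds_from_locality_associativity:
  assumes G: "trunc2 G" and H: "trunc2 H" and K: "trunc2 (\<lambda>q p. K p q)"
    and loc: "\<And>m n. borcherds G H K L m n"
    and assoc: "\<And>l n. borcherds G H K l M n"
  shows "borcherds G H K l m n"
proof -
  define B where "B l m n =
    expand_sum K l m n - (expand_diff G l m n - ((-1) powi l) *\<^sub>C expand_diff H l n m)" for l m n
  have rec: "B (l + 1) m n = B l (m + 1) n - B l m (n + 1)" for l m n
    unfolding B_def expand_sum_rec[OF K] expand_diff_rec[OF G] expand_diff_rec[OF H]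
    by (simp add: power_int_add scaleC_simps algebra_simps)
  have B0: "B l m n = 0 \<longleftrightarrow> borcherds G H K l m n" for l m n
    by (simp add: B_def borcherds_def)
  have up: "\<forall>m n. B (L + int j) m n = 0" for j
  proof (induction j)
    case 0 then show ?case using loc B0 by simp
  next
    case (Suc j) then show ?case using rec[of "L + int j"] by (simp add: algebra_simps)
  qed
  have down: "\<forall>m n. B (L - int j) m n = 0" for j
  proof (induction j)
    case 0 then show ?case using loc B0 by simp
  next
    case (Suc j)
    let ?l = "L - int (Suc j)"
    \<comment> \<open>As the defect vanishes at l + 1, the recursion makes it at l a function of m +
      n only; vanishing on the single column m = M therefore spreads to every m, upwards and
      downwards.\<close>
    have eq: "B ?l (m + 1) n = B ?l m (n + 1)" for m n
      using rec[of ?l m n] Suc by simp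
    have a: "B ?l (M + int i) n = 0" for i n
    proof (induction i arbitrary: n)
      case 0 then show ?case using assoc B0 by simp
    next
      case (Suc i) then show ?case using eq[of "M + int i" n] by (simp add: algebra_simps)
    qed
    have b: "B ?l (M - int i) n = 0" for i n
    proof (induction i arbitrary: n)
      case 0 then show ?case using assoc B0 by simp
    next
      case (Suc i) then show ?case using eq[of "M - int (Suc i)" "n - 1"] by (simp add: algebra_simps)
    qed
    show ?case
    proof (intro allI)
      fix m n show "B ?l m n = 0"
        using a[of "nat (m - M)" n] b[of "nat (M - m)" n] by (cases "m \<ge> M") auto
    qed
  qed
  have "B l m n = 0"
    using up[of "nat (l - L)"] down[of "nat (L - l)"] by (cases "l \<ge> L") auto
  then show ?thesis by (simp add: B0)
qed

section \<open>Convolutions of fields\<close>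

lemma Sum_any_triangle:
  fixes g :: "nat \<Rightarrow> nat \<Rightarrow> 'a::comm_monoid_add"
  assumes "\<And>i j. N \<le> i + j \<Longrightarrow> g i j = 0"
  shows "Sum_any (\<lambda>i. Sum_any (g i)) = Sum_any (\<lambda>k. \<Sum>i\<le>k. g i (k - i))"
proof -
  have fin: "finite {(i, j). i + j \<le> N}"
    by (rule finite_subset[of _ "{..N} \<times> {..N}"]) auto
  have "Sum_any (\<lambda>i. Sum_any (g i)) = Sum_any (\<lambda>(i, j). g i j)"
    by (rule Sum_any_pair[OF fin]) (auto intro!: assms)
  also have "\<dots> = (\<Sum>(i, j)\<in>{(i, j). i + j \<le> N}. g i j)"
    by (rule Sum_any_eq_sum[OF fin]) (auto intro!: assms)
  also have "\<dots> = (\<Sum>k\<le>N. \<Sum>i\<le>k. g i (k - i))"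
    by (rule sum.triangle_reindex_eq)
  also have "\<dots> = Sum_any (\<lambda>k. \<Sum>i\<le>k. g i (k - i))"
    by (rule Sum_any_eq_sum[symmetric]) (auto intro!: sum.neutral assms)
  finally show ?thesis .
qed

lemma finite_support_sum:
  assumes "\<And>i. i \<in> I \<Longrightarrow> finite {x. f i x \<noteq> 0}"
  shows "finite {x. (\<Sum>i\<in>I. f i x) \<noteq> 0}"
proof (cases "finite I")
  case True
  have "{x. (\<Sum>i\<in>I. f i x) \<noteq> 0} \<subseteq> (\<Union>i\<in>I. {x. f i x \<noteq> 0})"
  proof
    fix x assume "x \<in> {x. (\<Sum>i\<in>I. f i x) \<noteq> 0}"
    then obtain i where "i \<in> I" "f i x \<noteq> 0" using sum.not_neutral_contains_not_neutral by force
    then show "x \<in> (\<Union>i\<in>I. {x. f i x \<noteq> 0})" by blast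
  qed
  then show ?thesis by (rule finite_subset) (use True assms in simp)
qed simp

lemma Sum_any_sum:
  assumes "\<And>i. i \<in> I \<Longrightarrow> finite {x. f i x \<noteq> 0}"
  shows "Sum_any (\<lambda>x. \<Sum>i\<in>I. f i x) = (\<Sum>i\<in>I. Sum_any (f i))"
  using assms
proof (induction I rule: infinite_finite_induct)
  case (insert j I)
  have "finite {x. (\<Sum>i\<in>I. f i x) \<noteq> 0}"
    by (rule finite_support_sum) (use insert in simp)
  then show ?case using insert by (simp add: Sum_any.distrib)
qed auto

text \<open>Coefficients of the product of two series in two variables, multiplied through
  \<open>b\<close>; the -1 comes from placing index p at z^(-p-1). With \<open>b = tens\<close> it
  describes the composition of two tensor product modes.\<close>

definition conv ::
    "('a \<Rightarrow> 'b \<Rightarrow> 'c::comm_monoid_add) \<Rightarrow> (int \<Rightarrow> int \<Rightarrow> 'a) \<Rightarrow> (int \<Rightarrow> int \<Rightarrow> 'b) \<Rightarrow>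
     int \<Rightarrow> int \<Rightarrow> 'c" where
  "conv b G G' p q = Sum_any (\<lambda>(s, t). b (G s t) (G' (p - 1 - s) (q - 1 - t)))"

lemma trunc2_uniform:
  assumes "trunc2 G" "finite Q"
  shows "\<exists>P. \<forall>q\<in>Q. \<forall>p\<ge>P. G p q = 0"
proof -
  obtain f where f: "\<And>q p. p \<ge> f q \<Longrightarrow> G p q = 0"
    using trunc2D2[OF assms(1)] by metis
  show ?thesis
  proof (intro exI ballI allI impI)
    fix q p assume "q \<in> Q" "Max (insert 0 (f ` Q)) \<le> p"
    then have "f q \<le> p" using assms(2) by auto
    then show "G p q = 0" by (rule f)
  qed
qed

text \<open>The uniform bounds confine t to an interval. Over its finitely many values the remaining
  bounds can be taken uniform as well, and they confine s.\<close>

lemma conv_finite: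
  assumes "trunc2 G" "trunc2 G'" "\<And>y. b 0 y = 0" "\<And>x. b x 0 = 0"
  shows "finite {(s, t). b (G s t) (G' (p - s) (q - t)) \<noteq> 0}"
proof -
  obtain B where B: "\<And>q p. B \<le> q \<Longrightarrow> G p q = 0" using trunc2D1[OF assms(1)] by blast
  obtain B' where B': "\<And>q p. B' \<le> q \<Longrightarrow> G' p q = 0" using trunc2D1[OF assms(2)] by blast
  obtain P where P: "\<forall>r\<in>{q - B'..B}. \<forall>p\<ge>P. G p r = 0"
    using trunc2_uniform[OF assms(1) finite_atLeastAtMost_int[of "q - B'" "B"]] by (elim exE)
  obtain P' where P': "\<forall>r\<in>{q - B..B'}. \<forall>p\<ge>P'. G' p r = 0"
    using trunc2_uniform[OF assms(2) finite_atLeastAtMost_int[of "q - B" "B'"]] by (elim exE)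
  have "{(s, t). b (G s t) (G' (p - s) (q - t)) \<noteq> 0} \<subseteq> {p - P'..P} \<times> {q - B'..B}"
  proof
    fix x assume x: "x \<in> {(s, t). b (G s t) (G' (p - s) (q - t)) \<noteq> 0}"
    obtain s t where st: "x = (s, t)" by (cases x)
    have nz: "G s t \<noteq> 0" "G' (p - s) (q - t) \<noteq> 0" using x st assms(3,4) by force+
    have t: "t < B" using nz(1) B[of t s] by linarith
    have t': "q - t < B'" using nz(2) B'[of "q - t" "p - s"] by linarith
    have "G s t = 0" if "P \<le> s" using P t t' that by simp
    moreover have "G' (p - s) (q - t) = 0" if "P' \<le> p - s" using P' t t' that by simp
    ultimately have "s < P" "p - s < P'" using nz by linarith+
    then show "x \<in> {p - P'..P} \<times> {q - B'..B}" using t t' st by simp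
  qed
  then show ?thesis by (rule finite_subset) simp
qed

lemma conv_finite':
  assumes "trunc2 G" "trunc2 G'" "cbilinear b"
  shows "finite {x. (case x of (s, t) \<Rightarrow> b (G s t) (G' (p - s) (q - t))) \<noteq> 0}"
  using conv_finite[OF assms(1,2), of b p q] cbilinear_zero[OF assms(3)]
  by (simp add: case_prod_unfold)

lemma trunc2_shift: "trunc2 G \<Longrightarrow> trunc2 (\<lambda>p q. G (p + u) (q + v))"
  unfolding trunc2_def by (metis add.commute add_le_cancel_left diff_add_cancel diff_le_eq)

lemma trunc2_scale: "trunc2 G \<Longrightarrow> trunc2 (\<lambda>p q. c *\<^sub>C G p q)"
  unfolding trunc2_def by (metis cvec.scale_zero_right)

lemma trunc2_conv:
  assumes "trunc2 G" "trunc2 G'" "cbilinear b"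
  shows "trunc2 (conv b G G')"
  unfolding trunc2_def
proof (intro conjI allI)
  note z = cbilinear_zero[OF assms(3)]
  obtain B where B: "\<And>q p. B \<le> q \<Longrightarrow> G p q = 0" using trunc2D1[OF assms(1)] by blast
  obtain B' where B': "\<And>q p. B' \<le> q \<Longrightarrow> G' p q = 0" using trunc2D1[OF assms(2)] by blast
  show "\<exists>B. \<forall>q\<ge>B. \<forall>p. conv b G G' p q = 0"
  proof (intro exI allI impI)
    fix q p assume q: "B + B' \<le> q"
    have "b (G s t) (G' (p - 1 - s) (q - 1 - t)) = 0" for s t
      by (cases "B \<le> t") (use q in \<open>auto simp: z B B'\<close>)
    then show "conv b G G' p q = 0" unfolding conv_def by (simp add: case_prod_unfold)
  qed
  fix q
  obtain P where P: "\<forall>r\<in>{q - B'..B}. \<forall>p\<ge>P. G p r = 0"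
    using trunc2_uniform[OF assms(1) finite_atLeastAtMost_int[of "q - B'" "B"]] by (elim exE)
  obtain P' where P': "\<forall>r\<in>{q - B - 1..B'}. \<forall>p\<ge>P'. G' p r = 0"
    using trunc2_uniform[OF assms(2) finite_atLeastAtMost_int[of "q - B - 1" "B'"]] by (elim exE)
  show "\<exists>P. \<forall>p\<ge>P. conv b G G' p q = 0"
  proof (intro exI allI impI)
    fix p assume p: "P + P' \<le> p"
    have "b (G s t) (G' (p - 1 - s) (q - 1 - t)) = 0" for s t
    proof (cases "B \<le> t \<or> B' \<le> q - 1 - t")
      case True then show ?thesis by (auto simp: z B B')
    next
      case False
      then have "t \<in> {q - B'..B}" "q - 1 - t \<in> {q - B - 1..B'}" by auto
      then show ?thesis
        by (cases "P \<le> s") (use p in \<open>auto simp: z P P'\<close>)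
    qed
    then show "conv b G G' p q = 0" unfolding conv_def by (simp add: case_prod_unfold)
  qed
qed

lemma Sum_any_shift_pair:
  fixes g :: "int \<Rightarrow> int \<Rightarrow> 'a::comm_monoid_add"
  shows "Sum_any (\<lambda>(s, t). g s t) = Sum_any (\<lambda>(s, t). g (s + u) (t + v))"
proof -
  have "bij (\<lambda>(s, t). (s + u, t + v))"
    by (rule bij_betw_byWitness[where f' = "\<lambda>(s, t). (s - u, t - v)"]) auto
  from Sum_any_reindex[OF this, of "\<lambda>(s, t). g s t"] show ?thesis
    by (simp add: case_prod_unfold)
qed

text \<open>Transfers what is known for truncated data to iterates, whose truncation conditions have
  the two variables interchanged.\<close>

lemma conv_swap: "conv b (\<lambda>p q. G q p) (\<lambda>p q. G' q p) q p = conv b G G' p q"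
proof -
  have "bij (\<lambda>(s, t). (t, s))"
    by (rule bij_betw_byWitness[where f' = "\<lambda>(s, t). (t, s)"]) auto
  from Sum_any_reindex[OF this, of "\<lambda>(s, t). b (G s t) (G' (p - 1 - s) (q - 1 - t))"]
  show ?thesis unfolding conv_def by (simp add: case_prod_unfold)
qed

lemma conv_shift:
  "conv b (\<lambda>s t. G (s + u) (t + v)) (\<lambda>s t. G' (s + u') (t + v')) p q =
    conv b G G' (p + u + u') (q + v + v')"
proof -
  have "conv b G G' (p + u + u') (q + v + v') =
    Sum_any (\<lambda>(s, t). b (G (s + u) (t + v))
      (G' (p + u + u' - 1 - (s + u)) (q + v + v' - 1 - (t + v))))"
    unfolding conv_def by (rule Sum_any_shift_pair)
  then show ?thesis unfolding conv_def by (simp add: algebra_simps)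
qed

lemma conv_poly:
  assumes "trunc2 G" "trunc2 G'" "cbilinear b"
  shows "conv b (\<lambda>p q. \<Sum>i\<in>I. c i *\<^sub>C G (p + u i) (q + v i))
      (\<lambda>p q. \<Sum>j\<in>J. d j *\<^sub>C G' (p + u' j) (q + v' j)) p q =
    (\<Sum>i\<in>I. \<Sum>j\<in>J. (c i * d j) *\<^sub>C conv b G G' (p + u i + u' j) (q + v i + v' j))"
proof -
  let ?g = "\<lambda>i j. \<lambda>(s, t). b (G (s + u i) (t + v i)) (G' (p - 1 - s + u' j) (q - 1 - t + v' j))"
  have fin: "finite {x. ?g i j x \<noteq> 0}" for i j
    by (rule conv_finite'[OF trunc2_shift[OF assms(1), of "u i" "v i"]
          trunc2_shift[OF assms(2), of "u' j" "v' j"] assms(3)])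
  have fin': "finite {x. (c i * d j) *\<^sub>C ?g i j x \<noteq> 0}" for i j
    by (rule finite_subset[OF _ fin[of i j]]) auto
  have fin'': "finite {x. (\<Sum>j\<in>J. (c i * d j) *\<^sub>C ?g i j x) \<noteq> 0}" for i
    by (rule finite_support_sum[OF fin'])
  have "conv b (\<lambda>p q. \<Sum>i\<in>I. c i *\<^sub>C G (p + u i) (q + v i))
      (\<lambda>p q. \<Sum>j\<in>J. d j *\<^sub>C G' (p + u' j) (q + v' j)) p q =
    Sum_any (\<lambda>x. \<Sum>i\<in>I. \<Sum>j\<in>J. (c i * d j) *\<^sub>C ?g i j x)"
    unfolding conv_def
    by (simp add: cbilinear_sum[OF assms(3)] cbilinear_scale[OF assms(3)] case_prod_unfold)
  also have "\<dots> = (\<Sum>i\<in>I. Sum_any (\<lambda>x. \<Sum>j\<in>J. (c i * d j) *\<^sub>C ?g i j x))"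
    by (rule Sum_any_sum[OF fin''])
  also have "\<dots> = (\<Sum>i\<in>I. \<Sum>j\<in>J. Sum_any (\<lambda>x. (c i * d j) *\<^sub>C ?g i j x))"
    by (simp only: Sum_any_sum[OF fin'])
  also have "\<dots> = (\<Sum>i\<in>I. \<Sum>j\<in>J. (c i * d j) *\<^sub>C Sum_any (?g i j))"
    by (subst clinear_Sum_any[OF _ fin, where f = "scaleC d" for d]) (auto intro: clinearI simp: scaleC_simps)
  also have "\<dots> = (\<Sum>i\<in>I. \<Sum>j\<in>J. (c i * d j) *\<^sub>C conv b G G' (p + u i + u' j) (q + v i + v' j))"
    by (simp add: conv_shift[symmetric]) (simp add: conv_def)
  finally show ?thesis .
qed

lemma vandermonde_sum:
  fixes f :: "nat \<Rightarrow> 'a::complex_vector"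
  shows "(\<Sum>i\<le>L. \<Sum>j\<le>L'. ((of_nat L gchoose i) * (of_nat L' gchoose j)) *\<^sub>C f (i + j)) =
    (\<Sum>k\<le>L + L'. (of_nat (L + L') gchoose k) *\<^sub>C f k)"
proof -
  let ?g = "\<lambda>i j. ((of_nat L gchoose i) * (of_nat L' gchoose j)) *\<^sub>C f (i + j)"
  have z: "(of_nat n gchoose i :: complex) = 0" if "n < i" for n i
    using that by (simp add: binomial_gbinomial[symmetric])
  have z2: "?g i j = 0" if "Suc (L + L') \<le> i + j" for i j
    using that by (cases "L < i") (auto simp: z)
  have "(\<Sum>i\<le>L. \<Sum>j\<le>L'. ?g i j) = Sum_any (\<lambda>i. Sum_any (?g i))"
    by (subst Sum_any_eq_sum[of "{..L'}"], simp, simp add: z)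
      (rule Sum_any_eq_sum[symmetric], simp, simp add: z)
  also have "\<dots> = Sum_any (\<lambda>k. \<Sum>i\<le>k. ?g i (k - i))"
    by (rule Sum_any_triangle[OF z2])
  also have "\<dots> = Sum_any (\<lambda>k. (of_nat (L + L') gchoose k) *\<^sub>C f k)"
    by (rule Sum_any.cong)
      (simp add: gbinomial_Vandermonde[symmetric] atLeast0AtMost cvec.scale_sum_left)
  also have "\<dots> = (\<Sum>k\<le>L + L'. (of_nat (L + L') gchoose k) *\<^sub>C f k)"
    by (rule Sum_any_eq_sum) (simp_all add: z del: of_nat_add)
  finally show ?thesis .
qed

lemma expand_diff_nat:
  "expand_diff G (int L) m n =
    (\<Sum>i\<le>L. ((-1) ^ i * (of_nat L gchoose i)) *\<^sub>C G (m + (int L - int i)) (n + int i))"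
  unfolding expand_diff_def
  by (subst Sum_any_eq_sum[where A = "{..L}"])
    (auto simp: binomial_gbinomial[symmetric] algebra_simps not_le)

lemma expand_sum_nat:
  "expand_sum K l (int M) n =
    (\<Sum>i\<le>M. (of_nat M gchoose i) *\<^sub>C K (l + int i) (n + (int M - int i)))"
  unfolding expand_sum_def
  by (subst Sum_any_eq_sum[where A = "{..M}"])
    (auto simp: binomial_gbinomial[symmetric] algebra_simps not_le)

text \<open>A nonnegative power of z1 - z2 is a polynomial, so it may be moved into the two factors
  term by term, and (z1 - z2)^L (z1 - z2)^L' is recombined by Vandermonde. This is what locality of
  a product of fields requires.\<close>

lemma expand_diff_conv_nat:
  assumes "trunc2 G" "trunc2 G'" "cbilinear b"
  shows "conv b (expand_diff G (int L)) (expand_diff G' (int L')) m n =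
    expand_diff (conv b G G') (int (L + L')) m n"
proof -
  have "conv b (expand_diff G (int L)) (expand_diff G' (int L')) m n =
    (\<Sum>i\<le>L. \<Sum>j\<le>L'. (((-1) ^ i * (of_nat L gchoose i)) * ((-1) ^ j * (of_nat L' gchoose j))) *\<^sub>C
      conv b G G' (m + (int L - int i) + (int L' - int j)) (n + int i + int j))"
    unfolding expand_diff_nat[abs_def] by (rule conv_poly[OF assms])
  also have "\<dots> = (\<Sum>i\<le>L. \<Sum>j\<le>L'. ((of_nat L gchoose i) * (of_nat L' gchoose j)) *\<^sub>C
      ((-1) ^ (i + j) *\<^sub>C conv b G G' (m + (int (L + L') - int (i + j))) (n + int (i + j))))"
    by (intro sum.cong refl) (simp add: scaleC_scaleC power_add algebra_simps)
  also have "\<dots> = expand_diff (conv b G G') (int (L + L')) m n"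
    by (subst vandermonde_sum) (simp add: expand_diff_nat scaleC_scaleC mult.commute del: of_nat_add)
  finally show ?thesis .
qed

lemma expand_sum_conv_nat:
  assumes "trunc2 (\<lambda>q p. K p q)" "trunc2 (\<lambda>q p. K' p q)" "cbilinear b"
  shows "conv b (\<lambda>l n. expand_sum K l (int L) n) (\<lambda>l n. expand_sum K' l (int L') n) m n =
    expand_sum (conv b K K') m (int (L + L')) n"
proof -
  have "conv b (\<lambda>l n. expand_sum K l (int L) n) (\<lambda>l n. expand_sum K' l (int L') n) m n =
    conv b (\<lambda>n l. expand_sum K l (int L) n) (\<lambda>n l. expand_sum K' l (int L') n) n m"
    by (subst conv_swap[symmetric]) simp
  also have "\<dots> = (\<Sum>i\<le>L. \<Sum>j\<le>L'. ((of_nat L gchoose i) * (of_nat L' gchoose j)) *\<^sub>C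
      conv b (\<lambda>q p. K p q) (\<lambda>q p. K' p q) (n + (int L - int i) + (int L' - int j)) (m + int i + int j))"
    unfolding expand_sum_nat by (rule conv_poly[OF assms])
  also have "\<dots> = (\<Sum>i\<le>L. \<Sum>j\<le>L'. ((of_nat L gchoose i) * (of_nat L' gchoose j)) *\<^sub>C
      conv b K K' (m + int (i + j)) (n + (int (L + L') - int (i + j))))"
    by (subst conv_swap) (simp add: algebra_simps)
  also have "\<dots> = expand_sum (conv b K K') m (int (L + L')) n"
    by (subst vandermonde_sum) (simp add: expand_sum_nat del: of_nat_add)
  finally show ?thesis .
qed

text \<open>Each summand depends on s but the sum does not: after negation of the upper arguments
  the two binomials have upper arguments -s-1 and s+k-l, and Vandermonde sees only their
  sum.\<close>

lemma expand_diff_coeff: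
  fixes l s :: int
  assumes a_def: "a = (\<lambda>(x::int) (i::nat). (-1) ^ i * (of_int x gchoose i) :: complex)"
  shows "(\<Sum>i\<le>k. a (s + int i) i * a (l - 1 - s - int i) (k - i)) = a l k"
proof -
  have 1: "a (s + int i) i = (of_int (- s - 1) gchoose i)" for i
    unfolding a_def by (subst gbinomial_negated_upper) simp
  have 2: "a (l - 1 - s - int i) (k - i) = (of_int (s + int k - l) gchoose (k - i))" if "i \<le> k" for i
    unfolding a_def using that by (subst gbinomial_negated_upper) (simp add: of_nat_diff algebra_simps)
  have "(\<Sum>i\<le>k. a (s + int i) i * a (l - 1 - s - int i) (k - i)) =
    (\<Sum>i\<le>k. (of_int (- s - 1) gchoose i) * (of_int (s + int k - l) gchoose (k - i)))"
    by (rule sum.cong) (auto simp: 1 2)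
  also have "\<dots> = (of_int (- s - 1) + of_int (s + int k - l) gchoose k)"
    by (subst gbinomial_Vandermonde[symmetric]) (simp add: atLeast0AtMost)
  also have "\<dots> = a l k"
    unfolding a_def by (subst (2) gbinomial_negated_upper) simp
  finally show ?thesis .
qed

text \<open>For m = 0 and varying l, \<open>expand_diff\<close> gives the coefficients of the series
  obtained by the substitution z1 = z0 + z2, expanded in nonnegative powers of z2. A substitution is
  multiplicative, so this holds for negative l too, where the powers of z1 - z2 themselves cannot be
  distributed.\<close>

lemma expand_diff_conv:
  assumes G: "trunc2 G" and G': "trunc2 G'" and b: "cbilinear b"
  shows "conv b (\<lambda>l n. expand_diff G l 0 n) (\<lambda>l n. expand_diff G' l 0 n) l n =
    expand_diff (conv b G G') l 0 n"
proof -
  define a where "a = (\<lambda>(x::int) (i::nat). (-1) ^ i * (of_int x gchoose i) :: complex)"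
  note z = cbilinear_zero[OF b]
  obtain B where B: "\<And>q p. B \<le> q \<Longrightarrow> G p q = 0" using trunc2D1[OF G] by blast
  obtain B' where B': "\<And>q p. B' \<le> q \<Longrightarrow> G' p q = 0" using trunc2D1[OF G'] by blast
  define C where "C = nat (B + B' - n)"
  let ?g = "\<lambda>i. \<lambda>j. \<lambda>(s, t). b (G (s - int i) (t + int i)) (G' (l - 1 - s - int j) (n - 1 - t + int j))"
  let ?\<Phi> = "\<lambda>i j. \<lambda>(s, t). (a (s + int i) i * a (l - 1 - s - int i) j) *\<^sub>C
      b (G s t) (G' (l - 1 - s - int (i + j)) (n - 1 - t + int (i + j)))"
  have fin: "finite {x. ?g i j x \<noteq> 0}" for i j
    using conv_finite'[OF trunc2_shift[OF G, of "- int i" "int i"]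
        trunc2_shift[OF G', of "- int j" "int j"] b, of "l - 1" "n - 1"]
    by simp
  have fin1: "finite {x. (case x of (s, t) \<Rightarrow> (a s i * a (l - 1 - s) j) *\<^sub>C ?g i j (s, t)) \<noteq> 0}" for i j
    by (rule finite_subset[OF _ fin[of i j]]) auto
  have finc: "finite {x. (case x of (s, t) \<Rightarrow> c s *\<^sub>C b (G s t) (G' (l' - 1 - s) (n' - 1 - t))) \<noteq> 0}" for c l' n'
    by (rule finite_subset[OF _ conv_finite'[OF G G' b, of "l' - 1" "n' - 1"]]) auto
  have \<Phi>0: "?\<Phi> i j x = 0" if "C \<le> i + j" for i j x
  proof (cases x)
    case (Pair s t)
    show ?thesis
    proof (cases "B \<le> t")
      case False
      then have "B' \<le> n - 1 - t + int (i + j)" using that by (simp add: C_def)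
      then show ?thesis using Pair by (simp add: B' z)
    qed (simp add: Pair B z)
  qed
  have inner: "b (expand_diff G s 0 t) (expand_diff G' (l - 1 - s) 0 (n - 1 - t)) =
      (\<Sum>i<C. \<Sum>j<C. (a s i * a (l - 1 - s) j) *\<^sub>C ?g i j (s, t))" for s t
  proof -
    consider "B \<le> t" | "B' \<le> n - 1 - t" | "t < B" "n - 1 - t < B'" by linarith
    then show ?thesis
    proof cases
      case 1 then show ?thesis by (simp add: expand_diff_def B z)
    next
      case 2 then show ?thesis by (simp add: expand_diff_def B' z)
    next
      case 3
      have "expand_diff G s 0 t = (\<Sum>i<C. a s i *\<^sub>C G (s - int i) (t + int i))"
        unfolding expand_diff_def
        by (subst Sum_any_nat[of C]) (use 3 in \<open>auto simp: a_def C_def B\<close>)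
      moreover have "expand_diff G' (l - 1 - s) 0 (n - 1 - t) =
          (\<Sum>j<C. a (l - 1 - s) j *\<^sub>C G' (l - 1 - s - int j) (n - 1 - t + int j))"
        unfolding expand_diff_def
        by (subst Sum_any_nat[of C]) (use 3 in \<open>auto simp: a_def C_def B'\<close>)
      ultimately show ?thesis by (simp add: cbilinear_sum[OF b] cbilinear_scale[OF b])
    qed
  qed
  have "conv b (\<lambda>l n. expand_diff G l 0 n) (\<lambda>l n. expand_diff G' l 0 n) l n =
      Sum_any (\<lambda>x. \<Sum>i<C. \<Sum>j<C. case x of (s, t) \<Rightarrow> (a s i * a (l - 1 - s) j) *\<^sub>C ?g i j (s, t))"
    unfolding conv_def inner by (simp add: case_prod_unfold)
  also have "\<dots> = (\<Sum>i<C. \<Sum>j<C. Sum_any (\<lambda>x. case x of (s, t) \<Rightarrow> (a s i * a (l - 1 - s) j) *\<^sub>C ?g i j (s, t)))"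
    by (simp only: Sum_any_sum[OF finite_support_sum[OF fin1]] Sum_any_sum[OF fin1])
  also have "\<dots> = (\<Sum>i<C. \<Sum>j<C. Sum_any (?\<Phi> i j))"
  proof (intro sum.cong refl)
    fix i j
    show "Sum_any (\<lambda>x. case x of (s, t) \<Rightarrow> (a s i * a (l - 1 - s) j) *\<^sub>C ?g i j (s, t)) = Sum_any (?\<Phi> i j)"
      by (subst Sum_any_shift_pair[of _ "int i" "- int i"]) (simp add: algebra_simps)
  qed
  also have "\<dots> = Sum_any (\<lambda>i. Sum_any (\<lambda>j. Sum_any (?\<Phi> i j)))"
    by (subst Sum_any_nat[of C], simp add: \<Phi>0[simplified], rule Sum_any_nat[symmetric])
      (simp add: \<Phi>0[simplified])
  also have "\<dots> = Sum_any (\<lambda>k. \<Sum>i\<le>k. Sum_any (?\<Phi> i (k - i)))"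
    by (rule Sum_any_triangle[of C]) (simp add: \<Phi>0[simplified])
  also have "\<dots> = Sum_any (\<lambda>k. a l k *\<^sub>C conv b G G' (l - int k) (n + int k))"
  proof (rule Sum_any.cong)
    fix k
    let ?h = "\<lambda>i. \<lambda>(s, t). (a (s + int i) i * a (l - 1 - s - int i) (k - i)) *\<^sub>C
      b (G s t) (G' ((l - int k) - 1 - s) ((n + int k) - 1 - t))"
    have "(\<Sum>i\<le>k. Sum_any (?\<Phi> i (k - i))) = (\<Sum>i\<le>k. Sum_any (?h i))"
      by (rule sum.cong) (simp_all add: algebra_simps)
    also have "\<dots> = Sum_any (\<lambda>x. \<Sum>i\<le>k. ?h i x)"
      by (rule Sum_any_sum[symmetric]) (rule finc)
    also have "\<dots> = Sum_any (\<lambda>(s, t). a l k *\<^sub>C b (G s t) (G' ((l - int k) - 1 - s) ((n + int k) - 1 - t)))"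
      by (rule Sum_any.cong)
        (simp only: case_prod_unfold cvec.scale_sum_left[symmetric] expand_diff_coeff[OF a_def])
    also have "\<dots> = a l k *\<^sub>C conv b G G' (l - int k) (n + int k)"
      unfolding conv_def
      by (subst clinear_Sum_any[where f = "scaleC (a l k)"])
        (use finc[of "\<lambda>_. 1" "l - int k" "n + int k"] in
          \<open>auto intro!: clinearI simp: scaleC_simps case_prod_unfold mult.commute\<close>)
    finally show "(\<Sum>i\<le>k. Sum_any (?\<Phi> i (k - i))) = a l k *\<^sub>C conv b G G' (l - int k) (n + int k)" .
  qed
  finally show ?thesis by (simp add: expand_diff_def a_def)
qed

text \<open>A factor z1^M is absorbed into a shift of the first index before the substitution z1 =
  z0 + z2 is made.\<close>

lemma expand_diff_conv_shift:
  assumes G: "trunc2 G" and G': "trunc2 G'" and b: "cbilinear b"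
  shows "conv b (\<lambda>l n. expand_diff G l M n) (\<lambda>l n. expand_diff G' l M' n) l n =
    expand_diff (conv b G G') l (M + M') n"
proof -
  have *: "expand_diff G l M n = expand_diff (\<lambda>p q. G (p + M) (q + 0)) l 0 n"
    for G :: "int \<Rightarrow> int \<Rightarrow> 'x::complex_vector" and l M n
    by (simp add: expand_diff_def algebra_simps)
  show ?thesis
    unfolding *[of G] *[of G']
    by (subst expand_diff_conv[OF trunc2_shift[OF G] trunc2_shift[OF G'] b])
      (simp add: expand_diff_def conv_shift[of _ _ _ 0 _ _ 0, simplified] algebra_simps)
qed

lemma expand_diff_zero: "(\<And>p q. a \<le> p \<Longrightarrow> G q p = 0) \<Longrightarrow> a \<le> n \<Longrightarrow> expand_diff G l m n = 0"
  by (simp add: expand_diff_def)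

lemma expand_sum_zero: "(\<And>p q. a \<le> p \<Longrightarrow> K p q = 0) \<Longrightarrow> a \<le> l \<Longrightarrow> expand_sum K l m n = 0"
  by (simp add: expand_sum_def)

lemma scale_conv:
  assumes "trunc2 G" "trunc2 G'" "cbilinear b"
  shows "conv b (\<lambda>p q. c *\<^sub>C G p q) (\<lambda>p q. d *\<^sub>C G' p q) p q = (c * d) *\<^sub>C conv b G G' p q"
  using conv_poly[OF assms, where I = "{0::nat}" and c = "\<lambda>_. c" and u = "\<lambda>_. 0" and v = "\<lambda>_. 0"
      and J = "{0::nat}" and d = "\<lambda>_. d" and u' = "\<lambda>_. 0" and v' = "\<lambda>_. 0"]
  by simp

lemma self_le_int_nat: "n \<le> int (nat n)"
  by simp

lemma trunc2_add:
  fixes G H :: "int \<Rightarrow> int \<Rightarrow> 'a::comm_monoid_add"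
  assumes "trunc2 G" "trunc2 H"
  shows "trunc2 (\<lambda>p q. G p q + H p q)"
  unfolding trunc2_def
proof (intro conjI allI)
  obtain B B' where "\<forall>q\<ge>B. \<forall>p. G p q = 0" "\<forall>q\<ge>B'. \<forall>p. H p q = 0"
    using assms unfolding trunc2_def by blast
  then show "\<exists>B. \<forall>q\<ge>B. \<forall>p. G p q + H p q = 0"
    by (intro exI[of _ "max B B'"]) simp
  fix q
  obtain P P' where "\<forall>p\<ge>P. G p q = 0" "\<forall>p\<ge>P'. H p q = 0"
    using assms unfolding trunc2_def by blast
  then show "\<exists>P. \<forall>p\<ge>P. G p q + H p q = 0"
    by (intro exI[of _ "max P P'"]) simp
qed

lemma trunc2_expand_diff:
  assumes "trunc2 F"
  shows "trunc2 (expand_diff F (int L))"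
proof -
  have "trunc2 (\<lambda>m n. \<Sum>i\<in>I. c i *\<^sub>C F (m + u i) (n + v i))" if "finite I"
    for I :: "nat set" and c u v
    using that
  proof (induction I)
    case empty show ?case by (simp add: trunc2_def)
  next
    case (insert i I)
    then show ?case using trunc2_add[OF trunc2_scale[OF trunc2_shift[OF assms]] insert.IH] by simp
  qed
  from this[of "{..L}"] show ?thesis unfolding expand_diff_nat[abs_def] by simp
qed

text \<open>Orders of locality add under products, and so do the exponents M for which (z2 + z0)^M
  makes the product associative. These two special cases can be split between the factors, and
  \<open>borcherds_from_locality_associativity\<close> recovers all other exponents from
  them.\<close>

theorem borcherds_conv:
  assumes G: "trunc2 G" and H: "trunc2 H" and K: "trunc2 (\<lambda>q p. K p q)"
    and G': "trunc2 G'" and H': "trunc2 H'" and K': "trunc2 (\<lambda>q p. K' p q)"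
    and b: "cbilinear b"
    and bor: "\<And>l m n. borcherds G H K l m n" and bor': "\<And>l m n. borcherds G' H' K' l m n"
  shows "borcherds (conv b G G') (conv b H H') (conv b K K') l m n"
proof -
  have Kc: "trunc2 (\<lambda>q p. conv b K K' p q)"
    using trunc2_conv[OF K K' b] by (subst conv_swap[symmetric])
  obtain N where "\<And>q p. N \<le> p \<Longrightarrow> K p q = 0" using trunc2D1[OF K] by blast
  then have N: "K p q = 0" if "int (nat N) \<le> p" for p q
    using that order_trans[OF self_le_int_nat] by blast
  obtain N' where "\<And>q p. N' \<le> p \<Longrightarrow> K' p q = 0" using trunc2D1[OF K'] by blast
  then have N': "K' p q = 0" if "int (nat N') \<le> p" for p q
    using that order_trans[OF self_le_int_nat] by blast
  obtain M where "\<And>q p. M \<le> q \<Longrightarrow> H p q = 0" using trunc2D1[OF H] by blast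
  then have M: "H p q = 0" if "int (nat M) \<le> q" for p q
    using that order_trans[OF self_le_int_nat] by blast
  obtain M' where "\<And>q p. M' \<le> q \<Longrightarrow> H' p q = 0" using trunc2D1[OF H'] by blast
  then have M': "H' p q = 0" if "int (nat M') \<le> q" for p q
    using that order_trans[OF self_le_int_nat] by blast
  define L where "L = nat N" define L' where "L' = nat N'"
  note z = cbilinear_zero[OF b]
  have Kc0: "conv b K K' p q = 0" if "int (L + L') \<le> p" for p q
  proof -
    have "b (K s t) (K' (p - 1 - s) (q - 1 - t)) = 0" for s t
      by (cases "int (nat N) \<le> s") (use that in \<open>auto simp: z N N' L_def L'_def\<close>)
    then show ?thesis by (simp add: conv_def case_prod_unfold)
  qed
  have Hc0: "conv b H H' p q = 0" if "int (nat M + nat M') \<le> q" for p q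
  proof -
    have "b (H s t) (H' (p - 1 - s) (q - 1 - t)) = 0" for s t
      by (cases "int (nat M) \<le> t") (use that in \<open>auto simp: z M M'\<close>)
    then show ?thesis by (simp add: conv_def case_prod_unfold)
  qed
  \<comment> \<open>L lies beyond the last nonzero a_p b, so the iterate side of the identity is
    zero and locality of order L is left.\<close>
  have loc: "expand_diff G (int L) = (\<lambda>m n. (-1) ^ L *\<^sub>C expand_diff H (int L) n m)"
  proof (intro ext)
    fix m n
    have "expand_sum K (int L) m n = 0"
      by (rule expand_sum_zero[of "int L"]) (simp_all only: L_def N order_refl)
    then show "expand_diff G (int L) m n = (-1) ^ L *\<^sub>C expand_diff H (int L) n m"
      using bor[of "int L" m n] by (simp add: borcherds_def)
  qed
  have loc': "expand_diff G' (int L') = (\<lambda>m n. (-1) ^ L' *\<^sub>C expand_diff H' (int L') n m)"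
  proof (intro ext)
    fix m n
    have "expand_sum K' (int L') m n = 0"
      by (rule expand_sum_zero[of "int L'"]) (simp_all only: L'_def N' order_refl)
    then show "expand_diff G' (int L') m n = (-1) ^ L' *\<^sub>C expand_diff H' (int L') n m"
      using bor'[of "int L'" m n] by (simp add: borcherds_def)
  qed
  have locality: "borcherds (conv b G G') (conv b H H') (conv b K K') (int (L + L')) m n" for m n
  proof -
    have "expand_diff (conv b G G') (int (L + L')) m n =
        conv b (\<lambda>m n. (-1) ^ L *\<^sub>C expand_diff H (int L) n m)
          (\<lambda>m n. (-1) ^ L' *\<^sub>C expand_diff H' (int L') n m) m n"
      by (simp only: expand_diff_conv_nat[OF G G' b, symmetric] loc loc')
    also have "\<dots> = conv b (\<lambda>m n. (-1) ^ L *\<^sub>C expand_diff H (int L) m n)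
          (\<lambda>m n. (-1) ^ L' *\<^sub>C expand_diff H' (int L') m n) n m"
      by (subst conv_swap[symmetric]) simp
    also have "\<dots> = (-1) ^ (L + L') *\<^sub>C expand_diff (conv b H H') (int (L + L')) n m"
      by (subst scale_conv[OF trunc2_expand_diff[OF H] trunc2_expand_diff[OF H'] b])
        (simp add: expand_diff_conv_nat[OF H H' b] power_add del: of_nat_add)
    finally show ?thesis
      unfolding borcherds_def
      by (simp add: expand_sum_zero[OF Kc0] power_int_of_nat del: of_nat_add)
  qed
  \<comment> \<open>M lies beyond the last nonzero a_q x, so the side with b acting last is zero and
    associativity is left.\<close>
  have as: "(\<lambda>l n. expand_sum K l (int (nat M)) n) = (\<lambda>l n. expand_diff G l (int (nat M)) n)"
  proof (intro ext)
    fix l n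
    have "expand_diff H l n (int (nat M)) = 0"
      by (rule expand_diff_zero[of "int (nat M)"]) (simp_all only: M order_refl)
    then show "expand_sum K l (int (nat M)) n = expand_diff G l (int (nat M)) n"
      using bor[of l "int (nat M)" n] by (simp add: borcherds_def)
  qed
  have as': "(\<lambda>l n. expand_sum K' l (int (nat M')) n) = (\<lambda>l n. expand_diff G' l (int (nat M')) n)"
  proof (intro ext)
    fix l n
    have "expand_diff H' l n (int (nat M')) = 0"
      by (rule expand_diff_zero[of "int (nat M')"]) (simp_all only: M' order_refl)
    then show "expand_sum K' l (int (nat M')) n = expand_diff G' l (int (nat M')) n"
      using bor'[of l "int (nat M')" n] by (simp add: borcherds_def)
  qed
  have assoc: "borcherds (conv b G G') (conv b H H') (conv b K K') l (int (nat M + nat M')) n" for l n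
  proof -
    have "expand_sum (conv b K K') l (int (nat M + nat M')) n =
        expand_diff (conv b G G') l (int (nat M + nat M')) n"
      unfolding expand_sum_conv_nat[OF K K' b, symmetric] as as'
      by (simp add: expand_diff_conv_shift[OF G G' b])
    then show ?thesis
      unfolding borcherds_def by (simp add: expand_diff_zero[OF Hc0])
  qed
  show ?thesis
    by (rule borcherds_from_locality_associativity[OF trunc2_conv[OF G G' b]
          trunc2_conv[OF H H' b] Kc locality assoc])
qed

section \<open>Tensor products of modules and intertwining operators\<close>

definition modal :: "('a::complex_vector \<Rightarrow> int \<Rightarrow> 'm::complex_vector \<Rightarrow> 'n::complex_vector) \<Rightarrow> bool" where
  "modal Y \<longleftrightarrow> (\<forall>a n. clinear (Y a n)) \<and> (\<forall>n x. clinear (\<lambda>a. Y a n x)) \<and>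
     (\<forall>a x. \<exists>N. \<forall>n\<ge>N. Y a n x = 0)"

text \<open>One notion for modules and for intertwining operators with integral modes:
  \<open>Y1\<close>, \<open>Y2\<close> and \<open>Y3\<close> act on the space of w, on the source
  and on the target of \<open>J w n\<close>. For a module \<open>YM\<close> over \<open>Y\<close> it
  reads \<open>jacobi Y YM YM YM\<close>.\<close>

definition jacobi ::
    "('a::complex_vector \<Rightarrow> int \<Rightarrow> 'w \<Rightarrow> 'w) \<Rightarrow> ('a \<Rightarrow> int \<Rightarrow> 'x \<Rightarrow> 'x) \<Rightarrow>
     ('a \<Rightarrow> int \<Rightarrow> 'y \<Rightarrow> 'y) \<Rightarrow> ('w::complex_vector \<Rightarrow> int \<Rightarrow> 'x::complex_vector \<Rightarrow> 'y::complex_vector) \<Rightarrow> bool" where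
  "jacobi Y1 Y2 Y3 J \<longleftrightarrow> (\<forall>a w x l m n.
     borcherds (\<lambda>p q. Y3 a p (J w q x)) (\<lambda>p q. J w p (Y2 a q x)) (\<lambda>p q. J (Y1 a p w) q x) l m n)"

lemma modal_clinear: "modal Y \<Longrightarrow> clinear (Y a n)" "modal Y \<Longrightarrow> clinear (\<lambda>a. Y a n x)"
  and modal_trunc: "modal Y \<Longrightarrow> \<exists>N. \<forall>n\<ge>N. Y a n x = 0"
  by (auto simp: modal_def)

lemma modal_zero [simp]: "modal Y \<Longrightarrow> Y a n 0 = 0" "modal Y \<Longrightarrow> Y 0 n x = 0"
  using clinear_zero[of "Y a n"] clinear_zero[of "\<lambda>a. Y a n x"] by (auto simp: modal_def)

lemma modal_add:
  "modal Y \<Longrightarrow> Y a n (x + y) = Y a n x + Y a n y" "modal Y \<Longrightarrow> Y (a + b) n x = Y a n x + Y b n x"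
  using clinear_add[of "Y a n"] clinear_add[of "\<lambda>a. Y a n x"] by (auto simp: modal_def)

lemma modal_diff:
  "modal Y \<Longrightarrow> Y a n (x - y) = Y a n x - Y a n y" "modal Y \<Longrightarrow> Y (a - b) n x = Y a n x - Y b n x"
  using clinear_diff[of "Y a n"] clinear_diff[of "\<lambda>a. Y a n x"] by (auto simp: modal_def)

lemma modal_minus:
  "modal Y \<Longrightarrow> Y a n (- x) = - Y a n x" "modal Y \<Longrightarrow> Y (- a) n x = - Y a n x"
  using clinear_minus[of "Y a n"] clinear_minus[of "\<lambda>a. Y a n x"] by (auto simp: modal_def)

lemma modal_scale:
  "modal Y \<Longrightarrow> Y a n (c *\<^sub>C x) = c *\<^sub>C Y a n x" "modal Y \<Longrightarrow> Y (c *\<^sub>C a) n x = c *\<^sub>C Y a n x"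
  using clinear_scale[of "Y a n"] clinear_scale[of "\<lambda>a. Y a n x"] by (auto simp: modal_def)

lemma modal_sum:
  "modal Y \<Longrightarrow> Y a n (sum f I) = (\<Sum>i\<in>I. Y a n (f i))"
  "modal Y \<Longrightarrow> Y (sum g I) n x = (\<Sum>i\<in>I. Y (g i) n x)"
  using clinear_sum[of "Y a n"] clinear_sum[of "\<lambda>a. Y a n x"] by (auto simp: modal_def)

lemma trunc2_product:
  assumes "modal Y" "modal J"
  shows "trunc2 (\<lambda>p q. Y a p (J w q x))"
  unfolding trunc2_def
proof (intro conjI allI)
  obtain N where "\<forall>n\<ge>N. J w n x = 0" using modal_trunc[OF assms(2)] by blast
  then show "\<exists>B. \<forall>q\<ge>B. \<forall>p. Y a p (J w q x) = 0"
    by (intro exI[of _ N]) (simp add: assms)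
  show "\<exists>P. \<forall>p\<ge>P. Y a p (J w q x) = 0" for q by (rule modal_trunc[OF assms(1)])
qed

lemma trunc2_iterate:
  assumes "modal Y" "modal J"
  shows "trunc2 (\<lambda>q p. J (Y a p w) q x)"
  unfolding trunc2_def
proof (intro conjI allI)
  obtain N where "\<forall>n\<ge>N. Y a n w = 0" using modal_trunc[OF assms(1)] by blast
  then show "\<exists>B. \<forall>q\<ge>B. \<forall>p. J (Y a q w) p x = 0"
    by (intro exI[of _ N]) (simp add: assms)
  show "\<exists>P. \<forall>p\<ge>P. J (Y a q w) p x = 0" for q by (rule modal_trunc[OF assms(2)])
qed

lemma Sum_any_scale:
  assumes "finite {x. f x \<noteq> 0}"
  shows "Sum_any (\<lambda>x. c *\<^sub>C f x) = c *\<^sub>C Sum_any f"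
  by (rule clinear_Sum_any[symmetric, OF _ assms]) (auto intro: clinearI simp: scaleC_simps mult.commute)

lemma borcherds_iff_modes:
  assumes "trunc2 G" "trunc2 H"
  shows "borcherds G H K l m n \<longleftrightarrow>
    Sum_any (\<lambda>i::nat. (of_int m gchoose i) *\<^sub>C K (l + int i) (m + n - int i)) =
    Sum_any (\<lambda>i::nat. ((-1) ^ i * (of_int l gchoose i)) *\<^sub>C
      (G (l + m - int i) (n + int i) - ((-1) powi l) *\<^sub>C H (l + n - int i) (m + int i)))"
proof -
  note fG = expand_diff_finite[OF assms(1), of "\<lambda>i. of_int l gchoose i" "l + m" n]
  note fH = expand_diff_finite[OF assms(2), of "\<lambda>i. of_int l gchoose i" "l + n" m]
  have fH': "finite {i. ((-1) powi l) *\<^sub>C ((-1) ^ i * (of_int l gchoose i)) *\<^sub>C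
      H (l + n - int i) (m + int i) \<noteq> 0}"
    by (rule finite_subset[OF _ fH]) auto
  have "Sum_any (\<lambda>i::nat. ((-1) ^ i * (of_int l gchoose i)) *\<^sub>C
      (G (l + m - int i) (n + int i) - ((-1) powi l) *\<^sub>C H (l + n - int i) (m + int i))) =
    Sum_any (\<lambda>i::nat. ((-1) ^ i * (of_int l gchoose i)) *\<^sub>C G (l + m - int i) (n + int i) -
      ((-1) powi l) *\<^sub>C ((-1) ^ i * (of_int l gchoose i)) *\<^sub>C H (l + n - int i) (m + int i))"
    by (rule Sum_any.cong) (simp add: scaleC_simps mult.commute)
  also have "\<dots> = expand_diff G l m n - ((-1) powi l) *\<^sub>C expand_diff H l n m"
    unfolding expand_diff_def
    by (subst Sum_any_diff[OF fG fH'], subst Sum_any_scale[OF fH]) simp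
  finally show ?thesis by (simp add: borcherds_def expand_sum_def)
qed

lemma expand_diff_add:
  assumes "trunc2 G" "trunc2 G'"
  shows "expand_diff (\<lambda>p q. G p q + G' p q) l m n = expand_diff G l m n + expand_diff G' l m n"
  unfolding expand_diff_def
  using Sum_any.distrib[OF expand_diff_finite[OF assms(1), of "\<lambda>i. of_int l gchoose i" "l + m" n]
      expand_diff_finite[OF assms(2), of "\<lambda>i. of_int l gchoose i" "l + m" n]]
  by (simp add: scaleC_simps)

lemma expand_sum_add:
  assumes "trunc2 (\<lambda>q p. K p q)" "trunc2 (\<lambda>q p. K' p q)"
  shows "expand_sum (\<lambda>p q. K p q + K' p q) l m n = expand_sum K l m n + expand_sum K' l m n"
  unfolding expand_sum_def
  using Sum_any.distrib[OF expand_sum_finite[OF assms(1), of "\<lambda>i. of_int m gchoose i" l "m + n"]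
      expand_sum_finite[OF assms(2), of "\<lambda>i. of_int m gchoose i" l "m + n"]]
  by (simp add: scaleC_simps)

lemma borcherds_add:
  assumes "borcherds G H K l m n" "borcherds G' H' K' l m n"
    "trunc2 G" "trunc2 H" "trunc2 (\<lambda>q p. K p q)" "trunc2 G'" "trunc2 H'" "trunc2 (\<lambda>q p. K' p q)"
  shows "borcherds (\<lambda>p q. G p q + G' p q) (\<lambda>p q. H p q + H' p q) (\<lambda>p q. K p q + K' p q) l m n"
  using assms(1,2) by (simp add: borcherds_def expand_diff_add expand_sum_add assms(3-) scaleC_simps)

lemma borcherds_zero: "borcherds (\<lambda>p q. 0) (\<lambda>p q. 0) (\<lambda>p q. 0) l m n"
  by (simp add: borcherds_def expand_diff_def expand_sum_def)

lemma jacobi_modes: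
  assumes "modal Y1" "modal Y2" "modal Y3" "modal J" "jacobi Y1 Y2 Y3 J"
  shows "Sum_any (\<lambda>i::nat. (of_int m gchoose i) *\<^sub>C J (Y1 a (l + int i) w) (m + n - int i) x) =
    Sum_any (\<lambda>i::nat. ((-1) ^ i * (of_int l gchoose i)) *\<^sub>C
      (Y3 a (l + m - int i) (J w (n + int i) x) -
        ((-1) powi l) *\<^sub>C J w (l + n - int i) (Y2 a (m + int i) x)))"
  using assms(5)
  unfolding jacobi_def borcherds_iff_modes[OF trunc2_product[OF assms(3,4)] trunc2_product[OF assms(4,2)]]
  by blast

lemma vertex_module_iff:
  assumes "modal Y"
  shows "vertex_module UNIV Y vac YM \<longleftrightarrow>
    modal YM \<and> jacobi Y YM YM YM \<and> (\<forall>n x. YM vac n x = (if n = -1 then x else 0))"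
proof -
  have m: "modal YM \<longleftrightarrow> (\<forall>a n. clinear (YM a n)) \<and> (\<forall>a b n x. YM (a + b) n x = YM a n x + YM b n x) \<and>
     (\<forall>t a n x. YM (t *\<^sub>C a) n x = t *\<^sub>C YM a n x) \<and> (\<forall>a x. \<exists>N. \<forall>n\<ge>N. YM a n x = 0)"
    unfolding modal_def clinear_iff by blast
  have j: "jacobi Y YM YM YM \<longleftrightarrow> (\<forall>a b l m n x.
        (Sum_any (\<lambda>i::nat. (of_int m gchoose i) *\<^sub>C YM (Y a (l + int i) b) (m + n - int i) x)) =
        (Sum_any (\<lambda>i::nat. ((-1) ^ i * (of_int l gchoose i)) *\<^sub>C
           (YM a (l + m - int i) (YM b (n + int i) x) -
            ((-1) powi l) *\<^sub>C YM b (l + n - int i) (YM a (m + int i) x)))))" if "modal YM"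
    unfolding jacobi_def borcherds_iff_modes[OF trunc2_product[OF that that] trunc2_product[OF that that]]
    by blast
  show ?thesis
  proof (cases "modal YM")
    case True
    then show ?thesis unfolding vertex_module_def j[OF True] ball_UNIV m by (simp only: conj_ac)
  next
    case False
    then show ?thesis using m unfolding vertex_module_def ball_UNIV by blast
  qed
qed

lemma vertex_algebra_modal:
  assumes "vertex_algebra Y vac"
  shows "modal Y"
  using assms unfolding vertex_algebra_def vertex_module_def modal_def clinear_iff by auto

lemma vertex_algebra_iff:
  "vertex_algebra Y vac \<longleftrightarrow> modal Y \<and> jacobi Y Y Y Y \<and> (\<forall>n x. Y vac n x = (if n = -1 then x else 0)) \<and>
     (\<forall>a. Y a (-1) vac = a \<and> (\<forall>n\<ge>0. Y a n vac = 0))"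
  using vertex_algebra_modal[of Y vac] vertex_module_iff[of Y vac Y] unfolding vertex_algebra_def by auto

section \<open>Finitely supported functions and pure tensors\<close>

lemma pm_sum_singles: "x = (\<Sum>i\<in>Poly_Mapping.keys x. Poly_Mapping.single i (Poly_Mapping.lookup x i))"
  by (rule poly_mapping_eqI) (simp add: lookup_sum lookup_single when_def in_keys_iff)

lemma pm_induct [case_names zero single add]:
  assumes "P 0" "\<And>i c. P (Poly_Mapping.single i c)" "\<And>x y. P x \<Longrightarrow> P y \<Longrightarrow> P (x + y)"
  shows "P (x :: 'i \<Rightarrow>\<^sub>0 'a::comm_monoid_add)"
proof -
  have "P (\<Sum>i\<in>I. Poly_Mapping.single i (Poly_Mapping.lookup x i))" if "finite I" for I
    using that by (induction I) (auto intro: assms)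
  from this[OF finite_keys] show ?thesis
    by (subst pm_sum_singles)
qed

lemma lookup_scaleC [simp]:
  "Poly_Mapping.lookup (c *\<^sub>C x) i = c *\<^sub>C Poly_Mapping.lookup x i"
  by (simp add: scaleC_poly_mapping_def map.rep_eq when_def)

lemma scaleC_single: "c *\<^sub>C Poly_Mapping.single i x = Poly_Mapping.single i (c *\<^sub>C x)"
  by (rule poly_mapping_eqI) (simp add: lookup_single when_def)

lemma pm_clinear_eqI:
  assumes "clinear f" "clinear g" "\<And>i x. f (Poly_Mapping.single i x) = g (Poly_Mapping.single i x)"
  shows "f x = g x"
  by (induction x rule: pm_induct) (simp_all add: clinear_zero clinear_add assms)

lemma pm_clinear_eqI_basis:
  fixes x :: "'i \<Rightarrow>\<^sub>0 complex" and f :: "('i \<Rightarrow>\<^sub>0 complex) \<Rightarrow> 'a::complex_vector"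
  assumes "clinear f" "clinear g" "\<And>i. f (Poly_Mapping.single i 1) = g (Poly_Mapping.single i 1)"
  shows "f x = g x"
proof (rule pm_clinear_eqI[OF assms(1,2)])
  fix i :: 'i and c :: complex
  have "Poly_Mapping.single i c = c *\<^sub>C Poly_Mapping.single i 1"
    by (simp add: scaleC_single scaleC_complex_def)
  then show "f (Poly_Mapping.single i c) = g (Poly_Mapping.single i c)"
    by (simp add: clinear_scale assms)
qed

lemma lookup_tens [simp]: "Poly_Mapping.lookup (tens x u) i = Poly_Mapping.lookup u i *\<^sub>C x"
  by (simp add: tens_def map.rep_eq when_def)

lemma cbilinear_tens: "cbilinear tens"
  unfolding cbilinear_def clinear_iff
  by (auto intro!: poly_mapping_eqI simp: lookup_add scaleC_simps scaleC_complex_def mult.commute)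

lemma tens_simps:
  "tens (x + y) u = tens x u + tens y u" "tens x (u + v) = tens x u + tens x v"
  "tens (c *\<^sub>C x) u = c *\<^sub>C tens x u" "tens x (c *\<^sub>C u) = c *\<^sub>C tens x u"
  "tens 0 u = 0" "tens x 0 = 0" "tens (- x) u = - tens x u" "tens x (- u) = - tens x u"
  "tens (x - y) u = tens x u - tens y u" "tens x (u - v) = tens x u - tens x v"
  by (auto intro!: poly_mapping_eqI simp: lookup_add lookup_minus scaleC_simps scaleC_complex_def mult.commute)

lemma tens_single: "tens x (Poly_Mapping.single i c) = Poly_Mapping.single i (c *\<^sub>C x)"
  by (rule poly_mapping_eqI) (simp add: lookup_single when_def)

lemma tens_eq_0_iff: "tens x u = 0 \<longleftrightarrow> x = 0 \<or> u = 0"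
proof
  assume 0: "tens x u = 0"
  show "x = 0 \<or> u = 0"
  proof (rule disjCI)
    assume "u \<noteq> 0"
    then obtain i where "Poly_Mapping.lookup u i \<noteq> 0" by (metis lookup_zero poly_mapping_eqI)
    moreover have "Poly_Mapping.lookup u i *\<^sub>C x = 0" using 0 by (metis lookup_tens lookup_zero)
    ultimately show "x = 0" by simp
  qed
qed (auto simp: tens_simps)

lemma clinear_tens: "clinear (tens x)" "clinear (\<lambda>x. tens x u)"
  by (auto simp: clinear_iff tens_simps)

lemma clinear_keys_sum:
  fixes g :: "'i \<Rightarrow> 'a::complex_vector \<Rightarrow> 'b::complex_vector"
  assumes "\<And>i. clinear (g i)"
  shows "clinear (\<lambda>x. \<Sum>i\<in>Poly_Mapping.keys x. g i (Poly_Mapping.lookup x i))"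
proof (rule clinearI)
  have *: "(\<Sum>i\<in>Poly_Mapping.keys x. g i (Poly_Mapping.lookup x i)) = (\<Sum>i\<in>A. g i (Poly_Mapping.lookup x i))"
    if "finite A" "Poly_Mapping.keys x \<subseteq> A" for x A
    by (rule sum.mono_neutral_left) (use that assms in \<open>auto simp: in_keys_iff clinear_zero\<close>)
  fix x y :: "'i \<Rightarrow>\<^sub>0 'a" and c
  let ?A = "Poly_Mapping.keys x \<union> Poly_Mapping.keys y"
  show "(\<Sum>i\<in>Poly_Mapping.keys (x + y). g i (Poly_Mapping.lookup (x + y) i)) =
    (\<Sum>i\<in>Poly_Mapping.keys x. g i (Poly_Mapping.lookup x i)) +
    (\<Sum>i\<in>Poly_Mapping.keys y. g i (Poly_Mapping.lookup y i))"
    by (subst (1 2 3) *[of ?A])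
      (auto simp: lookup_add clinear_add[OF assms] sum.distrib in_keys_iff)
  show "(\<Sum>i\<in>Poly_Mapping.keys (c *\<^sub>C x). g i (Poly_Mapping.lookup (c *\<^sub>C x) i)) =
    c *\<^sub>C (\<Sum>i\<in>Poly_Mapping.keys x. g i (Poly_Mapping.lookup x i))"
    by (subst *[of "Poly_Mapping.keys x"])
      (auto simp: clinear_scale[OF assms] cvec.scale_sum_right in_keys_iff)
qed

lemma tensor_product_finite:
  assumes "modal Y1" "modal Y2"
  shows "finite {t. tens (Y1 a t x) (Y2 u (n - t) y) \<noteq> 0}"
proof -
  obtain N where N: "\<And>n. N \<le> n \<Longrightarrow> Y1 a n x = 0" using modal_trunc[OF assms(1)] by blast
  obtain N' where N': "\<And>n. N' \<le> n \<Longrightarrow> Y2 u n y = 0" using modal_trunc[OF assms(2)] by blast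
  have "{t. tens (Y1 a t x) (Y2 u (n - t) y) \<noteq> 0} \<subseteq> {n - N'..N}"
  proof
    fix t assume "t \<in> {t. tens (Y1 a t x) (Y2 u (n - t) y) \<noteq> 0}"
    then have "Y1 a t x \<noteq> 0" "Y2 u (n - t) y \<noteq> 0" by (auto simp: tens_eq_0_iff)
    then have "t < N" "n - t < N'" using N N' by (meson not_le)+
    then show "t \<in> {n - N'..N}" by auto
  qed
  then show ?thesis by (rule finite_subset) simp
qed

text \<open>\<open>tensor_modes\<close> is assembled from basis vectors of the second factor; this
  is its value on arbitrary pure tensors, with u and y unrestricted. Identities of vertex operators
  on the second factor can be applied only in this form.\<close>

definition tensor_pair ::
    "('a::complex_vector \<Rightarrow> int \<Rightarrow> 'b::complex_vector \<Rightarrow> 'c::complex_vector) \<Rightarrow>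
     (('i \<Rightarrow>\<^sub>0 complex) \<Rightarrow> int \<Rightarrow> ('j \<Rightarrow>\<^sub>0 complex) \<Rightarrow> ('l \<Rightarrow>\<^sub>0 complex)) \<Rightarrow>
     'a \<Rightarrow> ('i \<Rightarrow>\<^sub>0 complex) \<Rightarrow> int \<Rightarrow> 'b \<Rightarrow> ('j \<Rightarrow>\<^sub>0 complex) \<Rightarrow> ('l \<Rightarrow>\<^sub>0 'c)" where
  "tensor_pair Y1 Y2 a u n x y = Sum_any (\<lambda>t. tens (Y1 a t x) (Y2 u (n - 1 - t) y))"

lemma tensor_pair_clinear:
  assumes Y: "modal Y1" "modal Y2"
  shows "clinear (\<lambda>a. tensor_pair Y1 Y2 a u n x y)" "clinear (\<lambda>u. tensor_pair Y1 Y2 a u n x y)"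
    "clinear (\<lambda>x. tensor_pair Y1 Y2 a u n x y)" "clinear (\<lambda>y. tensor_pair Y1 Y2 a u n x y)"
proof -
  note f = tensor_product_finite[OF Y, of _ _ _ "n - 1"]
  show "clinear (\<lambda>a. tensor_pair Y1 Y2 a u n x y)" "clinear (\<lambda>u. tensor_pair Y1 Y2 a u n x y)"
    "clinear (\<lambda>x. tensor_pair Y1 Y2 a u n x y)" "clinear (\<lambda>y. tensor_pair Y1 Y2 a u n x y)"
    unfolding tensor_pair_def
    by (rule clinearI; simp add: modal_add[OF Y(1)] modal_add[OF Y(2)] modal_scale[OF Y(1)]
        modal_scale[OF Y(2)] tens_simps Sum_any.distrib[OF f f] Sum_any_scale[OF f])+
qed

lemma tensor_modes_pair:
  "tensor_modes Y1 Y2 a n x =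
     (\<Sum>i\<in>Poly_Mapping.keys a. \<Sum>j\<in>Poly_Mapping.keys x.
        tensor_pair Y1 Y2 (Poly_Mapping.lookup a i) (Poly_Mapping.single i 1) n
          (Poly_Mapping.lookup x j) (Poly_Mapping.single j 1))"
  unfolding tensor_modes_def tensor_pair_def by simp

lemma tensor_modes_clinear:
  assumes "modal Y1" "modal Y2"
  shows "clinear (tensor_modes Y1 Y2 a n)" "clinear (\<lambda>a. tensor_modes Y1 Y2 a n x)"
proof -
  show "clinear (\<lambda>a. tensor_modes Y1 Y2 a n x)"
    unfolding tensor_modes_pair
    by (rule clinear_keys_sum)
      (rule clinearI; simp add: clinear_add[OF tensor_pair_clinear(1)[OF assms]]
        clinear_scale[OF tensor_pair_clinear(1)[OF assms]] sum.distrib cvec.scale_sum_right)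
  have "clinear (\<lambda>x. tensor_modes Y1 Y2 a n x)"
    unfolding tensor_modes_pair
    by (subst sum.swap, rule clinear_keys_sum)
      (rule clinearI; simp add: clinear_add[OF tensor_pair_clinear(3)[OF assms]]
        clinear_scale[OF tensor_pair_clinear(3)[OF assms]] sum.distrib cvec.scale_sum_right)
  then show "clinear (tensor_modes Y1 Y2 a n)" by simp
qed

lemma tensor_modes_single:
  assumes "modal Y1" "modal Y2"
  shows "tensor_modes Y1 Y2 (Poly_Mapping.single i \<alpha>) n (Poly_Mapping.single j \<xi>) =
    tensor_pair Y1 Y2 \<alpha> (Poly_Mapping.single i 1) n \<xi> (Poly_Mapping.single j 1)"
  by (simp add: tensor_modes_pair clinear_zero[OF tensor_pair_clinear(1)[OF assms]]
      clinear_zero[OF tensor_pair_clinear(3)[OF assms]])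

lemma tensor_modes_tens:
  assumes Y: "modal Y1" "modal Y2"
  shows "tensor_modes Y1 Y2 (tens a u) n (tens x y) = tensor_pair Y1 Y2 a u n x y"
proof -
  have c1: "clinear (\<lambda>u. tensor_modes Y1 Y2 (tens a u) n z)" for z
    by (rule clinear_compose[OF tensor_modes_clinear(2)[OF Y] clinear_tens(1)])
  have c2: "clinear (\<lambda>y. tensor_modes Y1 Y2 z n (tens x y))" for z
    by (rule clinear_compose[OF tensor_modes_clinear(1)[OF Y] clinear_tens(1)])
  have 1: "tensor_modes Y1 Y2 (tens a u) n (tens x (Poly_Mapping.single j 1)) =
    tensor_pair Y1 Y2 a u n x (Poly_Mapping.single j 1)" for j
  proof (rule pm_clinear_eqI_basis[where x = u, OF c1 tensor_pair_clinear(2)[OF Y]])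
    fix i
    show "tensor_modes Y1 Y2 (tens a (Poly_Mapping.single i 1)) n (tens x (Poly_Mapping.single j 1)) =
      tensor_pair Y1 Y2 a (Poly_Mapping.single i 1) n x (Poly_Mapping.single j 1)"
      by (simp only: tens_single scaleC_one tensor_modes_single[OF Y])
  qed
  show ?thesis
    by (rule pm_clinear_eqI_basis[where x = y, OF c2 tensor_pair_clinear(4)[OF Y]]) (rule 1)
qed

lemma modal_tensor:
  assumes Y: "modal Y1" "modal Y2"
  shows "modal (tensor_modes Y1 Y2)"
  unfolding modal_def
proof (intro conjI allI)
  show "clinear (tensor_modes Y1 Y2 a n)" "clinear (\<lambda>a. tensor_modes Y1 Y2 a n x)" for a n x
    by (rule tensor_modes_clinear[OF Y])+
  show "\<exists>N. \<forall>n\<ge>N. tensor_modes Y1 Y2 a n x = 0" for a x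
  proof (induction a rule: pm_induct)
    case zero
    then show ?case by (simp add: tensor_modes_def)
  next
    case (add a b)
    then obtain N N' where "\<And>n. N \<le> n \<Longrightarrow> tensor_modes Y1 Y2 a n x = 0"
      "\<And>n. N' \<le> n \<Longrightarrow> tensor_modes Y1 Y2 b n x = 0" by blast
    then show ?case
      by (intro exI[of _ "max N N'"]) (simp add: clinear_add[OF tensor_modes_clinear(2)[OF Y]])
  next
    case (single i \<alpha>)
    show ?case
    proof (induction x rule: pm_induct)
      case zero
      then show ?case by (simp add: tensor_modes_def)
    next
      case (add a b)
      then obtain N N' where "\<And>n. N \<le> n \<Longrightarrow> tensor_modes Y1 Y2 (Poly_Mapping.single i \<alpha>) n a = 0"
        "\<And>n. N' \<le> n \<Longrightarrow> tensor_modes Y1 Y2 (Poly_Mapping.single i \<alpha>) n b = 0" by blast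
      then show ?case
        by (intro exI[of _ "max N N'"]) (simp add: clinear_add[OF tensor_modes_clinear(1)[OF Y]])
    next
      case (single j \<xi>)
      obtain N where N: "\<And>n. N \<le> n \<Longrightarrow> Y1 \<alpha> n \<xi> = 0" using modal_trunc[OF Y(1)] by blast
      obtain N' where N': "\<And>n. N' \<le> n \<Longrightarrow> Y2 (Poly_Mapping.single i 1) n (Poly_Mapping.single j 1) = 0"
        using modal_trunc[OF Y(2)] by blast
      have "tens (Y1 \<alpha> t \<xi>) (Y2 (Poly_Mapping.single i 1) (n - 1 - t) (Poly_Mapping.single j 1)) = 0"
        if "N + N' \<le> n" for n t
        by (cases "N \<le> t") (use that in \<open>auto simp: tens_eq_0_iff N N'\<close>)
      then show ?case
        by (intro exI[of _ "N + N'"]) (simp add: tensor_modes_single[OF Y] tensor_pair_def)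
    qed
  qed
qed

text \<open>Brings a composition of tensor product modes into the form of a convolution of the
  compositions in the two factors, to which \<open>borcherds_conv\<close> applies; iterates are
  treated likewise afterwards.\<close>

lemma tensor_pair_conv:
  assumes Y: "modal Y" "modal Y'" and J: "modal J" "modal J'"
  shows "tensor_modes Y Y' (tens a u) p (tensor_modes J J' (tens w v) q (tens x y)) =
    conv tens (\<lambda>s t. Y a s (J w t x)) (\<lambda>s t. Y' u s (J' v t y)) p q"
proof -
  note finp = conv_finite'[OF trunc2_product[OF Y(1) J(1), of a w x]
      trunc2_product[OF Y(2) J(2), of u v y] cbilinear_tens, where p = "p - 1" and q = "q - 1"]
  have sw: "Sum_any (\<lambda>t. Sum_any (\<lambda>s. g s t)) = Sum_any (\<lambda>(s, t). g s t)"
    if "finite {x. (case x of (s, t) \<Rightarrow> g s t) \<noteq> 0}" for g :: "int \<Rightarrow> int \<Rightarrow> 'z::comm_monoid_add"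
  proof -
    have "Sum_any (\<lambda>t. Sum_any (\<lambda>s. g s t)) = Sum_any (\<lambda>s. Sum_any (\<lambda>t. g s t))"
      by (rule Sum_any_swap[symmetric, OF that]) simp
    also have "\<dots> = Sum_any (\<lambda>(s, t). g s t)" by (rule Sum_any_pair[OF that]) simp
    finally show ?thesis .
  qed
  have "tensor_modes Y Y' (tens a u) p (tensor_modes J J' (tens w v) q (tens x y)) =
    Sum_any (\<lambda>t. tensor_modes Y Y' (tens a u) p (tens (J w t x) (J' v (q - 1 - t) y)))"
    unfolding tensor_modes_tens[OF J] tensor_pair_def
    by (rule clinear_Sum_any[OF tensor_modes_clinear(1)[OF Y] tensor_product_finite[OF J]])
  also have "\<dots> = Sum_any (\<lambda>t. Sum_any (\<lambda>s. tens (Y a s (J w t x)) (Y' u (p - 1 - s) (J' v (q - 1 - t) y))))"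
    by (simp only: tensor_modes_tens[OF Y] tensor_pair_def)
  also have "\<dots> = conv tens (\<lambda>s t. Y a s (J w t x)) (\<lambda>s t. Y' u s (J' v t y)) p q"
    unfolding conv_def by (rule sw[OF finp])
  finally show "tensor_modes Y Y' (tens a u) p (tensor_modes J J' (tens w v) q (tens x y)) =
    conv tens (\<lambda>s t. Y a s (J w t x)) (\<lambda>s t. Y' u s (J' v t y)) p q" .
qed

lemma tensor_iterate_conv:
  assumes Y: "modal Y" "modal Y'" and J: "modal J" "modal J'"
  shows "tensor_modes J J' (tensor_modes Y Y' (tens a u) p (tens w v)) q (tens x y) =
    conv tens (\<lambda>s t. J (Y a s w) t x) (\<lambda>s t. J' (Y' u s v) t y) p q"
proof -
  note finp = conv_finite'[OF trunc2_iterate[OF Y(1) J(1), of a w x]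
      trunc2_iterate[OF Y(2) J(2), of u v y] cbilinear_tens, where p = "q - 1" and q = "p - 1"]
  have "tensor_modes J J' (tensor_modes Y Y' (tens a u) p (tens w v)) q (tens x y) =
    Sum_any (\<lambda>s. tensor_modes J J' (tens (Y a s w) (Y' u (p - 1 - s) v)) q (tens x y))"
    unfolding tensor_modes_tens[OF Y] tensor_pair_def
    by (rule clinear_Sum_any[OF tensor_modes_clinear(2)[OF J] tensor_product_finite[OF Y]])
  also have "\<dots> = Sum_any (\<lambda>s. Sum_any (\<lambda>t. tens (J (Y a s w) t x) (J' (Y' u (p - 1 - s) v) (q - 1 - t) y)))"
    by (simp only: tensor_modes_tens[OF J] tensor_pair_def)
  also have "\<dots> = Sum_any (\<lambda>t. Sum_any (\<lambda>s. tens (J (Y a s w) t x) (J' (Y' u (p - 1 - s) v) (q - 1 - t) y)))"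
    by (rule Sum_any_swap[symmetric, OF finp]) simp
  also have "\<dots> = Sum_any (\<lambda>(t, s). tens (J (Y a s w) t x) (J' (Y' u (p - 1 - s) v) (q - 1 - t) y))"
    by (rule Sum_any_pair[OF finp]) simp
  also have "\<dots> = conv tens (\<lambda>t s. J (Y a s w) t x) (\<lambda>t s. J' (Y' u s v) t y) q p"
    unfolding conv_def by simp
  finally show ?thesis by (subst (asm) conv_swap)
qed

text \<open>The identity is additive in all three arguments, so pure tensors suffice; on these it is
  \<open>borcherds_conv\<close> for the bilinear map \<open>tens\<close>.\<close>

theorem jacobi_tensor:
  assumes Y1: "modal Y1" "modal Y1'" and Y2: "modal Y2" "modal Y2'" and Y3: "modal Y3" "modal Y3'"
    and J: "modal J" "modal J'" and jac: "jacobi Y1 Y2 Y3 J" "jacobi Y1' Y2' Y3' J'"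
  shows "jacobi (tensor_modes Y1 Y1') (tensor_modes Y2 Y2') (tensor_modes Y3 Y3') (tensor_modes J J')"
  unfolding jacobi_def
proof (intro allI)
  note M = modal_tensor[OF Y1] modal_tensor[OF Y2] modal_tensor[OF Y3] modal_tensor[OF J]
  note tr = trunc2_product[OF M(3,4)] trunc2_product[OF M(4,2)] trunc2_iterate[OF M(1,4)]
  fix a w x l m n
  let ?B = "\<lambda>a w x. borcherds (\<lambda>p q. tensor_modes Y3 Y3' a p (tensor_modes J J' w q x))
    (\<lambda>p q. tensor_modes J J' w p (tensor_modes Y2 Y2' a q x))
    (\<lambda>p q. tensor_modes J J' (tensor_modes Y1 Y1' a p w) q x) l m n"
  show "?B a w x"
  proof (induction a rule: pm_induct)
    case zero then show ?case using M by (simp add: borcherds_zero)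
  next
    case (add a b)
    then show ?case
      using borcherds_add[OF add tr tr] by (simp add: modal_add[OF M(1)] modal_add[OF M(2)]
        modal_add[OF M(3)] modal_add[OF M(4)])
  next
    case (single i \<alpha>)
    show ?case
    proof (induction w rule: pm_induct)
      case zero then show ?case using M by (simp add: borcherds_zero)
    next
      case (add a b)
      then show ?case
        using borcherds_add[OF add tr tr] by (simp add: modal_add[OF M(1)] modal_add[OF M(2)]
          modal_add[OF M(3)] modal_add[OF M(4)])
    next
      case (single j \<omega>)
      show ?case
      proof (induction x rule: pm_induct)
        case zero then show ?case using M by (simp add: borcherds_zero)
      next
        case (add a b)
        then show ?case
          using borcherds_add[OF add tr tr] by (simp add: modal_add[OF M(1)] modal_add[OF M(2)]
            modal_add[OF M(3)] modal_add[OF M(4)])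
      next
        case (single k \<xi>)
        have t: "Poly_Mapping.single i \<alpha> = tens \<alpha> (Poly_Mapping.single i 1)"
          "Poly_Mapping.single j \<omega> = tens \<omega> (Poly_Mapping.single j 1)"
          "Poly_Mapping.single k \<xi> = tens \<xi> (Poly_Mapping.single k 1)"
          by (simp_all add: tens_single)
        show ?case
          unfolding t tensor_pair_conv[OF Y3 J] tensor_pair_conv[OF J Y2] tensor_iterate_conv[OF Y1 J]
          by (rule borcherds_conv[OF trunc2_product[OF Y3(1) J(1)] trunc2_product[OF J(1) Y2(1)]
                trunc2_iterate[OF Y1(1) J(1)] trunc2_product[OF Y3(2) J(2)] trunc2_product[OF J(2) Y2(2)]
                trunc2_iterate[OF Y1(2) J(2)] cbilinear_tens])
            (use jac in \<open>auto simp: jacobi_def\<close>)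
      qed
    qed
  qed
qed

lemma tensor_vacuum:
  assumes Y: "modal Y" "modal Y'" and v: "\<And>n x. Y vac n x = (if n = -1 then x else 0)"
  shows "tensor_modes Y Y' (tens vac u) n (tens x y) = tens x (Y' u n y)"
  unfolding tensor_modes_tens[OF Y] tensor_pair_def v
  by (subst Sum_any_single[where a = "-1"]) (auto simp: tens_simps)

lemma tensor_vacuum':
  assumes Y: "modal Y" "modal Y'" and v: "\<And>n x. Y' vac n x = (if n = -1 then x else 0)"
  shows "tensor_modes Y Y' (tens a vac) n (tens x y) = tens (Y a n x) y"
  unfolding tensor_modes_tens[OF Y] tensor_pair_def v
  by (subst Sum_any_single[where a = n]) (auto simp: tens_simps)

lemma tensor_vacuum_vacuum:
  assumes Y: "modal Y" "modal Y'" and v: "\<And>n x. Y vac n x = (if n = -1 then x else 0)"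
    "\<And>n x. Y' vac' n x = (if n = -1 then x else 0)"
  shows "tensor_modes Y Y' (tens vac vac') n x = (if n = -1 then x else 0)"
proof (induction x rule: pm_induct)
  case zero then show ?case by (simp add: modal_tensor[OF Y])
next
  case (single i c)
  have "Poly_Mapping.single i c = tens c (Poly_Mapping.single i 1)" by (simp add: tens_single)
  then show ?case by (simp only: tensor_vacuum[OF Y v(1)] v(2)) (simp add: tens_simps)
next
  case (add x y) then show ?case by (simp add: modal_add[OF modal_tensor[OF Y]])
qed

section \<open>Skew-symmetry\<close>

lemma alternating_vandermonde:
  fixes m N :: int
  shows "(\<Sum>i\<le>k. (-1) ^ i * (of_int m gchoose i) * (of_int (N - int i) gchoose (k - i))) =
    (of_int (N - m) gchoose k :: complex)"
proof -
  have "(\<Sum>i\<le>k. (-1) ^ i * (of_int m gchoose i) * (of_int (N - int i) gchoose (k - i)) :: complex) =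
    (\<Sum>i\<le>k. (-1) ^ k * ((of_int m gchoose i) * (of_int (int k - N - 1) gchoose (k - i))))"
  proof (rule sum.cong[OF refl])
    fix i assume "i \<in> {..k}"
    then have i: "i \<le> k" by simp
    have "(of_int (N - int i) gchoose (k - i) :: complex) =
      (-1) ^ (k - i) * (of_int (int k - N - 1) gchoose (k - i))"
      by (subst gbinomial_negated_upper) (use i in \<open>simp add: of_nat_diff algebra_simps\<close>)
    moreover have "(-1) ^ k = ((-1) ^ i * (-1) ^ (k - i) :: complex)"
      using i by (simp add: power_add[symmetric])
    ultimately show "(-1) ^ i * (of_int m gchoose i) * (of_int (N - int i) gchoose (k - i)) =
      ((-1) ^ k * ((of_int m gchoose i) * (of_int (int k - N - 1) gchoose (k - i))) :: complex)"
      by (simp only: mult_ac)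
  qed
  also have "\<dots> = (-1) ^ k * (of_int m + of_int (int k - N - 1) gchoose k)"
    by (simp only: gbinomial_Vandermonde[symmetric] atLeast0AtMost sum_distrib_left)
  also have "\<dots> = (of_int (N - m) gchoose k)"
    by (subst (2) gbinomial_negated_upper) (simp add: algebra_simps)
  finally show ?thesis .
qed

lemma vandermonde_of_int:
  "(\<Sum>i\<le>k. (of_int a gchoose i) * (of_int b gchoose (k - i)) :: complex) = (of_int (a + b) gchoose k)"
  by (simp only: of_int_add gbinomial_Vandermonde[symmetric] atLeast0AtMost)

text \<open>The t-th divided derivative of log(1 + x) is (-1)^(t+1)/t (1 + x)^(-t); multiply by (1 +
  x)^m and compare coefficients of x^k. This is what makes the coefficients 1/j in Delta(s,z) the
  right ones. For t = 0 the logarithm itself would remain, so that case is excluded.\<close>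

lemma log_vandermonde:
  fixes m :: int
  assumes "0 < t"
  shows "(\<Sum>u\<le>k. ((-1) ^ (t + u + 1) / of_nat (t + u)) * (of_nat (t + u) gchoose t) *
      (of_int m gchoose (k - u)) :: complex) = (-1) ^ (t + 1) / of_nat t * (of_int (m - int t) gchoose k)"
proof -
  have 1: "((-1) ^ (t + u + 1) / of_nat (t + u)) * (of_nat (t + u) gchoose t) =
      (-1) ^ (t + 1) / of_nat t * (of_int (- int t) gchoose u :: complex)" for u
  proof -
    obtain t' where t: "t = Suc t'" using assms by (cases t) auto
    have "of_nat t * (of_nat (t + u) gchoose t :: complex) = of_nat (t + u) * (of_nat (t' + u) gchoose t')"
      using gbinomial_absorption[of t' "of_nat (t + u) :: complex"] by (simp add: t)
    also have "(of_nat (t' + u) gchoose t' :: complex) = (of_nat (t' + u) gchoose u)"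
      by (subst gbinomial_of_nat_symmetric) auto
    also have "\<dots> = (-1) ^ u * (of_int (- int t) gchoose u)"
      by (subst gbinomial_negated_upper) (simp add: t algebra_simps)
    finally have e: "of_nat t * (of_nat (t + u) gchoose t :: complex) =
      of_nat (t + u) * ((-1) ^ u * (of_int (- int t) gchoose u))" .
    have nz: "(of_nat t :: complex) \<noteq> 0" "(of_nat (t + u) :: complex) \<noteq> 0"
      using assms by (simp_all del: of_nat_add)
    have s: "(-1) ^ (t + u + 1) * (-1) ^ u = ((-1) ^ (t + 1) :: complex)"
      by (simp add: power_add)
    have field: "A / X * Z = C / W * B"
      if "W * Z = X * (D * B)" "A * D = C" "W \<noteq> 0" "X \<noteq> 0" for A B C D W X Z :: complex
    proof -
      have "A * Z * W = A * (W * Z)" by (simp only: mult_ac)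
      also have "\<dots> = C * B * X" by (simp only: that(1) that(2)[symmetric] mult_ac)
      finally show ?thesis using that(3,4) by (simp add: divide_simps mult_ac)
    qed
    show ?thesis by (rule field[OF e s nz])
  qed
  have "(\<Sum>u\<le>k. ((-1) ^ (t + u + 1) / of_nat (t + u)) * (of_nat (t + u) gchoose t) *
      (of_int m gchoose (k - u)) :: complex) =
    (\<Sum>u\<le>k. (-1) ^ (t + 1) / of_nat t * ((of_int (- int t) gchoose u) * (of_int m gchoose (k - u))))"
    by (simp only: 1 mult.assoc)
  also have "\<dots> = (-1) ^ (t + 1) / of_nat t * (of_int (m - int t) gchoose k)"
    by (simp only: sum_distrib_left[symmetric] vandermonde_of_int) simp
  finally show ?thesis .
qed

definition divpow :: "('w::complex_vector \<Rightarrow> 'w) \<Rightarrow> nat \<Rightarrow> 'w \<Rightarrow> 'w" where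
  "divpow T u w = (1 / fact u) *\<^sub>C (T ^^ u) w"

text \<open>
  \<open>skew T YW w n b\<close> is the \<open>n\<close>-th mode of \<open>e\<^bsup>zT\<^esup> YW(b,-z) w\<close>.
\<close>

definition skew ::
    "('w::complex_vector \<Rightarrow> 'w) \<Rightarrow> ('v::complex_vector \<Rightarrow> int \<Rightarrow> 'w \<Rightarrow> 'w) \<Rightarrow> 'w \<Rightarrow> int \<Rightarrow> 'v \<Rightarrow> 'w" where
  "skew T YW w n b = Sum_any (\<lambda>u::nat. ((-1) powi (n + int u + 1)) *\<^sub>C divpow T u (YW b (n + int u) w))"

lemma divpow_clinear: "clinear T \<Longrightarrow> clinear (divpow T u)"
  unfolding divpow_def by (rule clinear_compose[OF _ clinear_funpow])
    (auto intro: clinearI simp: scaleC_simps mult.commute)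

lemma divpow_0 [simp]: "divpow T 0 w = w"
  by (simp add: divpow_def scaleC_one)

lemma divpow_Suc: "clinear T \<Longrightarrow> of_nat (Suc u) *\<^sub>C divpow T (Suc u) w = T (divpow T u w)"
  by (simp add: divpow_def clinear_scale scaleC_scaleC del: of_nat_Suc)

lemma divpow_Suc': "clinear T \<Longrightarrow> divpow T (Suc u) w = (1 / of_nat (Suc u)) *\<^sub>C T (divpow T u w)"
  by (simp add: divpow_Suc[symmetric] scaleC_scaleC del: of_nat_Suc)

lemma divpow_divpow:
  assumes "clinear T"
  shows "divpow T u (divpow T v w) = (of_nat (u + v) gchoose u) *\<^sub>C divpow T (u + v) w"
proof -
  have "(of_nat (u + v) gchoose u :: complex) = fact (u + v) / (fact u * fact v)"
    by (simp add: binomial_gbinomial[symmetric] binomial_fact del: of_nat_add)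
  then show ?thesis
    by (simp add: divpow_def clinear_scale[OF clinear_funpow[OF assms]] scaleC_scaleC funpow_add del: of_nat_add)
qed

lemma skew_finite:
  assumes "modal YW" "clinear T"
  shows "finite {u::nat. c u *\<^sub>C divpow T u (YW b (n + int u) w) \<noteq> 0}"
proof -
  obtain N where N: "\<And>n. N \<le> n \<Longrightarrow> YW b n w = 0" using modal_trunc[OF assms(1)] by blast
  show ?thesis
    by (rule finite_support_nat[of "nat (N - n)"])
      (simp add: N clinear_zero[OF divpow_clinear[OF assms(2)]])
qed

lemma skew_clinear:
  assumes "modal YW" "clinear T"
  shows "clinear (\<lambda>w. skew T YW w n b)" "clinear (skew T YW w n)"
proof -
  note f = skew_finite[OF assms, of "\<lambda>u. (-1) powi (n + int u + 1)" _ n]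
  note l = clinear_add[OF divpow_clinear[OF assms(2)]] clinear_scale[OF divpow_clinear[OF assms(2)]]
  have s: "Sum_any (\<lambda>u. ((-1) powi (n + int u + 1)) *\<^sub>C c *\<^sub>C g u) =
      c *\<^sub>C Sum_any (\<lambda>u. ((-1) powi (n + int u + 1)) *\<^sub>C g u)"
    if "finite {u. ((-1) powi (n + int u + 1)) *\<^sub>C g u \<noteq> 0}" for c and g :: "nat \<Rightarrow> 'z::complex_vector"
    using Sum_any_scale[OF that, of c] by (simp add: mult.commute)
  show "clinear (\<lambda>w. skew T YW w n b)"
    unfolding skew_def
    by (rule clinearI) (simp_all only: modal_add[OF assms(1)] modal_scale[OF assms(1)] l
        scaleC_add_right Sum_any.distrib[OF f f] s[OF f])
  show "clinear (skew T YW w n)"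
    unfolding skew_def
    by (rule clinearI) (simp_all only: modal_add[OF assms(1)] modal_scale[OF assms(1)] l
        scaleC_add_right Sum_any.distrib[OF f f] s[OF f])
qed

lemma skew_trunc:
  assumes "modal YW" "clinear T"
  shows "\<exists>N. \<forall>n\<ge>N. skew T YW w n b = 0"
proof -
  obtain N where N: "\<And>n. N \<le> n \<Longrightarrow> YW b n w = 0" using modal_trunc[OF assms(1)] by blast
  show ?thesis
    by (rule exI[of _ N]) (simp add: skew_def N clinear_zero[OF divpow_clinear[OF assms(2)]])
qed

text \<open>The coefficients of e^(xT) Y(a,z) = Y(a,z+x) e^(xT). The hypothesis on \<open>T\<close>
  is the infinitesimal form of this conjugation.\<close>

lemma divpow_commute:
  assumes "clinear T" "modal YW"
    and T: "\<And>n w. T (YW a n w) = YW a n (T w) - of_int n *\<^sub>C YW a (n - 1) w"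
  shows "divpow T u (YW a n w) =
    (\<Sum>v\<le>u. ((-1) ^ v * (of_int n gchoose v)) *\<^sub>C YW a (n - int v) (divpow T (u - v) w))"
proof (induction u)
  case 0 show ?case by (simp add: scaleC_one)
next
  case (Suc u)
  let ?c = "\<lambda>v. (-1) ^ v * (of_int n gchoose v) :: complex"
  let ?g = "\<lambda>v. YW a (n - int v) (divpow T (Suc u - v) w)"
  have g: "T (YW a (n - int v) (divpow T (u - v) w)) =
    of_nat (Suc u - v) *\<^sub>C ?g v - (of_int n - of_nat v) *\<^sub>C ?g (Suc v)" if "v \<le> u" for v
  proof -
    have "T (divpow T (u - v) w) = of_nat (Suc u - v) *\<^sub>C divpow T (Suc u - v) w"
      using divpow_Suc[OF assms(1), of "u - v" w] that by (simp add: Suc_diff_le del: of_nat_Suc)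
    then show ?thesis
      unfolding T by (simp add: modal_scale[OF assms(2)] algebra_simps)
  qed
  \<comment> \<open>Multiplication by u + 1 turns the divided power into \<open>T\<close> applied to
    the preceding one; the factor is cancelled at the end.\<close>
  have "of_nat (Suc u) *\<^sub>C divpow T (Suc u) (YW a n w) = T (divpow T u (YW a n w))"
    by (rule divpow_Suc[OF assms(1)])
  also have "\<dots> = (\<Sum>v\<le>u. ?c v *\<^sub>C T (YW a (n - int v) (divpow T (u - v) w)))"
    by (simp only: Suc clinear_sum[OF assms(1)] clinear_scale[OF assms(1)])
  also have "\<dots> = (\<Sum>v\<le>u. (?c v * of_nat (Suc u - v)) *\<^sub>C ?g v - (?c v * (of_int n - of_nat v)) *\<^sub>C ?g (Suc v))"
    by (rule sum.cong) (simp_all only: atMost_iff g cvec.scale_right_diff_distrib scaleC_scaleC)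
  also have "\<dots> = (\<Sum>v\<le>u. (?c v * of_nat (Suc u - v)) *\<^sub>C ?g v) -
      (\<Sum>v\<le>u. (?c v * (of_int n - of_nat v)) *\<^sub>C ?g (Suc v))"
    by (rule sum_subtractf)
  also have "(\<Sum>v\<le>u. (?c v * of_nat (Suc u - v)) *\<^sub>C ?g v) =
      (\<Sum>v\<le>Suc u. (?c v * of_nat (Suc u - v)) *\<^sub>C ?g v)"
    by simp
  also have "(\<Sum>v\<le>u. (?c v * (of_int n - of_nat v)) *\<^sub>C ?g (Suc v)) =
      (\<Sum>v\<le>Suc u. - (of_nat v * ?c v) *\<^sub>C ?g v)"
  proof -
    have c: "?c v * (of_int n - of_nat v) = - (of_nat (Suc v) * ?c (Suc v))" for v
    proof -
      have "of_nat (Suc v) * (of_int n gchoose Suc v :: complex) = (of_int n - of_nat v) * (of_int n gchoose v)"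
        using gbinomial_absorb_comp[of "of_int n :: complex" v] gbinomial_absorption[of v "of_int n :: complex"]
        by (simp del: of_nat_Suc)
      then have "?c v * (of_int n - of_nat v) = (-1) ^ v * (of_nat (Suc v) * (of_int n gchoose Suc v))"
        by (simp only: mult_ac)
      then show ?thesis by simp
    qed
    have "(\<Sum>v\<le>Suc u. - (of_nat v * ?c v) *\<^sub>C ?g v) =
        (\<Sum>v\<le>u. - (of_nat (Suc v) * ?c (Suc v)) *\<^sub>C ?g (Suc v))"
      by (simp only: sum.atMost_Suc_shift of_nat_0 mult_zero_left minus_zero cvec.scale_zero_left add_0_left)
    then show ?thesis by (simp only: c)
  qed
  also have "(\<Sum>v\<le>Suc u. (?c v * of_nat (Suc u - v)) *\<^sub>C ?g v) - (\<Sum>v\<le>Suc u. - (of_nat v * ?c v) *\<^sub>C ?g v) =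
      (\<Sum>v\<le>Suc u. of_nat (Suc u) *\<^sub>C ?c v *\<^sub>C ?g v)"
    unfolding sum_subtractf[symmetric]
  proof (rule sum.cong[OF refl])
    fix v assume "v \<in> {..Suc u}"
    then have "?c v * of_nat (Suc u - v) - - (of_nat v * ?c v) = of_nat (Suc u) * ?c v"
      by (simp add: of_nat_diff algebra_simps del: of_nat_Suc)
    then show "(?c v * of_nat (Suc u - v)) *\<^sub>C ?g v - - (of_nat v * ?c v) *\<^sub>C ?g v =
        of_nat (Suc u) *\<^sub>C ?c v *\<^sub>C ?g v"
      by (simp only: cvec.scale_left_diff_distrib[symmetric] scaleC_scaleC)
  qed
  also have "\<dots> = of_nat (Suc u) *\<^sub>C (\<Sum>v\<le>Suc u. ?c v *\<^sub>C ?g v)"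
    by (simp only: cvec.scale_sum_right)
  finally show ?case
    by (metis (no_types, lifting) cvec.scale_left_imp_eq of_nat_eq_0_iff nat.distinct(1))
qed

text \<open>The same conjugation solved the other way: Y(a,z) e^(xT) = e^(xT) Y(a,z-x).\<close>

lemma commute_divpow:
  assumes "clinear T" "modal YW"
    and T: "\<And>n w. T (YW a n w) = YW a n (T w) - of_int n *\<^sub>C YW a (n - 1) w"
  shows "YW a n (divpow T u w) =
    (\<Sum>v\<le>u. (of_int n gchoose v) *\<^sub>C divpow T (u - v) (YW a (n - int v) w))"
proof (induction u arbitrary: n)
  case 0 show ?case by (simp add: scaleC_one)
next
  case (Suc u)
  let ?c = "\<lambda>v. (of_int n gchoose v) :: complex"
  let ?g = "\<lambda>v. divpow T (Suc u - v) (YW a (n - int v) w)"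
  have g: "T (divpow T (u - v) (YW a (n - int v) w)) = of_nat (Suc u - v) *\<^sub>C ?g v" if "v \<le> u" for v
    using divpow_Suc[OF assms(1), of "u - v" "YW a (n - int v) w"] that
    by (simp add: Suc_diff_le del: of_nat_Suc)
  have c: "of_int n * (of_int (n - 1) gchoose v) = (of_nat (Suc v) * ?c (Suc v) :: complex)" for v
    using gbinomial_absorption[of v "of_int n :: complex"] by simp
  have "of_nat (Suc u) *\<^sub>C YW a n (divpow T (Suc u) w) = YW a n (T (divpow T u w))"
    by (simp only: divpow_Suc[OF assms(1), symmetric] modal_scale[OF assms(2)])
  also have "\<dots> = T (YW a n (divpow T u w)) + of_int n *\<^sub>C YW a (n - 1) (divpow T u w)"
    by (simp add: T)
  also have "\<dots> = (\<Sum>v\<le>u. (?c v * of_nat (Suc u - v)) *\<^sub>C ?g v) +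
      (\<Sum>v\<le>u. (of_nat (Suc v) * ?c (Suc v)) *\<^sub>C ?g (Suc v))"
  proof (rule arg_cong2[where f = "(+)"])
    show "T (YW a n (divpow T u w)) = (\<Sum>v\<le>u. (?c v * of_nat (Suc u - v)) *\<^sub>C ?g v)"
      unfolding Suc[of n] clinear_sum[OF assms(1)] clinear_scale[OF assms(1)]
      by (rule sum.cong) (simp_all only: atMost_iff g scaleC_scaleC)
    show "of_int n *\<^sub>C YW a (n - 1) (divpow T u w) =
        (\<Sum>v\<le>u. (of_nat (Suc v) * ?c (Suc v)) *\<^sub>C ?g (Suc v))"
      unfolding Suc[of "n - 1"] cvec.scale_sum_right scaleC_scaleC c
      by (rule sum.cong) (simp_all add: algebra_simps)
  qed
  also have "(\<Sum>v\<le>u. (?c v * of_nat (Suc u - v)) *\<^sub>C ?g v) =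
      (\<Sum>v\<le>Suc u. (?c v * of_nat (Suc u - v)) *\<^sub>C ?g v)"
    by simp
  also have "(\<Sum>v\<le>u. (of_nat (Suc v) * ?c (Suc v)) *\<^sub>C ?g (Suc v)) =
      (\<Sum>v\<le>Suc u. (of_nat v * ?c v) *\<^sub>C ?g v)"
    by (subst sum.atMost_Suc_shift) (simp del: of_nat_Suc)
  also have "(\<Sum>v\<le>Suc u. (?c v * of_nat (Suc u - v)) *\<^sub>C ?g v) + (\<Sum>v\<le>Suc u. (of_nat v * ?c v) *\<^sub>C ?g v) =
      (\<Sum>v\<le>Suc u. of_nat (Suc u) *\<^sub>C ?c v *\<^sub>C ?g v)"
    unfolding sum.distrib[symmetric]
  proof (rule sum.cong[OF refl])
    fix v assume "v \<in> {..Suc u}"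
    then have "?c v * of_nat (Suc u - v) + of_nat v * ?c v = of_nat (Suc u) * ?c v"
      by (simp add: of_nat_diff algebra_simps del: of_nat_Suc)
    then show "(?c v * of_nat (Suc u - v)) *\<^sub>C ?g v + (of_nat v * ?c v) *\<^sub>C ?g v =
        of_nat (Suc u) *\<^sub>C ?c v *\<^sub>C ?g v"
      by (simp only: cvec.scale_left_distrib[symmetric] scaleC_scaleC)
  qed
  also have "\<dots> = of_nat (Suc u) *\<^sub>C (\<Sum>v\<le>Suc u. ?c v *\<^sub>C ?g v)"
    by (simp only: cvec.scale_sum_right)
  finally show ?case
    by (metis (no_types, lifting) cvec.scale_left_imp_eq of_nat_eq_0_iff nat.distinct(1))
qed

lemma funpow_intertwiner:
  assumes "modal J" and JT: "\<And>w n. J (T w) n x = - of_int n *\<^sub>C J w (n - 1) x"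
  shows "J ((T ^^ u) w) n x = ((-1) ^ u * fact u * (of_int n gchoose u)) *\<^sub>C J w (n - int u) x"
proof (induction u arbitrary: n)
  case 0 show ?case by (simp add: scaleC_one)
next
  case (Suc u)
  have "fact (Suc u) * (of_int n gchoose Suc u) = (of_int n * fact u * (of_int (n - 1) gchoose u) :: complex)"
    using gbinomial_absorption[of u "of_int n :: complex"] by (simp add: mult_ac)
  then have c: "- of_int n * ((-1) ^ u * fact u * (of_int (n - 1) gchoose u)) =
      ((-1) ^ Suc u * fact (Suc u) * (of_int n gchoose Suc u) :: complex)"
    by (simp add: mult.assoc[symmetric] del: fact_Suc)
  have "J ((T ^^ Suc u) w) n x = - of_int n *\<^sub>C J ((T ^^ u) w) (n - 1) x"
    by (simp only: funpow.simps o_def JT)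
  also have "\<dots> = ((-1) ^ Suc u * fact (Suc u) * (of_int n gchoose Suc u)) *\<^sub>C J w (n - 1 - int u) x"
    by (simp only: Suc scaleC_scaleC c)
  finally show ?case by (simp add: algebra_simps)
qed

text \<open>By the derivative property of \<open>J\<close>, a factor e^(xT) on its first argument
  shifts z to z + x. So this is J(Y(b,-x)w, z + x), read off coefficient by coefficient.\<close>

lemma skew_intertwiner:
  assumes J: "modal J" and YW: "modal YW" and T: "clinear T"
    and JT: "\<And>w n. J (T w) n x = - of_int n *\<^sub>C J w (n - 1) x"
  shows "J (skew T YW w p b) q x = - ((-1) powi p) *\<^sub>C
    Sum_any (\<lambda>u::nat. (of_int q gchoose u) *\<^sub>C J (YW b (p + int u) w) (q - int u) x)"
proof -
  have fin: "finite {u::nat. (of_int q gchoose u) *\<^sub>C J (YW b (p + int u) w) (q - int u) x \<noteq> 0}"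
    by (rule expand_sum_finite[OF trunc2_iterate[OF YW J]])
  have "J (skew T YW w p b) q x =
    Sum_any (\<lambda>u::nat. J (((-1) powi (p + int u + 1)) *\<^sub>C divpow T u (YW b (p + int u) w)) q x)"
    unfolding skew_def
    by (rule clinear_Sum_any[OF modal_clinear(2)[OF J] skew_finite[OF YW T]])
  also have "\<dots> = Sum_any (\<lambda>u::nat. (- ((-1) powi p)) *\<^sub>C
      (of_int q gchoose u) *\<^sub>C J (YW b (p + int u) w) (q - int u) x)"
  proof (rule Sum_any.cong)
    fix u
    have "((-1) powi (p + int u + 1)) * (1 / fact u) * ((-1) ^ u * fact u * (of_int q gchoose u)) =
        - ((-1) powi p) * (of_int q gchoose u :: complex)"
      by (simp add: power_int_add mult.assoc[symmetric] power_mult_distrib[symmetric])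
    then show "J (((-1) powi (p + int u + 1)) *\<^sub>C divpow T u (YW b (p + int u) w)) q x =
        (- ((-1) powi p)) *\<^sub>C (of_int q gchoose u) *\<^sub>C J (YW b (p + int u) w) (q - int u) x"
      unfolding divpow_def modal_scale[OF J] funpow_intertwiner[where J = J and T = T, OF J JT] scaleC_scaleC
      by (simp only: mult.assoc)
  qed
  also have "\<dots> = - ((-1) powi p) *\<^sub>C
    Sum_any (\<lambda>u::nat. (of_int q gchoose u) *\<^sub>C J (YW b (p + int u) w) (q - int u) x)"
    by (rule Sum_any_scale[OF fin])
  finally show ?thesis .
qed

text \<open>The Jacobi kernel is symmetric under the exchange of z1 and z2 together with z0 -> -z0.
  Hence the identity for b and w yields one for w and b, in which w_p b is the product defined by
  skew-symmetry.\<close>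

lemma skew_borcherds:
  assumes J: "modal J" and YW: "modal YW" and YX: "modal YX" and YY: "modal YY" and T: "clinear T"
    and JT: "\<And>w n x. J (T w) n x = - of_int n *\<^sub>C J w (n - 1) x"
    and jac: "jacobi YW YX YY J"
  shows "borcherds (\<lambda>p q. J w p (YX b q x)) (\<lambda>p q. YY b p (J w q x))
    (\<lambda>p q. J (skew T YW w p b) q x) l m n"
proof -
  let ?K = "\<lambda>p q. J (YW b p w) q x"
  have "expand_sum (\<lambda>p q. J (skew T YW w p b) q x) l m n = - ((-1) powi l) *\<^sub>C expand_sum ?K l n m"
  proof -
    obtain N where "\<And>n. N \<le> n \<Longrightarrow> YW b n w = 0" using modal_trunc[OF YW] by blast
    then have N: "?K (l + int u) r = 0" if "nat (N - l) \<le> u" for u r using that J by simp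
    let ?g = "\<lambda>i u. (of_int m gchoose i) *\<^sub>C (- ((-1) powi (l + int i))) *\<^sub>C
        (of_int (m + n - int i) gchoose u) *\<^sub>C ?K (l + int (i + u)) (m + n - int (i + u))"
    have fin: "finite {u::nat. (of_int (m + n - int i) gchoose u) *\<^sub>C
        ?K (l + int i + int u) (m + n - int i - int u) \<noteq> 0}" for i
      by (rule expand_sum_finite[OF trunc2_iterate[OF YW J]])
    have "expand_sum (\<lambda>p q. J (skew T YW w p b) q x) l m n = Sum_any (\<lambda>i. Sum_any (?g i))"
      unfolding expand_sum_def skew_intertwiner[OF J YW T JT]
    proof (rule Sum_any.cong)
      fix i
      have "Sum_any (?g i) = (of_int m gchoose i) *\<^sub>C (- ((-1) powi (l + int i))) *\<^sub>C
        Sum_any (\<lambda>u. (of_int (m + n - int i) gchoose u) *\<^sub>C ?K (l + int i + int u) (m + n - int i - int u))"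
        unfolding scaleC_scaleC[of "of_int m gchoose i"]
        by (subst Sum_any_scale[OF fin, symmetric]) (simp add: algebra_simps)
      then show "(of_int m gchoose i) *\<^sub>C (- ((-1) powi (l + int i))) *\<^sub>C
        Sum_any (\<lambda>u. (of_int (m + n - int i) gchoose u) *\<^sub>C ?K (l + int i + int u) (m + n - int i - int u)) =
        Sum_any (?g i)" by simp
    qed
    also have "\<dots> = Sum_any (\<lambda>k. \<Sum>i\<le>k. ?g i (k - i))"
      by (rule Sum_any_triangle[of "nat (N - l)"]) (simp only: N cvec.scale_zero_right)
    also have "\<dots> = Sum_any (\<lambda>k. (- ((-1) powi l)) *\<^sub>C (of_int n gchoose k) *\<^sub>C ?K (l + int k) (n + m - int k))"
    proof (rule Sum_any.cong)
      fix k
      have "(\<Sum>i\<le>k. ?g i (k - i)) = (\<Sum>i\<le>k. ((- ((-1) powi l)) * ((-1) ^ i * (of_int m gchoose i) *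
          (of_int (m + n - int i) gchoose (k - i)))) *\<^sub>C ?K (l + int k) (n + m - int k))"
        by (rule sum.cong[OF refl]) (simp add: scaleC_scaleC power_int_add mult_ac add_ac)
      also have "\<dots> = (- ((-1) powi l)) *\<^sub>C (of_int n gchoose k) *\<^sub>C ?K (l + int k) (n + m - int k)"
        by (simp only: cvec.scale_sum_left[symmetric] sum_distrib_left[symmetric] alternating_vandermonde scaleC_scaleC)
          simp
      finally show "(\<Sum>i\<le>k. ?g i (k - i)) =
        (- ((-1) powi l)) *\<^sub>C (of_int n gchoose k) *\<^sub>C ?K (l + int k) (n + m - int k)" .
    qed
    also have "\<dots> = - ((-1) powi l) *\<^sub>C expand_sum ?K l n m"
      unfolding expand_sum_def
      by (rule Sum_any_scale[OF expand_sum_finite[OF trunc2_iterate[OF YW J]]])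
    finally show ?thesis .
  qed
  moreover have "expand_sum ?K l n m = expand_diff (\<lambda>p q. YY b p (J w q x)) l n m -
      ((-1) powi l) *\<^sub>C expand_diff (\<lambda>p q. J w p (YX b q x)) l m n"
    using jac unfolding jacobi_def borcherds_def by blast
  ultimately show ?thesis
    unfolding borcherds_def by (simp add: scaleC_simps power_int_minus_one_mult_self)
qed

section \<open>Combinatorics of the commutator formula with s\<close>

lemma Sum_any_swap_nat:
  fixes g :: "nat \<Rightarrow> nat \<Rightarrow> 'a::comm_monoid_add"
  assumes "\<And>a b. C \<le> a \<or> C \<le> b \<Longrightarrow> g a b = 0"
  shows "Sum_any (\<lambda>a. Sum_any (\<lambda>b. g a b)) = Sum_any (\<lambda>b. Sum_any (\<lambda>a. g a b))"
  by (rule Sum_any_swap[of "{..<C} \<times> {..<C}"]) (auto intro: assms simp: not_less)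

lemma Sum_any_zero: "(\<And>x. g x = 0) \<Longrightarrow> Sum_any g = 0"
  by simp

text \<open>Collected by z = i + v, the coefficient of \<open>g z y\<close> is an alternating
  Vandermonde sum with equal upper arguments, hence (0 choose z), and only z = 0 survives. This is
  the half of the commutator formula in which a acts last.\<close>

lemma skew_product_sum1:
  fixes g :: "nat \<Rightarrow> nat \<Rightarrow> 'a::complex_vector" and q :: int
  assumes z: "\<And>z y. C \<le> z + y \<Longrightarrow> g z y = 0"
  shows "Sum_any (\<lambda>u::nat. Sum_any (\<lambda>i::nat. \<Sum>v\<le>u. ((-1) ^ (u + i + v) * (of_int q gchoose i) *
      (of_int (q - int i) gchoose v)) *\<^sub>C g (i + v) (u - v))) = Sum_any (\<lambda>y. ((-1) ^ y) *\<^sub>C g 0 y)"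
    (is "Sum_any (\<lambda>u::nat. Sum_any (\<lambda>i::nat. \<Sum>v\<le>u. ?F u i v)) = _")
proof -
  let ?E = "\<lambda>i v y. ((-1) ^ (y + i) * (of_int q gchoose i) * (of_int (q - int i) gchoose v)) *\<^sub>C g (i + v) y"
  have E0: "?E i v y = 0" if "C \<le> i + v + y" for i v y
    using z[OF that] by simp
  have "Sum_any (\<lambda>u. Sum_any (\<lambda>i. \<Sum>v\<le>u. ?F u i v)) = Sum_any (\<lambda>i. Sum_any (\<lambda>u. \<Sum>v\<le>u. ?F u i v))"
  proof (rule Sum_any_swap_nat[of C])
    fix u i assume "C \<le> u \<or> C \<le> i"
    then show "(\<Sum>v\<le>u. ?F u i v) = 0" by (intro sum.neutral) (auto intro!: z)
  qed
  also have "\<dots> = Sum_any (\<lambda>i. Sum_any (\<lambda>v. Sum_any (\<lambda>y. ?E i v y)))"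
  proof (rule Sum_any.cong)
    fix i
    have "Sum_any (\<lambda>v. Sum_any (\<lambda>y. ?E i v y)) = Sum_any (\<lambda>u. \<Sum>v\<le>u. ?E i v (u - v))"
      by (rule Sum_any_triangle[of C]) (rule E0, simp)
    also have "\<dots> = Sum_any (\<lambda>u. \<Sum>v\<le>u. ?F u i v)"
    proof (intro Sum_any.cong sum.cong refl)
      fix u v :: nat assume "v \<in> {..u}"
      then have "u + i + v = (u - v + i) + 2 * v" by simp
      then have "(-1) ^ (u + i + v) = ((-1) ^ (u - v + i) :: complex)"
        by (simp only: power_add power_mult) simp
      then show "?E i v (u - v) = ?F u i v" by simp
    qed
    finally show "Sum_any (\<lambda>u. \<Sum>v\<le>u. ?F u i v) = Sum_any (\<lambda>v. Sum_any (\<lambda>y. ?E i v y))" by simp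
  qed
  also have "\<dots> = Sum_any (\<lambda>z. \<Sum>i\<le>z. Sum_any (\<lambda>y. ?E i (z - i) y))"
    by (rule Sum_any_triangle[of C]) (rule Sum_any_zero, rule E0, simp)
  also have "\<dots> = Sum_any (\<lambda>z. (of_int 0 gchoose z) *\<^sub>C Sum_any (\<lambda>y. ((-1) ^ y) *\<^sub>C g z y))"
  proof (rule Sum_any.cong)
    fix k
    have f: "finite {y. ((-1) ^ y) *\<^sub>C g k y \<noteq> 0}"
      by (rule finite_support_nat[of C]) (simp add: z)
    have "(\<Sum>i\<le>k. Sum_any (\<lambda>y. ?E i (k - i) y)) =
      (\<Sum>i\<le>k. ((-1) ^ i * (of_int q gchoose i) * (of_int (q - int i) gchoose (k - i))) *\<^sub>C
        Sum_any (\<lambda>y. ((-1) ^ y) *\<^sub>C g k y))"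
      by (rule sum.cong[OF refl], subst Sum_any_scale[OF f, symmetric])
        (simp add: scaleC_scaleC power_add mult_ac)
    then show "(\<Sum>i\<le>k. Sum_any (\<lambda>y. ?E i (k - i) y)) =
      (of_int 0 gchoose k) *\<^sub>C Sum_any (\<lambda>y. ((-1) ^ y) *\<^sub>C g k y)"
      by (simp only: cvec.scale_sum_left[symmetric] alternating_vandermonde) simp
  qed
  also have "\<dots> = Sum_any (\<lambda>y. ((-1) ^ y) *\<^sub>C g 0 y)"
    by (subst Sum_any_single[of 0]) (simp_all add: gbinomial_0_left scaleC_one)
  finally show ?thesis .
qed

text \<open>In \<open>h U i\<close>, U is the total power of \<open>T\<close> and i the mode of a
  that is applied to s. For fixed U, Vandermonde merges j and U into the upper argument j + U; the
  alternating form then removes j + U again and leaves (q choose i).\<close>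

lemma skew_product_sum2:
  fixes h :: "nat \<Rightarrow> nat \<Rightarrow> 'a::complex_vector" and q :: int
  assumes h0: "\<And>U i. C \<le> U \<or> C \<le> i \<Longrightarrow> h U i = 0"
  shows "Sum_any (\<lambda>t. Sum_any (\<lambda>u. Sum_any (\<lambda>y. \<Sum>v\<le>y. ((of_nat j gchoose t) * (-1) ^ (u + y) *
        (of_int (q + int j - int t + int u) gchoose v) * (of_nat (u + (y - v)) gchoose u)) *\<^sub>C
        h (u + (y - v)) (t + y)))) =
    Sum_any (\<lambda>U. Sum_any (\<lambda>i. ((-1) ^ (U + i) * (of_int q gchoose i)) *\<^sub>C h U i))"
    (is "Sum_any (\<lambda>t::nat. Sum_any (\<lambda>u::nat. Sum_any (\<lambda>y::nat. \<Sum>v\<le>y. ?G t u y v))) = _")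
proof -
  define F where "F t u v x = ((of_nat j gchoose t) * (-1) ^ (u + v + x) *
      (of_int (q + int j - int t + int u) gchoose v) * (of_nat (u + x) gchoose u)) *\<^sub>C h (u + x) (t + v + x)" for t u v x
  define E where "E t v x U = ((of_nat j gchoose t) * (-1) ^ (U + v) *
      (of_int (q + int j - int t + int U - int x) gchoose v) * (of_nat U gchoose x)) *\<^sub>C h U (t + v + x)" for t v x U
  have F0: "F t u v x = 0" if "C \<le> u + x \<or> C \<le> t + v + x" for t u v x
    using h0[OF that] by (simp add: F_def)
  have E0: "E t v x U = 0" if "C \<le> U \<or> C \<le> t + v + x" for t v x U
    using h0[OF that] by (simp add: E_def)
  have 1: "Sum_any (\<lambda>y. \<Sum>v\<le>y. ?G t u y v) = Sum_any (\<lambda>v. Sum_any (\<lambda>x. F t u v x))" for t u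
  proof -
    have "Sum_any (\<lambda>v. Sum_any (\<lambda>x. F t u v x)) = Sum_any (\<lambda>y. \<Sum>v\<le>y. F t u v (y - v))"
      by (rule Sum_any_triangle[of C]) (rule F0, simp)
    also have "\<dots> = Sum_any (\<lambda>y. \<Sum>v\<le>y. ?G t u y v)"
      unfolding F_def by (intro Sum_any.cong sum.cong refl) simp
    finally show ?thesis by simp
  qed
  have 2: "Sum_any (\<lambda>u. Sum_any (\<lambda>v. Sum_any (\<lambda>x. F t u v x))) =
      Sum_any (\<lambda>v. Sum_any (\<lambda>U. Sum_any (\<lambda>x. E t v x U)))" for t
  proof -
    have "Sum_any (\<lambda>u. Sum_any (\<lambda>v. Sum_any (\<lambda>x. F t u v x))) =
      Sum_any (\<lambda>v. Sum_any (\<lambda>u. Sum_any (\<lambda>x. F t u v x)))"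
      by (rule Sum_any_swap_nat[of C], rule Sum_any_zero, rule F0) auto
    also have "\<dots> = Sum_any (\<lambda>v. Sum_any (\<lambda>U. Sum_any (\<lambda>x. E t v x U)))"
    proof (rule Sum_any.cong)
      fix v
      have "Sum_any (\<lambda>u. Sum_any (\<lambda>x. F t u v x)) = Sum_any (\<lambda>x. Sum_any (\<lambda>u. F t u v x))"
        by (rule Sum_any_swap_nat[of C], rule F0) auto
      also have "\<dots> = Sum_any (\<lambda>U. \<Sum>x\<le>U. F t (U - x) v x)"
        by (rule Sum_any_triangle[of C], rule F0) auto
      also have "\<dots> = Sum_any (\<lambda>U. Sum_any (\<lambda>x. E t v x U))"
      proof (rule Sum_any.cong)
        fix U
        have "(\<Sum>x\<le>U. F t (U - x) v x) = (\<Sum>x\<le>U. E t v x U)"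
        proof (rule sum.cong[OF refl])
          fix x :: nat assume "x \<in> {..U}"
          then have x: "x \<le> U" by simp
          then have "(of_nat U gchoose (U - x) :: complex) = (of_nat U gchoose x)"
            by (simp add: gbinomial_of_nat_symmetric[symmetric])
          then show "F t (U - x) v x = E t v x U"
            using x by (simp add: F_def E_def of_nat_diff add_ac diff_add_eq)
        qed
        also have "\<dots> = Sum_any (\<lambda>x. E t v x U)"
          by (rule Sum_any_eq_sum[symmetric]) (simp_all add: E_def binomial_gbinomial[symmetric])
        finally show "(\<Sum>x\<le>U. F t (U - x) v x) = Sum_any (\<lambda>x. E t v x U)" .
      qed
      finally show "Sum_any (\<lambda>u. Sum_any (\<lambda>x. F t u v x)) = Sum_any (\<lambda>U. Sum_any (\<lambda>x. E t v x U))" .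
    qed
    finally show ?thesis .
  qed
  have "Sum_any (\<lambda>t. Sum_any (\<lambda>v. Sum_any (\<lambda>U. Sum_any (\<lambda>x. E t v x U)))) =
      Sum_any (\<lambda>t. Sum_any (\<lambda>U. Sum_any (\<lambda>v. Sum_any (\<lambda>x. E t v x U))))"
    by (rule Sum_any.cong, rule Sum_any_swap_nat[of C], rule Sum_any_zero, rule E0) auto
  also have "\<dots> = Sum_any (\<lambda>U. Sum_any (\<lambda>t. Sum_any (\<lambda>v. Sum_any (\<lambda>x. E t v x U))))"
    by (rule Sum_any_swap_nat[of C], rule Sum_any_zero, rule Sum_any_zero, rule E0) auto
  also have "\<dots> = Sum_any (\<lambda>U. Sum_any (\<lambda>v. Sum_any (\<lambda>t. Sum_any (\<lambda>x. E t v x U))))"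
    by (rule Sum_any.cong, rule Sum_any_swap_nat[of C], rule Sum_any_zero, rule E0) auto
  also have "\<dots> = Sum_any (\<lambda>U. Sum_any (\<lambda>i. ((-1) ^ (U + i) * (of_int q gchoose i)) *\<^sub>C h U i))"
  proof (rule Sum_any.cong)
    fix U
    let ?D = "\<lambda>w v. ((-1) ^ (U + v) * (of_int (int j + int U) gchoose w) *
        (of_int (q + int j + int U - int w) gchoose v)) *\<^sub>C h U (w + v)"
    have D0: "?D w v = 0" if "C \<le> w + v" for w v using h0[of "w + v" U] that h0 by simp
    have "Sum_any (\<lambda>v. Sum_any (\<lambda>t. Sum_any (\<lambda>x. E t v x U))) = Sum_any (\<lambda>v. Sum_any (\<lambda>w. ?D w v))"
    proof (rule Sum_any.cong)
      fix v
      have "Sum_any (\<lambda>t. Sum_any (\<lambda>x. E t v x U)) = Sum_any (\<lambda>w. \<Sum>t\<le>w. E t v (w - t) U)"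
        by (rule Sum_any_triangle[of C], rule E0) auto
      also have "\<dots> = Sum_any (\<lambda>w. ?D w v)"
      proof (rule Sum_any.cong)
        fix w
        have "(\<Sum>t\<le>w. E t v (w - t) U) = (\<Sum>t\<le>w. ((-1) ^ (U + v) *
            (of_int (q + int j + int U - int w) gchoose v) *
            ((of_int (int j) gchoose t) * (of_int (int U) gchoose (w - t)))) *\<^sub>C h U (w + v))"
        proof (rule sum.cong[OF refl])
          fix t :: nat assume t: "t \<in> {..w}"
          then have "q + int j - int t + int U - int (w - t) = q + int j + int U - int w"
            "t + v + (w - t) = w + v" by auto
          then show "E t v (w - t) U = ((-1) ^ (U + v) *
            (of_int (q + int j + int U - int w) gchoose v) *
            ((of_int (int j) gchoose t) * (of_int (int U) gchoose (w - t)))) *\<^sub>C h U (w + v)"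
            by (simp only: E_def of_int_of_nat_eq mult_ac)
        qed
        also have "\<dots> = ?D w v"
          unfolding cvec.scale_sum_left[symmetric] sum_distrib_left[symmetric] vandermonde_of_int
          by (simp only: mult_ac)
        finally show "(\<Sum>t\<le>w. E t v (w - t) U) = ?D w v" .
      qed
      finally show "Sum_any (\<lambda>t. Sum_any (\<lambda>x. E t v x U)) = Sum_any (\<lambda>w. ?D w v)" .
    qed
    also have "\<dots> = Sum_any (\<lambda>w. Sum_any (\<lambda>v. ?D w v))"
      by (rule Sum_any_swap_nat[of C], rule D0) auto
    also have "\<dots> = Sum_any (\<lambda>i. \<Sum>w\<le>i. ?D w (i - w))"
      by (rule Sum_any_triangle[of C]) (rule D0)
    also have "\<dots> = Sum_any (\<lambda>i. ((-1) ^ (U + i) * (of_int q gchoose i)) *\<^sub>C h U i)"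
    proof (rule Sum_any.cong)
      fix i
      have "(\<Sum>w\<le>i. ?D w (i - w)) = (\<Sum>w\<le>i. ((-1) ^ (U + i) * ((-1) ^ w * (of_int (int j + int U) gchoose w) *
          (of_int (q + int j + int U - int w) gchoose (i - w)))) *\<^sub>C h U i)"
      proof (rule sum.cong[OF refl])
        fix w :: nat assume "w \<in> {..i}"
        then have w: "w \<le> i" by simp
        then have "U + i + w = U + (i - w) + 2 * w" by simp
        then have "(-1) ^ (U + (i - w)) = ((-1) ^ (U + i) * (-1) ^ w :: complex)"
          by (simp only: power_add[symmetric]) (simp only: power_add power_mult, simp)
        then show "?D w (i - w) = ((-1) ^ (U + i) * ((-1) ^ w * (of_int (int j + int U) gchoose w) *
          (of_int (q + int j + int U - int w) gchoose (i - w)))) *\<^sub>C h U i"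
          using w by (simp only: le_add_diff_inverse mult_ac)
      qed
      also have "\<dots> = ((-1) ^ (U + i) * (of_int q gchoose i)) *\<^sub>C h U i"
        by (simp only: cvec.scale_sum_left[symmetric] sum_distrib_left[symmetric] alternating_vandermonde) simp
      finally show "(\<Sum>w\<le>i. ?D w (i - w)) = ((-1) ^ (U + i) * (of_int q gchoose i)) *\<^sub>C h U i" .
    qed
    finally show "Sum_any (\<lambda>v. Sum_any (\<lambda>t. Sum_any (\<lambda>x. E t v x U))) =
      Sum_any (\<lambda>i. ((-1) ^ (U + i) * (of_int q gchoose i)) *\<^sub>C h U i)" .
  qed
  finally show ?thesis by (simp only: 1 2)
qed

lemma jacobi_iterate:
  assumes "modal Y1" "modal Y2" "modal Y3" "modal J" "jacobi Y1 Y2 Y3 J"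
  shows "J (Y1 a l w) n x = Sum_any (\<lambda>i::nat. ((-1) ^ i * (of_int l gchoose i)) *\<^sub>C
      (Y3 a (l - int i) (J w (n + int i) x) - ((-1) powi l) *\<^sub>C J w (l + n - int i) (Y2 a (int i) x)))"
proof -
  have "Sum_any (\<lambda>i::nat. (of_int 0 gchoose i) *\<^sub>C J (Y1 a (l + int i) w) (0 + n - int i) x) = J (Y1 a l w) n x"
    by (subst Sum_any_single[of 0]) (simp_all add: gbinomial_0_left scaleC_one)
  then show ?thesis using jacobi_modes[OF assms, of 0 a l w n x] by simp
qed

lemma jacobi_commutator:
  assumes "modal Y1" "modal Y2" "modal Y3" "modal J" "jacobi Y1 Y2 Y3 J"
  shows "Y3 a m (J w n x) - J w n (Y2 a m x) =
    Sum_any (\<lambda>i::nat. (of_int m gchoose i) *\<^sub>C J (Y1 a (int i) w) (m + n - int i) x)"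
proof -
  have "Sum_any (\<lambda>i::nat. ((-1) ^ i * (of_int 0 gchoose i)) *\<^sub>C
      (Y3 a (0 + m - int i) (J w (n + int i) x) -
        ((-1) powi 0) *\<^sub>C J w (0 + n - int i) (Y2 a (m + int i) x))) =
    Y3 a m (J w n x) - J w n (Y2 a m x)"
    by (subst Sum_any_single[of 0]) (simp_all add: gbinomial_0_left scaleC_one)
  then show ?thesis using jacobi_modes[OF assms, of m a 0 w n x] by simp
qed

text \<open>The commutator of s_j with a_q, obtained from the module action alone: (a_q b)_n s is
  expanded by the iterate formula, and the powers of \<open>T\<close> are moved through the modes.
  The terms with a acting last give a_q (s_j b), those with b acting last give the sum over
  t.\<close>

lemma skew_product:
  assumes Y: "modal Y" and YW: "modal YW" and T: "clinear T" and jac: "jacobi Y YW YW YW"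
    and Ta: "\<And>n w. T (YW a n w) = YW a n (T w) - of_int n *\<^sub>C YW a (n - 1) w"
    and Tb: "\<And>n w. T (YW b n w) = YW b n (T w) - of_int n *\<^sub>C YW b (n - 1) w"
  shows "skew T YW s (int j) (Y a q b) =
    Sum_any (\<lambda>t. (of_nat j gchoose t) *\<^sub>C skew T YW (skew T YW s (int t) a) (q + int j - int t) b) +
    YW a q (skew T YW s (int j) b)"
proof -
  note dl = divpow_clinear[OF T]
  obtain N where N: "\<And>n. N \<le> n \<Longrightarrow> YW a n s = 0" using modal_trunc[OF YW] by blast
  obtain N' where N': "\<And>n. N' \<le> n \<Longrightarrow> YW b n s = 0" using modal_trunc[OF YW] by blast
  \<comment> \<open>A bound common to all i exists because a_i s is nonzero for only finitely many i
    >= 0.\<close>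
  obtain M where M: "\<And>i n. i < nat N \<Longrightarrow> M \<le> n \<Longrightarrow> YW b n (YW a (int i) s) = 0"
  proof -
    have "\<forall>i. \<exists>N. \<forall>n\<ge>N. YW b n (YW a (int i) s) = 0" using modal_trunc[OF YW] by blast
    then obtain f where f: "\<forall>i. \<forall>n\<ge>f i. YW b n (YW a (int i) s) = 0" by metis
    have "YW b n (YW a (int i) s) = 0" if "i < nat N" "Max (insert 0 (f ` {..<nat N})) \<le> n" for i n
      using f that by (meson Max_ge finite_imageI finite_insert finite_lessThan image_eqI insertI2 lessThan_iff order_trans)
    then show ?thesis by (rule that)
  qed
  define C where "C = nat N + nat (N' - int j) + nat (M - q - int j) + nat N"
  define h where "h U i = divpow T U (YW b (q + int j + int U - int i) (YW a (int i) s))" for U i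
  define g where "g z y = YW a (q - int z) (divpow T y (YW b (int j + int y + int z) s))" for z y
  have h0: "h U i = 0" if "C \<le> U \<or> C \<le> i" for U i
  proof (cases "nat N \<le> i")
    case True then show ?thesis by (simp add: h_def N YW clinear_zero[OF dl])
  next
    case False
    then show ?thesis using that M[of i "q + int j + int U - int i"]
      by (simp add: h_def C_def clinear_zero[OF dl])
  qed
  have g0: "g z y = 0" if "C \<le> z + y" for z y
    using that by (simp add: g_def N' YW clinear_zero[OF dl] C_def)
  have finu: "finite {u::nat. c u *\<^sub>C divpow T u (YW b (n + int u) w) \<noteq> 0}" for c n w b
    by (rule skew_finite[OF YW T])

  let ?A = "\<lambda>u i. ((-1) ^ (u + i) * (of_int q gchoose i)) *\<^sub>C
      divpow T u (YW a (q - int i) (YW b (int j + int u + int i) s))"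
  let ?H = "\<lambda>u i. ((-1) ^ (u + i) * (of_int q gchoose i)) *\<^sub>C h u i"
  have A0: "?A u i = 0" if "nat N' \<le> i" for u i
    using that by (simp add: N' YW clinear_zero[OF dl])
  have A0': "?A u i = 0" if "nat N' \<le> u" for u i
    using that by (simp add: N' YW clinear_zero[OF dl])
  have fA: "finite {i. ?A u i \<noteq> 0}" for u by (rule finite_support_nat[of "nat N'"]) (rule A0)
  have fH: "finite {i. c *\<^sub>C ?H u i \<noteq> 0}" for u c
    by (rule finite_support_nat[of C]) (simp add: h0)
  have fH': "finite {i. ?H u i \<noteq> 0}" for u
    by (rule finite_support_nat[of C]) (simp add: h0)
  have fA2: "finite {u. Sum_any (\<lambda>i. ?A u i) \<noteq> 0}"
    by (rule finite_support_nat[of "nat N'"], rule Sum_any_zero, rule A0')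
  have fH2: "finite {u. ((-1) powi q) *\<^sub>C Sum_any (?H u) \<noteq> 0}"
    by (rule finite_support_nat[of C]) (simp add: h0)
  have lhs_u: "((-1) powi (int j + int u + 1)) *\<^sub>C divpow T u (YW (Y a q b) (int j + int u) s) =
      - ((-1) ^ j) *\<^sub>C Sum_any (\<lambda>i. ?A u i) + ((-1) ^ j) *\<^sub>C ((-1) powi q) *\<^sub>C Sum_any (\<lambda>i. ?H u i)" for u
  proof -
    let ?t = "\<lambda>i. ((-1) ^ i * (of_int q gchoose i)) *\<^sub>C
      (YW a (q - int i) (YW b (int j + int u + int i) s) -
       ((-1) powi q) *\<^sub>C YW b (q + (int j + int u) - int i) (YW a (int i) s))"
    have ft: "finite {i. ?t i \<noteq> 0}"
      by (rule finite_support_nat[of "nat N + nat N'"]) (simp add: N N' YW)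
    have "((-1) powi (int j + int u + 1)) *\<^sub>C divpow T u (YW (Y a q b) (int j + int u) s) =
      Sum_any (\<lambda>i. ((-1) powi (int j + int u + 1)) *\<^sub>C divpow T u (?t i))"
      unfolding jacobi_iterate[OF Y YW YW YW jac]
      by (rule clinear_Sum_any[OF clinear_compose[OF _ dl] ft])
        (auto intro: clinearI simp: scaleC_simps mult.commute)
    also have "\<dots> = Sum_any (\<lambda>i. (- ((-1) ^ j)) *\<^sub>C ?A u i - (- ((-1) ^ j * ((-1) powi q))) *\<^sub>C ?H u i)"
    proof (rule Sum_any.cong)
      fix i
      have s: "((-1) powi (int j + int u + 1) * (-1) ^ i :: complex) = - ((-1) ^ j) * (-1) ^ (u + i)"
        by (simp add: power_int_add power_add)
      have e: "q + (int j + int u) - int i = q + int j + int u - int i" by simp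
      show "((-1) powi (int j + int u + 1)) *\<^sub>C divpow T u (?t i) =
        (- ((-1) ^ j)) *\<^sub>C ?A u i - (- ((-1) ^ j * ((-1) powi q))) *\<^sub>C ?H u i"
        unfolding clinear_scale[OF dl] clinear_diff[OF dl] scaleC_scaleC mult.assoc[symmetric] s
          cvec.scale_right_diff_distrib h_def e
        by (simp add: mult_ac)
    qed
    also have "\<dots> = Sum_any (\<lambda>i. (- ((-1) ^ j)) *\<^sub>C ?A u i) - Sum_any (\<lambda>i. (- ((-1) ^ j * ((-1) powi q))) *\<^sub>C ?H u i)"
      by (rule Sum_any_diff[OF _ fH]) (rule finite_subset[OF _ fA[of u]], auto)
    also have "\<dots> = (- ((-1) ^ j)) *\<^sub>C Sum_any (?A u) - (- ((-1) ^ j * ((-1) powi q))) *\<^sub>C Sum_any (?H u)"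
      by (simp only: Sum_any_scale[OF fA] Sum_any_scale[OF fH'])
    finally show ?thesis by (simp add: scaleC_scaleC)
  qed
  have "skew T YW s (int j) (Y a q b) =
    Sum_any (\<lambda>u. - ((-1) ^ j) *\<^sub>C Sum_any (\<lambda>i. ?A u i) + ((-1) ^ j) *\<^sub>C ((-1) powi q) *\<^sub>C Sum_any (\<lambda>i. ?H u i))"
    unfolding skew_def lhs_u ..
  also have "\<dots> = Sum_any (\<lambda>u. - ((-1) ^ j) *\<^sub>C Sum_any (\<lambda>i. ?A u i)) +
      Sum_any (\<lambda>u. ((-1) ^ j) *\<^sub>C ((-1) powi q) *\<^sub>C Sum_any (\<lambda>i. ?H u i))"
    by (rule Sum_any.distrib) (rule finite_subset[OF _ fA2], force, rule finite_subset[OF _ fH2], force)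
  also have "\<dots> = - ((-1) ^ j) *\<^sub>C Sum_any (\<lambda>u. Sum_any (\<lambda>i. ?A u i)) +
      ((-1) ^ j) *\<^sub>C ((-1) powi q) *\<^sub>C Sum_any (\<lambda>u. Sum_any (\<lambda>i. ?H u i))"
  proof -
    have fH3: "finite {u. Sum_any (?H u) \<noteq> 0}"
      by (rule finite_support_nat[of C]) (simp add: h0)
    show ?thesis by (simp only: Sum_any_scale[OF fA2] Sum_any_scale[OF fH2] Sum_any_scale[OF fH3])
  qed
  finally have lhs: "skew T YW s (int j) (Y a q b) =
      - ((-1) ^ j) *\<^sub>C Sum_any (\<lambda>u. Sum_any (\<lambda>i. ?A u i)) +
      ((-1) ^ j) *\<^sub>C ((-1) powi q) *\<^sub>C Sum_any (\<lambda>u. Sum_any (\<lambda>i. ?H u i))" .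
  have A: "- ((-1) ^ j) *\<^sub>C Sum_any (\<lambda>u. Sum_any (\<lambda>i. ?A u i)) = YW a q (skew T YW s (int j) b)"
  proof -
    have "Sum_any (\<lambda>u. Sum_any (\<lambda>i. ?A u i)) =
      Sum_any (\<lambda>u. Sum_any (\<lambda>i. \<Sum>v\<le>u. ((-1) ^ (u + i + v) * (of_int q gchoose i) *
        (of_int (q - int i) gchoose v)) *\<^sub>C g (i + v) (u - v)))"
    proof (intro Sum_any.cong)
      fix u i
      have "?A u i = (\<Sum>v\<le>u. ((-1) ^ (u + i) * (of_int q gchoose i)) *\<^sub>C ((-1) ^ v * (of_int (q - int i) gchoose v)) *\<^sub>C
        YW a (q - int i - int v) (divpow T (u - v) (YW b (int j + int u + int i) s)))"
        by (subst divpow_commute[OF T YW Ta]) (rule cvec.scale_sum_right)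
      also have "\<dots> = (\<Sum>v\<le>u. ((-1) ^ (u + i + v) * (of_int q gchoose i) *
        (of_int (q - int i) gchoose v)) *\<^sub>C g (i + v) (u - v))"
      proof (rule sum.cong[OF refl])
        fix v assume "v \<in> {..u}"
        then have "int j + int (u - v) + int (i + v) = int j + int u + int i"
          "q - int (i + v) = q - int i - int v" by auto
        then show "((-1) ^ (u + i) * (of_int q gchoose i)) *\<^sub>C ((-1) ^ v * (of_int (q - int i) gchoose v)) *\<^sub>C
          YW a (q - int i - int v) (divpow T (u - v) (YW b (int j + int u + int i) s)) =
          ((-1) ^ (u + i + v) * (of_int q gchoose i) * (of_int (q - int i) gchoose v)) *\<^sub>C g (i + v) (u - v)"
          unfolding g_def by (simp only: scaleC_scaleC power_add mult_ac)
      qed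
      finally show "?A u i = (\<Sum>v\<le>u. ((-1) ^ (u + i + v) * (of_int q gchoose i) *
        (of_int (q - int i) gchoose v)) *\<^sub>C g (i + v) (u - v))" .
    qed
    also have "\<dots> = Sum_any (\<lambda>y. ((-1) ^ y) *\<^sub>C g 0 y)"
      by (rule skew_product_sum1[OF g0])
    finally have S: "Sum_any (\<lambda>u. Sum_any (\<lambda>i. ?A u i)) = Sum_any (\<lambda>y. ((-1) ^ y) *\<^sub>C g 0 y)" .
    have fg: "finite {y. ((-1) ^ y) *\<^sub>C g 0 y \<noteq> 0}"
      by (rule finite_support_nat[of C]) (simp add: g0)
    have "YW a q (skew T YW s (int j) b) =
      Sum_any (\<lambda>u. YW a q (((-1) powi (int j + int u + 1)) *\<^sub>C divpow T u (YW b (int j + int u) s)))"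
      unfolding skew_def by (rule clinear_Sum_any[OF modal_clinear(1)[OF YW] finu])
    also have "\<dots> = Sum_any (\<lambda>y. (- ((-1) ^ j)) *\<^sub>C ((-1) ^ y) *\<^sub>C g 0 y)"
      by (rule Sum_any.cong) (simp add: modal_scale[OF YW] modal_minus[OF YW] g_def power_int_add scaleC_scaleC)
    also have "\<dots> = (- ((-1) ^ j)) *\<^sub>C Sum_any (\<lambda>y. ((-1) ^ y) *\<^sub>C g 0 y)"
      by (rule Sum_any_scale[OF fg])
    finally show ?thesis by (simp only: S)
  qed
  have H: "Sum_any (\<lambda>t. (of_nat j gchoose t) *\<^sub>C skew T YW (skew T YW s (int t) a) (q + int j - int t) b) =
      ((-1) ^ j) *\<^sub>C ((-1) powi q) *\<^sub>C Sum_any (\<lambda>u. Sum_any (\<lambda>i. ?H u i))"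
  proof -
    let ?G = "\<lambda>t u y v. ((of_nat j gchoose t) * (-1) ^ (u + y) *
        (of_int (q + int j - int t + int u) gchoose v) * (of_nat (u + (y - v)) gchoose u)) *\<^sub>C
        h (u + (y - v)) (t + y)"
    have G0: "?G t u y v = 0" if "C \<le> t + y" for t u y v
      using h0[of "t + y" "u + (y - v)"] h0 that by simp
    have G0': "?G t u y v = 0" if "C \<le> u" for t u y v
      using h0 that by simp
    have fG1: "finite {y. (\<Sum>v\<le>y. ?G t u y v) \<noteq> 0}" for t u
      by (rule finite_support_nat[of C], rule sum.neutral, rule ballI, rule G0, simp)
    have fG2: "finite {u. Sum_any (\<lambda>y. \<Sum>v\<le>y. ?G t u y v) \<noteq> 0}" for t
      by (rule finite_support_nat[of C], rule Sum_any_zero, rule sum.neutral, rule ballI, rule G0', simp)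
    have fG3: "finite {t. Sum_any (\<lambda>u. Sum_any (\<lambda>y. \<Sum>v\<le>y. ?G t u y v)) \<noteq> 0}"
      by (rule finite_support_nat[of C], rule Sum_any_zero, rule Sum_any_zero, rule sum.neutral, rule ballI, rule G0, simp)
    have inner: "(of_nat j gchoose t) *\<^sub>C ((-1) powi (q + int j - int t + int u + 1)) *\<^sub>C
        divpow T u (YW b (q + int j - int t + int u) (skew T YW s (int t) a)) =
        (((-1) ^ j) * ((-1) powi q)) *\<^sub>C Sum_any (\<lambda>y. \<Sum>v\<le>y. ?G t u y v)" for t u
    proof -
      let ?r = "q + int j - int t + int u"
      let ?f = "\<lambda>w. (of_nat j gchoose t) *\<^sub>C ((-1) powi (?r + 1)) *\<^sub>C divpow T u (YW b ?r w)"
      have cl: "clinear ?f"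
        by (rule clinearI) (simp_all add: modal_add[OF YW] modal_scale[OF YW] clinear_add[OF dl]
          clinear_scale[OF dl] scaleC_simps mult_ac)
      have "?f (skew T YW s (int t) a) = Sum_any (\<lambda>y. ?f (((-1) powi (int t + int y + 1)) *\<^sub>C divpow T y (YW a (int t + int y) s)))"
        unfolding skew_def by (rule clinear_Sum_any[OF cl finu])
      also have "\<dots> = Sum_any (\<lambda>y. (((-1) ^ j) * ((-1) powi q)) *\<^sub>C (\<Sum>v\<le>y. ?G t u y v))"
      proof (rule Sum_any.cong)
        fix y
        have s: "(-1) powi (?r + 1) * (-1) powi (int t + int y + 1) = ((-1) ^ j * (-1) powi q * (-1) ^ (u + y) :: complex)"
          by (simp add: power_int_add power_int_diff power_add)
        have "?f (((-1) powi (int t + int y + 1)) *\<^sub>C divpow T y (YW a (int t + int y) s)) =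
          ((of_nat j gchoose t) * ((-1) powi (?r + 1) * (-1) powi (int t + int y + 1))) *\<^sub>C
            divpow T u (YW b ?r (divpow T y (YW a (int t + int y) s)))"
          by (simp add: modal_scale[OF YW] clinear_scale[OF dl] scaleC_scaleC mult_ac)
        also have "\<dots> = (\<Sum>v\<le>y. ((of_nat j gchoose t) * ((-1) ^ j * (-1) powi q * (-1) ^ (u + y))) *\<^sub>C
            (of_int ?r gchoose v) *\<^sub>C (of_nat (u + (y - v)) gchoose u) *\<^sub>C
            divpow T (u + (y - v)) (YW b (?r - int v) (YW a (int t + int y) s)))"
          unfolding s by (subst commute_divpow[OF T YW Tb])
            (simp only: clinear_sum[OF dl] clinear_scale[OF dl] divpow_divpow[OF T] cvec.scale_sum_right)
        also have "\<dots> = (\<Sum>v\<le>y. (((-1) ^ j) * ((-1) powi q)) *\<^sub>C ?G t u y v)"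
        proof (rule sum.cong[OF refl])
          fix v assume "v \<in> {..y}"
          then have "q + int j + int (u + (y - v)) - int (t + y) = ?r - int v"
            "int (t + y) = int t + int y" by auto
          then show "((of_nat j gchoose t) * ((-1) ^ j * (-1) powi q * (-1) ^ (u + y))) *\<^sub>C
            (of_int ?r gchoose v) *\<^sub>C (of_nat (u + (y - v)) gchoose u) *\<^sub>C
            divpow T (u + (y - v)) (YW b (?r - int v) (YW a (int t + int y) s)) =
            (((-1) ^ j) * ((-1) powi q)) *\<^sub>C ?G t u y v"
            unfolding h_def by (simp only: scaleC_scaleC mult_ac)
        qed
        finally show "?f (((-1) powi (int t + int y + 1)) *\<^sub>C divpow T y (YW a (int t + int y) s)) =
          (((-1) ^ j) * ((-1) powi q)) *\<^sub>C (\<Sum>v\<le>y. ?G t u y v)"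
          by (simp only: cvec.scale_sum_right)
      qed
      also have "\<dots> = (((-1) ^ j) * ((-1) powi q)) *\<^sub>C Sum_any (\<lambda>y. \<Sum>v\<le>y. ?G t u y v)"
        by (rule Sum_any_scale[OF fG1])
      finally show ?thesis .
    qed
    have "Sum_any (\<lambda>t. (of_nat j gchoose t) *\<^sub>C skew T YW (skew T YW s (int t) a) (q + int j - int t) b) =
      Sum_any (\<lambda>t. Sum_any (\<lambda>u. (((-1) ^ j) * ((-1) powi q)) *\<^sub>C Sum_any (\<lambda>y. \<Sum>v\<le>y. ?G t u y v)))"
    proof (rule Sum_any.cong)
      fix t
      show "(of_nat j gchoose t) *\<^sub>C skew T YW (skew T YW s (int t) a) (q + int j - int t) b =
        Sum_any (\<lambda>u. (((-1) ^ j) * ((-1) powi q)) *\<^sub>C Sum_any (\<lambda>y. \<Sum>v\<le>y. ?G t u y v))"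
        unfolding skew_def[of T YW "skew T YW s (int t) a"]
        by (subst Sum_any_scale[OF finu, symmetric]) (simp only: inner)
    qed
    also have "\<dots> = (((-1) ^ j) * ((-1) powi q)) *\<^sub>C Sum_any (\<lambda>t. Sum_any (\<lambda>u. Sum_any (\<lambda>y. \<Sum>v\<le>y. ?G t u y v)))"
      by (simp only: Sum_any_scale[OF fG2] Sum_any_scale[OF fG3])
    also have "\<dots> = (((-1) ^ j) * ((-1) powi q)) *\<^sub>C Sum_any (\<lambda>u. Sum_any (\<lambda>i. ?H u i))"
      by (subst skew_product_sum2[OF h0]) auto
    finally show ?thesis by (simp only: scaleC_scaleC)
  qed
  show ?thesis unfolding lhs A H by (rule add.commute)
qed

section \<open>The logarithmic twist\<close>

lemma expand_diff_scale:
  assumes "trunc2 G"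
  shows "expand_diff (\<lambda>p q. c *\<^sub>C G p q) l m n = c *\<^sub>C expand_diff G l m n"
  unfolding expand_diff_def
  using Sum_any_scale[OF expand_diff_finite[OF assms(1), of "\<lambda>i. of_int l gchoose i" "l + m" n], of c]
  by (simp add: mult_ac)

lemma trunc2_sum:
  assumes "\<And>i. i \<in> I \<Longrightarrow> trunc2 (G i)"
  shows "trunc2 (\<lambda>p q. \<Sum>i\<in>I. (G i p q :: 'a::comm_monoid_add))"
  using assms
proof (induction I rule: infinite_finite_induct)
  case (insert i I)
  then show ?case using trunc2_add[of "G i" "\<lambda>p q. \<Sum>i\<in>I. G i p q"] by simp
qed (simp_all add: trunc2_def)

lemma expand_diff_sum:
  assumes "finite I" "\<And>i. i \<in> I \<Longrightarrow> trunc2 (G i)"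
  shows "expand_diff (\<lambda>p q. \<Sum>i\<in>I. c i *\<^sub>C G i p q) l m n = (\<Sum>i\<in>I. c i *\<^sub>C expand_diff (G i) l m n)"
  using assms
proof (induction I)
  case empty then show ?case by (simp add: expand_diff_def)
next
  case (insert i I)
  have "trunc2 (\<lambda>p q. \<Sum>i\<in>I. c i *\<^sub>C G i p q)"
    by (rule trunc2_sum) (use insert in \<open>auto intro: trunc2_scale\<close>)
  then show ?case
    using insert expand_diff_add[OF trunc2_scale[of "G i" "c i"], of "\<lambda>p q. \<Sum>i\<in>I. c i *\<^sub>C G i p q" l m n]
    by (simp add: expand_diff_scale)
qed

lemma expand_diff_shift:
  "expand_diff (\<lambda>p q. G (p - u) q) l m n = expand_diff G l (m - u) n"
  "expand_diff (\<lambda>p q. G p (q - u)) l m n = expand_diff G l m (n - u)"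
  by (simp_all add: expand_diff_def algebra_simps)

lemma trunc2_shift1: "trunc2 G \<Longrightarrow> trunc2 (\<lambda>p q. G (p - u) q)"
  and trunc2_shift2: "trunc2 G \<Longrightarrow> trunc2 (\<lambda>p q. G p (q - u))"
  using trunc2_shift[of G "- u" 0] trunc2_shift[of G 0 "- u"] by simp_all

lemma Sum_any_nat_offset:
  fixes f :: "nat \<Rightarrow> 'a::comm_monoid_add"
  assumes "\<And>j. j < t \<Longrightarrow> f j = 0" "\<And>j. C \<le> j \<Longrightarrow> f j = 0"
  shows "Sum_any f = Sum_any (\<lambda>u. f (t + u))"
proof -
  have "Sum_any f = sum f {t..<t + C}"
    by (rule Sum_any_eq_sum) (use assms in \<open>auto simp: not_le not_less\<close>)
  also have "\<dots> = (\<Sum>u<C. f (t + u))"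
    using sum.shift_bounds_nat_ivl[of f 0 t C] by (simp add: lessThan_atLeast0 add.commute)
  also have "\<dots> = Sum_any (\<lambda>u. f (t + u))"
    by (rule Sum_any_nat[symmetric]) (use assms in auto)
  finally show ?thesis .
qed

text \<open>The coefficient of s_j z^(-j) in the exponent of Delta(s,z), which is also the
  coefficient of x^j in log(1 + x).\<close>

definition log_coeff :: "nat \<Rightarrow> complex" where
  "log_coeff j = (-1) ^ (j + 1) / of_nat j"

text \<open>
  The coefficient of \<open>z\<^bsup>-n-1\<^esup>\<close> in \<open>J(log-part of \<Delta>(s,z) a, z)\<close>; note that
  \<open>log_coeff 0 = 0\<close>.
\<close>

definition log_term where
  "log_term T YW J s a n x = Sum_any (\<lambda>j::nat. log_coeff j *\<^sub>C J (skew T YW s (int j) a) (n - int j) x)"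

lemma log_coeff_0 [simp]: "log_coeff 0 = 0"
  by (simp add: log_coeff_def)

lemma expand_diff_Pair:
  assumes "trunc2 G" "trunc2 G'"
  shows "expand_diff (\<lambda>p q. (G p q, G' p q)) l m n = (expand_diff G l m n, expand_diff G' l m n)"
proof -
  let ?c = "\<lambda>i. (-1) ^ i * (of_int l gchoose i) :: complex"
  let ?g = "\<lambda>i. ?c i *\<^sub>C (G (l + m - int i) (n + int i), G' (l + m - int i) (n + int i))"
  have f: "finite {i. ?g i \<noteq> 0}"
    by (rule finite_subset[OF _ finite_UnI[OF
        expand_diff_finite[OF assms(1), of "\<lambda>i. of_int l gchoose i" "l + m" n]
        expand_diff_finite[OF assms(2), of "\<lambda>i. of_int l gchoose i" "l + m" n]]])
      (auto simp: scaleC_prod_def zero_prod_def)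
  have "clinear fst" "clinear snd" by (auto intro!: clinearI simp: scaleC_prod_def)
  from this[THEN clinear_Sum_any, OF f] show ?thesis
    unfolding expand_diff_def by (simp add: prod_eq_iff scaleC_prod_def)
qed

lemma expand_sum_Pair:
  assumes "trunc2 (\<lambda>q p. K p q)" "trunc2 (\<lambda>q p. K' p q)"
  shows "expand_sum (\<lambda>p q. (K p q, K' p q)) l m n = (expand_sum K l m n, expand_sum K' l m n)"
proof -
  let ?g = "\<lambda>i. (of_int m gchoose i) *\<^sub>C (K (l + int i) (m + n - int i), K' (l + int i) (m + n - int i))"
  have f: "finite {i. ?g i \<noteq> 0}"
    by (rule finite_subset[OF _ finite_UnI[OF
        expand_sum_finite[OF assms(1), of "\<lambda>i. of_int m gchoose i" l "m + n"]
        expand_sum_finite[OF assms(2), of "\<lambda>i. of_int m gchoose i" l "m + n"]]])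
      (auto simp: scaleC_prod_def zero_prod_def)
  have "clinear fst" "clinear snd" by (auto intro!: clinearI simp: scaleC_prod_def)
  from this[THEN clinear_Sum_any, OF f] show ?thesis
    unfolding expand_sum_def by (simp add: prod_eq_iff scaleC_prod_def)
qed

text \<open>The data of the twist with the extended algebra stripped away: \<open>J\<close> is an
  intertwining operator with integral modes, \<open>T\<close> plays the role of L(-1), and s_j a
  means \<open>skew T YW s j a\<close>. Covariance under \<open>T\<close> and the vanishing of s_0
  are asked on the subalgebra \<open>A\<close>; both conditions are stable under products and will
  be checked on generators.\<close>

locale log_twist =
  fixes A :: "'v::complex_vector set" and Y :: "'v \<Rightarrow> int \<Rightarrow> 'v \<Rightarrow> 'v" and vac :: 'v
    and YW :: "'v \<Rightarrow> int \<Rightarrow> 'w::complex_vector \<Rightarrow> 'w"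
    and YX :: "'v \<Rightarrow> int \<Rightarrow> 'x::complex_vector \<Rightarrow> 'x"
    and YY :: "'v \<Rightarrow> int \<Rightarrow> 'y::complex_vector \<Rightarrow> 'y"
    and J :: "'w \<Rightarrow> int \<Rightarrow> 'x \<Rightarrow> 'y" and T :: "'w \<Rightarrow> 'w" and s :: 'w
  assumes Y: "modal Y"
    and W: "vertex_module UNIV Y vac YW"
    and X: "vertex_module UNIV Y vac YX"
    and YY: "vertex_module UNIV Y vac YY"
    and J: "modal J" "jacobi YW YX YY J"
    and T: "clinear T"
    and JT: "\<And>w n x. J (T w) n x = - of_int n *\<^sub>C J w (n - 1) x"
    and TA: "\<And>a n w. a \<in> A \<Longrightarrow> T (YW a n w) = YW a n (T w) - of_int n *\<^sub>C YW a (n - 1) w"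
    and sA: "\<And>a. a \<in> A \<Longrightarrow> skew T YW s 0 a = 0"
begin

abbreviation "D \<equiv> log_term T YW J s"
abbreviation "S \<equiv> skew T YW s"

lemma W': "modal YW" "jacobi Y YW YW YW" "YW vac n x = (if n = -1 then x else 0)"
  and X': "modal YX" "jacobi Y YX YX YX" "YX vac n x' = (if n = -1 then x' else 0)"
  and YY': "modal YY" "jacobi Y YY YY YY" "YY vac n y = (if n = -1 then y else 0)"
  using W X YY unfolding vertex_module_iff[OF Y] by auto

lemma skew_bound: "\<exists>C. \<forall>j\<ge>C. S (int j) a = 0"
proof -
  obtain N where "\<And>n. N \<le> n \<Longrightarrow> S n a = 0" using skew_trunc[OF W'(1) T] by metis
  then show ?thesis by (intro exI[of _ "nat N"]) simp
qed

lemma log_term_finite: "finite {j::nat. log_coeff j *\<^sub>C J (S (int j) a) (n - int j) x \<noteq> 0}"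
proof -
  obtain C where C: "\<And>j. C \<le> j \<Longrightarrow> S (int j) a = 0" using skew_bound by blast
  show ?thesis by (rule finite_support_nat[of C]) (simp add: C J)
qed

lemma log_term_sum:
  assumes "\<And>j. C \<le> j \<Longrightarrow> S (int j) a = 0"
  shows "D a n x = (\<Sum>j<C. log_coeff j *\<^sub>C J (S (int j) a) (n - int j) x)"
  unfolding log_term_def by (rule Sum_any_nat) (simp add: assms J)

lemma modal_log_term: "modal D"
  unfolding modal_def
proof (intro conjI allI)
  note sc = skew_clinear[OF W'(1) T]
  have sw: "Sum_any (\<lambda>j. log_coeff j *\<^sub>C c *\<^sub>C f j) = c *\<^sub>C Sum_any (\<lambda>j. log_coeff j *\<^sub>C f j)"
    if "finite {j. log_coeff j *\<^sub>C f j \<noteq> 0}" for c and f :: "nat \<Rightarrow> 'y"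
    using Sum_any_scale[OF that, of c] by (simp add: mult.commute)
  show "clinear (D a n)" for a n
    unfolding log_term_def
    by (rule clinearI) (simp_all only: modal_add[OF J(1)] modal_scale[OF J(1)] scaleC_add_right
        Sum_any.distrib[OF log_term_finite log_term_finite] sw[OF log_term_finite])
  show "clinear (\<lambda>a. D a n x)" for n x
    unfolding log_term_def
    by (rule clinearI) (simp_all only: clinear_add[OF sc(2)] clinear_scale[OF sc(2)] modal_add[OF J(1)]
        modal_scale[OF J(1)] scaleC_add_right Sum_any.distrib[OF log_term_finite log_term_finite] sw[OF log_term_finite])
  show "\<exists>N. \<forall>n\<ge>N. D a n x = 0" for a x
  proof -
    obtain C where C: "\<And>j. C \<le> j \<Longrightarrow> S (int j) a = 0" using skew_bound by blast
    have "\<exists>N. \<forall>n\<ge>N. (\<Sum>j<B. log_coeff j *\<^sub>C J (S (int j) a) (n - int j) x) = 0" for B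
    proof (induction B)
      case (Suc B)
      then obtain N where N: "\<forall>n\<ge>N. (\<Sum>j<B. log_coeff j *\<^sub>C J (S (int j) a) (n - int j) x) = 0" by blast
      obtain N' where "\<forall>n\<ge>N'. J (S (int B) a) n x = 0" using modal_trunc[OF J(1)] by blast
      then show ?case
        using N by (intro exI[of _ "max N (N' + int B)"]) simp
    qed simp
    from this[of C] show ?thesis by (simp only: log_term_sum[OF C])
  qed
qed

lemma log_term_vac: "D vac n x = 0"
proof -
  have "S (int j) vac = 0" for j
    unfolding skew_def by (rule Sum_any_zero) (simp add: W' clinear_zero[OF divpow_clinear[OF T]])
  then show ?thesis by (simp add: log_term_def J)
qed

text \<open>Insert the commutator formula for s_j (a_p b). The parts a_p (s_j b) merely shift n by
  j. In the parts (s_t a)_r b, summation over j >= t by \<open>log_vandermonde\<close> restores the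
  single coefficient \<open>log_coeff t\<close> and shifts m by t.\<close>

lemma expand_sum_log_term:
  assumes a: "a \<in> A" and b: "b \<in> A"
    and C1: "\<And>j. C1 \<le> j \<Longrightarrow> S (int j) a = 0" and C2: "\<And>j. C2 \<le> j \<Longrightarrow> S (int j) b = 0"
  shows "expand_sum (\<lambda>p q. D (Y a p b) q x) l m n =
    (\<Sum>t<C1. log_coeff t *\<^sub>C expand_sum (\<lambda>p q. J (skew T YW (S (int t) a) p b) q x) l (m - int t) n) +
    (\<Sum>j<C2. log_coeff j *\<^sub>C expand_sum (\<lambda>p q. J (YW a p (S (int j) b)) q x) l m (n - int j))"
proof -
  let ?K1 = "\<lambda>t p q. J (skew T YW (S (int t) a) p b) q x"
  let ?K2 = "\<lambda>j p q. J (YW a p (S (int j) b)) q x"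
  have "\<exists>P. \<forall>p\<ge>P. skew T YW (S (int t) a) p b = 0" for t by (rule skew_trunc[OF W'(1) T])
  then obtain P1 where P1: "\<And>t p. P1 t \<le> p \<Longrightarrow> skew T YW (S (int t) a) p b = 0" by metis
  have "\<exists>P. \<forall>p\<ge>P. YW a p (S (int j) b) = 0" for j by (rule modal_trunc[OF W'(1)])
  then obtain P2 where P2: "\<And>j p. P2 j \<le> p \<Longrightarrow> YW a p (S (int j) b) = 0" by metis
  define C where "C = C1 + C2 + nat (Max (insert 0 (P1 ` {..<C1})) - l + int C1) +
      nat (Max (insert 0 (P2 ` {..<C2})) - l)"
  have K1_0: "?K1 t p q = 0" if "C1 \<le> t \<or> int C + l - int C1 \<le> p" for t p q
  proof (cases "C1 \<le> t")
    case True then show ?thesis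
      by (simp add: C1 J clinear_zero[OF skew_clinear(1)[OF W'(1) T]])
  next
    case False
    then have "P1 t \<le> Max (insert 0 (P1 ` {..<C1}))" by (intro Max_ge) auto
    moreover have "Max (insert 0 (P1 ` {..<C1})) - l + int C1 \<le> int C"
      using self_le_int_nat[of "Max (insert 0 (P1 ` {..<C1})) - l + int C1"]
      unfolding C_def of_nat_add by linarith
    ultimately have "P1 t \<le> p" using that False by linarith
    then show ?thesis by (simp add: P1 J)
  qed
  have K2_0: "?K2 j p q = 0" if "C2 \<le> j \<or> int C + l \<le> p" for j p q
  proof (cases "C2 \<le> j")
    case True then show ?thesis by (simp add: C2 J W')
  next
    case False
    then have "P2 j \<le> Max (insert 0 (P2 ` {..<C2}))" by (intro Max_ge) auto
    moreover have "Max (insert 0 (P2 ` {..<C2})) - l \<le> int C"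
      using self_le_int_nat[of "Max (insert 0 (P2 ` {..<C2})) - l"]
      unfolding C_def of_nat_add by linarith
    ultimately have "P2 j \<le> p" using that False by linarith
    then show ?thesis by (simp add: P2 J)
  qed
  let ?e = "\<lambda>i j t. ((of_int m gchoose i) * log_coeff j * (of_nat j gchoose t)) *\<^sub>C
      ?K1 t (l + int i + int j - int t) (m + n - int i - int j)"
  let ?f = "\<lambda>i j. ((of_int m gchoose i) * log_coeff j) *\<^sub>C ?K2 j (l + int i) (m + n - int i - int j)"
  have e0: "?e i j t = 0" if "C \<le> i \<or> C \<le> j \<or> C \<le> t \<or> C \<le> i + j" for i j t
  proof -
    have "C1 \<le> t \<or> int C + l - int C1 \<le> l + int i + int j - int t"
      using that by (auto simp: C_def)
    then show ?thesis by (simp only: K1_0 cvec.scale_zero_right)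
  qed
  have f0: "?f i j = 0" if "C \<le> i \<or> C \<le> j" for i j
  proof -
    have "C2 \<le> j \<or> int C + l \<le> l + int i" using that by (auto simp: C_def)
    then show ?thesis by (simp only: K2_0 cvec.scale_zero_right)
  qed
  have fe: "finite {j. Sum_any (?e i j) \<noteq> 0}" for i
    by (rule finite_support_nat[of C], rule Sum_any_zero, rule e0, simp)
  have ff: "finite {j. ?f i j \<noteq> 0}" for i
    by (rule finite_support_nat[of C], rule f0, simp)
  have fe2: "finite {i. Sum_any (\<lambda>j. Sum_any (?e i j)) \<noteq> 0}"
    by (rule finite_support_nat[of C], rule Sum_any_zero, rule Sum_any_zero, rule e0, simp)
  have ff2: "finite {i. Sum_any (?f i) \<noteq> 0}"
    by (rule finite_support_nat[of C], rule Sum_any_zero, rule f0, simp)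
  have inner: "(of_int m gchoose i) *\<^sub>C D (Y a (l + int i) b) (m + n - int i) x =
      Sum_any (\<lambda>j. Sum_any (?e i j)) + Sum_any (?f i)" for i
  proof -
    have "(of_int m gchoose i) *\<^sub>C log_coeff j *\<^sub>C J (S (int j) (Y a (l + int i) b)) (m + n - int i - int j) x =
      Sum_any (?e i j) + ?f i j" for j
    proof -
      let ?r = "m + n - int i - int j"
      have ft: "finite {t::nat. (of_nat j gchoose t) *\<^sub>C skew T YW (S (int t) a) (l + int i + int j - int t) b \<noteq> 0}"
        by (rule finite_support_nat[of C1]) (simp add: C1 clinear_zero[OF skew_clinear(1)[OF W'(1) T]])
      have ft': "finite {t::nat. (of_nat j gchoose t) *\<^sub>C ?K1 t (l + int i + int j - int t) ?r \<noteq> 0}"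
        by (rule finite_support_nat[of C1]) (simp add: K1_0)
      have "J (S (int j) (Y a (l + int i) b)) ?r x =
        J (Sum_any (\<lambda>t. (of_nat j gchoose t) *\<^sub>C skew T YW (S (int t) a) (l + int i + int j - int t) b)) ?r x
        + ?K2 j (l + int i) ?r"
        by (subst skew_product[OF Y W'(1) T W'(2) TA[OF a] TA[OF b]]) (rule modal_add(2)[OF J(1)])
      also have "J (Sum_any (\<lambda>t. (of_nat j gchoose t) *\<^sub>C skew T YW (S (int t) a) (l + int i + int j - int t) b)) ?r x =
        Sum_any (\<lambda>t. (of_nat j gchoose t) *\<^sub>C ?K1 t (l + int i + int j - int t) ?r)"
        by (subst clinear_Sum_any[OF modal_clinear(2)[OF J(1)] ft]) (simp only: modal_scale[OF J(1)])
      finally have J_eq: "J (S (int j) (Y a (l + int i) b)) ?r x =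
        Sum_any (\<lambda>t. (of_nat j gchoose t) *\<^sub>C ?K1 t (l + int i + int j - int t) ?r) + ?K2 j (l + int i) ?r" .
      have "Sum_any (?e i j) = ((of_int m gchoose i) * log_coeff j) *\<^sub>C
        Sum_any (\<lambda>t. (of_nat j gchoose t) *\<^sub>C ?K1 t (l + int i + int j - int t) ?r)"
        by (subst Sum_any_scale[OF ft', symmetric]) (simp only: scaleC_scaleC mult.assoc)
      then show ?thesis by (simp only: J_eq scaleC_add_right scaleC_scaleC)
    qed
    then show ?thesis
      unfolding log_term_def Sum_any_scale[OF log_term_finite, symmetric]
      by (simp only: Sum_any.distrib[OF fe ff])
  qed
  have part1: "Sum_any (\<lambda>i. Sum_any (\<lambda>j. Sum_any (?e i j))) =
      (\<Sum>t<C1. log_coeff t *\<^sub>C expand_sum (?K1 t) l (m - int t) n)"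
  proof -
    have "Sum_any (\<lambda>i. Sum_any (\<lambda>j. Sum_any (\<lambda>t. ?e i j t))) = Sum_any (\<lambda>i. Sum_any (\<lambda>t. Sum_any (\<lambda>j. ?e i j t)))"
      by (rule Sum_any.cong, rule Sum_any_swap_nat[of C], rule e0) auto
    also have "\<dots> = Sum_any (\<lambda>t. Sum_any (\<lambda>i. Sum_any (\<lambda>j. ?e i j t)))"
      by (rule Sum_any_swap_nat[of C], rule Sum_any_zero, rule e0) auto
    also have "\<dots> = Sum_any (\<lambda>t. log_coeff t *\<^sub>C expand_sum (?K1 t) l (m - int t) n)"
    proof (rule Sum_any.cong)
      fix t
      show "Sum_any (\<lambda>i. Sum_any (\<lambda>j. ?e i j t)) = log_coeff t *\<^sub>C expand_sum (?K1 t) l (m - int t) n"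
      \<comment> \<open>The logarithm identity does not cover t = 0: here the hypothesis s_0 a = 0
        is decisive.\<close>
      proof (cases "t = 0")
        case True
        then have "?K1 t p q = 0" for p q
          using sA[OF a] by (simp add: J clinear_zero[OF skew_clinear(1)[OF W'(1) T]])
        then show ?thesis using True by (simp add: expand_sum_def)
      next
        case False
        have fK: "finite {k::nat. c k *\<^sub>C ?K1 t (l + int k) (m - int t + n - int k) \<noteq> 0}" for c
          by (rule finite_support_nat[of C]) (simp add: K1_0)
        have "Sum_any (\<lambda>i. Sum_any (\<lambda>j. ?e i j t)) = Sum_any (\<lambda>i. Sum_any (\<lambda>u. ?e i (t + u) t))"
          by (rule Sum_any.cong, rule Sum_any_nat_offset[of _ _ C])
            (simp add: binomial_gbinomial[symmetric], rule e0, simp)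
        also have "\<dots> = Sum_any (\<lambda>u. Sum_any (\<lambda>i. ?e i (t + u) t))"
          by (rule Sum_any_swap_nat[of C], rule e0) auto
        also have "\<dots> = Sum_any (\<lambda>k. \<Sum>u\<le>k. ?e (k - u) (t + u) t)"
          by (rule Sum_any_triangle[of C], rule e0) auto
        also have "\<dots> = Sum_any (\<lambda>k. log_coeff t *\<^sub>C (of_int (m - int t) gchoose k) *\<^sub>C
            ?K1 t (l + int k) (m - int t + n - int k))"
        proof (rule Sum_any.cong)
          fix k
          have "(\<Sum>u\<le>k. ?e (k - u) (t + u) t) = (\<Sum>u\<le>k. (log_coeff (t + u) * (of_nat (t + u) gchoose t) *
              (of_int m gchoose (k - u))) *\<^sub>C ?K1 t (l + int k) (m - int t + n - int k))"
          proof (rule sum.cong[OF refl])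
            fix u :: nat assume "u \<in> {..k}"
            then have "l + int (k - u) + int (t + u) - int t = l + int k"
              "m + n - int (k - u) - int (t + u) = m - int t + n - int k" by auto
            then show "?e (k - u) (t + u) t = (log_coeff (t + u) * (of_nat (t + u) gchoose t) *
              (of_int m gchoose (k - u))) *\<^sub>C ?K1 t (l + int k) (m - int t + n - int k)"
              by (simp only: mult_ac)
          qed
          also have "\<dots> = (log_coeff t * (of_int (m - int t) gchoose k)) *\<^sub>C ?K1 t (l + int k) (m - int t + n - int k)"
            unfolding cvec.scale_sum_left[symmetric] log_coeff_def
            by (subst log_vandermonde) (use False in simp_all)
          finally show "(\<Sum>u\<le>k. ?e (k - u) (t + u) t) = log_coeff t *\<^sub>C (of_int (m - int t) gchoose k) *\<^sub>C
            ?K1 t (l + int k) (m - int t + n - int k)" by (simp only: scaleC_scaleC)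
        qed
        also have "\<dots> = log_coeff t *\<^sub>C expand_sum (?K1 t) l (m - int t) n"
          unfolding expand_sum_def by (rule Sum_any_scale[OF fK])
        finally show ?thesis .
      qed
    qed
    also have "\<dots> = (\<Sum>t<C1. log_coeff t *\<^sub>C expand_sum (?K1 t) l (m - int t) n)"
      by (rule Sum_any_nat) (simp add: expand_sum_def K1_0)
    finally show ?thesis .
  qed
  have part2: "Sum_any (\<lambda>i. Sum_any (?f i)) = (\<Sum>j<C2. log_coeff j *\<^sub>C expand_sum (?K2 j) l m (n - int j))"
  proof -
    have "Sum_any (\<lambda>i. Sum_any (\<lambda>j. ?f i j)) = Sum_any (\<lambda>j. Sum_any (\<lambda>i. ?f i j))"
      by (rule Sum_any_swap_nat[of C], rule f0)
    also have "\<dots> = Sum_any (\<lambda>j. log_coeff j *\<^sub>C expand_sum (?K2 j) l m (n - int j))"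
    proof (rule Sum_any.cong)
      fix j
      have fK: "finite {i::nat. c i *\<^sub>C ?K2 j (l + int i) (m + (n - int j) - int i) \<noteq> 0}" for c
        by (rule finite_support_nat[of C]) (simp add: K2_0)
      show "Sum_any (\<lambda>i. ?f i j) = log_coeff j *\<^sub>C expand_sum (?K2 j) l m (n - int j)"
        unfolding expand_sum_def Sum_any_scale[OF fK, symmetric]
        by (rule Sum_any.cong) (simp add: scaleC_scaleC mult_ac algebra_simps)
    qed
    also have "\<dots> = (\<Sum>j<C2. log_coeff j *\<^sub>C expand_sum (?K2 j) l m (n - int j))"
      by (rule Sum_any_nat) (simp add: expand_sum_def K2_0)
    finally show ?thesis .
  qed
  have "expand_sum (\<lambda>p q. D (Y a p b) q x) l m n =
      Sum_any (\<lambda>i. Sum_any (\<lambda>j. Sum_any (?e i j)) + Sum_any (?f i))"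
    unfolding expand_sum_def by (simp only: inner)
  also have "\<dots> = Sum_any (\<lambda>i. Sum_any (\<lambda>j. Sum_any (?e i j))) + Sum_any (\<lambda>i. Sum_any (?f i))"
    by (rule Sum_any.distrib[OF fe2 ff2])
  finally show ?thesis by (simp only: part1 part2)
qed

text \<open>The cocycle identity for \<open>D\<close>. It is the sum, weighted by
  \<open>log_coeff\<close>, of the skewed Jacobi identities for s_t a with m - t in place of m and
  of the Jacobi identities for s_j b with n - j in place of n.\<close>

lemma borcherds_log_term:
  assumes a: "a \<in> A" and b: "b \<in> A"
  shows "borcherds (\<lambda>p q. D a p (YX b q x) + YY a p (D b q x))
    (\<lambda>p q. D b p (YX a q x) + YY b p (D a q x)) (\<lambda>p q. D (Y a p b) q x) l m n"
proof -
  obtain C1 where C1: "\<And>j. C1 \<le> j \<Longrightarrow> S (int j) a = 0" using skew_bound by blast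
  obtain C2 where C2: "\<And>j. C2 \<le> j \<Longrightarrow> S (int j) b = 0" using skew_bound by blast
  have R: "expand_diff (\<lambda>p q. D a p (YX b q x) + YY a p (D b q x)) l m n =
      (\<Sum>t<C. log_coeff t *\<^sub>C expand_diff (\<lambda>p q. J (S (int t) a) p (YX b q x)) l (m - int t) n) +
      (\<Sum>j<C'. log_coeff j *\<^sub>C expand_diff (\<lambda>p q. YY a p (J (S (int j) b) q x)) l m (n - int j))"
    if C: "\<And>j. C \<le> j \<Longrightarrow> S (int j) a = 0" and C': "\<And>j. C' \<le> j \<Longrightarrow> S (int j) b = 0"
    for a b C C' m n
  proof -
    note t1 = trunc2_shift1[OF trunc2_product[OF J(1) X'(1)]]
    note t2 = trunc2_shift2[OF trunc2_product[OF YY'(1) J(1)]]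
    have "expand_diff (\<lambda>p q. D a p (YX b q x) + YY a p (D b q x)) l m n =
      expand_diff (\<lambda>p q. D a p (YX b q x)) l m n + expand_diff (\<lambda>p q. YY a p (D b q x)) l m n"
      by (rule expand_diff_add[OF trunc2_product[OF modal_log_term X'(1)] trunc2_product[OF YY'(1) modal_log_term]])
    also have "expand_diff (\<lambda>p q. D a p (YX b q x)) l m n =
      expand_diff (\<lambda>p q. \<Sum>t<C. log_coeff t *\<^sub>C J (S (int t) a) (p - int t) (YX b q x)) l m n"
      by (simp only: log_term_sum[OF C])
    also have "\<dots> = (\<Sum>t<C. log_coeff t *\<^sub>C expand_diff (\<lambda>p q. J (S (int t) a) (p - int t) (YX b q x)) l m n)"
      by (rule expand_diff_sum) (simp_all add: t1)
    also have "\<dots> = (\<Sum>t<C. log_coeff t *\<^sub>C expand_diff (\<lambda>p q. J (S (int t) a) p (YX b q x)) l (m - int t) n)"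
      by (simp only: expand_diff_shift(1)[where G = "\<lambda>p q. J w p (YX b q x)" for w])
    also have "expand_diff (\<lambda>p q. YY a p (D b q x)) l m n =
      expand_diff (\<lambda>p q. \<Sum>j<C'. log_coeff j *\<^sub>C YY a p (J (S (int j) b) (q - int j) x)) l m n"
      by (simp only: log_term_sum[OF C'] modal_sum[OF YY'(1)] modal_scale[OF YY'(1)])
    also have "\<dots> = (\<Sum>j<C'. log_coeff j *\<^sub>C expand_diff (\<lambda>p q. YY a p (J (S (int j) b) (q - int j) x)) l m n)"
      by (rule expand_diff_sum) (simp_all add: t2)
    also have "\<dots> = (\<Sum>j<C'. log_coeff j *\<^sub>C expand_diff (\<lambda>p q. YY a p (J (S (int j) b) q x)) l m (n - int j))"
      by (simp only: expand_diff_shift(2)[where G = "\<lambda>p q. YY a p (J w q x)" for w])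
    finally show ?thesis .
  qed
  have b1: "expand_sum (\<lambda>p q. J (skew T YW (S (int t) a) p b) q x) l (m - int t) n =
      expand_diff (\<lambda>p q. J (S (int t) a) p (YX b q x)) l (m - int t) n -
      ((-1) powi l) *\<^sub>C expand_diff (\<lambda>p q. YY b p (J (S (int t) a) q x)) l n (m - int t)" for t
    using skew_borcherds[OF J(1) W'(1) X'(1) YY'(1) T JT J(2)] unfolding borcherds_def by blast
  have b2: "expand_sum (\<lambda>p q. J (YW a p (S (int j) b)) q x) l m (n - int j) =
      expand_diff (\<lambda>p q. YY a p (J (S (int j) b) q x)) l m (n - int j) -
      ((-1) powi l) *\<^sub>C expand_diff (\<lambda>p q. J (S (int j) b) p (YX a q x)) l (n - int j) m" for j
    using J(2) unfolding jacobi_def borcherds_def by blast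
  show ?thesis
    unfolding borcherds_def
    by (simp only: expand_sum_log_term[OF a b C1 C2] R[OF C1 C2] R[OF C2 C1] b1 b2)
      (simp add: cvec.scale_right_diff_distrib sum_subtractf cvec.scale_sum_right scaleC_add_right mult.commute)
qed

text \<open>The action is triangular: its diagonal entries are the two given modules, and the
  off-diagonal entry of the Borcherds identity is the cocycle identity.\<close>

lemma vertex_module_log_twist:
  assumes cl: "\<And>a b. a \<in> A \<Longrightarrow> b \<in> A \<Longrightarrow> a + b \<in> A" "\<And>a c. a \<in> A \<Longrightarrow> c *\<^sub>C a \<in> A"
  shows "vertex_module A Y vac (\<lambda>a n (x, y). (YX a n x, YY a n y + D a n x))"
    (is "vertex_module A Y vac ?Yt")
proof -
  note mD = modal_log_term
  have clin: "clinear (?Yt a n)" for a n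
    by (rule clinearI) (auto simp: modal_add[OF X'(1)] modal_add[OF YY'(1)] modal_add[OF mD]
      modal_scale[OF X'(1)] modal_scale[OF YY'(1)] modal_scale[OF mD] scaleC_prod_def scaleC_add_right)
  have add: "?Yt (a + b) n x = ?Yt a n x + ?Yt b n x" for a b n x
    by (cases x) (simp add: modal_add[OF X'(1)] modal_add[OF YY'(1)] modal_add[OF mD])
  have scl: "?Yt (c *\<^sub>C a) n x = c *\<^sub>C ?Yt a n x" for c a n x
    by (cases x) (simp add: modal_scale[OF X'(1)] modal_scale[OF YY'(1)] modal_scale[OF mD]
      scaleC_prod_def scaleC_add_right)
  have tr: "\<exists>N. \<forall>n\<ge>N. ?Yt a n x = 0" for a x
  proof -
    obtain u v where x: "x = (u, v)" by (cases x)
    obtain N1 N2 N3 where "\<forall>n\<ge>N1. YX a n u = 0" "\<forall>n\<ge>N2. YY a n v = 0" "\<forall>n\<ge>N3. D a n u = 0"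
      using modal_trunc[OF X'(1)] modal_trunc[OF YY'(1)] modal_trunc[OF mD] by metis
    then show ?thesis unfolding x
      by (intro exI[of _ "max N1 (max N2 N3)"]) (simp add: zero_prod_def)
  qed
  have "clinear (\<lambda>a. ?Yt a n x)" for n x by (rule clinearI) (rule add scl)+
  then have mt: "modal ?Yt"
    unfolding modal_def using clin tr by blast
  have vac: "?Yt vac n x = (if n = -1 then x else 0)" for n x
    by (cases x) (simp add: X'(3) YY'(3) log_term_vac zero_prod_def)
  have bor: "borcherds (\<lambda>p q. ?Yt a p (?Yt b q x)) (\<lambda>p q. ?Yt b p (?Yt a q x)) (\<lambda>p q. ?Yt (Y a p b) q x) l m n"
    if ab: "a \<in> A" "b \<in> A" for a b x l m n
  proof -
    obtain u v where x: "x = (u, v)" by (cases x)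
    note t1 = trunc2_product[OF YY'(1) YY'(1)]
    note t2 = trunc2_product[OF mD X'(1)] trunc2_product[OF YY'(1) mD]
    have ed: "expand_diff (\<lambda>p q. ?Yt a p (?Yt b q x)) l m n =
        (expand_diff (\<lambda>p q. YX a p (YX b q u)) l m n,
         expand_diff (\<lambda>p q. YY a p (YY b q v)) l m n + expand_diff (\<lambda>p q. D a p (YX b q u) + YY a p (D b q u)) l m n)"
      for a b l m n
    proof -
      have "expand_diff (\<lambda>p q. ?Yt a p (?Yt b q x)) l m n = expand_diff (\<lambda>p q. (YX a p (YX b q u),
          YY a p (YY b q v) + (D a p (YX b q u) + YY a p (D b q u)))) l m n"
        by (simp add: x modal_add[OF YY'(1)] add_ac)
      also have "\<dots> = (expand_diff (\<lambda>p q. YX a p (YX b q u)) l m n,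
          expand_diff (\<lambda>p q. YY a p (YY b q v) + (D a p (YX b q u) + YY a p (D b q u))) l m n)"
        by (rule expand_diff_Pair[OF trunc2_product[OF X'(1) X'(1)] trunc2_add[OF t1 trunc2_add[OF t2]]])
      finally show ?thesis by (simp only: expand_diff_add[OF t1 trunc2_add[OF t2]])
    qed
    have es: "expand_sum (\<lambda>p q. ?Yt (Y a p b) q x) l m n =
        (expand_sum (\<lambda>p q. YX (Y a p b) q u) l m n,
         expand_sum (\<lambda>p q. YY (Y a p b) q v) l m n + expand_sum (\<lambda>p q. D (Y a p b) q u) l m n)"
    proof -
      note i = trunc2_iterate[OF Y YY'(1)] trunc2_iterate[OF Y mD]
      show ?thesis unfolding x
        by (simp add: expand_sum_Pair[OF trunc2_iterate[OF Y X'(1)] trunc2_add[OF i]] expand_sum_add[OF i])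
    qed
    have 1: "borcherds (\<lambda>p q. YX a p (YX b q u)) (\<lambda>p q. YX b p (YX a q u)) (\<lambda>p q. YX (Y a p b) q u) l m n"
      using X'(2) by (simp add: jacobi_def)
    have 2: "borcherds (\<lambda>p q. YY a p (YY b q v)) (\<lambda>p q. YY b p (YY a q v)) (\<lambda>p q. YY (Y a p b) q v) l m n"
      using YY'(2) by (simp add: jacobi_def)
    show ?thesis
      using 1 2 borcherds_log_term[OF ab, of u l m n]
      unfolding borcherds_def ed es by (simp add: scaleC_prod_def scaleC_add_right)
  qed
  show ?thesis
    unfolding vertex_module_def
  proof (intro conjI ballI allI)
    fix a b l m n x assume "a \<in> A" "b \<in> A"
    from borcherds_iff_modes[OF trunc2_product[OF mt mt] trunc2_product[OF mt mt], THEN iffD1, OF bor[OF this]]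
    show "Sum_any (\<lambda>i. (of_int m gchoose i) *\<^sub>C ?Yt (Y a (l + int i) b) (m + n - int i) x) =
        Sum_any (\<lambda>i. ((-1) ^ i * (of_int l gchoose i)) *\<^sub>C (?Yt a (l + m - int i) (?Yt b (n + int i) x) -
          ((-1) powi l) *\<^sub>C ?Yt b (l + n - int i) (?Yt a (m + int i) x)))" .
  qed (rule clin add scl tr vac)+
qed

end

section \<open>Nilpotent rank and the twisted action\<close>

lemma eigen_independent:
  assumes T: "clinear T" and "finite A" "\<And>t. t \<in> A \<Longrightarrow> T (f t) = t *\<^sub>C f t" "sum f A = 0" "t \<in> A"
  shows "f t = 0"
  using assms(2-)
proof (induction A arbitrary: f t)
  case (insert a A)
  have "(\<Sum>u\<in>A. (u - a) *\<^sub>C f u) = 0"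
  proof -
    have "(\<Sum>u\<in>A. (u - a) *\<^sub>C f u) = (\<Sum>u\<in>insert a A. u *\<^sub>C f u) - a *\<^sub>C (\<Sum>u\<in>insert a A. f u)"
      using insert.hyps by (simp add: cvec.scale_sum_right sum_subtractf scaleC_simps)
    also have "(\<Sum>u\<in>insert a A. u *\<^sub>C f u) = T (\<Sum>u\<in>insert a A. f u)"
      unfolding clinear_sum[OF T] by (rule sum.cong) (simp_all add: insert.prems(1))
    finally show ?thesis by (simp add: insert.prems(2) clinear_zero[OF T] del: sum.insert)
  qed
  moreover have "T ((u - a) *\<^sub>C f u) = u *\<^sub>C (u - a) *\<^sub>C f u" if "u \<in> A" for u
    using insert.prems(1)[of u] that by (simp add: clinear_scale[OF T] mult.commute)
  ultimately have 0: "(u - a) *\<^sub>C f u = 0" if "u \<in> A" for u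
    using insert.IH[of "\<lambda>u. (u - a) *\<^sub>C f u" u] that by blast
  have A: "f u = 0" if "u \<in> A" for u using 0[OF that] that insert.hyps by auto
  then have "f a = 0" using insert.prems(2) insert.hyps by (simp add: sum.neutral)
  then show ?case using A insert.prems(3) by auto
qed simp

lemma Sum_any_lookup: "Sum_any (Poly_Mapping.lookup f) = (\<Sum>t\<in>Poly_Mapping.keys f. Poly_Mapping.lookup f t)"
  by (rule Sum_any_eq_sum) (simp_all add: in_keys_iff)

lemma Sum_any_lookup_superset:
  "finite A \<Longrightarrow> Poly_Mapping.keys f \<subseteq> A \<Longrightarrow> Sum_any (Poly_Mapping.lookup f) = (\<Sum>t\<in>A. Poly_Mapping.lookup f t)"
  by (rule Sum_any_eq_sum) (auto simp: in_keys_iff)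

lemma eigen_decomp_unique:
  assumes T: "clinear T" and f: "eigen_decomp T x f" and g: "eigen_decomp T x g"
  shows "f = g"
proof (rule poly_mapping_eqI)
  fix t
  let ?A = "insert t (Poly_Mapping.keys f \<union> Poly_Mapping.keys g)"
  have "Poly_Mapping.lookup f t - Poly_Mapping.lookup g t = 0"
  proof (rule eigen_independent[OF T, of ?A "\<lambda>t. Poly_Mapping.lookup f t - Poly_Mapping.lookup g t"])
    show "(\<Sum>t\<in>?A. Poly_Mapping.lookup f t - Poly_Mapping.lookup g t) = 0"
      unfolding sum_subtractf
      using f g Sum_any_lookup_superset[of ?A f] Sum_any_lookup_superset[of ?A g]
      by (simp add: eigen_decomp_def subset_insertI2)
  qed (use f g in \<open>auto simp: eigen_decomp_def clinear_diff[OF T] scaleC_simps\<close>)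
  then show "Poly_Mapping.lookup f t = Poly_Mapping.lookup g t" by simp
qed

lemma eigen_decomp_single: "T x = t *\<^sub>C x \<Longrightarrow> clinear T \<Longrightarrow> eigen_decomp T x (Poly_Mapping.single t x)"
  unfolding eigen_decomp_def
  by (auto simp: lookup_single when_def clinear_zero intro: Sum_any_single[symmetric])

lemma eigen_decomp_add:
  assumes "clinear T" "eigen_decomp T x f" "eigen_decomp T y g"
  shows "eigen_decomp T (x + y) (f + g)"
  unfolding eigen_decomp_def
proof (intro conjI allI)
  show "T (Poly_Mapping.lookup (f + g) t) = t *\<^sub>C Poly_Mapping.lookup (f + g) t" for t
    using assms by (simp add: lookup_add clinear_add scaleC_add_right eigen_decomp_def)
  have "finite {t. Poly_Mapping.lookup f t \<noteq> 0}" "finite {t. Poly_Mapping.lookup g t \<noteq> 0}"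
    by (simp_all add: in_keys_iff[symmetric])
  then show "x + y = Sum_any (Poly_Mapping.lookup (f + g))"
    using assms by (simp add: lookup_add[abs_def] Sum_any.distrib eigen_decomp_def)
qed

lemma acts_semisimplyI:
  assumes T: "clinear T" and gen: "\<And>x. x \<in> cvec.span {x. \<exists>t. T x = t *\<^sub>C x}"
  shows "acts_semisimply T"
proof -
  have "\<exists>f. eigen_decomp T x f" for x
    using gen[of x]
  proof (induction x rule: cvec.span_induct_alt)
    case base show ?case
      by (rule exI[of _ 0]) (simp add: eigen_decomp_def clinear_zero[OF T])
  next
    case (step c x y)
    then obtain t g where t: "T x = t *\<^sub>C x" and g: "eigen_decomp T y g" by auto
    have "T (c *\<^sub>C x) = t *\<^sub>C (c *\<^sub>C x)" by (simp add: clinear_scale[OF T] t mult.commute)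
    from eigen_decomp_add[OF T eigen_decomp_single[OF this T] g] show ?case by blast
  qed
  then show ?thesis
    unfolding acts_semisimply_def using eigen_decomp_unique[OF T] by blast
qed

text \<open>Eigenspace decompositions are unique for every linear \<open>T\<close>, so the definite
  description is determined on the kernel even when \<open>T\<close> is not semisimple. This matters
  for s_0, which squares to zero on the extended space.\<close>

lemma eigen_component_kernel:
  assumes "clinear T" "T x = 0"
  shows "eigen_component T t x = (if t = 0 then x else 0)"
proof -
  have "eigen_decomp T x (Poly_Mapping.single 0 x)"
    by (rule eigen_decomp_single) (simp_all add: assms)
  then have "(THE f. eigen_decomp T x f) = Poly_Mapping.single 0 x"
    using eigen_decomp_unique[OF assms(1)] by blast
  then show ?thesis by (simp add: eigen_component_def lookup_single when_def)
qed

text \<open>\<open>M = L + N - t\<close> preserves the eigenspaces of \<open>L\<close>, so a power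
  of it that kills x kills every \<open>L\<close>-component of x. On the component for u \<noteq> t
  it is (u - t) + N with N^2 = 0, hence injective. The case N = 0 is reused for
  non-splitting.\<close>

lemma gen_eigenspace_semisimple_plus_nilpotent:
  assumes L: "clinear L" and N: "clinear N" and ss: "acts_semisimply L"
    and comm: "\<And>x. N (L x) = L (N x)" and nil: "\<And>x. N (N x) = 0"
  shows "x \<in> gen_eigenspace (\<lambda>x. L x + N x) t \<longleftrightarrow> L x = t *\<^sub>C x"
proof
  assume x: "L x = t *\<^sub>C x"
  have "((\<lambda>y. L y + N y - t *\<^sub>C y) ^^ 2) x = 0"
    using x comm[of x] by (simp add: numeral_2_eq_2 nil clinear_scale[OF N])
  then show "x \<in> gen_eigenspace (\<lambda>x. L x + N x) t"
    unfolding gen_eigenspace_def by blast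
next
  assume "x \<in> gen_eigenspace (\<lambda>x. L x + N x) t"
  define M where "M = (\<lambda>y. L y + N y - t *\<^sub>C y)"
  obtain n where n: "(M ^^ n) x = 0"
    using \<open>x \<in> _\<close> unfolding gen_eigenspace_def M_def by blast
  obtain f where f: "eigen_decomp L x f" using ss unfolding acts_semisimply_def by blast
  let ?f = "Poly_Mapping.lookup f"
  have M: "clinear M"
    unfolding M_def by (rule clinearI)
      (simp_all add: clinear_add[OF L] clinear_add[OF N] clinear_scale[OF L] clinear_scale[OF N] scaleC_simps mult.commute)
  have LM: "L y = u *\<^sub>C y \<Longrightarrow> L (M y) = u *\<^sub>C M y" for u y
    unfolding M_def
    by (simp add: clinear_add[OF L] clinear_diff[OF L] clinear_scale[OF L] comm[symmetric]
        clinear_scale[OF N] scaleC_simps mult.commute)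
  have LMn: "L y = u *\<^sub>C y \<Longrightarrow> L ((M ^^ n) y) = u *\<^sub>C (M ^^ n) y" for u y n
    by (induction n) (auto simp: LM)
  have inj: "y = 0" if "L y = u *\<^sub>C y" "u \<noteq> t" "M y = 0" for u y
  proof -
    have "u *\<^sub>C y + N y - t *\<^sub>C y = 0" using that by (simp add: M_def)
    then have 1: "(u - t) *\<^sub>C y + N y = 0" by (simp add: algebra_simps)
    have "N ((u - t) *\<^sub>C y + N y) = N 0" by (simp only: 1)
    then have "N y = 0" using that(2) by (simp add: clinear_add[OF N] clinear_scale[OF N] nil clinear_zero[OF N])
    then show "y = 0" using 1 that(2) by simp
  qed
  have injn: "L y = u *\<^sub>C y \<Longrightarrow> u \<noteq> t \<Longrightarrow> (M ^^ n) y = 0 \<Longrightarrow> y = 0" for u y n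
    by (induction n) (auto intro: inj LMn)
  have fu: "L (?f u) = u *\<^sub>C ?f u" for u using f by (simp add: eigen_decomp_def)
  have xs: "x = (\<Sum>u\<in>Poly_Mapping.keys f. ?f u)"
    using f by (simp add: eigen_decomp_def Sum_any_lookup)
  have "(\<Sum>u\<in>Poly_Mapping.keys f. (M ^^ n) (?f u)) = 0"
    using n xs by (metis clinear_sum[OF clinear_funpow[OF M]])
  then have "(M ^^ n) (?f u) = 0" if "u \<in> Poly_Mapping.keys f" for u
    using eigen_independent[OF L _ _ _ that, of "\<lambda>u. (M ^^ n) (?f u)"] LMn[OF fu] by simp
  then have "?f u = 0" if "u \<in> Poly_Mapping.keys f" "u \<noteq> t" for u
    using injn[OF fu that(2)] that(1) by blast
  then have "Poly_Mapping.keys f \<subseteq> {t}" by (auto simp: in_keys_iff)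
  then have "x = ?f t" using xs Sum_any_lookup_superset[of "{t}" f] by (simp add: Sum_any_lookup)
  then show "L x = t *\<^sub>C x" using fu[of t] by simp
qed

text \<open>Generalised eigenvectors of L + N are eigenvectors of L, so the description inside
  \<open>semisimple_part\<close> selects the L-decomposition; the semisimple part is L and the
  nilpotent part is N.\<close>

lemma nilpotent_rank_two:
  assumes L: "clinear L" and N: "clinear N" and ss: "acts_semisimply L"
    and comm: "\<And>x. N (L x) = L (N x)" and nil: "\<And>x. N (N x) = 0" and nz: "N z \<noteq> 0"
  shows "sum_of_gen_eigenspaces (\<lambda>x. L x + N x)" "nilpotent_rank (\<lambda>x. L x + N x) 2"
proof -
  let ?T = "\<lambda>x. L x + N x"
  have ge: "gen_eigen_decomp ?T x f \<longleftrightarrow> eigen_decomp L x f" for x f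
    unfolding gen_eigen_decomp_def eigen_decomp_def
      gen_eigenspace_semisimple_plus_nilpotent[OF L N ss comm nil] ..
  show "sum_of_gen_eigenspaces ?T"
    using ss by (simp add: sum_of_gen_eigenspaces_def acts_semisimply_def ge)
  have sp: "semisimple_part ?T x = L x" for x
  proof -
    define f where "f = (THE f. eigen_decomp L x f)"
    have f: "eigen_decomp L x f"
      unfolding f_def by (rule theI') (use ss in \<open>simp add: acts_semisimply_def\<close>)
    have fin: "finite {t. Poly_Mapping.lookup f t \<noteq> 0}" by (simp add: in_keys_iff[symmetric])
    have "semisimple_part ?T x = Sum_any (\<lambda>t. L (Poly_Mapping.lookup f t))"
      unfolding semisimple_part_def ge f_def[symmetric] using f by (simp add: eigen_decomp_def)
    also have "\<dots> = L (Sum_any (Poly_Mapping.lookup f))"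
      by (rule clinear_Sum_any[OF L fin, symmetric])
    also have "\<dots> = L x" using f by (simp add: eigen_decomp_def)
    finally show ?thesis .
  qed
  show "nilpotent_rank ?T 2"
    unfolding nilpotent_rank_def Let_def sp
    using nil nz by (auto simp: numeral_2_eq_2)
qed

section \<open>Delta(s,z) on the extended algebra\<close>

context log_twist
begin

context
  fixes conf :: 'v and I :: "'w \<Rightarrow> complex \<Rightarrow> 'x \<Rightarrow> 'y"
  assumes conf: "T = YW conf 0"
    and IJ: "\<And>w n x. I w (of_int n) x = J w n x"
begin

abbreviation "YV \<equiv> extended_vertex_operator conf Y YW"

lemma extended_left_zero: "YV (0, w) n (v, w') = (0, skew T YW w n v)"
  unfolding extended_vertex_operator_def skew_def divpow_def conf[symmetric]
  by (simp add: Y W')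

text \<open>Every mode of \<open>(0, s)\<close> maps into the second summand and kills that summand.
  Products of two such modes are therefore zero, and only the terms q = 0 and q = 1 of the
  exponential remain.\<close>

lemma exp_coeff_extended:
  "exp_coeff (\<lambda>n v. ((-1) ^ n / (- of_nat n)) *\<^sub>C YV (0, s) (int n) v) j (a, 0) =
    (if j = 0 then (a, 0) else (0, log_coeff j *\<^sub>C S (int j) a))"
proof -
  define B where "B = (\<lambda>n v. ((-1) ^ n / (- of_nat n)) *\<^sub>C YV (0, s) (int n) v)"
  have A: "B n (v, w) = (0, log_coeff n *\<^sub>C S (int n) v)" for n v w
    by (simp add: B_def extended_left_zero scaleC_prod_def log_coeff_def)
  have S0: "S n 0 = 0" for n by (rule clinear_zero[OF skew_clinear(2)[OF W'(1) T]])
  have B0: "B n 0 = 0" for n using A[of n 0 0] by (simp add: S0 zero_prod_def)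
  have p1: "pow_coeff B 1 j (a, 0) = (if j = 0 then 0 else B j (a, 0))" for j
  proof -
    have "pow_coeff B 1 j (a, 0) = (\<Sum>i=1..j. if i = j then B i (a, 0) else 0)"
      unfolding One_nat_def pow_coeff.simps
      by (rule sum.cong) (auto simp: B0)
    then show ?thesis by (simp add: sum.delta)
  qed
  have p2: "pow_coeff B (Suc (Suc q)) j (a, 0) = 0" for q j
  proof -
    have "fst (pow_coeff B (Suc q) j (a, 0)) = 0" for q j
    proof -
      have "fst (B i x) = 0" for i x by (cases x) (simp only: A fst_conv)
      then show ?thesis by (simp add: fst_sum)
    qed
    moreover have "B i x = 0" if "fst x = 0" for i x
      using that by (cases x) (simp add: A S0 zero_prod_def)
    ultimately show ?thesis unfolding pow_coeff.simps(2)[of _ "Suc q"] by (intro sum.neutral) blast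
  qed
  have "exp_coeff B j (a, 0) = (\<Sum>q\<le>j. if q = 0 then pow_coeff B 0 j (a, 0)
      else if q = 1 then pow_coeff B 1 j (a, 0) else 0)"
    unfolding exp_coeff_def
  proof (rule sum.cong[OF refl])
    fix q
    consider "q = 0" | "q = 1" | q' where "q = Suc (Suc q')" by (metis One_nat_def not0_implies_Suc)
    then show "(1 / fact q) *\<^sub>C pow_coeff B q j (a, 0) = (if q = 0 then pow_coeff B 0 j (a, 0)
      else if q = 1 then pow_coeff B 1 j (a, 0) else 0)"
      by cases (simp_all add: scaleC_one p2 del: pow_coeff.simps)
  qed
  also have "\<dots> = (if j = 0 then (a, 0) else B j (a, 0))"
  proof (cases j)
    case (Suc i)
    have "{..j} = insert 0 (insert 1 {2..j})" using Suc by auto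
    then have "(\<Sum>q\<le>j. if q = 0 then pow_coeff B 0 j (a, 0)
      else if q = 1 then pow_coeff B 1 j (a, 0) else 0) = pow_coeff B 0 j (a, 0) + pow_coeff B 1 j (a, 0)"
      by (simp del: pow_coeff.simps)
    then show ?thesis using Suc p1[of j] by simp
  qed simp
  finally show ?thesis by (simp only: A B_def[symmetric])
qed

text \<open>All terms of the exponential lie in the kernel of s_0, so each has only a 0-component,
  and the term with index j contributes exactly to z^(-j).\<close>

lemma Delta_coeff_extended:
  assumes "a \<in> A"
  shows "Delta_coeff YV (0, s) i (a, 0) =
    (if i = 0 then (a, 0) else if i < 0 then (0, log_coeff (nat (- i)) *\<^sub>C S (- i) a) else 0)"
proof -
  have S0: "S n 0 = 0" for n by (rule clinear_zero[OF skew_clinear(2)[OF W'(1) T]])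
  have cl: "clinear (YV (0, s) 0)"
  proof (rule clinearI)
    fix x y :: "'v \<times> 'w" and c
    show "YV (0, s) 0 (x + y) = YV (0, s) 0 x + YV (0, s) 0 y"
      by (cases x; cases y) (simp add: extended_left_zero clinear_add[OF skew_clinear(2)[OF W'(1) T]])
    show "YV (0, s) 0 (c *\<^sub>C x) = c *\<^sub>C YV (0, s) 0 x"
      by (cases x) (simp add: extended_left_zero scaleC_prod_def clinear_scale[OF skew_clinear(2)[OF W'(1) T]])
  qed
  let ?E = "\<lambda>j. if j = 0 then (a, 0) else (0, log_coeff j *\<^sub>C S (int j) a)"
  have k: "YV (0, s) 0 (?E j) = 0" for j
    using sA[OF assms] by (simp add: extended_left_zero S0 zero_prod_def)
  have "Delta_coeff YV (0, s) i (a, 0) = Sum_any (\<lambda>j::nat. if i + int j = 0 then ?E j else 0)"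
    unfolding Delta_coeff_def exp_coeff_extended
  proof (rule Sum_any.cong)
    fix j :: nat
    have "((of_int (i + int j) :: complex) = 0) = (i + int j = 0)" by (rule of_int_eq_0_iff)
    then show "eigen_component (YV (0, s) 0) (of_int (i + int j)) (?E j) = (if i + int j = 0 then ?E j else 0)"
      using eigen_component_kernel[OF cl k[of j], of "of_int (i + int j)"] by simp
  qed
  also have "\<dots> = (if i \<le> 0 then ?E (nat (- i)) else 0)"
  proof (cases "i \<le> 0")
    case True
    then have "(i + int j = 0) = (j = nat (- i))" for j by auto
    then show ?thesis using True by simp
  next
    case False
    then show ?thesis by simp
  qed
  finally show ?thesis by auto
qed

lemma twisted_operator_extended:
  assumes a: "a \<in> A"
  shows "twisted_operator YV (0, s) (extended_module_operator YX YY I) (a, 0) n =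
    (\<lambda>(x, y). (YX a n x, YY a n y + D a n x))"
proof (rule ext, clarify)
  fix x y
  let ?M = "extended_module_operator YX YY I"
  obtain C where C: "\<And>j. C \<le> j \<Longrightarrow> S (int j) a = 0" using skew_bound by blast
  have M: "?M (v, w) m (x, y) = (YX v m x, YY v m y + J w m x)" for v w m
    by (simp add: extended_module_operator_def IJ)
  let ?f = "\<lambda>i. ?M (Delta_coeff YV (0, s) i (a, 0)) (n + i) (x, y)"
  have f: "?f i = (if i = 0 then (YX a n x, YY a n y) else if i < 0 then
      (0, log_coeff (nat (- i)) *\<^sub>C J (S (- i) a) (n + i) x) else 0)" for i
    unfolding Delta_coeff_extended[OF a]
    using M[of 0 0] by (simp add: M X' YY' J modal_scale[OF J(1)] zero_prod_def)
  have "twisted_operator YV (0, s) ?M (a, 0) n (x, y) = (\<Sum>i\<in>{- int C..0}. ?f i)"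
    unfolding twisted_operator_def
  proof (rule Sum_any_eq_sum)
    fix i assume i: "i \<notin> {- int C..0}"
    then have "i < - int C \<or> 0 < i" by auto
    then show "?f i = 0"
    proof
      assume iC: "i < - int C"
      then have "S (- i) a = 0" using C[of "nat (- i)"] by simp
      moreover have "i < 0" using iC by simp
      ultimately show ?thesis by (simp add: f J zero_prod_def)
    qed (simp add: f)
  qed simp
  also have "{- int C..0} = insert 0 ((\<lambda>j. - int (Suc j)) ` {..<C})"
  proof (intro equalityI subsetI)
    fix i assume "i \<in> {- int C..0}"
    then show "i \<in> insert 0 ((\<lambda>j. - int (Suc j)) ` {..<C})"
      by (cases "i = 0") (auto intro!: image_eqI[of _ _ "nat (- i - 1)"])
  qed auto
  also have "(\<Sum>i\<in>insert 0 ((\<lambda>j. - int (Suc j)) ` {..<C}). ?f i) = ?f 0 + (\<Sum>j<C. ?f (- int (Suc j)))"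
    by (subst sum.insert) (auto simp: sum.reindex inj_on_def simp del: of_nat_Suc)
  also have "(\<Sum>j<C. ?f (- int (Suc j))) = (0, \<Sum>j<C. log_coeff (Suc j) *\<^sub>C J (S (int (Suc j)) a) (n - int (Suc j)) x)"
  proof -
    have "?f (- int (Suc j)) = (0, log_coeff (Suc j) *\<^sub>C J (S (int (Suc j)) a) (n - int (Suc j)) x)" for j
    proof -
      have "- int (Suc j) \<noteq> 0" "- int (Suc j) < 0" "nat (- (- int (Suc j))) = Suc j" by auto
      then show ?thesis by (simp only: f if_False if_True minus_minus diff_conv_add_uminus)
    qed
    then show ?thesis by (simp only: prod_eq_iff fst_sum snd_sum fst_conv snd_conv sum.neutral_const)
  qed
  also have "(\<Sum>j<C. log_coeff (Suc j) *\<^sub>C J (S (int (Suc j)) a) (n - int (Suc j)) x) = D a n x"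
    using log_term_sum[of "Suc C" a n x] C by (simp add: sum.lessThan_Suc_shift del: of_nat_Suc sum.lessThan_Suc)
  finally show "twisted_operator YV (0, s) ?M (a, 0) n (x, y) = (YX a n x, YY a n y + D a n x)"
    using f[of 0] by simp
qed

end

end

section \<open>Modules over the lattice vertex algebra\<close>

lemma clinear_lin_ext: "clinear (lin_ext f)"
  unfolding lin_ext_def
  by (rule clinear_keys_sum) (rule clinearI, simp_all add: scaleC_add_left scaleC_complex_def)

lemma lin_ext_single: "lin_ext f (Poly_Mapping.single i c) = c *\<^sub>C f i"
  by (simp add: lin_ext_def)

lemma heis_clinear: "clinear (heis k l lam a n)"
  unfolding heis_def by (rule clinear_lin_ext)

lemma form_simps:
  "form (a + b) c = form a c + form b c" "form a (b + c) = form a b + form a c"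
  "form (t *\<^sub>C a) c = t * form a c" "form a (t *\<^sub>C c) = t * form a c"
  "form (a - b) c = form a c - form b c" "form 0 c = 0" "form a 0 = 0"
  by (simp_all add: form_def scaleC_prod_def scaleC_complex_def algebra_simps)

lemma heis_basis_linear:
  "heis_basis k l lam (a + b) n i = heis_basis k l lam a n i + heis_basis k l lam b n i"
  "heis_basis k l lam (t *\<^sub>C a) n i = t *\<^sub>C heis_basis k l lam a n i"
proof -
  obtain X m where i: "i = (X, m)" by (cases i)
  consider "n < 0" | "n = 0" | "0 < n" by linarith
  then show "heis_basis k l lam (a + b) n i = heis_basis k l lam a n i + heis_basis k l lam b n i"
  proof cases
    case 1 then show ?thesis by (simp add: i single_add)
  next
    case 2 then show ?thesis by (simp add: i single_add form_simps(1))
  next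
    case 3 then show ?thesis
      by (simp add: i single_add form_simps(1) distrib_left distrib_right)
  qed
  consider "n < 0" | "n = 0" | "0 < n" by linarith
  then show "heis_basis k l lam (t *\<^sub>C a) n i = t *\<^sub>C heis_basis k l lam a n i"
  proof cases
    case 1 then show ?thesis
      by (simp add: i scaleC_add_right scaleC_single scaleC_complex_def scaleC_prod_def)
  next
    case 2 then show ?thesis
      by (simp add: i form_simps(3) scaleC_single scaleC_complex_def)
  next
    case 3 then show ?thesis
      by (simp add: i form_simps(3) scaleC_single scaleC_add_right scaleC_complex_def mult.left_commute mult.assoc)
  qed
qed

lemma heis_add: "heis k l lam (a + b) n x = heis k l lam a n x + heis k l lam b n x"
  and heis_scale: "heis k l lam (t *\<^sub>C a) n x = t *\<^sub>C heis k l lam a n x"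
  unfolding heis_def lin_ext_def
  by (simp_all add: heis_basis_linear scaleC_add_right sum.distrib cvec.scale_sum_right mult.commute)

lemma heis_diff: "heis k l lam (a - b) n x = heis k l lam a n x - heis k l lam b n x"
proof -
  have "a - b = a + (-1) *\<^sub>C b" by (simp add: scaleC_prod_def scaleC_complex_def prod_eq_iff)
  then have "heis k l lam (a - b) n x = heis k l lam (a + (-1) *\<^sub>C b) n x" by (rule arg_cong)
  then show ?thesis by (simp only: heis_add heis_scale) simp
qed

lemma heis_exp_pos: "0 < n \<Longrightarrow> heis k l lam a n (basis_exp m) = 0"
  by (simp add: heis_def basis_exp_def lin_ext_single)

lemma heis_exp_zero: "heis k l lam a 0 (basis_exp m) = form a (charge k l lam m) *\<^sub>C basis_exp m"
  by (simp add: heis_def basis_exp_def lin_ext_single scaleC_single scaleC_complex_def scaleC_one)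

lemma charge_zero: "charge k 0 0 m = of_int m *\<^sub>C cvector"
  by (simp add: charge_def)

lemma pow_coeff_killed:
  assumes "\<And>i. 0 < i \<Longrightarrow> A i v = 0" "\<And>i. 0 < i \<Longrightarrow> A i 0 = 0"
  shows "pow_coeff A (Suc q) j v = 0"
proof (induction q arbitrary: j)
  case 0 show ?case by (auto intro!: sum.neutral simp: assms)
next
  case (Suc q) then show ?case by (simp add: assms del: pow_coeff.simps(2) add: pow_coeff.simps(2)[of A "Suc q"])
qed

lemma exp_coeff_killed:
  assumes "\<And>i. 0 < i \<Longrightarrow> A i v = 0" "\<And>i. 0 < i \<Longrightarrow> A i 0 = 0"
  shows "exp_coeff A j v = (if j = 0 then v else 0)"
proof -
  have "exp_coeff A j v = (\<Sum>q\<le>j. if q = 0 then pow_coeff A 0 j v else 0)"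
    unfolding exp_coeff_def
  proof (rule sum.cong[OF refl])
    fix q show "(1 / fact q) *\<^sub>C pow_coeff A q j v = (if q = 0 then pow_coeff A 0 j v else 0)"
      by (cases q) (simp_all only: pow_coeff_killed[of A v, OF assms] fact_0, simp_all add: scaleC_one)
  qed
  then show ?thesis by simp
qed

text \<open>Positive Heisenberg modes vanish on exponentials, so the annihilating half of the vertex
  operator acts as the identity; the zero mode contributes z^(q l), which shifts the index by q
  l.\<close>

lemma lattice_mode_exp:
  "lattice_mode k l lam q n (basis_exp m) =
    (if 0 \<le> - n - 1 - q * l
     then exp_coeff (\<lambda>i v. (1 / of_nat i) *\<^sub>C heis k l lam (of_int q *\<^sub>C cvector) (- int i) v)
       (nat (- n - 1 - q * l)) (basis_exp (m + q))
     else 0)"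
proof -
  let ?neg = "exp_coeff (\<lambda>i v. (1 / of_nat i) *\<^sub>C heis k l lam (of_int q *\<^sub>C cvector) (- int i) v)"
  let ?pos = "exp_coeff (\<lambda>i v. (- 1 / of_nat i) *\<^sub>C heis k l lam (of_int q *\<^sub>C cvector) (int i) v)"
  have neg0: "?neg j 0 = 0" for j
  proof -
    have "pow_coeff (\<lambda>i v. (1 / of_nat i) *\<^sub>C heis k l lam (of_int q *\<^sub>C cvector) (- int i) v) r j 0 = 0" for r j
      by (induction r arbitrary: j) (auto intro!: sum.neutral simp: clinear_zero[OF heis_clinear])
    then show ?thesis by (simp add: exp_coeff_def)
  qed
  have sh: "shift q (basis_exp m) = basis_exp (m + q)"
    by (simp add: shift_def basis_exp_def lin_ext_single scaleC_one)
  have pos: "?pos i (basis_exp (m + q)) = (if i = 0 then basis_exp (m + q) else 0)" for i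
    by (rule exp_coeff_killed) (simp_all add: heis_exp_pos clinear_zero[OF heis_clinear])
  show ?thesis
    unfolding lattice_mode_def Let_def sh pos
    by (subst Sum_any_single[of 0]) (simp_all add: neg0)
qed

locale lattice_ops =
  fixes k :: complex and YPi :: "int \<Rightarrow> complex \<Rightarrow> Pi \<Rightarrow> int \<Rightarrow> Pi \<Rightarrow> Pi"
  assumes ops: "lattice_vertex_operators k YPi"
begin

abbreviation "H \<equiv> heis k"
abbreviation "e0 \<equiv> basis_exp 0"
text \<open>The state a(-1)1. Through it the Heisenberg operators become modes of a vertex operator,
  and the Jacobi identity applies to them.\<close>

definition hv :: "hvec \<Rightarrow> Pi" where "hv a = H 0 0 a (-1) e0"

lemma va: "vertex_algebra (YPi 0 0) e0"
  and vm: "vertex_module UNIV (YPi 0 0) e0 (YPi l lam)"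
  and YPi_heis: "YPi l lam (hv a) n = H l lam a n"
  and YPi_exp: "YPi l lam (basis_exp q) n = lattice_mode k l lam q n"
  using ops unfolding lattice_vertex_operators_def hv_def by blast+

lemma modal0: "modal (YPi 0 0)"
  by (rule vertex_algebra_modal[OF va])

lemma modal: "modal (YPi l lam)" and jac: "jacobi (YPi 0 0) (YPi l lam) (YPi l lam) (YPi l lam)"
  and YPi_vac: "YPi l lam e0 n x = (if n = -1 then x else 0)"
  using vm[of l lam] unfolding vertex_module_iff[OF modal0] by auto

lemma creation: "YPi 0 0 a (-1) e0 = a" "0 \<le> n \<Longrightarrow> YPi 0 0 a n e0 = 0"
  using va unfolding vertex_algebra_def by auto

lemma commutator:
  "YPi l lam a m (YPi l lam b n x) - YPi l lam b n (YPi l lam a m x) =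
    Sum_any (\<lambda>i::nat. (of_int m gchoose i) *\<^sub>C YPi l lam (YPi 0 0 a (int i) b) (m + n - int i) x)"
  by (rule jacobi_commutator[OF modal0 modal modal modal jac])

lemma iterate:
  "YPi l lam (YPi 0 0 a j b) n x = Sum_any (\<lambda>i::nat. ((-1) ^ i * (of_int j gchoose i)) *\<^sub>C
      (YPi l lam a (j - int i) (YPi l lam b (n + int i) x) -
       ((-1) powi j) *\<^sub>C YPi l lam b (j + n - int i) (YPi l lam a (int i) x)))"
  by (rule jacobi_iterate[OF modal0 modal modal modal jac])

lemma heis_hv: "0 \<le> n \<Longrightarrow> H 0 0 a n (hv b) = (if n = 1 then form a b *\<^sub>C e0 else 0)"
proof -
  assume n: "0 \<le> n"
  have hv: "hv b = Poly_Mapping.single ({#(GenC, 0)#}, 0) (fst b) + Poly_Mapping.single ({#(GenD, 0)#}, 0) (snd b)"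
    by (simp add: hv_def heis_def basis_exp_def lin_ext_single scaleC_one)
  have b: "b = fst b *\<^sub>C cvector + snd b *\<^sub>C dvector"
    by (simp add: prod_eq_iff cvector_def dvector_def scaleC_prod_def scaleC_complex_def)
  consider "n = 0" | "n = 1" | "1 < n" using n by linarith
  then show ?thesis
  proof cases
    case 1
    then show ?thesis
      unfolding hv clinear_add[OF heis_clinear] unfolding heis_def lin_ext_single
      by (simp add: charge_zero form_simps)
  next
    case 2
    have "H 0 0 a n (hv b) = Poly_Mapping.single ({#}, 0) (fst b * form a cvector + snd b * form a dvector)"
      unfolding hv clinear_add[OF heis_clinear] unfolding heis_def lin_ext_single
      using 2 by (simp add: scaleC_single scaleC_complex_def single_add)
    also have "fst b * form a cvector + snd b * form a dvector = form a b"
      by (subst (3) b) (simp add: form_simps)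
    finally show ?thesis using 2 by (simp add: basis_exp_def scaleC_single scaleC_complex_def)
  next
    case 3
    then have "nat (n - 1) \<noteq> 0" by simp
    then show ?thesis
      unfolding hv clinear_add[OF heis_clinear] unfolding heis_def lin_ext_single
      using 3 by simp
  qed
qed

lemma heis_commutator:
  "H l lam a m (H l lam b n x) - H l lam b n (H l lam a m x) =
    (if m + n = 0 then (of_int m * form a b) *\<^sub>C x else 0)"
proof -
  have "H l lam a m (H l lam b n x) - H l lam b n (H l lam a m x) =
    Sum_any (\<lambda>i::nat. (of_int m gchoose i) *\<^sub>C YPi l lam (YPi 0 0 (hv a) (int i) (hv b)) (m + n - int i) x)"
    using commutator[of l lam "hv a" m "hv b" n x] by (simp add: YPi_heis)
  also have "\<dots> = (of_int m gchoose 1) *\<^sub>C YPi l lam (YPi 0 0 (hv a) (int 1) (hv b)) (m + n - int 1) x"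
    by (rule Sum_any_single) (simp add: YPi_heis heis_hv modal)
  also have "\<dots> = (if m + n = 0 then (of_int m * form a b) *\<^sub>C x else 0)"
    by (simp add: YPi_heis heis_hv modal_scale[OF modal] YPi_vac scaleC_scaleC)
  finally show ?thesis .
qed

lemma heis_commute_neg: "m < 0 \<Longrightarrow> n < 0 \<Longrightarrow> H l lam a m (H l lam b n x) = H l lam b n (H l lam a m x)"
  using heis_commutator[of l lam a m b n x] by simp

lemma heis_exp_commutator:
  "H l lam a m (YPi l lam (basis_exp q) n x) - YPi l lam (basis_exp q) n (H l lam a m x) =
    (of_int q * form a cvector) *\<^sub>C YPi l lam (basis_exp q) (m + n) x"
proof -
  have "H l lam a m (YPi l lam (basis_exp q) n x) - YPi l lam (basis_exp q) n (H l lam a m x) =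
    Sum_any (\<lambda>i::nat. (of_int m gchoose i) *\<^sub>C YPi l lam (YPi 0 0 (hv a) (int i) (basis_exp q)) (m + n - int i) x)"
    using commutator[of l lam "hv a" m "basis_exp q" n x] by (simp add: YPi_heis)
  also have "\<dots> = (of_int m gchoose 0) *\<^sub>C YPi l lam (YPi 0 0 (hv a) (int 0) (basis_exp q)) (m + n - int 0) x"
    by (rule Sum_any_single) (simp add: YPi_heis heis_exp_pos modal)
  also have "\<dots> = (of_int q * form a cvector) *\<^sub>C YPi l lam (basis_exp q) (m + n) x"
    by (simp add: YPi_heis heis_exp_zero charge_zero form_simps modal_scale[OF modal] scaleC_one)
  finally show ?thesis .
qed

text \<open>For index -1 all coefficients (-1)^i (-1 choose i) equal 1 and -(-1)^(-1) = 1, so the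
  iterate formula becomes the normally ordered product. For index -2 the coefficients are i + 1,
  those of a derivative.\<close>

lemma normal_order:
  "YPi l lam (H 0 0 a (-1) b) n x =
    Sum_any (\<lambda>i::nat. H l lam a (- 1 - int i) (YPi l lam b (n + int i) x) +
      YPi l lam b (n - 1 - int i) (H l lam a (int i) x))"
proof -
  have "(-1) ^ i * (of_int (-1) gchoose i) = (1 :: complex)" for i
    by (subst gbinomial_negated_upper) (simp add: binomial_gbinomial[symmetric])
  moreover have "((-1) powi (-1) :: complex) = -1" by simp
  ultimately show ?thesis
    using iterate[of l lam "hv a" "-1" b n x] by (simp add: YPi_heis scaleC_simps algebra_simps)
qed

lemma normal_order2:
  "YPi l lam (H 0 0 a (-2) b) n x =
    Sum_any (\<lambda>i::nat. of_nat (i + 1) *\<^sub>C (H l lam a (- 2 - int i) (YPi l lam b (n + int i) x) -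
      YPi l lam b (n - 2 - int i) (H l lam a (int i) x)))"
proof -
  have "(-1) ^ i * (of_int (-2) gchoose i) = (of_nat (i + 1) :: complex)" for i
  proof -
    have "(of_nat (Suc i) gchoose i :: complex) = of_nat (Suc i)"
      by (simp only: binomial_gbinomial[symmetric] binomial_Suc_n)
    then have "(1 + of_nat i gchoose i :: complex) = 1 + of_nat i" by simp
    then show ?thesis by (subst gbinomial_negated_upper) (simp add: algebra_simps)
  qed
  moreover have "((-1) powi (-2) :: complex) = 1" by simp
  ultimately show ?thesis
    using iterate[of l lam "hv a" "-2" b n x] by (simp add: YPi_heis scaleC_simps algebra_simps)
qed

lemma exp_modes:
  "YPi l lam (basis_exp q) n (basis_exp m) =
    (if 0 \<le> - n - 1 - q * l
     then exp_coeff (\<lambda>i v. (1 / of_nat i) *\<^sub>C H l lam (of_int q *\<^sub>C cvector) (- int i) v)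
       (nat (- n - 1 - q * l)) (basis_exp (m + q))
     else 0)"
  by (simp add: YPi_exp lattice_mode_exp)

lemma exp_mode_vanish: "- n - 1 - q * l < 0 \<Longrightarrow> YPi l lam (basis_exp q) n (basis_exp m) = 0"
  by (simp add: exp_modes)

lemma exp_mode_0: "- n - 1 - q * l = 0 \<Longrightarrow> YPi l lam (basis_exp q) n (basis_exp m) = basis_exp (m + q)"
  by (simp add: exp_modes exp_coeff_def scaleC_one)

lemma exp_mode_1:
  assumes "- n - 1 - q * l = 1"
  shows "YPi l lam (basis_exp q) n (basis_exp m) = of_int q *\<^sub>C H l lam cvector (-1) (basis_exp (m + q))"
  unfolding exp_modes assms by (simp add: exp_coeff_def heis_scale scaleC_one)

text \<open>The coefficient of z^2 in exp(q c(-1) z + q c(-2) z^2/2).\<close>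

lemma exp_mode_2:
  assumes "- n - 1 - q * l = 2"
  shows "YPi l lam (basis_exp q) n (basis_exp m) =
    (of_int q / 2) *\<^sub>C H l lam cvector (-2) (basis_exp (m + q)) +
    ((of_int q)\<^sup>2 / 2) *\<^sub>C H l lam cvector (-1) (H l lam cvector (-1) (basis_exp (m + q)))"
proof -
  have *: "nat 2 = Suc (Suc 0)" "{1..Suc (Suc 0)} = {1, 2}" by auto
  show ?thesis
    unfolding exp_modes assms *(1) exp_coeff_def sum.atMost_Suc pow_coeff.simps *(2)
    by (simp add: exp_coeff_def heis_scale clinear_scale[OF heis_clinear] clinear_zero[OF heis_clinear]
        scaleC_add_right power2_eq_square)
qed

end

text \<open>The element a_{-2} 1 is the derivative of a, so its modes obey the derivative rule in
  every module. Expressing L(-1)a through it lets covariance be stated inside the algebra.\<close>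

lemma translation_modes:
  assumes Y: "modal Y" and M: "vertex_module UNIV Y vac YM"
  shows "YM (Y a (-2) vac) n x = - of_int n *\<^sub>C YM a (n - 1) x"
proof -
  have M': "modal YM" "jacobi Y YM YM YM" and vac: "\<And>n x. YM vac n x = (if n = -1 then x else 0)"
    using M unfolding vertex_module_iff[OF Y] by auto
  have c: "(-1) ^ i * (of_int (-2) gchoose i) = (of_nat (i + 1) :: complex)" for i
  proof -
    have "(of_nat (Suc i) gchoose i :: complex) = of_nat (Suc i)"
      by (simp only: binomial_gbinomial[symmetric] binomial_Suc_n)
    then have "(1 + of_nat i gchoose i :: complex) = 1 + of_nat i" by simp
    then show ?thesis by (subst gbinomial_negated_upper) (simp add: algebra_simps)
  qed
  let ?t = "\<lambda>i::nat. of_nat (i + 1) *\<^sub>C (YM a (- 2 - int i) (YM vac (n + int i) x) -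
      YM vac (- 2 + n - int i) (YM a (int i) x))"
  have "YM (Y a (-2) vac) n x = Sum_any ?t"
    using jacobi_iterate[OF Y M'(1,1,1,2), of a "-2" vac n x] unfolding c by simp
  also have "\<dots> = - of_int n *\<^sub>C YM a (n - 1) x"
  proof (cases "n < 0")
    case True
    have "Sum_any ?t = ?t (nat (- 1 - n))"
      by (rule Sum_any_single) (use True in \<open>auto simp: vac M'(1)\<close>)
    then show ?thesis using True by (simp add: vac)
  next
    case False
    show ?thesis
    proof (cases "n = 0")
      case True then show ?thesis by (simp add: vac M'(1))
    next
      case n: False
      have "Sum_any ?t = ?t (nat (n - 1))"
        by (rule Sum_any_single) (use False n in \<open>auto simp: vac M'(1)\<close>)
      then show ?thesis using False n by (simp add: vac M'(1))
    qed
  qed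
  finally show ?thesis .
qed

text \<open>Both maps act as derivations on a_n b: \<open>conf\<close> mode 0 by the commutator
  formula, a \<mapsto> a_{-2} 1 by the iterate formula on the vacuum. Hence covariance passes from
  generators to the generated subalgebra.\<close>

lemma translation_closed:
  assumes Y: "modal Y" and M: "vertex_module UNIV Y vac Y"
    and cr: "\<And>a. Y a (-1) vac = a" "\<And>a n. 0 \<le> n \<Longrightarrow> Y a n vac = 0"
    and a: "Y conf 0 a = Y a (-2) vac" and b: "Y conf 0 b = Y b (-2) vac"
  shows "Y conf 0 (Y a n b) = Y (Y a n b) (-2) vac"
proof -
  have jac: "jacobi Y Y Y Y" using M unfolding vertex_module_iff[OF Y] by auto
  have "Y conf 0 (Y a n b) - Y a n (Y conf 0 b) = Y (Y conf 0 a) n b"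
    unfolding jacobi_commutator[OF Y Y Y Y jac]
    by (subst Sum_any_single[of 0]) (simp_all add: gbinomial_0_left scaleC_one)
  then have 1: "Y conf 0 (Y a n b) = - of_int n *\<^sub>C Y a (n - 1) b + Y a n (Y b (-2) vac)"
    by (simp add: a b translation_modes[OF Y M] algebra_simps)
  let ?t = "\<lambda>i::nat. ((-1) ^ i * (of_int n gchoose i)) *\<^sub>C
      (Y a (n - int i) (Y b (- 2 + int i) vac) - ((-1) powi n) *\<^sub>C Y b (n + - 2 - int i) (Y a (int i) vac))"
  have "Y (Y a n b) (-2) vac = Sum_any ?t"
    by (rule jacobi_iterate[OF Y Y Y Y jac])
  also have "\<dots> = sum ?t {..<2}"
    by (rule Sum_any_nat) (simp add: cr(2) Y)
  also have "\<dots> = Y a n (Y b (-2) vac) + - of_int n *\<^sub>C Y a (n - 1) b"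
    by (simp add: numeral_2_eq_2 cr Y scaleC_one)
  finally show ?thesis using 1 by (simp add: add.commute)
qed

lemma translation_commutator:
  assumes Y: "modal Y" and M: "vertex_module UNIV Y vac YM"
    and a: "Y conf 0 a = Y a (-2) vac"
  shows "YM conf 0 (YM a n x) = YM a n (YM conf 0 x) - of_int n *\<^sub>C YM a (n - 1) x"
proof -
  have M': "modal YM" "jacobi Y YM YM YM"
    using M unfolding vertex_module_iff[OF Y] by auto
  have "YM conf 0 (YM a n x) - YM a n (YM conf 0 x) = YM (Y conf 0 a) n x"
    unfolding jacobi_commutator[OF Y M'(1,1,1,2)]
    by (subst Sum_any_single[of 0]) (simp_all add: gbinomial_0_left scaleC_one)
  then show ?thesis by (simp add: a translation_modes[OF Y M] algebra_simps)
qed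

text \<open>The Jacobi identity on the vacuum with m = -1 and n = 0; the creation property leaves a
  single term on the right.\<close>

lemma skew_symmetry:
  assumes Y: "modal Y" and jac: "jacobi Y Y Y Y"
    and cr: "\<And>a. Y a (-1) vac = a" "\<And>a n. 0 \<le> n \<Longrightarrow> Y a n vac = 0"
  shows "Y b l a = - ((-1) powi l) *\<^sub>C Sum_any (\<lambda>i::nat. ((-1) ^ i) *\<^sub>C Y (Y a (l + int i) b) (- 1 - int i) vac)"
proof -
  let ?S = "Sum_any (\<lambda>i::nat. ((-1) ^ i) *\<^sub>C Y (Y a (l + int i) b) (- 1 - int i) vac)"
  have "?S = Sum_any (\<lambda>i::nat. ((-1) ^ i * (of_int l gchoose i)) *\<^sub>C
      (Y a (l + -1 - int i) (Y b (0 + int i) vac) - ((-1) powi l) *\<^sub>C Y b (l + 0 - int i) (Y a (- 1 + int i) vac)))"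
  proof -
    have "(of_int (-1) gchoose i) = ((-1) ^ i :: complex)" for i
      by (subst gbinomial_negated_upper) (simp add: binomial_gbinomial[symmetric])
    then show ?thesis using jacobi_modes[OF Y Y Y Y jac, of "-1" a l b 0 vac] by simp
  qed
  also have "\<dots> = - ((-1) powi l) *\<^sub>C Y b l a"
    by (subst Sum_any_single[of 0]) (simp_all add: cr Y)
  finally show ?thesis by (simp add: scaleC_simps)
qed

section \<open>L(0) and L(-1) on the lattice modules\<close>

definition fock_degree :: "(heis_gen \<times> nat) multiset \<Rightarrow> nat" where
  "fock_degree X = (\<Sum>(g, j)\<in>#X. Suc j)"

lemma fock_degree_add [simp]: "fock_degree (add_mset (g, j) X) = Suc j + fock_degree X"
  and fock_degree_empty [simp]: "fock_degree {#} = 0"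
  by (simp_all add: fock_degree_def)

lemma fock_degree_0_iff: "fock_degree X = 0 \<longleftrightarrow> X = {#}"
  by (cases X) auto

context lattice_ops
begin

abbreviation "conf \<equiv> Pi_conformal k"

text \<open>c and d are isotropic with <c,d> = 2, so a = <d,a>/2 c + <c,a>/2 d. Results for the
  conformal vector, which is written in c and d, are brought back to a general a in this
  way.\<close>

lemma heis_cd: "H l lam a n x = (form dvector a / 2) *\<^sub>C H l lam cvector n x + (form cvector a / 2) *\<^sub>C H l lam dvector n x"
proof -
  have "a = (form dvector a / 2) *\<^sub>C cvector + (form cvector a / 2) *\<^sub>C dvector"
    by (simp add: prod_eq_iff form_def cvector_def dvector_def scaleC_prod_def scaleC_complex_def)
  then show ?thesis by (metis heis_add heis_scale)
qed

lemma conf_modes: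
  "YPi l lam conf n x = (1 / 2) *\<^sub>C Sum_any (\<lambda>i::nat. H l lam cvector (- 1 - int i) (H l lam dvector (n + int i) x) +
      H l lam dvector (n - 1 - int i) (H l lam cvector (int i) x))"
  unfolding Pi_conformal_def hv_def[symmetric] modal_scale[OF modal] normal_order YPi_heis ..

lemma heis_zero: "H l lam a n 0 = 0"
  by (rule clinear_zero[OF heis_clinear])

lemma conf_0_exp: "YPi l lam conf 0 (basis_exp m) = H l lam (charge k l lam m) (-1) (basis_exp m)"
proof -
  have "YPi l lam conf 0 (basis_exp m) = (1 / 2) *\<^sub>C (H l lam cvector (-1) (H l lam dvector 0 (basis_exp m)) +
      H l lam dvector (-1) (H l lam cvector 0 (basis_exp m)))"
    unfolding conf_modes by (subst Sum_any_single[of 0]) (simp_all add: heis_exp_pos heis_zero)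
  also have "\<dots> = H l lam (charge k l lam m) (-1) (basis_exp m)"
    by (subst (3) heis_cd) (simp add: heis_exp_zero clinear_scale[OF heis_clinear] scaleC_add_right)
  finally show ?thesis .
qed

lemma conf_1_exp:
  "YPi l lam conf 1 (basis_exp m) = (form (charge k l lam m) (charge k l lam m) / 2) *\<^sub>C basis_exp m"
proof -
  have "YPi l lam conf 1 (basis_exp m) = (1 / 2) *\<^sub>C H l lam dvector 0 (H l lam cvector 0 (basis_exp m))"
    unfolding conf_modes by (subst Sum_any_single[of 0]) (simp_all add: heis_exp_pos heis_zero)
  also have "\<dots> = (form (charge k l lam m) (charge k l lam m) / 2) *\<^sub>C basis_exp m"
    by (simp add: heis_exp_zero clinear_scale[OF heis_clinear] form_def cvector_def dvector_def scaleC_scaleC)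
  finally show ?thesis .
qed

lemma conf_exp_pos: "2 \<le> n \<Longrightarrow> YPi l lam conf n (basis_exp m) = 0"
proof -
  assume n: "2 \<le> n"
  have "H l lam dvector (n - 1 - int i) (H l lam cvector (int i) (basis_exp m)) = 0" for i
    using n by (cases "i = 0") (simp_all add: heis_exp_zero heis_exp_pos clinear_scale[OF heis_clinear] heis_zero)
  then show ?thesis unfolding conf_modes using n by (simp add: heis_exp_pos heis_zero)
qed

lemma conf_hv: "YPi 0 0 conf 0 (hv a) = H 0 0 a (-2) e0" "YPi 0 0 conf 1 (hv a) = hv a"
proof -
  have s: "H 0 0 b n (t *\<^sub>C x) = t *\<^sub>C H 0 0 b n x" for b n t x by (rule clinear_scale[OF heis_clinear])
  have "YPi 0 0 conf 0 (hv a) = (1 / 2) *\<^sub>C (form dvector a *\<^sub>C H 0 0 cvector (-2) e0 + form cvector a *\<^sub>C H 0 0 dvector (-2) e0)"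
    unfolding conf_modes
    by (subst Sum_any_single[of 1]) (auto simp: heis_hv heis_zero s)
  also have "\<dots> = H 0 0 a (-2) e0"
    by (subst (3) heis_cd) (simp add: scaleC_add_right)
  finally show "YPi 0 0 conf 0 (hv a) = H 0 0 a (-2) e0" .
  have "YPi 0 0 conf 1 (hv a) = (1 / 2) *\<^sub>C (form dvector a *\<^sub>C H 0 0 cvector (-1) e0 + form cvector a *\<^sub>C H 0 0 dvector (-1) e0)"
    unfolding conf_modes
    by (subst Sum_any_nat[of 2]) (auto simp: heis_hv heis_zero s numeral_2_eq_2)
  also have "\<dots> = hv a"
    unfolding hv_def by (subst (3) heis_cd) (simp add: scaleC_add_right)
  finally show "YPi 0 0 conf 1 (hv a) = hv a" .
qed

lemma translation_hv: "YPi 0 0 conf 0 (hv a) = YPi 0 0 (hv a) (-2) e0"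
  by (simp add: conf_hv YPi_heis)

lemma translation_exp: "YPi 0 0 conf 0 (basis_exp q) = YPi 0 0 (basis_exp q) (-2) e0"
  by (subst exp_mode_1) (simp_all add: conf_0_exp charge_zero heis_scale)

lemma conf_0_heis:
  "YPi l lam conf 0 (H l lam a n x) = H l lam a n (YPi l lam conf 0 x) - of_int n *\<^sub>C H l lam a (n - 1) x"
  using translation_commutator[OF modal0 vm translation_hv, of l lam a n x] by (simp add: YPi_heis)

lemma conf_1_heis:
  "YPi l lam conf 1 (H l lam a n x) = H l lam a n (YPi l lam conf 1 x) - of_int n *\<^sub>C H l lam a n x"
proof -
  let ?t = "\<lambda>i::nat. (of_int 1 gchoose i) *\<^sub>C YPi l lam (YPi 0 0 conf (int i) (hv a)) (1 + n - int i) x"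
  have "YPi l lam conf 1 (H l lam a n x) - H l lam a n (YPi l lam conf 1 x) = Sum_any ?t"
    using commutator[of l lam conf 1 "hv a" n x] by (simp add: YPi_heis)
  also have "\<dots> = sum ?t {..<2}"
  proof (rule Sum_any_nat)
    fix i :: nat assume "2 \<le> i"
    then have "(of_int 1 gchoose i :: complex) = 0"
      using binomial_gbinomial[where 'a = complex, of 1 i] by (simp add: binomial_eq_0)
    then show "?t i = 0" by (simp only: cvec.scale_zero_left)
  qed
  also have "\<dots> = - of_int n *\<^sub>C H l lam a n x"
    using translation_modes[OF modal0 vm, of l lam "hv a" "1 + n" x]
    by (simp add: numeral_2_eq_2 conf_hv(2) translation_hv YPi_heis scaleC_simps)
  finally show ?thesis by (simp add: algebra_simps)
qed

lemma single_add_mset: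
  "Poly_Mapping.single (add_mset (g, j) X, m) 1 = H l lam (gen_vec g) (- int (Suc j)) (Poly_Mapping.single (X, m) 1)"
  by (cases g) (simp_all add: heis_def lin_ext_single scaleC_one cvector_def dvector_def)

lemma conf_1_single:
  "YPi l lam conf 1 (Poly_Mapping.single (X, m) 1) =
    (form (charge k l lam m) (charge k l lam m) / 2 + of_nat (fock_degree X)) *\<^sub>C Poly_Mapping.single (X, m) 1"
proof (induction X)
  case empty then show ?case using conf_1_exp[of l lam m] by (simp add: basis_exp_def)
next
  case (add x X)
  obtain g j where x: "x = (g, j)" by (cases x)
  show ?case
    unfolding x single_add_mset[of _ _ _ _ l lam] conf_1_heis add.IH
    by (simp only: clinear_scale[OF heis_clinear]) (simp add: scaleC_add_left algebra_simps)
qed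

lemma heis_0_single:
  "H l lam a 0 (Poly_Mapping.single (X, m) 1) = form a (charge k l lam m) *\<^sub>C Poly_Mapping.single (X, m) 1"
  by (simp add: heis_def lin_ext_single scaleC_one scaleC_single scaleC_complex_def)

text \<open>The leading mode of e^(qc) carries one exponential to any other, and negative Heisenberg
  modes then build every monomial from the exponentials.\<close>

lemma generates:
  assumes U: "cvec.subspace U" "\<And>a n x. x \<in> U \<Longrightarrow> YPi l lam a n x \<in> U" and m0: "basis_exp m0 \<in> U"
  shows "x \<in> U"
proof -
  have e: "basis_exp m \<in> U" for m
    using U(2)[OF m0, of "basis_exp (m - m0)" "- 1 - (m - m0) * l"] by (subst (asm) exp_mode_0) auto
  have s: "Poly_Mapping.single (X, m) 1 \<in> U" for X m
  proof (induction X)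
    case empty then show ?case using e[of m] by (simp add: basis_exp_def)
  next
    case (add x X)
    then show ?case
      by (cases x) (metis U(2) YPi_heis single_add_mset)
  qed
  show ?thesis
  proof (induction x rule: pm_induct)
    case zero show ?case by (rule cvec.subspace_0[OF U(1)])
  next
    case (single i c)
    have "Poly_Mapping.single i c = c *\<^sub>C Poly_Mapping.single i 1" by (simp add: scaleC_single scaleC_complex_def)
    then show ?case using s cvec.subspace_scale[OF U(1)] by (cases i) auto
  next
    case (add x y) then show ?case by (rule cvec.subspace_add[OF U(1)])
  qed
qed

end

section \<open>Irreducible Virasoro modules and leading terms\<close>

lemma span_eigenvectors_decomp:
  assumes T: "clinear T" and "x \<in> cvec.span {x. \<exists>t\<in>S. T x = t *\<^sub>C x}"
  shows "\<exists>f. eigen_decomp T x f \<and> Poly_Mapping.keys f \<subseteq> S"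
  using assms(2)
proof (induction x rule: cvec.span_induct_alt)
  case base show ?case
    by (rule exI[of _ 0]) (simp add: eigen_decomp_def clinear_zero[OF T])
next
  case (step c x y)
  then obtain t g where t: "t \<in> S" "T x = t *\<^sub>C x" and g: "eigen_decomp T y g" "Poly_Mapping.keys g \<subseteq> S"
    by auto
  have "T (c *\<^sub>C x) = t *\<^sub>C (c *\<^sub>C x)" by (simp add: clinear_scale[OF T] t mult.commute)
  from eigen_decomp_add[OF T eigen_decomp_single[OF this T] g(1)]
  have "eigen_decomp T (c *\<^sub>C x + y) (Poly_Mapping.single t (c *\<^sub>C x) + g)" .
  moreover have "Poly_Mapping.keys (Poly_Mapping.single t (c *\<^sub>C x) + g) \<subseteq> S"
    using keys_add[of "Poly_Mapping.single t (c *\<^sub>C x)" g] g(2) t(1) by (auto split: if_splits)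
  ultimately show ?case by blast
qed

lemma eigenvector_in_span:
  assumes T: "clinear T" and "x \<in> cvec.span {x. \<exists>t\<in>S. T x = t *\<^sub>C x}" "T x = s *\<^sub>C x" "x \<noteq> 0"
  shows "s \<in> S"
proof -
  obtain f where f: "eigen_decomp T x f" "Poly_Mapping.keys f \<subseteq> S"
    using span_eigenvectors_decomp[OF assms(1,2)] by blast
  have "f = Poly_Mapping.single s x"
    by (rule eigen_decomp_unique[OF T f(1) eigen_decomp_single[OF assms(3) T]])
  then show ?thesis using f(2) assms(4) by simp
qed

text \<open>Words with their factors in arbitrary order. Each still has an L(0)-weight, and that
  their span is a submodule follows from the bracket alone.\<close>

inductive_set lowering_words :: "(int \<Rightarrow> 'v::complex_vector \<Rightarrow> 'v) \<Rightarrow> 'v \<Rightarrow> 'v set"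
  for L u where
  base: "u \<in> lowering_words L u"
| step: "x \<in> lowering_words L u \<Longrightarrow> n < 0 \<Longrightarrow> L n x \<in> lowering_words L u"

locale virasoro =
  fixes d :: complex and L :: "int \<Rightarrow> 'v::complex_vector \<Rightarrow> 'v"
  assumes rep: "virasoro_rep d L"
begin

lemma lin: "clinear (L n)"
  using rep by (simp add: virasoro_rep_def)

lemma bracket: "L m (L n x) = L n (L m x) + of_int (m - n) *\<^sub>C L (m + n) x +
    (if m + n = 0 then (of_int (m ^ 3 - m) / 12 * d) *\<^sub>C x else 0)"
proof -
  have "L m (L n x) - L n (L m x) = of_int (m - n) *\<^sub>C L (m + n) x +
    (if m + n = 0 then (of_int (m ^ 3 - m) / 12 * d) *\<^sub>C x else 0)"
    using rep unfolding virasoro_rep_def by blast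
  then show ?thesis by (simp add: algebra_simps)
qed

text \<open>By the bracket, any mode is moved past the outermost lowering operator; the induction
  hypothesis for all modes handles what is left, and lowering operators preserve the span by
  construction.\<close>

lemma lowering_words_submodule:
  assumes u: "L 0 u = h *\<^sub>C u" "\<And>n. 0 < n \<Longrightarrow> L n u = 0"
  shows "virasoro_submodule L (cvec.span (lowering_words L u))"
proof -
  let ?U = "cvec.span (lowering_words L u)"
  have closed: "L n y \<in> ?U" if "y \<in> ?U" "\<And>x. x \<in> lowering_words L u \<Longrightarrow> L n x \<in> ?U" for n y
    using that(1)
  proof (induction y rule: cvec.span_induct_alt)
    case base show ?case by (simp add: clinear_zero[OF lin] cvec.span_zero)
  next
    case (step c x y) then show ?case
      by (simp add: clinear_add[OF lin] clinear_scale[OF lin] cvec.span_add cvec.span_scale that(2))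
  qed
  have neg: "L n x \<in> ?U" if "n < 0" "x \<in> lowering_words L u" for n x
    using that by (auto intro: cvec.span_base lowering_words.step)
  have "L m x \<in> ?U" if "x \<in> lowering_words L u" for m x
    using that
  proof (induction arbitrary: m)
    case base
    consider "m < 0" | "m = 0" | "0 < m" by linarith
    then show ?case
      by cases (auto simp: u intro: neg lowering_words.base cvec.span_scale cvec.span_base cvec.span_zero)
  next
    case (step x n)
    have "L n (L m x) \<in> ?U" by (rule closed[OF step.IH neg[OF step.hyps(2)]])
    moreover have "x \<in> ?U" by (rule cvec.span_base[OF step.hyps(1)])
    ultimately show ?case
      by (subst bracket) (auto intro!: cvec.span_add cvec.span_scale step.IH cvec.span_zero)
  qed
  then show ?thesis
    unfolding virasoro_submodule_def using closed by (auto intro: cvec.subspace_span)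
qed

lemma lowering_words_weight:
  assumes u: "L 0 u = h *\<^sub>C u" and x: "x \<in> lowering_words L u"
  shows "x = u \<or> (\<exists>n::nat. 0 < n \<and> L 0 x = (h + of_nat n) *\<^sub>C x)"
proof -
  have "\<exists>n::nat. L 0 x = (h + of_nat n) *\<^sub>C x \<and> (n = 0 \<longrightarrow> x = u)"
    using x
  proof induction
    case base then show ?case by (intro exI[of _ 0]) (simp add: u)
  next
    case (step x n)
    then obtain m where m: "L 0 x = (h + of_nat m) *\<^sub>C x" by blast
    have "L 0 (L n x) = (h + of_nat (m + nat (- n))) *\<^sub>C L n x"
      using step.hyps(2) by (subst bracket) (simp add: m clinear_scale[OF lin] clinear_add[OF lin] scaleC_simps)
    then show ?case using step.hyps(2) by (intro exI[of _ "m + nat (- n)"]) auto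
  qed
  then show ?thesis by auto
qed

lemma span_lowering_words:
  assumes u: "L 0 u = h *\<^sub>C u" and x: "x \<in> cvec.span (lowering_words L u)"
  shows "\<exists>c y. x = c *\<^sub>C u + y \<and> y \<in> cvec.span {x. \<exists>t\<in>{h + of_nat n |n. 0 < n}. L 0 x = t *\<^sub>C x}"
  using x
proof (induction x rule: cvec.span_induct_alt)
  case base show ?case by (rule exI[of _ 0], rule exI[of _ 0]) (simp add: cvec.span_zero)
next
  case (step c x y)
  then obtain c' y' where y: "y = c' *\<^sub>C u + y'"
    "y' \<in> cvec.span {x. \<exists>t\<in>{h + of_nat n |n. 0 < n}. L 0 x = t *\<^sub>C x}" by blast
  from lowering_words_weight[OF u step.hyps(1)] show ?case
  proof
    assume "x = u"
    then have "c *\<^sub>C x + y = (c + c') *\<^sub>C u + y'" by (simp add: y scaleC_add_left)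
    then show ?thesis using y(2) by blast
  next
    assume "\<exists>n::nat. 0 < n \<and> L 0 x = (h + of_nat n) *\<^sub>C x"
    then have "x \<in> cvec.span {x. \<exists>t\<in>{h + of_nat n |n. 0 < n}. L 0 x = t *\<^sub>C x}"
      by (intro cvec.span_base) auto
    then have "c *\<^sub>C x + y' \<in> cvec.span {x. \<exists>t\<in>{h + of_nat n |n. 0 < n}. L 0 x = t *\<^sub>C x}"
      by (intro cvec.span_add cvec.span_scale y(2))
    moreover have "c *\<^sub>C x + y = c' *\<^sub>C u + (c *\<^sub>C x + y')" by (simp add: y)
    ultimately show ?thesis by blast
  qed
qed

end

locale irreducible_virasoro = virasoro d L for d and L :: "int \<Rightarrow> 'v::complex_vector \<Rightarrow> 'v" +
  fixes h :: complex and v :: 'v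
  assumes irr: "irreducible_highest_weight d h L v"
begin

lemma hw: "v \<noteq> 0" "L 0 v = h *\<^sub>C v" "0 < n \<Longrightarrow> L n v = 0"
  and simple: "virasoro_submodule L U \<Longrightarrow> U = {0} \<or> U = UNIV"
  and generated: "virasoro_submodule L U \<Longrightarrow> v \<in> U \<Longrightarrow> U = UNIV"
  using irr unfolding irreducible_highest_weight_def by blast+

lemma decomp: "\<exists>c y. x = c *\<^sub>C v + y \<and> y \<in> cvec.span {x. \<exists>t\<in>{h + of_nat n |n. 0 < n}. L 0 x = t *\<^sub>C x}"
  using span_lowering_words[OF hw(2), of x] generated[OF lowering_words_submodule[OF hw(2,3)]]
  by (auto intro: cvec.span_base lowering_words.base)

lemma span_weight_vectors: "x \<in> cvec.span {x. \<exists>t\<in>{h + of_nat n |n. True}. L 0 x = t *\<^sub>C x}"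
proof -
  obtain c y where x: "x = c *\<^sub>C v + y" and y: "y \<in> cvec.span {x. \<exists>t\<in>{h + of_nat n |n. 0 < n}. L 0 x = t *\<^sub>C x}"
    using decomp by blast
  have "y \<in> cvec.span {x. \<exists>t\<in>{h + of_nat n |n. True}. L 0 x = t *\<^sub>C x}"
    by (rule subsetD[OF cvec.span_mono y]) auto
  moreover have "v \<in> cvec.span {x. \<exists>t\<in>{h + of_nat n |n. True}. L 0 x = t *\<^sub>C x}"
    by (rule cvec.span_base) (auto simp: hw(2) intro!: exI[of _ "h"] exI[of _ "0::nat"])
  ultimately show ?thesis unfolding x by (intro cvec.span_add cvec.span_scale)
qed

text \<open>In an irreducible module u generates v and v generates u. Thus each of the two weights
  exceeds the other by a natural number, so they agree, and the weight space of weight h is the line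
  through v.\<close>

lemma singular_vector:
  assumes u: "u \<noteq> 0" "L 0 u = h' *\<^sub>C u" "\<And>n. 0 < n \<Longrightarrow> L n u = 0"
  shows "h' = h" "\<exists>c. u = c *\<^sub>C v"
proof -
  have "h' \<in> {h + of_nat n |n. True}"
    by (rule eigenvector_in_span[OF lin span_weight_vectors u(2,1)])
  moreover have "cvec.span (lowering_words L u) = UNIV"
    using simple[OF lowering_words_submodule[OF u(2,3)]] u(1) cvec.span_base[OF lowering_words.base[of u L]] by auto
  then obtain c y where vy: "v = c *\<^sub>C u + y" and y: "y \<in> cvec.span {x. \<exists>t\<in>{h' + of_nat n |n. 0 < n}. L 0 x = t *\<^sub>C x}"
    using span_lowering_words[OF u(2), of v] by auto
  have "v \<in> cvec.span {x. \<exists>t\<in>{h' + of_nat n |n. True}. L 0 x = t *\<^sub>C x}"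
  proof -
    have "y \<in> cvec.span {x. \<exists>t\<in>{h' + of_nat n |n. True}. L 0 x = t *\<^sub>C x}"
      by (rule subsetD[OF cvec.span_mono y]) auto
    moreover have "u \<in> cvec.span {x. \<exists>t\<in>{h' + of_nat n |n. True}. L 0 x = t *\<^sub>C x}"
      by (rule cvec.span_base) (auto simp: u(2) intro!: exI[of _ "h'"] exI[of _ "0::nat"])
    ultimately show ?thesis by (subst vy) (intro cvec.span_add cvec.span_scale)
  qed
  then have "h \<in> {h' + of_nat n |n. True}"
    by (rule eigenvector_in_span[OF lin _ hw(2,1)])
  ultimately obtain m n :: nat where mn: "h' = h + of_nat m" "h = h' + of_nat n" by blast
  then have "(of_nat (m + n) :: complex) = 0" by (simp add: algebra_simps)
  then have "m + n = 0" by (simp only: of_nat_eq_0_iff)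
  then show h: "h' = h" using mn by simp
  obtain c y where uy: "u = c *\<^sub>C v + y" and y: "y \<in> cvec.span {x. \<exists>t\<in>{h + of_nat n |n. 0 < n}. L 0 x = t *\<^sub>C x}"
    using decomp by blast
  have "L 0 y = h *\<^sub>C y"
  proof -
    have "y = u - c *\<^sub>C v" using uy by simp
    then show ?thesis using u(2) h by (simp add: clinear_diff[OF lin] clinear_scale[OF lin] hw(2) scaleC_simps mult.commute)
  qed
  then have "y = 0" using eigenvector_in_span[OF lin y, of h] by (auto simp: of_nat_eq_0_iff)
  then show "\<exists>c. u = c *\<^sub>C v" using uy by auto
qed

text \<open>
  With \<open>t = p'/p\<close>, \<open>d\<close> is the central charge \<open>d\<^bsub>p,p'\<^esub>\<close> and \<open>h\<close> is \<open>h\<^bsup>2,1\<^esup>\<close>; the difference of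
  the two sides is a singular vector of weight \<open>h + 2\<close>.
\<close>

lemma null_vector:
  assumes t: "t \<noteq> 0" and h: "h = 3 * t / 4 - 1 / 2" and d: "d = 13 - 6 * t - 6 / t"
  shows "L (-1) (L (-1) v) = t *\<^sub>C L (-2) v"
proof (rule ccontr)
  let ?u = "L (-1) (L (-1) v) - t *\<^sub>C L (-2) v"
  assume "L (-1) (L (-1) v) \<noteq> t *\<^sub>C L (-2) v"
  then have nz: "?u \<noteq> 0" by simp
  note s = clinear_diff[OF lin] clinear_scale[OF lin] clinear_add[OF lin] clinear_zero[OF lin]
  have two: "x + x = 2 *\<^sub>C x" for x :: 'v by (metis one_add_one scaleC_add_left scaleC_one)
  have u0: "L 0 ?u = (h + 2) *\<^sub>C ?u"
    by (simp add: s bracket[of 0] hw scaleC_simps algebra_simps two)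
  have u: "L n ?u = 0" if n: "0 < n" for n
  proof -
    \<comment> \<open>The value of h makes the coefficient for L(1) vanish, and the value of d then
      does so for L(2). For n >= 3 the commutators leave only positive modes on v.\<close>
    consider "n = 1" | "n = 2" | "3 \<le> n" using n by linarith
    then show ?thesis
    proof cases
      case 1
      have "L 1 ?u = (4 * h + 2 - 3 * t) *\<^sub>C L (-1) v"
        by (simp add: s bracket[of 1] bracket[of 0] hw scaleC_simps algebra_simps)
          (simp add: scaleC_add_left[symmetric])
      also have "4 * h + 2 - 3 * t = 0" by (simp add: h)
      finally show ?thesis using 1 by simp
    next
      case 2
      have "L 2 ?u = (6 * h - t * (4 * h + d / 2)) *\<^sub>C v"
        by (simp add: s bracket[of 2] bracket[of 1] bracket[of 0] hw scaleC_simps algebra_simps)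
      also have "6 * h - t * (4 * h + d / 2) = 0" using t by (simp add: h d field_simps)
      finally show ?thesis using 2 by simp
    next
      case 3
      then show ?thesis
        by (simp add: s bracket[of n] bracket[of "n - 1"] hw)
    qed
  qed
  from singular_vector(1)[OF nz u0 u] show False by simp
qed

end

text \<open>Let l be an order of locality of b and w. In the locality relation on x the terms
  containing J w n x drop out, and its leading coefficient expresses J w n (b_q x) through the
  higher modes b_{q+i} x with i > 0. Descending induction on q starts where b_q x = 0.\<close>

lemma kernel_right_closed:
  assumes m: "modal Y1" "modal Y2" "modal Y3" "modal J" and jac: "jacobi Y1 Y2 Y3 J"
    and x: "\<And>n. J w n x = 0"
  shows "J w n (Y2 b q x) = 0"
proof -
  obtain N where N: "\<And>n. N \<le> n \<Longrightarrow> Y1 b n w = 0" using modal_trunc[OF m(1)] by blast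
  define l where "l = nat N"
  obtain Q where Q: "\<And>q. Q \<le> q \<Longrightarrow> Y2 b q x = 0" using modal_trunc[OF m(2)] by blast
  have "\<forall>n. J w n (Y2 b (Q - int j) x) = 0" for j
  proof (induction j rule: less_induct)
    case (less j)
    show ?case
    proof (cases "j = 0")
      case True then show ?thesis by (simp add: Q m(4))
    next
      case False
      show ?thesis
      proof
        fix n
        let ?m = "Q - int j"
        have z: "J w n' (Y2 b (?m + int i) x) = 0" if "0 < i" for i n'
        proof (cases "i \<le> j")
          case True
          then have e: "?m + int i = Q - int (j - i)" by simp
          have "j - i < j" using that False by simp
          from less.IH[OF this] show ?thesis unfolding e by blast
        next
          case False then show ?thesis by (simp add: Q m(4))
        qed
        have "0 = Sum_any (\<lambda>i::nat. ((-1) ^ i * (of_int (int l) gchoose i)) *\<^sub>C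
            (Y3 b (int l + ?m - int i) (J w (n - int l + int i) x) -
             ((-1) powi (int l)) *\<^sub>C J w (int l + (n - int l) - int i) (Y2 b (?m + int i) x)))"
          by (subst jacobi_modes[OF m jac, symmetric]) (simp add: N m(4) l_def)
        also have "\<dots> = - ((-1) powi (int l)) *\<^sub>C J w n (Y2 b ?m x)"
          by (subst Sum_any_single[of 0]) (use z in \<open>simp_all add: x m(3)\<close>)
        finally show "J w n (Y2 b ?m x) = 0" by simp
      qed
    qed
  qed
  from this[of "nat (Q - q)"] show ?thesis by (cases "q \<le> Q") (simp_all add: Q m(4))
qed

lemma kernel_left_closed:
  assumes m: "modal Y1" "modal Y2" "modal Y3" "modal J" and jac: "jacobi Y1 Y2 Y3 J"
    and w: "\<And>n x. J w n x = 0"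
  shows "J (Y1 a l w) n x = 0"
  unfolding jacobi_iterate[OF m jac] by (simp add: w m(3))

text \<open>The vectors annihilated by \<open>J\<close> on the right or on the left form subspaces
  stable under the algebra. A nonzero \<open>J\<close> hence cannot vanish on a pair of generating
  vectors, and truncation provides a last nonzero mode.\<close>

lemma leading_term:
  assumes m: "modal Y1" "modal Y2" "modal Y3" "modal J" and jac: "jacobi Y1 Y2 Y3 J"
    and gw: "\<And>U. cvec.subspace U \<Longrightarrow> (\<And>a n x. x \<in> U \<Longrightarrow> Y1 a n x \<in> U) \<Longrightarrow> w0 \<in> U \<Longrightarrow> U = UNIV"
    and gx: "\<And>U. cvec.subspace U \<Longrightarrow> (\<And>a n x. x \<in> U \<Longrightarrow> Y2 a n x \<in> U) \<Longrightarrow> x0 \<in> U \<Longrightarrow> U = UNIV"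
    and nz: "J w n x \<noteq> 0"
  shows "\<exists>n0. J w0 n0 x0 \<noteq> 0 \<and> (\<forall>n>n0. J w0 n x0 = 0)"
proof -
  have "\<exists>n. J w0 n x0 \<noteq> 0"
  proof (rule ccontr)
    assume "\<not> (\<exists>n. J w0 n x0 \<noteq> 0)"
    then have x0: "x0 \<in> {x. \<forall>n. J w0 n x = 0}" by blast
    have "{x. \<forall>n. J w0 n x = 0} = UNIV"
      by (rule gx[OF _ _ x0]) (auto simp: cvec.subspace_def modal_add[OF m(4)] modal_scale[OF m(4)] m(4)
          intro: kernel_right_closed[OF m jac])
    then have w0: "w0 \<in> {w. \<forall>n x. J w n x = 0}" by blast
    have "{w. \<forall>n x. J w n x = 0} = UNIV"
      by (rule gw[OF _ _ w0]) (auto simp: cvec.subspace_def modal_add[OF m(4)] modal_scale[OF m(4)] m(4)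
          intro: kernel_left_closed[OF m jac])
    then show False using nz by blast
  qed
  then obtain n1 where n1: "J w0 n1 x0 \<noteq> 0" by blast
  obtain N where N: "\<And>n. N \<le> n \<Longrightarrow> J w0 n x0 = 0" using modal_trunc[OF m(4)] by blast
  let ?P = "\<lambda>j::nat. J w0 (N - int j) x0 \<noteq> 0"
  have "?P (nat (N - n1))" using n1 N[of n1] by (cases "n1 \<le> N") auto
  then have l: "?P (LEAST j. ?P j)" by (rule LeastI)
  have "J w0 n x0 = 0" if "N - int (LEAST j. ?P j) < n" for n
  proof (cases "N \<le> n")
    case False
    then have "nat (N - n) < (LEAST j. ?P j)" using that by linarith
    from not_less_Least[OF this] False show ?thesis by simp
  qed (rule N)
  then show ?thesis using l by blast
qed

text \<open>Complex mode indices fall into cosets of Z, and the Jacobi identity relates only indices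
  in one coset. Restriction to t + Z gives an operator with integral modes whose derivative rule
  keeps the shift t.\<close>

lemma intertwining_restrict:
  assumes I: "intertwining_operator conf Y1 Y2 Y3 I" and m: "modal Y1" "modal Y2" "modal Y3"
    and J: "J = (\<lambda>w n x. I w (t + of_int n) x)"
  shows "modal J" "jacobi Y1 Y2 Y3 J" "J (Y1 conf 0 w) n x = - (t + of_int n) *\<^sub>C J w (n - 1) x"
proof -
  show mJ: "modal J"
    unfolding modal_def
  proof (intro conjI allI)
    show "clinear (J w n)" "clinear (\<lambda>w. J w n x)" for w n x
      using I unfolding intertwining_operator_def J by blast+
    fix w x
    obtain N where N: "\<And>t. N \<le> Re t \<Longrightarrow> I w t x = 0"
      using I unfolding intertwining_operator_def by blast
    show "\<exists>N. \<forall>n\<ge>N. J w n x = 0"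
    proof (intro exI allI impI)
      fix n assume "\<lceil>N - Re t\<rceil> \<le> n"
      then have "N - Re t \<le> real_of_int n" by (simp add: ceiling_le_iff)
      then show "J w n x = 0" unfolding J by (intro N) simp
    qed
  qed
  show "jacobi Y1 Y2 Y3 J"
    unfolding jacobi_def borcherds_iff_modes[OF trunc2_product[OF m(3) mJ] trunc2_product[OF mJ m(2)]]
  proof (intro allI)
    fix a w x l m n
    have "Sum_any (\<lambda>i::nat. (of_int m gchoose i) *\<^sub>C
           I (Y1 a (l + int i) w) (of_int m + (t + of_int n) - of_nat i) x) =
        Sum_any (\<lambda>i::nat. ((-1) ^ i * (of_int l gchoose i)) *\<^sub>C
           (Y3 a (l + m - int i) (I w (t + of_int n + of_nat i) x) -
            ((-1) powi l) *\<^sub>C I w (of_int l + (t + of_int n) - of_nat i) (Y2 a (m + int i) x)))"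
      using I unfolding intertwining_operator_def by blast
    then show "Sum_any (\<lambda>i::nat. (of_int m gchoose i) *\<^sub>C J (Y1 a (l + int i) w) (m + n - int i) x) =
        Sum_any (\<lambda>i::nat. ((-1) ^ i * (of_int l gchoose i)) *\<^sub>C
           (Y3 a (l + m - int i) (J w (n + int i) x) -
            ((-1) powi l) *\<^sub>C J w (l + n - int i) (Y2 a (m + int i) x)))"
      unfolding J by (simp add: algebra_simps)
  qed
  have "I (Y1 conf 0 w) (t + of_int n) x = (- (t + of_int n)) *\<^sub>C I w (t + of_int n - 1) x"
    using I unfolding intertwining_operator_def by blast
  then show "J (Y1 conf 0 w) n x = - (t + of_int n) *\<^sub>C J w (n - 1) x"
    unfolding J by (simp add: algebra_simps)
qed

section \<open>The Sugawara vector\<close>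

locale vir_lattice = lattice_ops +
  fixes d :: complex and Y0 :: "'a::complex_vector \<Rightarrow> int \<Rightarrow> 'a \<Rightarrow> 'a" and vac \<omega> :: 'a
  assumes Vir: "virasoro_vertex_algebra d Y0 vac \<omega>" and k_nz: "k + 2 \<noteq> 0"
begin

abbreviation "Y \<equiv> tensor_modes Y0 (YPi 0 0)"
abbreviation "one \<equiv> tens vac e0"
abbreviation "c \<equiv> cvector"
abbreviation "\<nu> \<equiv> \<nu>vector k"

lemma Y0: "modal Y0" "jacobi Y0 Y0 Y0 Y0" "Y0 vac n x = (if n = -1 then x else 0)"
  "Y0 a (-1) vac = a" "0 \<le> n \<Longrightarrow> Y0 a n vac = 0"
  using Vir unfolding virasoro_vertex_algebra_def vertex_algebra_iff by auto

sublocale V: irreducible_virasoro d "\<lambda>n. Y0 \<omega> (n + 1)" 0 vac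
proof
  show "irreducible_highest_weight d 0 (\<lambda>n. Y0 \<omega> (n + 1)) vac"
    using Vir unfolding virasoro_vertex_algebra_def by blast
  then show "virasoro_rep d (\<lambda>n. Y0 \<omega> (n + 1))"
    unfolding irreducible_highest_weight_def by blast
qed

lemma translation_vac: "Y0 \<omega> 0 vac = Y0 vac (-2) vac"
  by (simp add: Y0)

lemma translation_\<omega>: "Y0 \<omega> 0 \<omega> = Y0 \<omega> (-2) vac"
proof -
  have "Y0 \<omega> 0 (Y0 \<omega> (-1) vac) = Y0 \<omega> (-2) vac"
    using V.bracket[of "-1" "-2" vac] by (simp add: Y0 scaleC_one)
  then show ?thesis by (simp add: Y0)
qed

lemma modal_Y: "modal Y"
  by (rule modal_tensor[OF Y0(1) modal0])

lemma module_tensor: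
  assumes "vertex_module UNIV Y0 vac YM"
  shows "vertex_module UNIV Y one (tensor_modes YM (YPi l lam))"
proof -
  have M: "modal YM" "jacobi Y0 YM YM YM" "\<And>n x. YM vac n x = (if n = -1 then x else 0)"
    using assms unfolding vertex_module_iff[OF Y0(1)] by auto
  show ?thesis
    unfolding vertex_module_iff[OF modal_Y]
    using modal_tensor[OF M(1) modal, of l lam]
      jacobi_tensor[OF Y0(1) modal0 M(1) modal M(1) modal M(1) modal M(2) jac, of l lam]
      tensor_vacuum_vacuum[OF M(1) modal M(3) YPi_vac]
    by auto
qed

lemma module_0: "vertex_module UNIV Y0 vac Y0"
  using Vir unfolding virasoro_vertex_algebra_def vertex_algebra_def by blast

lemma module_Y: "vertex_module UNIV Y one Y"
  by (rule module_tensor[OF module_0])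

lemma jac_Y: "jacobi Y Y Y Y"
  using module_Y unfolding vertex_module_iff[OF modal_Y] by auto

lemma tens_creation: "Y (tens a u) n (tens vac e0) = Sum_any (\<lambda>t. tens (Y0 a t vac) (YPi 0 0 u (n - 1 - t) e0))"
  by (simp add: tensor_modes_tens[OF Y0(1) modal0] tensor_pair_def)

lemma creation_Y: "Y a (-1) one = a" "0 \<le> n \<Longrightarrow> Y a n one = 0"
proof -
  have t: "Poly_Mapping.single i x = tens x (Poly_Mapping.single i 1)" for i and x :: 'a
    by (simp add: tens_single)
  show "Y a (-1) one = a"
  proof (induction a rule: pm_induct)
    case zero show ?case by (simp add: modal_Y)
  next
    case (single i x)
    show ?case
      unfolding t[of i x] tens_creation
    proof (subst Sum_any_single[of "-1"])
      fix t :: int assume "t \<noteq> -1"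
      then have "0 \<le> t \<or> 0 \<le> -1 - 1 - t" by auto
      then show "tens (Y0 x t vac) (YPi 0 0 (Poly_Mapping.single i 1) (- 1 - 1 - t) e0) = 0"
        using Y0(5)[of t x] creation(2) by (auto simp: tens_simps)
    qed (simp add: Y0(4) creation(1))
  next
    case (add x y) then show ?case by (simp add: modal_add[OF modal_Y])
  qed
  show "Y a n one = 0" if n: "0 \<le> n"
  proof (induction a rule: pm_induct)
    case zero show ?case by (simp add: modal_Y)
  next
    case (single i x)
    show ?case
      unfolding t[of i x] tens_creation
    proof (rule Sum_any_zero)
      fix t :: int
      have "0 \<le> t \<or> 0 \<le> n - 1 - t" using n by auto
      then show "tens (Y0 x t vac) (YPi 0 0 (Poly_Mapping.single i 1) (n - 1 - t) e0) = 0"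
        using Y0(5)[of t x] creation(2) by (auto simp: tens_simps)
    qed
  next
    case (add x y) then show ?case by (simp add: modal_add[OF modal_Y])
  qed
qed

text \<open>The free-field form of the Sugawara vector.\<close>

definition csug :: "fock_index \<Rightarrow>\<^sub>0 'a" where
  "csug = tens \<omega> e0 + tens vac (conf - H 0 0 \<nu> (-2) e0)"

text \<open>The summand -\<nu>(-2)1 is a derivative, which accounts for the extra term n
  \<nu>(n-1).\<close>

lemma csug_modes:
  assumes "vertex_module UNIV Y0 vac YM"
  shows "tensor_modes YM (YPi l lam) csug n (tens x y) =
    tens (YM \<omega> n x) y + tens x (YPi l lam conf n y + of_int n *\<^sub>C H l lam \<nu> (n - 1) y)"
proof -
  have M: "modal YM" "\<And>n x. YM vac n x = (if n = -1 then x else 0)"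
    using assms unfolding vertex_module_iff[OF Y0(1)] by auto
  have v: "YPi l lam (H 0 0 \<nu> (-2) e0) n y = - of_int n *\<^sub>C H l lam \<nu> (n - 1) y"
    using translation_modes[OF modal0 vm, of l lam "hv \<nu>" n y] by (simp add: YPi_heis)
  show ?thesis
    unfolding csug_def modal_add[OF modal_tensor[OF M(1) modal]]
      tensor_vacuum'[OF M(1) modal YPi_vac] tensor_vacuum[OF M(1) modal M(2)]
    by (simp add: modal_diff[OF modal] v)
qed

text \<open>The condition that L(-1) of the Sugawara field acts on a as the translation operator,
  whose value at a is a_{-2} 1.\<close>

definition translates :: "(fock_index \<Rightarrow>\<^sub>0 'a) \<Rightarrow> bool" where
  "translates a \<longleftrightarrow> Y csug 0 a = Y a (-2) one"

lemma translates_tens: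
  assumes a: "Y0 \<omega> 0 a = Y0 a (-2) vac" and u: "YPi 0 0 conf 0 u = YPi 0 0 u (-2) e0"
  shows "translates (tens a u)"
proof -
  let ?t = "\<lambda>t. tens (Y0 a t vac) (YPi 0 0 u (- 2 - 1 - t) e0)"
  have "Y (tens a u) (-2) one = Sum_any ?t" by (rule tens_creation)
  also have "\<dots> = sum ?t {-2, -1}"
  proof (rule Sum_any_eq_sum)
    fix t :: int assume "t \<notin> {-2, -1}"
    then have "0 \<le> t \<or> 0 \<le> - 2 - 1 - t" by auto
    then show "?t t = 0" using Y0(5)[of t a] creation(2) by (auto simp: tens_simps)
  qed simp
  also have "\<dots> = tens (Y0 \<omega> 0 a) u + tens a (YPi 0 0 conf 0 u)"
    by (simp add: a u Y0(4) creation(1))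
  finally show ?thesis by (simp add: translates_def csug_modes[OF module_0])
qed

lemma translates_generated:
  assumes "\<And>a. a \<in> G \<Longrightarrow> translates a" "a \<in> generated_subalgebra Y one G"
  shows "translates a"
  using assms(2)
proof induction
  case vac
  show ?case by (rule translates_tens[OF translation_vac translation_exp])
next
  case (mode a b n)
  then show ?case
    unfolding translates_def
    by (intro translation_closed[OF modal_Y module_Y creation_Y])
qed (auto intro: assms(1)[unfolded translates_def]
    simp: translates_def modal_add[OF modal_Y] modal_scale[OF modal_Y])

lemma translation_product:
  assumes "YPi 0 0 conf 0 a = YPi 0 0 a (-2) e0" "YPi 0 0 conf 0 b = YPi 0 0 b (-2) e0"
  shows "YPi 0 0 conf 0 (YPi 0 0 a n b) = YPi 0 0 (YPi 0 0 a n b) (-2) e0"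
  by (rule translation_closed[OF modal0 vm creation assms])

lemma translates_Vk:
  assumes "a \<in> Vk_sl2 k Y vac \<omega>"
  shows "translates a"
proof (rule translates_generated[OF _ assms[unfolded Vk_sl2_def]])
  have add: "translates (a - b)" if "translates a" "translates b" for a b
    using that by (simp add: translates_def modal_diff[OF modal_Y])
  have scale: "translates (t *\<^sub>C a)" if "translates a" for t a
    using that by (simp add: translates_def modal_scale[OF modal_Y])
  have h: "YPi 0 0 conf 0 (H 0 0 b n u) = YPi 0 0 (H 0 0 b n u) (-2) e0"
    if "YPi 0 0 conf 0 u = YPi 0 0 u (-2) e0" for b n u
    using translation_product[OF translation_hv that, of b n] by (simp add: YPi_heis)
  fix a assume "a \<in> {e_vec vac, h_vec k vac, f_vec k vac \<omega>}"
  then show "translates a"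
    unfolding e_vec_def h_vec_def f_vec_def
    by (auto intro!: add scale translates_tens translation_vac translation_\<omega> translation_exp h)
qed

lemma form_\<nu>: "form \<nu> c = 1" "form \<nu> \<nu> = - k / 2" "form c c = 0" "form c \<nu> = 1"
  by (simp_all add: form_def \<nu>vector_def cvector_def)

text \<open>The working basis is \<nu> and c: f is written in \<nu> and e^(-c), and <c,c> = 0,
  <\<nu>,c> = 1 keep contractions short.\<close>

lemma heis_\<mu>: "H l lam (\<mu>vector k) n x = H l lam \<nu> n x + (k / 2) *\<^sub>C H l lam c n x"
proof -
  have "\<mu>vector k = \<nu> + (k / 2) *\<^sub>C c"
    by (simp add: prod_eq_iff \<mu>vector_def \<nu>vector_def cvector_def scaleC_prod_def scaleC_complex_def)
  then show ?thesis by (simp only: heis_add heis_scale)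
qed

lemma heis_d: "H l lam dvector n x = 2 *\<^sub>C H l lam \<nu> n x + (k / 2) *\<^sub>C H l lam c n x"
proof -
  have d: "dvector = 2 *\<^sub>C \<nu> + (k / 2) *\<^sub>C c"
    by (simp add: prod_eq_iff dvector_def \<nu>vector_def cvector_def scaleC_prod_def scaleC_complex_def)
  show ?thesis unfolding d by (simp only: heis_add heis_scale)
qed

lemma H_simps: "H l lam a n (x + y) = H l lam a n x + H l lam a n y"
  "H l lam a n (x - y) = H l lam a n x - H l lam a n y" "H l lam a n (t *\<^sub>C x) = t *\<^sub>C H l lam a n x"
  "H l lam a n 0 = 0" "H l lam a n (- x) = - H l lam a n x"
  by (simp_all add: clinear_add[OF heis_clinear] clinear_diff[OF heis_clinear]
      clinear_scale[OF heis_clinear] clinear_zero[OF heis_clinear] clinear_minus[OF heis_clinear])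

text \<open>The rule [\<nu>(m), e^c_n] = e^c_(m+n) moves all \<nu> to the left; what remains are the
  first few coefficients of the product of e^c with e^(-c).\<close>

lemma
  shows e_f_minus_one: "Y (e_vec vac) (-1) (f_vec k vac \<omega>) =
      (k + 2) *\<^sub>C tens \<omega> e0 + tens vac (2 *\<^sub>C H 0 0 \<nu> (-1) (H 0 0 c (-1) e0) - H 0 0 \<nu> (-1) (H 0 0 \<nu> (-1) e0)
        + (k / 2) *\<^sub>C (H 0 0 c (-2) e0 + H 0 0 c (-1) (H 0 0 c (-1) e0)) - (k + 1) *\<^sub>C H 0 0 \<nu> (-2) e0)"
    and e_f_0: "Y (e_vec vac) 0 (f_vec k vac \<omega>) = h_vec k vac"
    and e_f_1: "Y (e_vec vac) 1 (f_vec k vac \<omega>) = k *\<^sub>C one"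
    and e_f_pos: "2 \<le> n \<Longrightarrow> Y (e_vec vac) n (f_vec k vac \<omega>) = 0"
proof -
  let ?X = "YPi 0 0 (basis_exp 1)" and ?E = "basis_exp (-1)"
  have X: "?X n (H 0 0 \<nu> m x) = H 0 0 \<nu> m (?X n x) - ?X (m + n) x" for n m x
    using heis_exp_commutator[of 0 0 \<nu> m 1 n x] by (simp add: form_\<nu> scaleC_one algebra_simps)
  have X0: "?X n ?E = 0" if "0 \<le> n" for n by (rule exp_mode_vanish) (use that in simp)
  have X1: "?X (-1) ?E = e0" by (subst exp_mode_0) simp_all
  have X2: "?X (-2) ?E = H 0 0 c (-1) e0" by (subst exp_mode_1) (simp_all add: scaleC_one)
  have X3: "?X (-3) ?E = (1 / 2) *\<^sub>C H 0 0 c (-2) e0 + (1 / 2) *\<^sub>C H 0 0 c (-1) (H 0 0 c (-1) e0)"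
    by (subst exp_mode_2) simp_all
  have ef: "Y (e_vec vac) n (f_vec k vac \<omega>) = (k + 2) *\<^sub>C tens \<omega> (?X n ?E) -
      tens vac (?X n (H 0 0 \<nu> (-1) (H 0 0 \<nu> (-1) ?E))) - (k + 1) *\<^sub>C tens vac (?X n (H 0 0 \<nu> (-2) ?E))" for n
    unfolding e_vec_def f_vec_def modal_diff[OF modal_Y] modal_scale[OF modal_Y]
      tensor_vacuum[OF Y0(1) modal0 Y0(3)] ..
  have two: "x + x = 2 *\<^sub>C x" for x :: Pi by (metis one_add_one scaleC_add_left scaleC_one)
  show "Y (e_vec vac) (-1) (f_vec k vac \<omega>) =
      (k + 2) *\<^sub>C tens \<omega> e0 + tens vac (2 *\<^sub>C H 0 0 \<nu> (-1) (H 0 0 c (-1) e0) - H 0 0 \<nu> (-1) (H 0 0 \<nu> (-1) e0)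
        + (k / 2) *\<^sub>C (H 0 0 c (-2) e0 + H 0 0 c (-1) (H 0 0 c (-1) e0)) - (k + 1) *\<^sub>C H 0 0 \<nu> (-2) e0)"
  proof -
    have 1: "?X (-1) (H 0 0 \<nu> (-1) (H 0 0 \<nu> (-1) ?E)) = H 0 0 \<nu> (-1) (H 0 0 \<nu> (-1) e0)
        - 2 *\<^sub>C H 0 0 \<nu> (-1) (H 0 0 c (-1) e0) + (1 / 2) *\<^sub>C (H 0 0 c (-2) e0 + H 0 0 c (-1) (H 0 0 c (-1) e0))"
      by (simp add: X X1 X2 X3 H_simps scaleC_add_right two[symmetric])
    have 2: "?X (-1) (H 0 0 \<nu> (-2) ?E) = H 0 0 \<nu> (-2) e0 - (1 / 2) *\<^sub>C (H 0 0 c (-2) e0 + H 0 0 c (-1) (H 0 0 c (-1) e0))"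
      by (simp add: X X1 X3 scaleC_add_right)
    let ?q = "H 0 0 c (-2) e0 + H 0 0 c (-1) (H 0 0 c (-1) e0)"
    have q: "(k / 2) *\<^sub>C ?q = ((k + 1) / 2) *\<^sub>C ?q - (1 / 2) *\<^sub>C ?q"
      unfolding cvec.scale_left_diff_distrib[symmetric] by (simp add: add_divide_distrib)
    show ?thesis
      unfolding ef X1 1 2 q by (simp add: tens_simps(2,4,10) cvec.scale_right_diff_distrib)
  qed
  show "Y (e_vec vac) 0 (f_vec k vac \<omega>) = h_vec k vac"
  proof -
    have 1: "?X 0 (H 0 0 \<nu> (-1) (H 0 0 \<nu> (-1) ?E)) = H 0 0 c (-1) e0 - 2 *\<^sub>C H 0 0 \<nu> (-1) e0"
      by (simp add: X X0 X1 X2 H_simps two[symmetric])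
    have 2: "?X 0 (H 0 0 \<nu> (-2) ?E) = - H 0 0 c (-1) e0"
      by (simp add: X X0 X2 H_simps)
    show ?thesis
      unfolding ef h_vec_def 1 2 X0[OF order_refl] heis_\<mu>
      by (simp add: tens_simps scaleC_simps)
  qed
  show "Y (e_vec vac) 1 (f_vec k vac \<omega>) = k *\<^sub>C one"
  proof -
    have 1: "?X 1 (H 0 0 \<nu> (-1) (H 0 0 \<nu> (-1) ?E)) = e0"
      by (simp add: X X0 X1 H_simps)
    have 2: "?X 1 (H 0 0 \<nu> (-2) ?E) = - e0"
      by (simp add: X X0 X1 H_simps)
    show ?thesis
      unfolding ef 1 2 X0[OF zero_le_one] by (simp add: tens_simps scaleC_simps)
  qed
  show "Y (e_vec vac) n (f_vec k vac \<omega>) = 0" if "2 \<le> n"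
    using that by (simp add: ef X X0 H_simps tens_simps)
qed

text \<open>Skew-symmetry gives f_{-1} e = e_{-1} f - h_{-2} 1 from the products e_n f, so the field
  f is never expanded here. The terms quadratic in \<nu> cancel against those from h_{-1} h, and a
  common factor 2(k+2) remains.\<close>

lemma sugawara_eq: "sugawara k Y vac \<omega> = csug"
proof -
  let ?e = "e_vec vac" and ?f = "f_vec k vac \<omega>" and ?h = "h_vec k vac"
  have fe: "Y ?f (-1) ?e = Y ?e (-1) ?f - Y ?h (-2) one"
  proof -
    let ?t = "\<lambda>i::nat. ((-1) ^ i) *\<^sub>C Y (Y ?e (- 1 + int i) ?f) (- 1 - int i) one"
    have "Y ?f (-1) ?e = - ((-1) powi (-1)) *\<^sub>C Sum_any ?t"
      by (rule skew_symmetry[OF modal_Y jac_Y creation_Y])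
    also have "Sum_any ?t = sum ?t {..<3}"
      by (rule Sum_any_nat) (simp add: e_f_pos modal_Y)
    also have "\<dots> = Y ?e (-1) ?f - Y ?h (-2) one"
      using module_Y[unfolded vertex_module_iff[OF modal_Y]]
      by (simp add: numeral_3_eq_3 e_f_0 e_f_1 creation_Y modal_scale[OF modal_Y] scaleC_one)
    finally show ?thesis by (simp add: scaleC_one)
  qed
  have h: "Y ?h n (tens vac u) = tens vac (2 *\<^sub>C H 0 0 (\<mu>vector k) n u)" for n u
    unfolding h_vec_def hv_def[symmetric] modal_scale[OF modal_Y] tensor_vacuum[OF Y0(1) modal0 Y0(3)]
    by (simp add: YPi_heis tens_simps)
  have hh: "Y ?h (-1) ?h = tens vac (4 *\<^sub>C H 0 0 (\<mu>vector k) (-1) (H 0 0 (\<mu>vector k) (-1) e0))"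
    unfolding h_vec_def[of k vac, folded tens_simps(4)] using h[of "-1" "2 *\<^sub>C H 0 0 (\<mu>vector k) (-1) e0"]
    by (simp add: H_simps h_vec_def tens_simps)
  let ?cc = "H 0 0 c (-1) (H 0 0 c (-1) e0)" and ?\<nu>c = "H 0 0 \<nu> (-1) (H 0 0 c (-1) e0)"
    and ?\<nu>\<nu> = "H 0 0 \<nu> (-1) (H 0 0 \<nu> (-1) e0)" and ?c2 = "H 0 0 c (-2) e0" and ?\<nu>2 = "H 0 0 \<nu> (-2) e0"
  have cn: "H 0 0 c (-1) (H 0 0 \<nu> (-1) e0) = ?\<nu>c" by (rule heis_commute_neg) simp_all
  have conf: "conf = ?\<nu>c + (k / 4) *\<^sub>C ?cc"
    unfolding Pi_conformal_def heis_d by (simp add: H_simps cn scaleC_simps)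
  have mm: "H 0 0 (\<mu>vector k) (-1) (H 0 0 (\<mu>vector k) (-1) e0) = ?\<nu>\<nu> + k *\<^sub>C ?\<nu>c + (k\<^sup>2 / 4) *\<^sub>C ?cc"
  proof -
    have "(k / 2) *\<^sub>C ?\<nu>c + (k / 2) *\<^sub>C ?\<nu>c = k *\<^sub>C ?\<nu>c" unfolding scaleC_add_left[symmetric] by simp
    then show ?thesis unfolding heis_\<mu> by (simp add: H_simps cn scaleC_simps power2_eq_square add_ac)
  qed
  \<comment> \<open>Scalar multiples are broken into equal summands so that additive normalisation
    can match and cancel them.\<close>
  have expand: "2 *\<^sub>C x = x + x" "4 *\<^sub>C x = x + x + x + x" "k *\<^sub>C x = (k / 2) *\<^sub>C x + (k / 2) *\<^sub>C x"
    "(k * 2) *\<^sub>C x = (k / 2) *\<^sub>C x + (k / 2) *\<^sub>C x + (k / 2) *\<^sub>C x + (k / 2) *\<^sub>C x" for x :: "fock_index \<Rightarrow>\<^sub>0 'a"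
  proof -
    show t: "2 *\<^sub>C x = x + x" by (metis one_add_one scaleC_add_left scaleC_one)
    have "4 *\<^sub>C x = 2 *\<^sub>C x + 2 *\<^sub>C x" by (simp add: scaleC_add_left[symmetric])
    then show "4 *\<^sub>C x = x + x + x + x" by (simp only: t add.assoc)
  qed (simp_all add: scaleC_add_left[symmetric])
  have "Y ?e (-1) ?f + Y ?f (-1) ?e + (1 / 2) *\<^sub>C Y ?h (-1) ?h =
      (2 * (k + 2)) *\<^sub>C tens \<omega> e0 + tens vac ((2 * (k + 2)) *\<^sub>C ?\<nu>c + (k + k\<^sup>2 / 2) *\<^sub>C ?cc - (2 * (k + 2)) *\<^sub>C ?\<nu>2)"
    unfolding fe hh e_f_minus_one h mm unfolding heis_\<mu>
    by (simp add: tens_simps scaleC_simps algebra_simps) (simp add: expand add_ac)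
  also have "\<dots> = (2 * (k + 2)) *\<^sub>C csug"
  proof -
    have "(k + k\<^sup>2 / 2) = 2 * (k + 2) * (k / 4)" by (simp add: power2_eq_square field_simps)
    then show ?thesis
      unfolding csug_def conf by (simp add: tens_simps scaleC_add_right cvec.scale_right_diff_distrib)
  qed
  finally have sum: "Y ?e (-1) ?f + Y ?f (-1) ?e + (1 / 2) *\<^sub>C Y ?h (-1) ?h = (2 * (k + 2)) *\<^sub>C csug" .
  have "2 * (k + 2) \<noteq> 0" using k_nz by (simp only: mult_eq_0_iff) simp
  then have "1 / (2 * (k + 2)) * (2 * (k + 2)) = 1"
    unfolding times_divide_eq_left mult_1_left by (rule divide_self)
  then show ?thesis unfolding sugawara_def sum scaleC_scaleC by (simp only: scaleC_one)
qed

end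

section \<open>The screening operator\<close>

text \<open>With t = k + 2, the last two assumptions are the parametrisation of h^{2,1} and of the
  central charge under which \<open>null_vector\<close> holds.\<close>

locale screening = vir_lattice +
  fixes Y21 :: "'a \<Rightarrow> int \<Rightarrow> 'b::complex_vector \<Rightarrow> 'b" and v21 :: 'b and h21 :: complex
  assumes W21: "virasoro_irreducible_module d Y0 vac \<omega> h21 Y21 v21"
    and h21: "h21 = 3 * (k + 2) / 4 - 1 / 2" and d: "d = 13 - 6 * (k + 2) - 6 / (k + 2)"
begin

text \<open>Since \<mu> - (k/2) c = \<nu>, for this value the vector \<open>e0\<close> of the module
  \<open>P\<close> stands for e^\<nu>, and \<open>E\<close> for e^(\<nu> - c).\<close>

definition lam_w :: complex where "lam_w = - k / 2"

abbreviation "W \<equiv> tensor_modes Y21 (YPi 1 lam_w)"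
abbreviation "T \<equiv> W csug 0"
abbreviation "s \<equiv> tens v21 e0"
abbreviation "P \<equiv> YPi 1 lam_w"
abbreviation "Hw \<equiv> H 1 lam_w"
abbreviation "E \<equiv> basis_exp (- 1)"

lemma module_21: "vertex_module UNIV Y0 vac Y21"
  using W21 unfolding virasoro_irreducible_module_def by blast

lemma Y21: "modal Y21" "\<And>n x. Y21 vac n x = (if n = -1 then x else 0)"
  using module_21 unfolding vertex_module_iff[OF Y0(1)] by auto

sublocale V21: irreducible_virasoro d "\<lambda>n. Y21 \<omega> (n + 1)" h21 v21
proof
  show "irreducible_highest_weight d h21 (\<lambda>n. Y21 \<omega> (n + 1)) v21"
    using W21 unfolding virasoro_irreducible_module_def by blast
  then show "virasoro_rep d (\<lambda>n. Y21 \<omega> (n + 1))"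
    unfolding irreducible_highest_weight_def by blast
qed

lemma module_W: "vertex_module UNIV Y one W"
  by (rule module_tensor[OF module_21])

lemma W: "modal W" "jacobi Y W W W" "W one n x = (if n = -1 then x else 0)"
  using module_W unfolding vertex_module_iff[OF modal_Y] by auto

lemma T_clinear: "clinear T"
  by (rule modal_clinear(1)[OF W(1)])

lemma \<omega>_v21: "2 \<le> n \<Longrightarrow> Y21 \<omega> n v21 = 0" "Y21 \<omega> 1 v21 = h21 *\<^sub>C v21"
  using V21.hw(3)[of "n - 1"] V21.hw(2) by simp_all

lemma null_21: "Y21 \<omega> 0 (Y21 \<omega> 0 v21) = (k + 2) *\<^sub>C Y21 \<omega> (-1) v21"
  using V21.null_vector[OF k_nz h21 d] by simp

lemma charge_w: "charge k 1 lam_w m = \<nu> + of_int m *\<^sub>C c"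
  by (simp add: lam_w_def charge_def \<mu>vector_def \<nu>vector_def cvector_def scaleC_prod_def scaleC_complex_def prod_eq_iff)

lemma heis_w_0: "Hw \<nu> 0 e0 = (- k / 2) *\<^sub>C e0"
  by (simp only: heis_exp_zero charge_w) (simp add: form_simps form_\<nu>)

lemma E_modes: "0 < n \<Longrightarrow> P E n e0 = 0" "P E 0 e0 = E" "P E (-1) e0 = - Hw c (-1) E"
  "P E (-2) e0 = (1 / 2) *\<^sub>C Hw c (-1) (Hw c (-1) E) - (1 / 2) *\<^sub>C Hw c (-2) E"
proof -
  show "0 < n \<Longrightarrow> P E n e0 = 0" by (rule exp_mode_vanish) simp
  show "P E 0 e0 = E" by (subst exp_mode_0) simp_all
  show "P E (-1) e0 = - Hw c (-1) E" by (subst exp_mode_1) (simp_all add: scaleC_simps)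
  show "P E (-2) e0 = (1 / 2) *\<^sub>C Hw c (-1) (Hw c (-1) E) - (1 / 2) *\<^sub>C Hw c (-2) E"
    by (subst exp_mode_2) (simp_all add: scaleC_simps)
qed

text \<open>On e^\<nu> positive Heisenberg modes vanish and \<nu>(0) is the scalar <\<nu>,\<nu>> =
  -k/2, so the annihilating half of the normally ordered product shrinks to one term.\<close>

lemma normal_order_w:
  assumes "\<And>m. n + int N \<le> m \<Longrightarrow> P b m e0 = 0"
  shows "P (H 0 0 \<nu> (-1) b) n e0 = (\<Sum>i<N. Hw \<nu> (- 1 - int i) (P b (n + int i) e0)) - (k / 2) *\<^sub>C P b (n - 1) e0"
proof -
  have f: "finite {i::nat. Hw \<nu> (- 1 - int i) (P b (n + int i) e0) \<noteq> 0}"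
    by (rule finite_support_nat[of N]) (simp add: assms H_simps)
  have g: "finite {i::nat. P b (n - 1 - int i) (Hw \<nu> (int i) e0) \<noteq> 0}"
    by (rule finite_support_nat[of 1]) (simp add: heis_exp_pos modal)
  have "P (H 0 0 \<nu> (-1) b) n e0 = Sum_any (\<lambda>i::nat. Hw \<nu> (- 1 - int i) (P b (n + int i) e0)) +
      Sum_any (\<lambda>i::nat. P b (n - 1 - int i) (Hw \<nu> (int i) e0))"
    unfolding normal_order by (rule Sum_any.distrib[OF f g])
  also have "Sum_any (\<lambda>i::nat. Hw \<nu> (- 1 - int i) (P b (n + int i) e0)) =
      (\<Sum>i<N. Hw \<nu> (- 1 - int i) (P b (n + int i) e0))"
    by (rule Sum_any_nat) (simp add: assms H_simps)
  also have "Sum_any (\<lambda>i::nat. P b (n - 1 - int i) (Hw \<nu> (int i) e0)) = P b (n - 1 - int 0) (Hw \<nu> (int 0) e0)"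
    by (rule Sum_any_single) (simp add: heis_exp_pos modal)
  finally show ?thesis by (simp add: heis_w_0 modal_scale[OF modal] modal_minus[OF modal] scaleC_simps)
qed

lemma normal_order2_w:
  assumes "0 \<le> n"
  shows "P (H 0 0 \<nu> (-2) E) n e0 = (if n = 0 then Hw \<nu> (-2) E else 0) + (k / 2) *\<^sub>C P E (n - 2) e0"
proof -
  let ?t = "\<lambda>i::nat. of_nat (i + 1) *\<^sub>C (Hw \<nu> (- 2 - int i) (P E (n + int i) e0) - P E (n - 2 - int i) (Hw \<nu> (int i) e0))"
  have "P (H 0 0 \<nu> (-2) E) n e0 = Sum_any ?t" by (rule normal_order2)
  also have "\<dots> = ?t 0"
    by (rule Sum_any_single) (use assms in \<open>simp add: heis_exp_pos modal E_modes H_simps\<close>)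
  finally show ?thesis
    using assms by (auto simp: heis_w_0 E_modes modal_scale[OF modal] modal_minus[OF modal] scaleC_simps H_simps)
qed

text \<open>The inner factor of \<nu>(-1)^2 e^(-c) in f; its modes on e^\<nu> feed the second
  application of normal ordering.\<close>

lemma b_modes:
  fixes b defines "b \<equiv> H 0 0 \<nu> (-1) E"
  shows "2 \<le> n \<Longrightarrow> P b n e0 = 0" "P b 1 e0 = - (k / 2) *\<^sub>C E"
    "P b 0 e0 = Hw \<nu> (-1) E + (k / 2) *\<^sub>C Hw c (-1) E"
    "P b (-1) e0 = Hw \<nu> (-2) E - Hw \<nu> (-1) (Hw c (-1) E)
      - (k / 4) *\<^sub>C (Hw c (-1) (Hw c (-1) E) - Hw c (-2) E)"
  unfolding b_def
proof -
  have E: "P E n e0 = 0" if "1 \<le> n" for n using that by (simp add: E_modes)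
  show "2 \<le> n \<Longrightarrow> P (H 0 0 \<nu> (-1) E) n e0 = 0"
    by (subst normal_order_w[of n 0]) (simp_all add: E)
  show "P (H 0 0 \<nu> (-1) E) 1 e0 = - (k / 2) *\<^sub>C E"
    by (subst normal_order_w[of 1 0]) (simp_all add: E E_modes)
  show "P (H 0 0 \<nu> (-1) E) 0 e0 = Hw \<nu> (-1) E + (k / 2) *\<^sub>C Hw c (-1) E"
    by (subst normal_order_w[of 0 1]) (simp_all add: E E_modes scaleC_simps)
  show "P (H 0 0 \<nu> (-1) E) (-1) e0 = Hw \<nu> (-2) E - Hw \<nu> (-1) (Hw c (-1) E)
      - (k / 4) *\<^sub>C (Hw c (-1) (Hw c (-1) E) - Hw c (-2) E)"
    by (subst normal_order_w[of "-1" 2]) (simp_all add: E E_modes scaleC_simps H_simps numeral_2_eq_2)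
qed

text \<open>The product of f with s has a pole of order at most three. The scalar (k+2) h21 - k^2/4
  - k(k+1)/2, collected from the three summands of f, equals 2k + 2; it is the top coefficient and
  reappears in the lower modes with the expansion of e^(-c).\<close>

lemma f_modes_2: "W (f_vec k vac \<omega>) 2 s = (2 * k + 2) *\<^sub>C tens v21 E"
  and f_modes_1: "W (f_vec k vac \<omega>) 1 s = (k + 2) *\<^sub>C tens (Y21 \<omega> 0 v21) E + k *\<^sub>C tens v21 (Hw \<nu> (-1) E)
      - (2 * k + 2) *\<^sub>C tens v21 (Hw c (-1) E)"
  and f_modes_0: "W (f_vec k vac \<omega>) 0 s = (k + 2) *\<^sub>C tens (Y21 \<omega> (-1) v21) E
      - (k + 2) *\<^sub>C tens (Y21 \<omega> 0 v21) (Hw c (-1) E)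
      + (k + 1) *\<^sub>C tens v21 (Hw c (-1) (Hw c (-1) E) - Hw c (-2) E)
      - tens v21 (Hw \<nu> (-1) (Hw \<nu> (-1) E)) - tens v21 (Hw \<nu> (-2) E) - k *\<^sub>C tens v21 (Hw \<nu> (-1) (Hw c (-1) E))"
  and f_modes_pos: "3 \<le> n \<Longrightarrow> W (f_vec k vac \<omega>) n s = 0"
proof -
  let ?u = "H 0 0 \<nu> (-1) (H 0 0 \<nu> (-1) E)"
  have f: "W (f_vec k vac \<omega>) n s = (k + 2) *\<^sub>C W (tens \<omega> E) n s - tens v21 (P ?u n e0)
      - (k + 1) *\<^sub>C tens v21 (P (H 0 0 \<nu> (-2) E) n e0)" for n
    unfolding f_vec_def modal_diff[OF W(1)] modal_scale[OF W(1)] tensor_vacuum[OF Y21(1) modal Y21(2)] ..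
  have w: "W (tens \<omega> E) n s = (\<Sum>t\<in>{n - 1..1}. tens (Y21 \<omega> t v21) (P E (n - 1 - t) e0))" for n
    unfolding tensor_modes_tens[OF Y21(1) modal] tensor_pair_def
    by (rule Sum_any_eq_sum) (auto simp: \<omega>_v21 E_modes tens_simps not_le)
  have u: "P ?u n e0 = 0" if "3 \<le> n" for n
    using that by (subst normal_order_w[of n 0]) (simp_all add: b_modes)
  have u2: "P ?u 2 e0 = (k\<^sup>2 / 4) *\<^sub>C E"
    by (subst normal_order_w[of 2 0]) (simp_all add: b_modes scaleC_simps power2_eq_square)
  have u1: "P ?u 1 e0 = - k *\<^sub>C Hw \<nu> (-1) E - (k\<^sup>2 / 4) *\<^sub>C Hw c (-1) E"
  proof -
    have "P ?u 1 e0 = - ((k / 2) *\<^sub>C Hw \<nu> (-1) E + (k / 2) *\<^sub>C Hw \<nu> (-1) E) - (k\<^sup>2 / 4) *\<^sub>C Hw c (-1) E"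
      by (subst normal_order_w[of 1 1]) (simp_all add: b_modes scaleC_simps H_simps power2_eq_square)
    then show ?thesis unfolding scaleC_add_left[symmetric] by (simp add: scaleC_simps)
  qed
  have u0: "P ?u 0 e0 = Hw \<nu> (-1) (Hw \<nu> (-1) E) + k *\<^sub>C Hw \<nu> (-1) (Hw c (-1) E) - k *\<^sub>C Hw \<nu> (-2) E
      + (k\<^sup>2 / 8) *\<^sub>C (Hw c (-1) (Hw c (-1) E) - Hw c (-2) E)"
  proof -
    have "P ?u 0 e0 = Hw \<nu> (-1) (Hw \<nu> (-1) E)
      + ((k / 2) *\<^sub>C Hw \<nu> (-1) (Hw c (-1) E) + (k / 2) *\<^sub>C Hw \<nu> (-1) (Hw c (-1) E))
      - ((k / 2) *\<^sub>C Hw \<nu> (-2) E + (k / 2) *\<^sub>C Hw \<nu> (-2) E)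
      + (k\<^sup>2 / 8) *\<^sub>C (Hw c (-1) (Hw c (-1) E) - Hw c (-2) E)"
      by (subst normal_order_w[of 0 2])
        (simp_all add: b_modes scaleC_simps H_simps power2_eq_square numeral_2_eq_2)
    then show ?thesis unfolding scaleC_add_left[symmetric] by simp
  qed
  have i: "{2 - 1..1::int} = {1}" "{1 - 1..1::int} = {0, 1}" "{0 - 1..1::int} = {-1, 0, 1}" by auto
  show "W (f_vec k vac \<omega>) n s = 0" if "3 \<le> n"
    using that by (simp add: f w u normal_order2_w E_modes tens_simps)
  show "W (f_vec k vac \<omega>) 2 s = (2 * k + 2) *\<^sub>C tens v21 E"
  proof -
    have "W (f_vec k vac \<omega>) 2 s = ((k + 2) * h21 - k\<^sup>2 / 4 - (k + 1) * (k / 2)) *\<^sub>C tens v21 E"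
      unfolding f w i u2 normal_order2_w[of 2, simplified]
      by (simp add: E_modes \<omega>_v21 tens_simps scaleC_simps)
    also have "(k + 2) * h21 - k\<^sup>2 / 4 - (k + 1) * (k / 2) = 2 * k + 2"
      by (simp add: h21 power2_eq_square field_simps)
    finally show ?thesis .
  qed
  show "W (f_vec k vac \<omega>) 1 s = (k + 2) *\<^sub>C tens (Y21 \<omega> 0 v21) E + k *\<^sub>C tens v21 (Hw \<nu> (-1) E)
      - (2 * k + 2) *\<^sub>C tens v21 (Hw c (-1) E)"
  proof -
    have "W (f_vec k vac \<omega>) 1 s = (k + 2) *\<^sub>C tens (Y21 \<omega> 0 v21) E + k *\<^sub>C tens v21 (Hw \<nu> (-1) E)
      - ((k + 2) * h21 - k\<^sup>2 / 4 - (k + 1) * (k / 2)) *\<^sub>C tens v21 (Hw c (-1) E)"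
      unfolding f w i u1 normal_order2_w[of 1, simplified]
      by (simp add: E_modes \<omega>_v21 tens_simps scaleC_simps)
    also have "(k + 2) * h21 - k\<^sup>2 / 4 - (k + 1) * (k / 2) = 2 * k + 2"
      by (simp add: h21 power2_eq_square field_simps)
    finally show ?thesis .
  qed
  show "W (f_vec k vac \<omega>) 0 s = (k + 2) *\<^sub>C tens (Y21 \<omega> (-1) v21) E
      - (k + 2) *\<^sub>C tens (Y21 \<omega> 0 v21) (Hw c (-1) E)
      + (k + 1) *\<^sub>C tens v21 (Hw c (-1) (Hw c (-1) E) - Hw c (-2) E)
      - tens v21 (Hw \<nu> (-1) (Hw \<nu> (-1) E)) - tens v21 (Hw \<nu> (-2) E) - k *\<^sub>C tens v21 (Hw \<nu> (-1) (Hw c (-1) E))"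
  proof -
    define Q where "Q = Hw c (-1) (Hw c (-1) E) - Hw c (-2) E"
    have q: "P E (-2) e0 = (1 / 2) *\<^sub>C Q"
      by (simp add: E_modes scaleC_simps Q_def)
    have "W (f_vec k vac \<omega>) 0 s = (k + 2) *\<^sub>C tens (Y21 \<omega> (-1) v21) E
      - (k + 2) *\<^sub>C tens (Y21 \<omega> 0 v21) (Hw c (-1) E)
      + (((k + 2) * h21 - k\<^sup>2 / 4 - (k + 1) * (k / 2)) / 2) *\<^sub>C tens v21 Q
      - tens v21 (Hw \<nu> (-1) (Hw \<nu> (-1) E)) - k *\<^sub>C tens v21 (Hw \<nu> (-1) (Hw c (-1) E))
      - (k + 1) *\<^sub>C tens v21 (Hw \<nu> (-2) E) + k *\<^sub>C tens v21 (Hw \<nu> (-2) E)"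
      unfolding f w i u0[folded Q_def] normal_order2_w[of 0, simplified]
      by (simp add: E_modes(2,3) q \<omega>_v21 tens_simps scaleC_simps diff_divide_distrib algebra_simps)
        (simp add: scaleC_add_left[symmetric] add_divide_distrib)
    also have "((k + 2) * h21 - k\<^sup>2 / 4 - (k + 1) * (k / 2)) / 2 = k + 1"
      by (simp add: h21 power2_eq_square field_simps)
    finally show ?thesis unfolding Q_def by (simp add: scaleC_add_left scaleC_one)
  qed
qed

lemma T_tens: "T (tens x y) = tens (Y21 \<omega> 0 x) y + tens x (P conf 0 y)"
  by (simp add: csug_modes[OF module_21])

lemma conf_0_E: "P conf 0 E = Hw \<nu> (-1) E - Hw c (-1) E"
  unfolding conf_0_exp charge_w by (simp add: heis_add heis_scale heis_diff scaleC_simps)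

text \<open>By skew-symmetry s_0 f = -f_0 s + T f_1 s - T^2 f_2 s / 2. All terms with Heisenberg
  modes cancel, which leaves (L(-1)^2 - (k+2) L(-2)) v21 tensored with e^(\<nu> - c).\<close>

lemma screening_f: "skew T W s 0 (f_vec k vac \<omega>) = 0"
proof -
  note Tl = clinear_add[OF T_clinear] clinear_diff[OF T_clinear] clinear_scale[OF T_clinear]
  let ?f = "f_vec k vac \<omega>"
  let ?t = "\<lambda>u::nat. ((-1) powi (0 + int u + 1)) *\<^sub>C divpow T u (W ?f (0 + int u) s)"
  have "skew T W s 0 ?f = sum ?t {..<3}"
    unfolding skew_def by (rule Sum_any_nat) (simp add: f_modes_pos clinear_zero[OF divpow_clinear[OF T_clinear]])
  also have "\<dots> = - W ?f 0 s + T (W ?f 1 s) - (1 / 2) *\<^sub>C T (T (W ?f 2 s))"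
    by (simp add: numeral_3_eq_3 divpow_Suc'[OF T_clinear] Tl scaleC_one)
  also have "T (W ?f 1 s) = (k + 2) *\<^sub>C tens (Y21 \<omega> 0 (Y21 \<omega> 0 v21)) E
      + (k + 2) *\<^sub>C tens (Y21 \<omega> 0 v21) (Hw \<nu> (-1) E) - (k + 2) *\<^sub>C tens (Y21 \<omega> 0 v21) (Hw c (-1) E)
      + k *\<^sub>C tens (Y21 \<omega> 0 v21) (Hw \<nu> (-1) E)
      + k *\<^sub>C (tens v21 (Hw \<nu> (-1) (Hw \<nu> (-1) E)) - tens v21 (Hw \<nu> (-1) (Hw c (-1) E)) + tens v21 (Hw \<nu> (-2) E))
      - (2 * k + 2) *\<^sub>C tens (Y21 \<omega> 0 v21) (Hw c (-1) E)
      - (2 * k + 2) *\<^sub>C (tens v21 (Hw \<nu> (-1) (Hw c (-1) E)) - tens v21 (Hw c (-1) (Hw c (-1) E)) + tens v21 (Hw c (-2) E))"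
    unfolding f_modes_1
    by (simp add: Tl T_tens conf_0_heis conf_0_E H_simps tens_simps scaleC_add_right cvec.scale_right_diff_distrib
        heis_commute_neg[of "-1" "-1" _ _ c \<nu>])
  also have "(1 / 2) *\<^sub>C T (T (W ?f 2 s)) = (k + 1) *\<^sub>C (tens (Y21 \<omega> 0 (Y21 \<omega> 0 v21)) E
      + tens (Y21 \<omega> 0 v21) (Hw \<nu> (-1) E) - tens (Y21 \<omega> 0 v21) (Hw c (-1) E)
      + (tens (Y21 \<omega> 0 v21) (Hw \<nu> (-1) E) - tens (Y21 \<omega> 0 v21) (Hw c (-1) E))
      + (tens v21 (Hw \<nu> (-1) (Hw \<nu> (-1) E)) - tens v21 (Hw \<nu> (-1) (Hw c (-1) E)) + tens v21 (Hw \<nu> (-2) E))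
      - (tens v21 (Hw \<nu> (-1) (Hw c (-1) E)) - tens v21 (Hw c (-1) (Hw c (-1) E)) + tens v21 (Hw c (-2) E)))"
  proof -
    have "T (T (W ?f 2 s)) = (2 * k + 2) *\<^sub>C (tens (Y21 \<omega> 0 (Y21 \<omega> 0 v21)) E
        + tens (Y21 \<omega> 0 v21) (Hw \<nu> (-1) E) - tens (Y21 \<omega> 0 v21) (Hw c (-1) E)
        + (tens (Y21 \<omega> 0 v21) (Hw \<nu> (-1) E) - tens (Y21 \<omega> 0 v21) (Hw c (-1) E))
        + (tens v21 (Hw \<nu> (-1) (Hw \<nu> (-1) E)) - tens v21 (Hw \<nu> (-1) (Hw c (-1) E)) + tens v21 (Hw \<nu> (-2) E))
        - (tens v21 (Hw \<nu> (-1) (Hw c (-1) E)) - tens v21 (Hw c (-1) (Hw c (-1) E)) + tens v21 (Hw c (-2) E)))"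
      unfolding f_modes_2
      by (simp add: Tl T_tens conf_0_heis conf_0_E H_simps tens_simps
          heis_commute_neg[of "-1" "-1" _ _ c \<nu>])
    moreover have "1 / 2 * (2 * k + 2) = k + 1" by simp
    ultimately show ?thesis by (simp only: scaleC_scaleC)
  qed
  finally have eq: "skew T W s 0 ?f = - W ?f 0 s + ((k + 2) *\<^sub>C tens (Y21 \<omega> 0 (Y21 \<omega> 0 v21)) E
      + (k + 2) *\<^sub>C tens (Y21 \<omega> 0 v21) (Hw \<nu> (-1) E) - (k + 2) *\<^sub>C tens (Y21 \<omega> 0 v21) (Hw c (-1) E)
      + k *\<^sub>C tens (Y21 \<omega> 0 v21) (Hw \<nu> (-1) E)
      + k *\<^sub>C (tens v21 (Hw \<nu> (-1) (Hw \<nu> (-1) E)) - tens v21 (Hw \<nu> (-1) (Hw c (-1) E)) + tens v21 (Hw \<nu> (-2) E))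
      - (2 * k + 2) *\<^sub>C tens (Y21 \<omega> 0 v21) (Hw c (-1) E)
      - (2 * k + 2) *\<^sub>C (tens v21 (Hw \<nu> (-1) (Hw c (-1) E)) - tens v21 (Hw c (-1) (Hw c (-1) E)) + tens v21 (Hw c (-2) E)))
      - (k + 1) *\<^sub>C (tens (Y21 \<omega> 0 (Y21 \<omega> 0 v21)) E
      + tens (Y21 \<omega> 0 v21) (Hw \<nu> (-1) E) - tens (Y21 \<omega> 0 v21) (Hw c (-1) E)
      + (tens (Y21 \<omega> 0 v21) (Hw \<nu> (-1) E) - tens (Y21 \<omega> 0 v21) (Hw c (-1) E))
      + (tens v21 (Hw \<nu> (-1) (Hw \<nu> (-1) E)) - tens v21 (Hw \<nu> (-1) (Hw c (-1) E)) + tens v21 (Hw \<nu> (-2) E))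
      - (tens v21 (Hw \<nu> (-1) (Hw c (-1) E)) - tens v21 (Hw c (-1) (Hw c (-1) E)) + tens v21 (Hw c (-2) E)))" .
  have expand: "2 *\<^sub>C x = x + x" "(k * 2) *\<^sub>C x = k *\<^sub>C x + k *\<^sub>C x" "4 *\<^sub>C x = x + x + x + x"
    for x :: "fock_index \<Rightarrow>\<^sub>0 'b"
  proof -
    show t: "2 *\<^sub>C x = x + x" by (metis one_add_one scaleC_add_left scaleC_one)
    show "(k * 2) *\<^sub>C x = k *\<^sub>C x + k *\<^sub>C x" by (simp add: scaleC_add_left[symmetric])
    have "4 *\<^sub>C x = 2 *\<^sub>C x + 2 *\<^sub>C x" by (simp add: scaleC_add_left[symmetric])
    then show "4 *\<^sub>C x = x + x + x + x" by (simp only: t add.assoc)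
  qed
  \<comment> \<open>L(-1)^2 v21 occurs with coefficients k + 2 and -(k + 1); the single copy left
    over is rewritten by \<open>null_21\<close> and cancels the L(-2) term of f_0 s.\<close>
  show ?thesis
    unfolding eq f_modes_0 null_21
    by (simp add: tens_simps scaleC_simps algebra_simps) (simp add: expand algebra_simps)
qed

text \<open>Since <c,\<nu>> = 1, the product of e^c with e^\<nu> is regular. For h the reason is
  <\<mu>,\<nu>> = 0.\<close>

lemma screening_e: "skew T W s 0 (e_vec vac) = 0"
proof -
  have "W (e_vec vac) n s = 0" if "0 \<le> n" for n
    using that unfolding e_vec_def tensor_vacuum[OF Y21(1) modal Y21(2)]
    by (simp add: exp_mode_vanish tens_simps)
  then show ?thesis
    unfolding skew_def by (simp add: clinear_zero[OF divpow_clinear[OF T_clinear]])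
qed

lemma screening_h: "skew T W s 0 (h_vec k vac) = 0"
proof -
  have "Hw (\<mu>vector k) 0 e0 = 0"
    by (simp add: heis_exp_zero charge_w form_def \<mu>vector_def \<nu>vector_def cvector_def scaleC_prod_def scaleC_complex_def)
  then have "W (h_vec k vac) n s = 0" if "0 \<le> n" for n
    using that unfolding h_vec_def hv_def[symmetric] modal_scale[OF W(1)] tensor_vacuum[OF Y21(1) modal Y21(2)] YPi_heis
    by (cases "n = 0") (simp_all add: heis_exp_pos tens_simps)
  then show ?thesis
    unfolding skew_def by (simp add: clinear_zero[OF divpow_clinear[OF T_clinear]])
qed

abbreviation "Vk \<equiv> Vk_sl2 k Y vac \<omega>"

lemma Vk_translation:
  assumes "a \<in> Vk"
  shows "T (W a n w) = W a n (T w) - of_int n *\<^sub>C W a (n - 1) w"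
  by (rule translation_commutator[OF modal_Y module_W translates_Vk[OF assms, unfolded translates_def]])

text \<open>For j = 0 the commutator formula says that s_0 is a derivation of all products, so its
  kernel contains whatever e, h and f generate.\<close>

lemma screening_Vk: "a \<in> Vk \<Longrightarrow> skew T W s 0 a = 0"
  unfolding Vk_sl2_def
proof (induction rule: generated_subalgebra.induct)
  case vac
  show ?case unfolding skew_def by (simp add: W(3) clinear_zero[OF divpow_clinear[OF T_clinear]])
next
  case (gen a)
  then show ?case using screening_e screening_h screening_f by blast
next
  case (add a b)
  then show ?case by (simp add: clinear_add[OF skew_clinear(2)[OF W(1) T_clinear]])
next
  case (scale a t)
  have "skew T W s 0 (t *\<^sub>C a) = t *\<^sub>C skew T W s 0 a"
    by (rule clinear_scale[OF skew_clinear(2)[OF W(1) T_clinear]])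
  then show ?case by (simp only: scale.IH cvec.scale_zero_right)
next
  case (mode a b n)
  have Vk: "a \<in> Vk" "b \<in> Vk" using mode.hyps by (simp_all add: Vk_sl2_def)
  have z: "skew T W 0 m x = 0" for m x
    using clinear_zero[OF skew_clinear(1)[OF W(1) T_clinear]] .
  have "skew T W s (int 0) (Y a n b) =
    Sum_any (\<lambda>t. (of_nat 0 gchoose t) *\<^sub>C skew T W (skew T W s (int t) a) (n + int 0 - int t) b) +
    W a n (skew T W s (int 0) b)"
  proof (rule skew_product[OF modal_Y W(1) T_clinear W(2)])
    show "T (W a m w) = W a m (T w) - of_int m *\<^sub>C W a (m - 1) w" for m w
      by (rule Vk_translation[OF Vk(1)])
    show "T (W b m w) = W b m (T w) - of_int m *\<^sub>C W b (m - 1) w" for m w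
      by (rule Vk_translation[OF Vk(2)])
  qed
  moreover have "Sum_any (\<lambda>t. (of_nat 0 gchoose t) *\<^sub>C skew T W (skew T W s (int t) a) (n + int 0 - int t) b) = 0"
  proof (rule Sum_any_zero)
    fix t :: nat
    show "(of_nat 0 gchoose t) *\<^sub>C skew T W (skew T W s (int t) a) (n + int 0 - int t) b = 0"
    proof (cases t)
      case 0 then show ?thesis by (simp only: of_nat_0 mode.IH(1) z cvec.scale_zero_right)
    next
      case (Suc u) then show ?thesis by (simp only: of_nat_0 gbinomial_0_left) simp
    qed
  qed
  ultimately show ?case
    by (simp only: of_nat_0 mode.IH(2) modal_zero(1)[OF W(1)] add_0)
qed

end

section \<open>Screened pairs of modules\<close>

lemma vertex_module_subset:
  "vertex_module UNIV Y vac YM \<Longrightarrow> vertex_module A Y vac YM"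
  by (simp add: vertex_module_def)

text \<open>Lets the support of an eigenvector be located coefficient by coefficient, which
  identifies the leading vector of the lattice factor below.\<close>

lemma lookup_diagonal:
  assumes F: "clinear F" and d: "\<And>i. F (Poly_Mapping.single i 1) = c i *\<^sub>C Poly_Mapping.single i (1 :: complex)"
  shows "Poly_Mapping.lookup (F x) i = c i * Poly_Mapping.lookup x i"
proof (induction x rule: pm_induct)
  case (single j t)
  have t: "Poly_Mapping.single j t = t *\<^sub>C Poly_Mapping.single j 1"
    by (simp add: scaleC_single scaleC_complex_def)
  have "F (Poly_Mapping.single j t) = Poly_Mapping.single j (t * c j)"
    by (simp only: t clinear_scale[OF F] d scaleC_scaleC) (simp add: scaleC_single scaleC_complex_def)
  then show ?case by (simp add: lookup_single when_def)
qed (simp_all add: clinear_zero[OF F] clinear_add[OF F] lookup_add distrib_left)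

section \<open>Weight modules: an irreducible Virasoro module tensored with a lattice module\<close>

context vir_lattice
begin

context
  fixes YM :: "'a \<Rightarrow> int \<Rightarrow> 'm::complex_vector \<Rightarrow> 'm" and h :: complex and v and l :: int and lam :: complex
  assumes M: "virasoro_irreducible_module d Y0 vac \<omega> h YM v"
begin

lemma module_M: "vertex_module UNIV Y0 vac YM"
  using M unfolding virasoro_irreducible_module_def by blast

lemma modal_M: "modal YM" and vac_M: "YM vac n x = (if n = -1 then x else 0)"
  using module_M unfolding vertex_module_iff[OF Y0(1)] by auto

lemma irreducible_M: "irreducible_virasoro d (\<lambda>n. YM \<omega> (n + 1)) h v"
proof
  show "irreducible_highest_weight d h (\<lambda>n. YM \<omega> (n + 1)) v"
    using M unfolding virasoro_irreducible_module_def by blast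
  then show "virasoro_rep d (\<lambda>n. YM \<omega> (n + 1))"
    unfolding irreducible_highest_weight_def by blast
qed

abbreviation "Q \<equiv> tensor_modes YM (YPi l lam)"

lemma csug_1_single:
  assumes "YM \<omega> 1 x = t *\<^sub>C x"
  shows "Q csug 1 (tens x (Poly_Mapping.single (X, m) 1)) =
    (t + (form (charge k l lam m) (charge k l lam m) / 2 + of_nat (fock_degree X)) + form \<nu> (charge k l lam m)) *\<^sub>C
      tens x (Poly_Mapping.single (X, m) 1)"
  unfolding csug_modes[OF module_M] conf_1_single assms
  by (simp add: heis_0_single tens_simps scaleC_simps)

lemma span_tens:
  assumes "\<And>x i. x \<in> S \<Longrightarrow> tens x (Poly_Mapping.single i 1) \<in> cvec.span R" and "\<And>x. x \<in> cvec.span S"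
  shows "z \<in> cvec.span R"
proof (induction z rule: pm_induct)
  case zero show ?case by (rule cvec.span_zero)
next
  case (single i x)
  have "tens x (Poly_Mapping.single i 1) \<in> cvec.span R"
    using assms(2)[of x]
  proof (induction x rule: cvec.span_induct_alt)
    case base show ?case by (simp add: tens_simps cvec.span_zero)
  next
    case (step c x y)
    then show ?case
      using cvec.span_add[OF cvec.span_scale[OF assms(1)[OF step(1)]] step(2)]
      by (simp add: tens_simps)
  qed
  then show ?case by (simp add: tens_single)
next
  case (add x y) then show ?case by (rule cvec.span_add)
qed

lemma csug_1_span: "z \<in> cvec.span {z. \<exists>t. Q csug 1 z = t *\<^sub>C z}"
proof -
  interpret V: irreducible_virasoro d "\<lambda>n. YM \<omega> (n + 1)" h v by (rule irreducible_M)
  show ?thesis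
  proof (rule span_tens[where S = "{x. \<exists>t\<in>{h + of_nat n |n. True}. YM \<omega> (0 + 1) x = t *\<^sub>C x}"])
    fix x and i :: fock_index
    assume "x \<in> {x. \<exists>t\<in>{h + of_nat n |n. True}. YM \<omega> (0 + 1) x = t *\<^sub>C x}"
    then obtain t where t: "YM \<omega> 1 x = t *\<^sub>C x" by auto
    obtain X m where i: "i = (X, m)" by (cases i)
    show "tens x (Poly_Mapping.single i 1) \<in> cvec.span {z. \<exists>t. Q csug 1 z = t *\<^sub>C z}"
      unfolding i using csug_1_single[OF t, of X m] by (intro cvec.span_base) blast
  qed (rule V.span_weight_vectors)
qed

lemma csug_1_semisimple: "acts_semisimply (Q csug 1)"
  by (rule acts_semisimplyI[OF modal_clinear(1)[OF modal_tensor[OF modal_M modal]] csug_1_span])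

lemma h_0_semisimple: "acts_semisimply (Q (h_vec k vac) 0)"
proof (rule acts_semisimplyI)
  show "clinear (Q (h_vec k vac) 0)" by (rule modal_clinear(1)[OF modal_tensor[OF modal_M modal]])
  show "z \<in> cvec.span {z. \<exists>t. Q (h_vec k vac) 0 z = t *\<^sub>C z}" for z
  proof (rule span_tens[where S = UNIV])
    fix x and i :: fock_index
    obtain X m where i: "i = (X, m)" by (cases i)
    have "Q (h_vec k vac) 0 (tens x (Poly_Mapping.single (X, m) 1)) =
        (2 * form (\<mu>vector k) (charge k l lam m)) *\<^sub>C tens x (Poly_Mapping.single (X, m) 1)"
      unfolding h_vec_def hv_def[symmetric] modal_scale[OF modal_tensor[OF modal_M modal]]
        tensor_vacuum[OF modal_M modal vac_M] YPi_heis heis_0_single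
      by (simp add: tens_simps)
    then show "tens x (Poly_Mapping.single i 1) \<in> cvec.span {z. \<exists>t. Q (h_vec k vac) 0 z = t *\<^sub>C z}"
      unfolding i by (intro cvec.span_base) blast
  qed (simp add: cvec.span_base)
qed

lemma weight_module_Q: "weight_module A Y one csug (h_vec k vac) Q"
  unfolding weight_module_def
  using vertex_module_subset[OF module_tensor[OF module_M]] csug_1_semisimple h_0_semisimple by blast

lemma Virasoro_generates:
  assumes "cvec.subspace U" "\<And>a n x. x \<in> U \<Longrightarrow> YM a n x \<in> U" "v \<in> U"
  shows "U = UNIV"
  using irreducible_virasoro.generated[OF irreducible_M, of U] assms
  by (simp add: virasoro_submodule_def)

end

end

text \<open>X is the quotient and Z the submodule of the later extension. The assumption on
  \<open>lam\<close> ties the lattice to the Virasoro side: the pairing <\<nu>, l\<mu> + lam c> =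
  lam has to match the difference of weights h21 + hX - hZ, so that the product of the two
  intertwining operators has integral powers of z.\<close>

locale screened_pair = screening +
  fixes YX :: "'a \<Rightarrow> int \<Rightarrow> 'c::complex_vector \<Rightarrow> 'c" and vX :: 'c and hX
    and YZ :: "'a \<Rightarrow> int \<Rightarrow> 'd::complex_vector \<Rightarrow> 'd" and vZ :: 'd and hZ
    and l :: int and lam :: complex
    and I1 :: "'b \<Rightarrow> complex \<Rightarrow> 'c \<Rightarrow> 'd" and I2 :: "Pi \<Rightarrow> complex \<Rightarrow> Pi \<Rightarrow> Pi"
  assumes X: "virasoro_irreducible_module d Y0 vac \<omega> hX YX vX"
    and Z: "virasoro_irreducible_module d Y0 vac \<omega> hZ YZ vZ"
    and I1: "intertwining_operator \<omega> Y21 YX YZ I1" "nontrivial_intertwining I1"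
    and I2: "intertwining_operator conf (YPi 1 lam_w) (YPi l lam) (YPi (l + 1) (lam_w + lam)) I2"
      "nontrivial_intertwining I2"
    and lam: "lam = h21 + hX - hZ"
begin

abbreviation "QX \<equiv> tensor_modes YX (YPi l lam)"
abbreviation "QZ \<equiv> tensor_modes YZ (YPi (l + 1) (lam_w + lam))"
text \<open>
  Although the modes of \<open>I1\<close> and \<open>I2\<close> are indexed by complex numbers, comparing the weights of
  leading terms shows that only those in \<open>lam + \<int>\<close> and \<open>- lam + \<int>\<close>, respectively, occur.
\<close>

definition "J1 w n x = I1 w (lam + of_int n) x"
definition "J2 w n x = I2 w (- lam + of_int n) x"
abbreviation "J \<equiv> tensor_modes J1 J2"

text \<open>By the commutator formula the top nonzero mode of v21 on vX is annihilated by every L(m)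
  with m > 0, hence is a multiple of vZ. Its L(0)-weight is h21 + hX - 1 minus the mode index;
  equating this with hZ gives the index lam - 1 and with it the coset of every nonzero mode.\<close>

lemma leading_I1:
  assumes "I1 w t x \<noteq> 0"
  shows "\<exists>n::int. t + of_int n = lam - 1" "\<exists>a. a \<noteq> 0 \<and> I1 v21 (lam - 1) vX = a *\<^sub>C vZ"
    "\<And>n::int. 0 < n \<Longrightarrow> I1 v21 (lam - 1 + of_int n) vX = 0"
proof -
  interpret VX: irreducible_virasoro d "\<lambda>n. YX \<omega> (n + 1)" hX vX by (rule irreducible_M[OF X])
  interpret VZ: irreducible_virasoro d "\<lambda>n. YZ \<omega> (n + 1)" hZ vZ by (rule irreducible_M[OF Z])
  define I where "I = (\<lambda>w n x. I1 w (t + of_int n) x)"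
  note I = intertwining_restrict[OF I1(1) Y21(1) modal_M[OF X] modal_M[OF Z] I_def]
  have "I w 0 x \<noteq> 0" using assms by (simp add: I_def)
  from leading_term[OF Y21(1) modal_M[OF X] modal_M[OF Z] I(1,2) Virasoro_generates[OF W21] Virasoro_generates[OF X] this]
  obtain n0 where n0: "I v21 n0 vX \<noteq> 0" "\<And>n. n0 < n \<Longrightarrow> I v21 n vX = 0" by blast
  let ?u = "I v21 n0 vX"
  have L: "YZ \<omega> (m + 1) ?u = I v21 n0 (YX \<omega> (m + 1) vX) +
      (- (t + of_int (m + 1 + n0)) + of_int (m + 1) * h21) *\<^sub>C I v21 (m + n0) vX" for m
  proof -
    let ?t = "\<lambda>i::nat. (of_int (m + 1) gchoose i) *\<^sub>C I (Y21 \<omega> (int i) v21) (m + 1 + n0 - int i) vX"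
    have "YZ \<omega> (m + 1) ?u - I v21 n0 (YX \<omega> (m + 1) vX) = Sum_any ?t"
      by (rule jacobi_commutator[OF Y21(1) modal_M[OF X] modal_M[OF Z] I(1,2)])
    also have "\<dots> = sum ?t {..<2}"
      by (rule Sum_any_nat) (simp add: \<omega>_v21 I(1))
    also have "\<dots> = (- (t + of_int (m + 1 + n0)) + of_int (m + 1) * h21) *\<^sub>C I v21 (m + n0) vX"
      by (simp add: numeral_2_eq_2 I(3) \<omega>_v21 modal_scale[OF I(1)] scaleC_simps algebra_simps)
    finally show ?thesis by (simp add: algebra_simps)
  qed
  have u0: "YZ \<omega> (0 + 1) ?u = (hX + h21 - (t + of_int n0) - 1) *\<^sub>C ?u"
    using VX.hw(2) by (subst L) (simp add: modal_scale[OF I(1)] scaleC_simps algebra_simps)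
  have up: "YZ \<omega> (m + 1) ?u = 0" if "0 < m" for m
    using VX.hw(3)[OF that] n0(2)[of "m + n0"] that by (subst L) (simp add: I(1))
  note sv = VZ.singular_vector[OF n0(1) u0 up]
  have tn: "t + of_int n0 = lam - 1" using sv(1) unfolding lam by (simp add: algebra_simps)
  then show "\<exists>n::int. t + of_int n = lam - 1" by blast
  show "\<exists>a. a \<noteq> 0 \<and> I1 v21 (lam - 1) vX = a *\<^sub>C vZ"
    using sv(2) n0(1) tn by (auto simp: I_def)
  show "I1 v21 (lam - 1 + of_int n) vX = 0" if "0 < n" for n :: int
    using n0(2)[of "n0 + n"] that unfolding I_def tn[symmetric] by (simp add: algebra_simps)
qed

lemma I1_coset: "I1 w t x \<noteq> 0 \<Longrightarrow> \<exists>n::int. t = lam + of_int n"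
proof -
  assume "I1 w t x \<noteq> 0"
  from leading_I1(1)[OF this] obtain n :: int where "t + of_int n = lam - 1" by blast
  then have "t = lam + of_int (- 1 - n)" by (simp add: algebra_simps)
  then show ?thesis by blast
qed

text \<open>The analogue for e^\<nu> acting on \<open>E\<close>, which here stands for e^(l\<mu> +
  (lam-1)c). This vector is chosen because <\<nu>, l\<mu> + (lam-1)c> = lam - 1 places the top mode
  at -lam; added to the index lam - 1 of the Virasoro factor it gives -1, which belongs to mode 0 of
  the tensor product.\<close>

lemma leading_I2:
  "\<exists>a. a \<noteq> 0 \<and> I2 e0 (- lam) E = a *\<^sub>C E" "\<And>n::int. 0 < n \<Longrightarrow> I2 e0 (- lam + of_int n) E = 0"
proof -
  obtain w t x where nz: "I2 w t x \<noteq> 0" using I2(2) unfolding nontrivial_intertwining_def by blast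
  define I where "I = (\<lambda>w n x. I2 w (t + of_int n) x)"
  note I = intertwining_restrict[OF I2(1) modal modal modal I_def]
  have gen1: "U = UNIV"
    if "cvec.subspace U" "\<And>a n x. x \<in> U \<Longrightarrow> P a n x \<in> U" "e0 \<in> U" for U
    using generates[OF that] by blast
  have gen2: "U = UNIV"
    if "cvec.subspace U" "\<And>a n x. x \<in> U \<Longrightarrow> YPi l lam a n x \<in> U" "E \<in> U" for U
    using generates[OF that] by blast
  have "I w 0 x \<noteq> 0" using nz by (simp add: I_def)
  from leading_term[OF modal modal modal I(1,2) gen1 gen2 this]
  obtain n0 where n0: "I e0 n0 E \<noteq> 0" "\<And>n. n0 < n \<Longrightarrow> I e0 n E = 0" by blast
  let ?u = "I e0 n0 E"
  let ?Z = "YPi (l + 1) (lam_w + lam)" and ?HZ = "H (l + 1) (lam_w + lam)"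
  define \<beta> where "\<beta> = charge k l lam (-1)"
  define \<gamma> where "\<gamma> = charge k (l + 1) (lam_w + lam) (-1)"
  have \<nu>: "charge k 1 lam_w 0 = \<nu>" unfolding charge_w by simp
  have \<gamma>: "\<gamma> = \<nu> + \<beta>"
    unfolding \<gamma>_def \<beta>_def
    by (simp add: lam_w_def charge_def \<mu>vector_def \<nu>vector_def cvector_def scaleC_prod_def
        scaleC_complex_def prod_eq_iff algebra_simps add_divide_distrib)
  have \<nu>\<beta>: "form \<nu> \<beta> = lam - 1"
    unfolding \<beta>_def by (simp add: form_def charge_def \<mu>vector_def \<nu>vector_def cvector_def
        scaleC_prod_def scaleC_complex_def algebra_simps)
  have HZ: "?HZ a m ?u = I e0 n0 (H l lam a m E) + form a \<nu> *\<^sub>C I e0 (m + n0) E" for a m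
  proof -
    let ?t = "\<lambda>i::nat. (of_int m gchoose i) *\<^sub>C I (YPi 1 lam_w (hv a) (int i) e0) (m + n0 - int i) E"
    have "?Z (hv a) m ?u - I e0 n0 (YPi l lam (hv a) m E) = Sum_any ?t"
      by (rule jacobi_commutator[OF modal modal modal I(1,2)])
    also have "\<dots> = ?t 0"
      by (rule Sum_any_single) (simp add: YPi_heis heis_exp_pos I(1))
    finally show ?thesis
      by (simp add: YPi_heis heis_exp_zero \<nu> modal_scale[OF I(1)] scaleC_one algebra_simps)
  qed
  have HZ0: "?HZ a 0 ?u = form a \<gamma> *\<^sub>C ?u" for a
    unfolding HZ \<gamma> \<beta>_def by (simp add: heis_exp_zero modal_scale[OF I(1)] form_simps scaleC_add_left)
  have HZpos: "?HZ a m ?u = 0" if "0 < m" for a m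
    unfolding HZ using that n0(2)[of "m + n0"] by (simp add: heis_exp_pos I(1))
  \<comment> \<open>The conformal weight of the leading vector is computed twice, here from its
    Heisenberg charge and next from the derivative rule; comparison determines the mode
    index.\<close>
  have c1: "?Z conf 1 ?u = (form \<gamma> \<gamma> / 2) *\<^sub>C ?u"
  proof -
    have "?Z conf 1 ?u = (1 / 2) *\<^sub>C ?HZ dvector 0 (?HZ c 0 ?u)"
      unfolding conf_modes by (subst Sum_any_single[of 0]) (simp_all add: HZpos H_simps)
    then show ?thesis
      by (simp add: HZ0 H_simps form_def cvector_def dvector_def scaleC_scaleC)
  qed
  have c2: "?Z conf 1 ?u = (form \<beta> \<beta> / 2 + form \<nu> \<nu> / 2 - (t + of_int n0) - 1) *\<^sub>C ?u"
  proof -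
    let ?t = "\<lambda>i::nat. (of_int 1 gchoose i) *\<^sub>C I (YPi 1 lam_w conf (int i) e0) (1 + n0 - int i) E"
    have "?Z conf 1 ?u - I e0 n0 (YPi l lam conf 1 E) = Sum_any ?t"
      by (rule jacobi_commutator[OF modal modal modal I(1,2)])
    also have "\<dots> = sum ?t {..<2}"
      by (rule Sum_any_nat) (simp add: conf_exp_pos I(1))
    also have "\<dots> = (form \<nu> \<nu> / 2 - (t + of_int n0) - 1) *\<^sub>C ?u"
      by (simp add: numeral_2_eq_2 I(3) conf_1_exp \<nu> modal_scale[OF I(1)] scaleC_simps algebra_simps)
    finally show ?thesis
      by (simp add: conf_1_exp \<beta>_def[symmetric] modal_scale[OF I(1)] scaleC_simps algebra_simps)
  qed
  have "form \<gamma> \<gamma> / 2 = form \<beta> \<beta> / 2 + form \<nu> \<nu> / 2 - (t + of_int n0) - 1"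
    using c1 c2 n0(1) by (metis cvec.scale_right_imp_eq)
  moreover have "form \<gamma> \<gamma> = form \<nu> \<nu> + form \<beta> \<beta> + 2 * form \<nu> \<beta>"
    unfolding \<gamma> by (simp add: form_def algebra_simps)
  ultimately have "form \<nu> \<beta> = - (t + of_int n0) - 1" by (simp add: add_divide_distrib)
  then have "lam = - (t + of_int n0)" unfolding \<nu>\<beta> by (metis diff_add_cancel)
  then have tn: "t + of_int n0 = - lam" by (simp only: minus_minus)
  have D1: "Poly_Mapping.lookup (?HZ dvector 0 x) i =
      form dvector (charge k (l + 1) (lam_w + lam) (snd i)) * Poly_Mapping.lookup x i" for x i
    by (rule lookup_diagonal[OF heis_clinear]) (metis heis_0_single prod.collapse)
  have D2: "Poly_Mapping.lookup (?Z conf 1 x) i =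
      (form (charge k (l + 1) (lam_w + lam) (snd i)) (charge k (l + 1) (lam_w + lam) (snd i)) / 2 +
        of_nat (fock_degree (fst i))) * Poly_Mapping.lookup x i" for x i
    by (rule lookup_diagonal[OF modal_clinear(1)[OF modal]]) (metis conf_1_single prod.collapse)
  \<comment> \<open>The eigenvalue of d(0) fixes the lattice charge, and the conformal weight then
    leaves no room for Heisenberg creation operators.\<close>
  have supp: "X = {#} \<and> m = -1" if nz: "Poly_Mapping.lookup ?u (X, m) \<noteq> 0" for X m
  proof -
    have "Poly_Mapping.lookup (?HZ dvector 0 ?u) (X, m) =
        form dvector (charge k (l + 1) (lam_w + lam) m) * Poly_Mapping.lookup ?u (X, m)"
      using D1[of ?u "(X, m)"] by simp
    then have "form dvector \<gamma> = form dvector (charge k (l + 1) (lam_w + lam) m)"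
      using nz by (simp add: HZ0 scaleC_complex_def)
    then have "(of_int (2 + m * 2) :: complex) = 0"
      unfolding \<gamma>_def by (simp add: form_def dvector_def charge_def cvector_def scaleC_prod_def scaleC_complex_def algebra_simps)
    then have "2 + m * 2 = 0" by (simp only: of_int_eq_0_iff)
    then have m: "m = -1" by simp
    have "Poly_Mapping.lookup (?Z conf 1 ?u) (X, m) = (form \<gamma> \<gamma> / 2 + of_nat (fock_degree X)) * Poly_Mapping.lookup ?u (X, m)"
      using D2[of ?u "(X, m)"] by (simp add: m \<gamma>_def)
    then have "(of_nat (fock_degree X) :: complex) = 0"
      using nz by (simp add: c1 scaleC_complex_def distrib_right)
    then have "fock_degree X = 0" by (simp only: of_nat_eq_0_iff)
    then show ?thesis using m by (simp add: fock_degree_0_iff)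
  qed
  have u: "?u = Poly_Mapping.lookup ?u ({#}, -1) *\<^sub>C E"
  proof (rule poly_mapping_eqI)
    fix i :: fock_index
    show "Poly_Mapping.lookup ?u i = Poly_Mapping.lookup (Poly_Mapping.lookup ?u ({#}, -1) *\<^sub>C E) i"
    proof (cases "i = ({#}, -1)")
      case False
      then have "Poly_Mapping.lookup ?u i = 0" using supp[of "fst i" "snd i"] by (metis prod.collapse)
      then show ?thesis using False by (auto simp: basis_exp_def lookup_single when_def scaleC_complex_def)
    qed (simp add: basis_exp_def lookup_single scaleC_complex_def)
  qed
  have "I2 e0 (- lam) E = ?u" by (simp add: I_def tn)
  then show "\<exists>a. a \<noteq> 0 \<and> I2 e0 (- lam) E = a *\<^sub>C E"
    using u n0(1) by (metis cvec.scale_zero_left)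
  show "I2 e0 (- lam + of_int n) E = 0" if "0 < n" for n :: int
    using n0(2)[of "n0 + n"] that unfolding I_def tn[symmetric] by (simp add: algebra_simps)
qed

end

lemma vertex_module_cong:
  assumes "\<And>a. a \<in> A \<Longrightarrow> YM a = YM' a" "vac \<in> A" "\<And>a b. a \<in> A \<Longrightarrow> b \<in> A \<Longrightarrow> a + b \<in> A"
    "\<And>a t. a \<in> A \<Longrightarrow> t *\<^sub>C a \<in> A" "\<And>a b n. a \<in> A \<Longrightarrow> b \<in> A \<Longrightarrow> Y a n b \<in> A"
  shows "vertex_module A Y vac YM \<longleftrightarrow> vertex_module A Y vac YM'"
  unfolding vertex_module_def by (simp add: assms cong: ball_cong)

lemma Sum_any_coset:
  fixes g :: "complex \<Rightarrow> 'a::comm_monoid_add"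
  assumes "\<And>t. g t \<noteq> 0 \<Longrightarrow> \<exists>n::int. t = c + of_int n"
  shows "Sum_any g = Sum_any (\<lambda>n::int. g (c + of_int n))"
proof -
  let ?h = "\<lambda>n::int. c + of_int n"
  have i: "inj_on ?h A" for A by (rule inj_onI) simp
  have "{t. g t \<noteq> 0} = ?h ` {n. g (?h n) \<noteq> 0}" using assms by (auto simp: image_iff)
  then have "sum g {t. g t \<noteq> 0} = (\<Sum>n\<in>{n. g (?h n) \<noteq> 0}. g (?h n))"
    by (simp add: sum.reindex[OF i] o_def)
  then show ?thesis by (simp add: Sum_any.expand_set)
qed

context screened_pair
begin

lemma J1: "modal J1" "jacobi Y21 YX YZ J1" "J1 (Y21 \<omega> 0 w) n x = - (lam + of_int n) *\<^sub>C J1 w (n - 1) x"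
proof -
  have "J1 = (\<lambda>w n x. I1 w (lam + of_int n) x)" by (simp add: J1_def fun_eq_iff)
  note * = intertwining_restrict[OF I1(1) Y21(1) modal_M[OF X] modal_M[OF Z] this]
  show "modal J1" "jacobi Y21 YX YZ J1" "J1 (Y21 \<omega> 0 w) n x = - (lam + of_int n) *\<^sub>C J1 w (n - 1) x"
    by (rule *)+
qed

lemma J2: "modal J2" "jacobi P (YPi l lam) (YPi (l + 1) (lam_w + lam)) J2"
  "J2 (P conf 0 w) n x = - (- lam + of_int n) *\<^sub>C J2 w (n - 1) x"
proof -
  have "J2 = (\<lambda>w n x. I2 w (- lam + of_int n) x)" by (simp add: J2_def fun_eq_iff)
  note * = intertwining_restrict[OF I2(1) modal modal modal this]
  show "modal J2" "jacobi P (YPi l lam) (YPi (l + 1) (lam_w + lam)) J2"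
    "J2 (P conf 0 w) n x = - (- lam + of_int n) *\<^sub>C J2 w (n - 1) x"
    by (rule *)+
qed

lemma J: "modal J" "jacobi W QX QZ J"
  by (rule modal_tensor[OF J1(1) J2(1)])
    (rule jacobi_tensor[OF Y21(1) modal modal_M[OF X] modal modal_M[OF Z] modal J1(1) J2(1) J1(2) J2(2)])

text \<open>The derivative rules of \<open>J1\<close> and \<open>J2\<close> carry the shifts lam and
  -lam, which cancel in the tensor product and leave the integral index n.\<close>

lemma J_translation_tens:
  "J (T (tens a u)) n (tens x y) = - of_int n *\<^sub>C J (tens a u) (n - 1) (tens x y)"
proof -
  let ?g = "\<lambda>t. tens (J1 a t x) (J2 u (n - 2 - t) y)"
  have shift: "n - 1 - (t + 1) = n - 2 - t" and shift': "n - 1 - t - 1 = n - 2 - t" for t by simp_all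
  have fin: "finite {t. ?g t \<noteq> 0}" by (rule tensor_product_finite[OF J1(1) J2(1)])
  have fin': "finite {t. c t *\<^sub>C ?g t \<noteq> 0}" for c by (rule finite_subset[OF _ fin]) auto
  have "J (tens (Y21 \<omega> 0 a) u) n (tens x y) =
      Sum_any (\<lambda>t. - (lam + of_int t) *\<^sub>C tens (J1 a (t - 1) x) (J2 u (n - 1 - t) y))"
    unfolding tensor_modes_tens[OF J1(1) J2(1)] tensor_pair_def J1(3) tens_simps ..
  also have "\<dots> = Sum_any (\<lambda>t. - (lam + of_int (t + 1)) *\<^sub>C ?g t)"
    by (subst Sum_any_shift_int[where c = 1]) (simp only: shift add_diff_cancel_right')
  finally have 1: "J (tens (Y21 \<omega> 0 a) u) n (tens x y) = Sum_any (\<lambda>t. - (lam + of_int (t + 1)) *\<^sub>C ?g t)" .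
  have 2: "J (tens a (P conf 0 u)) n (tens x y) = Sum_any (\<lambda>t. - (- lam + of_int (n - 1 - t)) *\<^sub>C ?g t)"
    unfolding tensor_modes_tens[OF J1(1) J2(1)] tensor_pair_def J2(3) tens_simps by (simp only: shift')
  have "J (T (tens a u)) n (tens x y) =
      Sum_any (\<lambda>t. - (lam + of_int (t + 1)) *\<^sub>C ?g t + - (- lam + of_int (n - 1 - t)) *\<^sub>C ?g t)"
    unfolding T_tens modal_add[OF J(1)] 1 2 by (rule Sum_any.distrib[OF fin' fin', symmetric])
  also have "\<dots> = Sum_any (\<lambda>t. - of_int n *\<^sub>C ?g t)"
    by (rule Sum_any.cong) (simp add: scaleC_add_left[symmetric] del: cvec.scale_minus_left)
  also have "\<dots> = - of_int n *\<^sub>C Sum_any ?g" by (rule Sum_any_scale[OF fin])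
  also have "Sum_any ?g = J (tens a u) (n - 1) (tens x y)"
    unfolding tensor_modes_tens[OF J1(1) J2(1)] tensor_pair_def by simp
  finally show ?thesis .
qed

lemma J_translation: "J (T w) n x = - of_int n *\<^sub>C J w (n - 1) x"
proof (induction w rule: pm_induct)
  case zero show ?case by (simp add: J(1) W(1))
next
  case (single i a)
  show ?case
  proof (induction x rule: pm_induct)
    case zero show ?case by (simp add: J(1))
  next
    case (single j b)
    then show ?case
      using J_translation_tens[of a "Poly_Mapping.single i 1" n b "Poly_Mapping.single j 1"]
      by (simp add: tens_single scaleC_one)
  next
    case (add x y) then show ?case by (simp add: modal_add[OF J(1)] scaleC_simps)
  qed
next
  case (add x y) then show ?case by (simp add: modal_add[OF J(1)] modal_add[OF W(1)] scaleC_simps)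
qed

text \<open>The sum over complex indices runs over lam + Z, because \<open>I1\<close> vanishes
  elsewhere; the complementary indices of \<open>I2\<close> then lie in -lam + Z.\<close>

lemma J_restricts: "tensor_modes I1 I2 w (of_int n) x = J w n x"
proof -
  have "Sum_any (\<lambda>t. tens (I1 a t b) (I2 u (of_int n - 1 - t) y)) =
    Sum_any (\<lambda>t. tens (J1 a t b) (J2 u (n - 1 - t) y))" for a b u y
  proof -
    have "Sum_any (\<lambda>t. tens (I1 a t b) (I2 u (of_int n - 1 - t) y)) =
      Sum_any (\<lambda>t::int. tens (I1 a (lam + of_int t) b) (I2 u (of_int n - 1 - (lam + of_int t)) y))"
      by (rule Sum_any_coset) (auto simp: tens_eq_0_iff intro: I1_coset)
    then show ?thesis by (simp add: J1_def J2_def algebra_simps)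
  qed
  then show ?thesis unfolding tensor_modes_def by simp
qed

lemma Vk_closed: "one \<in> Vk" "a \<in> Vk \<Longrightarrow> b \<in> Vk \<Longrightarrow> a + b \<in> Vk" "a \<in> Vk \<Longrightarrow> t *\<^sub>C a \<in> Vk"
  "a \<in> Vk \<Longrightarrow> b \<in> Vk \<Longrightarrow> Y a n b \<in> Vk"
  unfolding Vk_sl2_def by (auto intro: generated_subalgebra.intros)

lemma csug_Vk: "csug \<in> Vk"
  unfolding sugawara_eq[symmetric] sugawara_def Vk_sl2_def
  by (intro generated_subalgebra.scale generated_subalgebra.add generated_subalgebra.mode generated_subalgebra.gen) simp_all

sublocale twist: log_twist Vk Y one W QX QZ J T s
  by (rule log_twist.intro)
    (rule modal_Y module_W module_tensor[OF module_M[OF X]] module_tensor[OF module_M[OF Z]] J T_clinear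
      J_translation Vk_translation screening_Vk; assumption?)+

text \<open>s is primary of conformal weight h21 - k/4 - k/2 = 1: here -k/4 is <\<nu>,\<nu>>/2, and
  -k/2 comes from the derivative term of \<open>csug\<close>.\<close>

lemma csug_s: "W csug 1 s = s" "2 \<le> n \<Longrightarrow> W csug n s = 0"
proof -
  have "W csug 1 s = tens (h21 *\<^sub>C v21) e0 + tens v21 ((- k / 2 / 2) *\<^sub>C e0 + (- k / 2) *\<^sub>C e0)"
    unfolding csug_modes[OF module_21] \<omega>_v21 conf_1_exp charge_w
    by (simp add: heis_w_0 form_\<nu> scaleC_one)
  also have "\<dots> = (h21 + (- k / 2 / 2 + - k / 2)) *\<^sub>C s"
    by (simp only: tens_simps scaleC_add_left)
  also have "h21 + (- k / 2 / 2 + - k / 2) = 1" by (simp add: h21 field_simps)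
  finally show "W csug 1 s = s" by (simp add: scaleC_one)
  show "W csug n s = 0" if "2 \<le> n"
    unfolding csug_modes[OF module_21] using that
    by (simp add: \<omega>_v21 conf_exp_pos heis_exp_pos tens_simps)
qed

lemma skew_csug: "skew T W s 1 csug = s" "2 \<le> j \<Longrightarrow> skew T W s j csug = 0"
proof -
  have "skew T W s 1 csug = ((-1) powi (1 + int 0 + 1)) *\<^sub>C divpow T 0 (W csug (1 + int 0) s)"
    unfolding skew_def by (rule Sum_any_single) (simp add: csug_s clinear_zero[OF divpow_clinear[OF T_clinear]])
  then show "skew T W s 1 csug = s" by (simp add: csug_s(1)[simplified] scaleC_one)
  show "skew T W s j csug = 0" if "2 \<le> j"
    unfolding skew_def by (rule Sum_any_zero) (use that in \<open>simp add: csug_s clinear_zero[OF divpow_clinear[OF T_clinear]]\<close>)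
qed

lemma log_term_csug: "log_term T W J s csug 1 x = J s 0 x"
proof -
  have "log_term T W J s csug 1 x = (\<Sum>j<2. log_coeff j *\<^sub>C J (skew T W s (int j) csug) (1 - int j) x)"
    by (rule twist.log_term_sum) (simp add: skew_csug)
  then show ?thesis by (simp add: numeral_2_eq_2 skew_csug log_coeff_def scaleC_one)
qed

text \<open>For a primary field of weight one, [L(0), s_0] is mode 1 of L(-1)s plus mode 0 of L(0)s
  = s, that is -s_0 + s_0.\<close>

lemma csug_screening: "QZ csug 1 (J s 0 x) = J s 0 (QX csug 1 x)"
proof -
  let ?t = "\<lambda>i::nat. (of_int 1 gchoose i) *\<^sub>C J (W csug (int i) s) (1 + 0 - int i) x"
  have "QZ csug 1 (J s 0 x) - J s 0 (QX csug 1 x) = Sum_any ?t"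
    by (rule jacobi_commutator[OF W(1) twist.X'(1) twist.YY'(1) J])
  also have "\<dots> = sum ?t {..<2}"
    by (rule Sum_any_nat) (simp add: csug_s J(1))
  also have "\<dots> = J (T s) 1 x + J s 0 x"
    by (simp add: numeral_2_eq_2 csug_s(1)[simplified] scaleC_one)
  also have "\<dots> = 0"
    by (simp add: J_translation[of s 1 x] scaleC_simps)
  finally show ?thesis by simp
qed

text \<open>Of all splittings of mode 0 between the factors, those with t > -1 vanish by the bound
  for \<open>I1\<close> and those with t < -1 by the bound for \<open>I2\<close>; the remaining one
  is the tensor product of the two leading vectors.\<close>

lemma screening_nonzero: "J s 0 (tens vX E) \<noteq> 0"
proof -
  have "J s 0 (tens vX E) = Sum_any (\<lambda>t. tens (J1 v21 t vX) (J2 e0 (0 - 1 - t) E))"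
    unfolding tensor_modes_tens[OF J1(1) J2(1)] tensor_pair_def ..
  also have "\<dots> = tens (J1 v21 (-1) vX) (J2 e0 (0 - 1 - (-1)) E)"
  proof (rule Sum_any_single)
    obtain w t x where nz: "I1 w t x \<noteq> 0" using I1(2) unfolding nontrivial_intertwining_def by blast
    fix t :: int assume "t \<noteq> -1"
    then consider "-1 < t" | "t < -1" by linarith
    then show "tens (J1 v21 t vX) (J2 e0 (0 - 1 - t) E) = 0"
    proof cases
      case 1
      have "J1 v21 t vX = 0"
        using leading_I1(3)[OF nz, of "t + 1"] 1 by (simp add: J1_def algebra_simps)
      then show ?thesis by (simp add: tens_simps)
    next
      case 2
      have "J2 e0 (0 - 1 - t) E = 0" unfolding J2_def using 2 by (intro leading_I2(2)) simp
      then show ?thesis by (simp add: tens_simps)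
    qed
  qed
  finally have *: "J s 0 (tens vX E) = tens (J1 v21 (-1) vX) (J2 e0 0 E)" by simp
  obtain w t x where nz: "I1 w t x \<noteq> 0" using I1(2) unfolding nontrivial_intertwining_def by blast
  obtain a where a: "a \<noteq> 0" "I1 v21 (lam - 1) vX = a *\<^sub>C vZ" using leading_I1(2)[OF nz] by blast
  obtain b where b: "b \<noteq> 0" "I2 e0 (- lam) E = b *\<^sub>C E" using leading_I2(1) by blast
  have "vZ \<noteq> 0"
    using irreducible_virasoro.hw(1)[OF irreducible_M[OF Z]] .
  moreover have "E \<noteq> 0" by (metis basis_exp_def lookup_single_eq lookup_zero zero_neq_one)
  ultimately have "tens (a *\<^sub>C vZ) (b *\<^sub>C E) \<noteq> 0" using a(1) b(1) by (simp add: tens_eq_0_iff)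
  then show ?thesis unfolding * by (simp add: J1_def J2_def a(2) b(2))
qed

section \<open>The twisted module and its extension\<close>

abbreviation "Ytw \<equiv> (\<lambda>a. twisted_operator (extended_vertex_operator csug Y W) (0, s)
  (extended_module_operator QX QZ (tensor_modes I1 I2)) (a, 0))"

lemma Ytw: "a \<in> Vk \<Longrightarrow> Ytw a n = (\<lambda>(x, y). (QX a n x, QZ a n y + log_term T W J s a n x))"
  by (rule twist.twisted_operator_extended[OF refl J_restricts])

lemma Ytw_csug: "Ytw csug 1 = (\<lambda>(x, y). (QX csug 1 x, QZ csug 1 y + J s 0 x))"
  using Ytw[OF csug_Vk, of 1] by (simp only: log_term_csug)

lemma module_Ytw: "vertex_module Vk Y one Ytw"
proof -
  have "vertex_module Vk Y one (\<lambda>a n (x, y). (QX a n x, QZ a n y + log_term T W J s a n x))"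
    by (rule twist.vertex_module_log_twist) (rule Vk_closed; assumption)+
  moreover have "vertex_module Vk Y one Ytw \<longleftrightarrow>
      vertex_module Vk Y one (\<lambda>a n (x, y). (QX a n x, QZ a n y + log_term T W J s a n x))"
    by (rule vertex_module_cong) (simp_all add: Vk_closed Ytw fun_eq_iff)
  ultimately show ?thesis by blast
qed

lemma semisimple_sum: "acts_semisimply (\<lambda>(x, y). (QX csug 1 x, QZ csug 1 y))"
proof (rule acts_semisimplyI)
  let ?L = "\<lambda>(x, y). (QX csug 1 x, QZ csug 1 y)"
  note mX = twist.X'(1) and mZ = twist.YY'(1)
  show "clinear ?L"
    by (auto intro!: clinearI simp: modal_add[OF mX] modal_add[OF mZ] modal_scale[OF mX] modal_scale[OF mZ] scaleC_prod_def)
  let ?S = "cvec.span {z. \<exists>t. ?L z = t *\<^sub>C z}"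
  have X': "(x, 0) \<in> ?S" for x
    using csug_1_span[OF X, of x l lam]
  proof (induction x rule: cvec.span_induct_alt)
    case base show ?case using cvec.span_zero[of "{z. \<exists>t. ?L z = t *\<^sub>C z}"] by (simp add: zero_prod_def)
  next
    case (step c x y)
    then obtain t where "QX csug 1 x = t *\<^sub>C x" by blast
    then have "?L (x, 0) = t *\<^sub>C (x, 0)" by (simp add: scaleC_prod_def mZ)
    then have "(x, 0) \<in> ?S" by (intro cvec.span_base) blast
    then have "c *\<^sub>C (x, 0) + (y, 0) \<in> ?S" using step(2) by (intro cvec.span_add cvec.span_scale)
    moreover have eq: "c *\<^sub>C (x, 0) + (y, 0) = (c *\<^sub>C x + y, 0)" by (simp add: scaleC_prod_def)
    ultimately show ?case unfolding eq by blast
  qed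
  have Z': "(0, y) \<in> ?S" for y
    using csug_1_span[OF Z, of y "l + 1" "lam_w + lam"]
  proof (induction y rule: cvec.span_induct_alt)
    case base show ?case using cvec.span_zero[of "{z. \<exists>t. ?L z = t *\<^sub>C z}"] by (simp add: zero_prod_def)
  next
    case (step c x y)
    then obtain t where "QZ csug 1 x = t *\<^sub>C x" by blast
    then have "?L (0, x) = t *\<^sub>C (0, x)" by (simp add: scaleC_prod_def mX)
    then have "(0, x) \<in> ?S" by (intro cvec.span_base) blast
    then have "c *\<^sub>C (0, x) + (0, y) \<in> ?S" using step(2) by (intro cvec.span_add cvec.span_scale)
    moreover have eq: "c *\<^sub>C (0, x) + (0, y) = (0, c *\<^sub>C x + y)" by (simp add: scaleC_prod_def)
    ultimately show ?case unfolding eq by blast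
  qed
  show "z \<in> ?S" for z
    using cvec.span_add[OF X'[of "fst z"] Z'[of "snd z"]] by simp
qed

theorem Ytw_rank_two: "sum_of_gen_eigenspaces (Ytw csug 1)" "nilpotent_rank (Ytw csug 1) 2"
proof -
  note mX = twist.X'(1) and mZ = twist.YY'(1)
  let ?L = "\<lambda>(x, y). (QX csug 1 x, QZ csug 1 y)"
  let ?N = "\<lambda>(x, y). (0, J s 0 x)"
  have eq: "Ytw csug 1 = (\<lambda>z. ?L z + ?N z)"
    unfolding Ytw_csug by (auto simp: fun_eq_iff)
  have L: "clinear ?L"
    by (auto intro!: clinearI simp: modal_add[OF mX] modal_add[OF mZ] modal_scale[OF mX] modal_scale[OF mZ] scaleC_prod_def)
  have N: "clinear ?N"
    by (auto intro!: clinearI simp: modal_add[OF J(1)] modal_scale[OF J(1)] scaleC_prod_def)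
  have c: "?N (?L z) = ?L (?N z)" and n: "?N (?N z) = 0" for z
    by (cases z; simp add: csug_screening mX J(1) zero_prod_def)+
  have nz: "?N (tens vX E, 0) \<noteq> 0" using screening_nonzero by (simp add: zero_prod_def)
  note * = nilpotent_rank_two[OF L N semisimple_sum c n nz]
  show "sum_of_gen_eigenspaces (Ytw csug 1)" "nilpotent_rank (Ytw csug 1) 2"
    unfolding eq by (rule *)+
qed

theorem Ytw_extension: "nonsplit_extension Vk QZ Ytw QX"
proof -
  note mX = twist.X'(1) and mZ = twist.YY'(1)
  have D0: "log_term T W J s a n 0 = 0" for a n by (rule modal_zero(1)[OF twist.modal_log_term])
  have \<iota>: "module_hom_on Vk QZ Ytw (\<lambda>y. (0, y))"
    unfolding module_hom_on_def by (auto intro!: clinearI simp: scaleC_prod_def Ytw mX D0)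
  have \<pi>: "module_hom_on Vk Ytw QX fst"
    unfolding module_hom_on_def by (auto intro!: clinearI simp: scaleC_prod_def Ytw)
  have "\<not> (\<exists>\<sigma>. module_hom_on Vk QX Ytw \<sigma> \<and> (\<forall>x. fst (\<sigma> x) = x))"
  proof
    assume "\<exists>\<sigma>. module_hom_on Vk QX Ytw \<sigma> \<and> (\<forall>x. fst (\<sigma> x) = x)"
    then obtain \<sigma> where \<sigma>: "module_hom_on Vk QX Ytw \<sigma>" and fst: "\<And>x. fst (\<sigma> x) = x" by blast
    let ?z = "tens vX E"
    have "YX \<omega> 1 vX = hX *\<^sub>C vX"
      using irreducible_virasoro.hw(2)[OF irreducible_M[OF X]] by simp
    from csug_1_single[OF X this, of l lam "{#}" "-1"]
    obtain t where t: "QX csug 1 ?z = t *\<^sub>C ?z" unfolding basis_exp_def by blast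
    obtain y where y: "\<sigma> ?z = (?z, y)" using fst[of ?z] by (metis prod.collapse)
    have "\<sigma> (QX csug 1 ?z) = Ytw csug 1 (\<sigma> ?z)" using \<sigma> csug_Vk unfolding module_hom_on_def by blast
    moreover have "\<sigma> (QX csug 1 ?z) = t *\<^sub>C (?z, y)"
      using \<sigma> by (simp add: module_hom_on_def clinear_scale t y)
    ultimately have "t *\<^sub>C (?z, y) = (QX csug 1 ?z, QZ csug 1 y + J s 0 ?z)"
      by (simp add: Ytw_csug y)
    then have ty: "J s 0 ?z = t *\<^sub>C y - QZ csug 1 y" by (simp add: scaleC_prod_def)
    have L: "clinear (QZ csug 1)" by (rule modal_clinear(1)[OF mZ])
    have "QZ csug 1 (J s 0 ?z) = t *\<^sub>C J s 0 ?z"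
      unfolding csug_screening t by (rule modal_scale(1)[OF J(1)])
    moreover have u: "QZ csug 1 y - t *\<^sub>C y = - J s 0 ?z" by (simp add: ty)
    \<comment> \<open>So y is a generalised eigenvector of the semisimple L(0), hence an
      eigenvector, which contradicts S \<noteq> 0 on the chosen vector. The \<open>+ 0\<close> fits
      the pattern L + N with N = 0.\<close>
    ultimately have "((\<lambda>z. QZ csug 1 z + 0 - t *\<^sub>C z) ^^ 2) y = 0"
      using u clinear_minus[OF L, of "J s 0 ?z"] by (simp add: numeral_2_eq_2 scaleC_simps)
    then have "y \<in> gen_eigenspace (\<lambda>z. QZ csug 1 z + 0) t" unfolding gen_eigenspace_def by blast
    then have "QZ csug 1 y = t *\<^sub>C y"
      by (subst (asm) gen_eigenspace_semisimple_plus_nilpotent[OF L _ csug_1_semisimple[OF Z]])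
        (simp_all add: clinearI clinear_zero[OF L])
    then show False using screening_nonzero ty by simp
  qed
  then show ?thesis
    unfolding nonsplit_extension_def using \<iota> \<pi>
    by (intro exI[of _ "\<lambda>y. (0, y)"] exI[of _ fst]) (auto simp: inj_def image_iff)
qed

end

theorem corollary9p6:
  fixes p p' r s :: nat
    and l :: int
    and k lam :: complex
    and Y0 :: "'a::complex_vector \<Rightarrow> int \<Rightarrow> 'a \<Rightarrow> 'a"
    and vac \<omega> :: 'a
    and Y21 :: "'a \<Rightarrow> int \<Rightarrow> 'b::complex_vector \<Rightarrow> 'b"
    and v21 :: 'b
    and Yrs :: "'a \<Rightarrow> int \<Rightarrow> 'c::complex_vector \<Rightarrow> 'c"
    and vrs :: 'c
    and Yr1s :: "'a \<Rightarrow> int \<Rightarrow> 'd::complex_vector \<Rightarrow> 'd"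
    and vr1s :: 'd
    and YPi :: "int \<Rightarrow> complex \<Rightarrow> Pi \<Rightarrow> int \<Rightarrow> Pi \<Rightarrow> Pi"
    and I1 :: "'b \<Rightarrow> complex \<Rightarrow> 'c \<Rightarrow> 'd"
    and I2 :: "Pi \<Rightarrow> complex \<Rightarrow> Pi \<Rightarrow> Pi"
  assumes "2 \<le> p" and "2 \<le> p'" and "coprime p p'"
    and k: "k + 2 = of_nat p' / of_nat p"
    and s: "1 \<le> s" "s \<le> p' - 1"
    and r: "1 \<le> r" "r \<le> p - 2"
    and lam: "lam = (1 / 2) * (of_nat s - 1 - (k + 2) * (of_nat r - 1))"
    and Vir: "virasoro_vertex_algebra (central_charge p p') Y0 vac \<omega>"
    and Vir21: "virasoro_irreducible_module (central_charge p p') Y0 vac \<omega>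
      (h_weight p p' 2 1) Y21 v21"
    and Virrs: "virasoro_irreducible_module (central_charge p p') Y0 vac \<omega>
      (h_weight p p' r s) Yrs vrs"
    and Virr1s: "virasoro_irreducible_module (central_charge p p') Y0 vac \<omega>
      (h_weight p p' (r + 1) s) Yr1s vr1s"
    and Pi: "lattice_vertex_operators k YPi"
    and I1: "intertwining_operator \<omega> Y21 Yrs Yr1s I1" "nontrivial_intertwining I1"
    and I2: "intertwining_operator (Pi_conformal k)
        (YPi 1 (- k / 2)) (YPi l lam) (YPi (l + 1) (- k / 2 + lam)) I2"
      "nontrivial_intertwining I2"
  shows
    "let
       Y = tensor_modes Y0 (YPi 0 0);
       one = tens vac (basis_exp 0);
       Vk = Vk_sl2 k Y vac \<omega>;
       \<omega>sug = sugawara k Y vac \<omega>;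
       h = h_vec k vac;
       YV = extended_vertex_operator \<omega>sug Y (tensor_modes Y21 (YPi 1 (- k / 2)));
       svec = (0, tens v21 (basis_exp 0));
       Yquot = tensor_modes Yrs (YPi l lam);
       Ysub = tensor_modes Yr1s (YPi (l + 1) (- k / 2 + lam));
       YM = extended_module_operator Yquot Ysub (tensor_modes I1 I2);
       Ytw = (\<lambda>a. twisted_operator YV svec YM (a, 0))
     in
       (logarithmic_module Vk Y one \<omega>sug Ytw \<and> nilpotent_rank (Ytw \<omega>sug 1) 2) \<and>
       (weight_module Vk Y one \<omega>sug h Ysub \<and> weight_module Vk Y one \<omega>sug h Yquot \<and>
        nonsplit_extension Vk Ysub Ytw Yquot)"
proof -
  have nz: "(of_nat p :: complex) \<noteq> 0" "(of_nat p' :: complex) \<noteq> 0"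
    using \<open>2 \<le> p\<close> \<open>2 \<le> p'\<close> by auto
  \<comment> \<open>With p' = t p, central charge and weights become rational functions of t in
    which p cancels.\<close>
  define P t where "P = (of_nat p :: complex)" and "t = k + 2"
  then have P: "(of_nat p :: complex) = P" and t: "k + 2 = t" by simp_all
  have nz': "P \<noteq> 0" "t \<noteq> 0" using nz unfolding P_def t_def k by simp_all
  have pp: "of_nat p' = t * P" using nz unfolding P_def t_def k by simp
  have cc: "central_charge p p' = 13 - 6 * (k + 2) - 6 / (k + 2)"
    unfolding central_charge_def pp P t using nz' by (simp add: field_simps power2_eq_square)
  have h21: "h_weight p p' 2 1 = 3 * (k + 2) / 4 - 1 / 2"
    unfolding h_weight_def pp P t using nz' by (simp add: field_simps power2_eq_square)
  \<comment> \<open>Here h^{r,s} - h^{r+1,s} = (s - r t)/2 - t/4, and adding h^{2,1} = 3t/4 - 1/2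
    gives (s - 1 - t (r - 1))/2, the prescribed value of lambda.\<close>
  have lam': "lam = h_weight p p' 2 1 + h_weight p p' r s - h_weight p p' (r + 1) s"
    unfolding h21 unfolding lam h_weight_def pp P t using nz' by (simp add: field_simps power2_eq_square)
  have t0: "k + 2 \<noteq> 0" using nz'(2) t by simp
  interpret screening k YPi "central_charge p p'" Y0 vac \<omega> Y21 v21 "h_weight p p' 2 1"
    by unfold_locales (rule Pi Vir t0 Vir21 h21 cc)+
  have lw: "- k / 2 = lam_w" by (simp add: lam_w_def)
  interpret screened_pair k YPi "central_charge p p'" Y0 vac \<omega> Y21 v21 "h_weight p p' 2 1"
    Yrs vrs "h_weight p p' r s" Yr1s vr1s "h_weight p p' (r + 1) s" l lam I1 I2
    by unfold_locales (rule Virrs Virr1s I1 I2[unfolded lw] lam')+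
  show ?thesis
    unfolding Let_def sugawara_eq lw logarithmic_module_def
    using module_Ytw Ytw_rank_two Ytw_extension weight_module_Q[OF Virr1s] weight_module_Q[OF Virrs] by blast
qed

end
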